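(* Let $s\in\mathbb{R}$, $m\in(0,\infty)$, $p,q\in[1,\infty]$ and $\rho\in\mathbb{N}$ with $\rho\ge n+1$. Let $a\in S^{m,\rho}$ be parabolic, and let $A_a$ be its $B_{pq}^s(\mathbb{T}^n,E)$-realization. Then $-A_a$ generates an analytic semigroup in $B_{pq}^s(\mathbb{T}^n,E)$.
   Context: Fix $n\in\mathbb{N}$ and an arbitrary (complex) Banach space $E$ with norm $\|\cdot\|$. $L(X,Y)$ is the space of continuous linear maps $X\to Y$ and $L(X)=L(X,X)$. $\langle x\rangle:=(1+|x|^2)^{1/2}$ for $x\in\mathbb{R}^n$, with $|\cdot|$ the Euclidean norm. $\mathbb{T}^n=(\mathbb{R}/2\pi\mathbb{Z})^n$ is equipped with the normalized measure $(2\pi)^{-n}dx$; functions on $\mathbb{T}^n$ are identified with functions on $\mathbb{R}^n$ that are $2\pi$-periodic in all variables. Distributions: $C^\infty(\mathbb{T}^n,E)$ is the Fréchet space of smooth functions $\mathbb{T}^n\to E$ with seminorms $\max_{|\alpha|\le N}\sup_x\|\partial^\alpha\varphi(x)\|$, $N\in\mathbb{N}_0$, and $C^\infty(\mathbb{T}^n):=C^\infty(\mathbb{T}^n,\mathbb{C})$. $\mathscr D'(\mathbb{T}^n,E):=L(C^\infty(\mathbb{T}^n),E)$, with $\langle u,\varphi\rangle:=u(\varphi)$. An integrable function $f\colon\mathbb{T}^n\to E$ is identified with the distribution $\varphi\mapsto(2\pi)^{-n}\int_{\mathbb{T}^n}\varphi(x)f(x)\,dx$. The Fourier coefficients of $u\in\mathscr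 D'(\mathbb{T}^n,E)$ are $\hat u(\mathbf k):=\langle u,e_{-\mathbf k}\rangle$, where $e_{\mathbf k}(x):=e^{i\mathbf k\cdot x}$, $\mathbf k\in\mathbb{Z}^n$. Toroidal pseudodifferential operators: for $a\colon\mathbb{Z}^n\to L(E)$ of at most polynomial growth, $\mathrm{op}[a]\colon\mathscr D'(\mathbb{T}^n,E)\to\mathscr D'(\mathbb{T}^n,E)$ is defined by $\langle\mathrm{op}[a]u,\varphi\rangle:=\sum_{\mathbf k\in\mathbb{Z}^n}\hat\varphi(-\mathbf k)a(\mathbf k)\hat u(\mathbf k)$ for $\varphi\in C^\infty(\mathbb{T}^n)$, i.e. $\mathrm{op}[a]u$ has Fourier coefficients $a(\mathbf k)\hat u(\mathbf k)$. If $\phi$ is a scalar function on $\mathbb{R}^n$ with polynomially bounded restriction to $\mathbb{Z}^n$, then $\mathrm{op}[\phi]$ means $\mathrm{op}[\phi|_{\mathbb{Z}^n}\,\mathrm{id}_E]$. Symbol class: with $\delta_j$ the $j$-th unit vector, $\Delta_{k_j}a(\mathbf k):=a(\mathbf k+\delta_j)-a(\mathbf k)$ and $\Delta_{\mathbf k}^\alpha:=\Delta_{k_1}^{\alpha_1}\cdots\Delta_{k_n}^{\alpha_n}$. For $m\in\mathbb{R}$, $\rho\in\mathbb{N}_0$, $S^{m,\rho}$ is the space of all $a\colon\mathbb{Z}^n\to L(E)$ with $\|a\|_{S^{m,\rho}}:=\max_{|\alpha|\le\rho}\sup_{\mathbf k\in\mathbb{Z}^n}\langle\mathbf k\rangle^{|\alpha|-m}\|\Delta_{\mathbf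 k}^\alpha a(\mathbf k)\|_{L(E)}<\infty$, with this norm. Besov spaces: a dyadic decomposition is a sequence $(\phi_j)_{j\in\mathbb{N}_0}\subset\mathscr S(\mathbb{R}^n)$ with $\operatorname{supp}\phi_0\subset\{|\xi|\le2\}$, $\operatorname{supp}\phi_j\subset\{2^{j-1}\le|\xi|\le2^{j+1}\}$ for $j\ge1$, $\sum_{j\ge0}\phi_j=1$ on $\mathbb{R}^n$, and for each $\alpha\in\mathbb{N}_0^n$ a constant $c_\alpha>0$ such that $|D^\alpha\phi_j(\xi)|\le c_\alpha2^{-j|\alpha|}$ for all $\xi,j$. Fix one (different choices give equivalent norms). For $s\in\mathbb{R}$, $p,q\in[1,\infty]$, $B^s_{pq}(\mathbb{T}^n,E)$ is the space of all $u\in\mathscr D'(\mathbb{T}^n,E)$ with $\|u\|_{B^s_{pq}(\mathbb{T}^n,E)}:=\big\|\big(2^{js}\|\mathrm{op}[\phi_j]u\|_{L^p(\mathbb{T}^n,E)}\big)_{j\in\mathbb{N}_0}\big\|_{\ell^q(\mathbb{N}_0)}<\infty$, where $L^p(\mathbb{T}^n,E)$ is the usual Bochner space with respect to the normalized measure. Parabolicity: for $m>0$, put $\langle\mathbf k,\lambda\rangle:=(1+|\mathbf k|^2+|\lambda|^{2/m})^{1/2}$ and $|(\mathbf k,\lambda)|:=(|\mathbf k|^2+|\lambda|^{2/m})^{1/2}$. A symbol $a\in S^{m,\rho}$ is parabolic with constants $\omega\ge0$, $\kappa>0$ if for all $(\mathbf k,\lambda)\in\mathbb{Z}^n\times\mathbb{C}$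 with $\operatorname{Re}\lambda\ge0$ and $|(\mathbf k,\lambda)|\ge\omega$ the operator $a(\mathbf k)+\lambda\colon E\to E$ is bijective and $\|(a(\mathbf k)+\lambda)^{-1}\|_{L(E)}\le\kappa\langle\mathbf k,\lambda\rangle^{-m}$. It is parabolic if this holds for some $\omega\ge0$, $\kappa>0$. Realization: the $B^s_{pq}(\mathbb{T}^n,E)$-realization $A_a$ of $a\in S^{m,\rho}$ is the unbounded operator in $B_{pq}^s(\mathbb{T}^n,E)$ with domain $D(A_a):=B^{s+m}_{pq}(\mathbb{T}^n,E)$ and $A_au:=\mathrm{op}[a]u$. Analytic semigroups are understood in the standard sense that does not require strong continuity at $t=0$ or density of the domain: a linear operator $B$ in a Banach space $X$ generates an analytic semigroup if it is sectorial, i.e. there are $\omega_0\in\mathbb{R}$, $\theta\in(\pi/2,\pi)$, $M>0$ such that the resolvent set of $B$ contains $\{\lambda\neq\omega_0:|\arg(\lambda-\omega_0)|<\theta\}$ and $\|(\lambda-B)^{-1}\|_{L(X)}\le M/|\lambda-\omega_0|$ there. *)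

theory Defs
  imports "HOL-Analysis.Analysis"
begin

section \<open>Complex Banach spaces\<close>

class complex_vector = real_vector +
  fixes scaleC :: "complex \<Rightarrow> 'a \<Rightarrow> 'a"  (infixr \<open>*\<^sub>C\<close> 75)
  assumes scaleC_add_right: "c *\<^sub>C (x + y) = c *\<^sub>C x + c *\<^sub>C y"
    and scaleC_add_left: "(c + d) *\<^sub>C x = c *\<^sub>C x + d *\<^sub>C x"
    and scaleC_scaleC: "c *\<^sub>C d *\<^sub>C x = (c * d) *\<^sub>C x"
    and scaleC_one: "1 *\<^sub>C x = x"
    and scaleC_of_real: "complex_of_real r *\<^sub>C x = r *\<^sub>R x"

class complex_banach = complex_vector + banach +
  assumes norm_scaleC: "norm (c *\<^sub>C x) = cmod c * norm x"

lemma scaleC_zero_right [simp]: "c *\<^sub>C (0::'a::complex_vector) = 0"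
  using scaleC_add_right[of c 0 "0::'a"] by simp

lemma scaleC_minus_right: "c *\<^sub>C (- x) = - (c *\<^sub>C (x::'a::complex_vector))"
  using scaleC_add_right[of c x "- x"] by (simp add: eq_neg_iff_add_eq_0 add.commute)

lemma scaleC_diff_right: "c *\<^sub>C (x - y) = c *\<^sub>C x - c *\<^sub>C (y::'a::complex_vector)"
  using scaleC_add_right[of c x "- y"] by (simp add: scaleC_minus_right)

lemma scaleC_left_commute: "c *\<^sub>C d *\<^sub>C x = d *\<^sub>C c *\<^sub>C (x::'a::complex_vector)"
  by (simp add: scaleC_scaleC mult.commute)

lemma bounded_linear_scaleC: "bounded_linear (\<lambda>x. c *\<^sub>C (x::'a::complex_banach))"
proof (rule bounded_linear_intro)
  show "c *\<^sub>C (r *\<^sub>R x) = r *\<^sub>R (c *\<^sub>C x)" for r and x :: 'a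
    by (simp add: scaleC_left_commute flip: scaleC_of_real)
  show "norm (c *\<^sub>C x) \<le> norm x * cmod c" for x :: 'a
    by (simp add: norm_scaleC)
qed (simp add: scaleC_add_right)

instantiation complex :: complex_banach
begin

definition scaleC_complex :: "complex \<Rightarrow> complex \<Rightarrow> complex" where
  "scaleC_complex c x = c * x"

instance
  by standard (simp_all add: scaleC_complex_def algebra_simps norm_mult scaleR_conv_of_real)

end

section \<open>Strong measurability, the Bochner integral and Lebesgue norms\<close>

text \<open>The Bochner integral of HOL-Analysis is restricted to second countable (that is, separable)
  range spaces. The following versions are for arbitrary Banach spaces.\<close>

definition strongly_measurable :: "'a measure \<Rightarrow> ('a \<Rightarrow> 'b::real_normed_vector) \<Rightarrow> bool" where
  "strongly_measurable M f \<longleftrightarrow>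
     (\<exists>s. (\<forall>i::nat. simple_function M (s i)) \<and> (AE x in M. (\<lambda>i. s i x) \<longlonglongrightarrow> f x))"

definition has_strong_bochner_integral ::
  "'a measure \<Rightarrow> ('a \<Rightarrow> 'b::real_normed_vector) \<Rightarrow> 'b \<Rightarrow> bool" where
  "has_strong_bochner_integral M f I \<longleftrightarrow>
     strongly_measurable M f \<and>
     (\<exists>s. (\<forall>i::nat. Bochner_Integration.simple_bochner_integrable M (s i)) \<and>
          (\<lambda>i. \<integral>\<^sup>+x. ennreal (norm (f x - s i x)) \<partial>M) \<longlonglongrightarrow> 0 \<and>
          (\<lambda>i. Bochner_Integration.simple_bochner_integral M (s i)) \<longlonglongrightarrow> I)"

definition strong_bochner_integral ::
  "'a measure \<Rightarrow> ('a \<Rightarrow> 'b::real_normed_vector) \<Rightarrow> 'b" where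
  "strong_bochner_integral M f = (THE I. has_strong_bochner_integral M f I)"

text \<open>Only used for positive exponents, whence the value at infinity.\<close>

definition ennreal_powr :: "ennreal \<Rightarrow> real \<Rightarrow> ennreal" where
  "ennreal_powr x r = (if x = \<infinity> then \<infinity> else ennreal (enn2real x powr r))"

text \<open>On \<^term>\<open>count_space UNIV\<close> this is the norm of the sequence space with exponent \<open>p\<close>.\<close>

definition Lebesgue_norm :: "ennreal \<Rightarrow> 'a measure \<Rightarrow> ('a \<Rightarrow> ennreal) \<Rightarrow> ennreal" where
  "Lebesgue_norm p M g =
     (if p = \<infinity> then Inf {C. AE x in M. g x \<le> C}
      else ennreal_powr (\<integral>\<^sup>+x. ennreal_powr (g x) (enn2real p) \<partial>M) (1 / enn2real p))"

section \<open>Multi-indices, derivatives and differences\<close>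

text \<open>An arbitrary enumeration of the coordinates. Partial derivatives of smooth functions and
  difference operators commute, so the choice does not matter below.\<close>

definition coordinates :: "'n::finite list" where
  "coordinates = (SOME js. distinct js \<and> set js = UNIV)"

definition multi_power :: "('n::finite \<Rightarrow> 'b \<Rightarrow> 'b) \<Rightarrow> ('n \<Rightarrow> nat) \<Rightarrow> 'b \<Rightarrow> 'b" where
  "multi_power T \<alpha> = foldr (\<lambda>j. T j ^^ \<alpha> j) coordinates"

abbreviation order_of :: "('n::finite \<Rightarrow> nat) \<Rightarrow> nat" where
  "order_of \<alpha> \<equiv> sum \<alpha> UNIV"

definition partial_derivative ::
  "'n \<Rightarrow> (real^'n \<Rightarrow> 'b::real_normed_vector) \<Rightarrow> real^'n \<Rightarrow> 'b" where
  "partial_derivative j f x = vector_derivative (\<lambda>t. f (x + t *\<^sub>R axis j 1)) (at 0)"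

text \<open>Differentiability of all iterated partial derivatives forces them to be continuous.\<close>

definition smooth :: "(real^'n \<Rightarrow> 'b::real_normed_vector) \<Rightarrow> bool" where
  "smooth f \<longleftrightarrow> (\<forall>js x. foldr partial_derivative js f differentiable (at x))"

definition multi_derivative ::
  "('n::finite \<Rightarrow> nat) \<Rightarrow> (real^'n \<Rightarrow> 'b::real_normed_vector) \<Rightarrow> real^'n \<Rightarrow> 'b" where
  "multi_derivative = multi_power partial_derivative"

definition difference :: "'n \<Rightarrow> (int^'n \<Rightarrow> 'b::ab_group_add) \<Rightarrow> int^'n \<Rightarrow> 'b" where
  "difference j a k = a (k + axis j 1) - a k"

definition multi_difference ::
  "('n::finite \<Rightarrow> nat) \<Rightarrow> (int^'n \<Rightarrow> 'b::ab_group_add) \<Rightarrow> int^'n \<Rightarrow> 'b" where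
  "multi_difference = multi_power difference"

definition schwartz :: "(real^'n \<Rightarrow> complex) \<Rightarrow> bool" where
  "schwartz f \<longleftrightarrow> smooth f \<and>
     (\<forall>\<alpha> \<beta>. bounded (range (\<lambda>x. (\<Prod>i\<in>UNIV. (x $ i) ^ \<beta> i) *\<^sub>R multi_derivative \<alpha> f x)))"

section \<open>Distributions on the torus\<close>

definition periodic :: "(real^'n \<Rightarrow> 'b) \<Rightarrow> bool" where
  "periodic f \<longleftrightarrow> (\<forall>j x. f (x + axis j (2 * pi)) = f x)"

definition torus_measure :: "(real^'n) measure" where
  "torus_measure = uniform_measure lborel (cbox 0 (\<chi> i. 2 * pi))"

definition test_functions :: "(real^'n \<Rightarrow> complex) set" where
  "test_functions = {\<phi>. smooth \<phi> \<and> periodic \<phi>}"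

definition test_seminorm :: "nat \<Rightarrow> (real^'n \<Rightarrow> complex) \<Rightarrow> real" where
  "test_seminorm N \<phi> =
     (MAX \<alpha>\<in>{\<alpha>. order_of \<alpha> \<le> N}. SUP x. norm (multi_derivative \<alpha> \<phi> x))"

definition test_topology :: "(real^'n \<Rightarrow> complex) topology" where
  "test_topology = topology_generated_by
     {{\<psi> \<in> test_functions. test_seminorm N (\<lambda>x. \<psi> x - \<phi> x) < \<delta>} | N \<phi> \<delta>.
        \<phi> \<in> test_functions \<and> \<delta> > 0}"

text \<open>Distributions are set to 0 outside the test functions, so that two of them are equal as
  soon as they agree on the test functions.\<close>

typedef (overloaded) ('n, 'e) distribution =
  "{u :: (real^'n::finite \<Rightarrow> complex) \<Rightarrow> 'e::complex_banach.
      (\<forall>\<phi>\<in>test_functions. \<forall>\<psi>\<in>test_functions. u (\<lambda>x. \<phi> x + \<psi> x) = u \<phi> + u \<psi>) \<and>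
      (\<forall>c. \<forall>\<phi>\<in>test_functions. u (\<lambda>x. c * \<phi> x) = c *\<^sub>C u \<phi>) \<and>
      continuous_map test_topology euclidean u \<and>
      (\<forall>\<phi>. \<phi> \<notin> test_functions \<longrightarrow> u \<phi> = 0)}"
  morphisms pairing Distribution
proof
  show "(\<lambda>_. 0) \<in> {u :: (real^'n::finite \<Rightarrow> complex) \<Rightarrow> 'e::complex_banach.
      (\<forall>\<phi>\<in>test_functions. \<forall>\<psi>\<in>test_functions. u (\<lambda>x. \<phi> x + \<psi> x) = u \<phi> + u \<psi>) \<and>
      (\<forall>c. \<forall>\<phi>\<in>test_functions. u (\<lambda>x. c * \<phi> x) = c *\<^sub>C u \<phi>) \<and>
      continuous_map test_topology euclidean u \<and>
      (\<forall>\<phi>. \<phi> \<notin> test_functions \<longrightarrow> u \<phi> = 0)}"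
    by simp
qed

setup_lifting type_definition_distribution

lemma continuous_map_scaleC:
  fixes f :: "'a \<Rightarrow> 'e::complex_banach"
  assumes "continuous_map X euclidean f"
  shows "continuous_map X euclidean (\<lambda>x. c *\<^sub>C f x)"
proof -
  have "continuous_map euclidean euclidean (\<lambda>x::'e. c *\<^sub>C x)"
    by (simp add: bounded_linear_scaleC linear_continuous_on)
  from continuous_map_compose[OF assms this] show ?thesis
    by (simp add: o_def)
qed

instantiation distribution :: (finite, complex_banach) complex_vector
begin

lift_definition zero_distribution :: "('a, 'b) distribution" is "\<lambda>_. 0"
  by simp

lift_definition plus_distribution ::
  "('a, 'b) distribution \<Rightarrow> ('a, 'b) distribution \<Rightarrow> ('a, 'b) distribution"
  is "\<lambda>u v \<phi>. u \<phi> + v \<phi>"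
  by (auto simp: scaleC_add_right intro: continuous_map_add)

lift_definition uminus_distribution :: "('a, 'b) distribution \<Rightarrow> ('a, 'b) distribution"
  is "\<lambda>u \<phi>. - u \<phi>"
  by (auto simp: scaleC_minus_right intro: continuous_map_minus)

lift_definition minus_distribution ::
  "('a, 'b) distribution \<Rightarrow> ('a, 'b) distribution \<Rightarrow> ('a, 'b) distribution"
  is "\<lambda>u v \<phi>. u \<phi> - v \<phi>"
  by (auto simp: scaleC_diff_right intro: continuous_map_diff)

lift_definition scaleC_distribution ::
  "complex \<Rightarrow> ('a, 'b) distribution \<Rightarrow> ('a, 'b) distribution"
  is "\<lambda>c u \<phi>. c *\<^sub>C u \<phi>"
  by (auto simp: scaleC_add_right intro: continuous_map_scaleC scaleC_left_commute)

definition scaleR_distribution ::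
  "real \<Rightarrow> ('a, 'b) distribution \<Rightarrow> ('a, 'b) distribution" where
  "scaleR_distribution r u = complex_of_real r *\<^sub>C u"

instance
proof
  fix u v w :: "('a, 'b) distribution" and c d :: complex and r t :: real
  show "u + v + w = u + (v + w)" by transfer (simp add: add.assoc)
  show "u + v = v + u" by transfer (simp add: add.commute)
  show "0 + u = u" by transfer simp
  show "- u + u = 0" by transfer simp
  show "u - v = u + - v" by transfer simp
  show C1: "c *\<^sub>C (u + v) = c *\<^sub>C u + c *\<^sub>C v" for c and u v :: "('a, 'b) distribution"
    by transfer (simp add: scaleC_add_right)
  show C2: "(c + d) *\<^sub>C u = c *\<^sub>C u + d *\<^sub>C u" for c d and u :: "('a, 'b) distribution"
    by transfer (simp add: scaleC_add_left)
  show C3: "c *\<^sub>C d *\<^sub>C u = (c * d) *\<^sub>C u" for c d and u :: "('a, 'b) distribution"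
    by transfer (simp add: scaleC_scaleC)
  show C4: "1 *\<^sub>C u = u" for u :: "('a, 'b) distribution"
    by transfer (simp add: scaleC_one)
  show "complex_of_real r *\<^sub>C u = r *\<^sub>R u" by (simp add: scaleR_distribution_def)
  show "r *\<^sub>R (u + v) = r *\<^sub>R u + r *\<^sub>R v" by (simp add: scaleR_distribution_def C1)
  show "(r + t) *\<^sub>R u = r *\<^sub>R u + t *\<^sub>R u" by (simp add: scaleR_distribution_def C2)
  show "r *\<^sub>R t *\<^sub>R u = (r * t) *\<^sub>R u" by (simp add: scaleR_distribution_def C3)
  show "1 *\<^sub>R u = u" by (simp add: scaleR_distribution_def C4)
qed

end

definition real_vec :: "int^'n \<Rightarrow> real^'n" where
  "real_vec k = (\<chi> i. real_of_int (k $ i))"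

definition character :: "int^'n \<Rightarrow> real^'n \<Rightarrow> complex" where
  "character k x = exp (\<i> * complex_of_real (real_vec k \<bullet> x))"

definition fourier_coeff :: "('n::finite, 'e::complex_banach) distribution \<Rightarrow> int^'n \<Rightarrow> 'e" where
  "fourier_coeff u k = pairing u (character (- k))"

text \<open>The Fourier coefficients of the distribution associated with a test function.\<close>

definition test_fourier_coeff :: "(real^'n \<Rightarrow> complex) \<Rightarrow> int^'n \<Rightarrow> complex" where
  "test_fourier_coeff \<phi> k = (\<integral>x. character (- k) x * \<phi> x \<partial>torus_measure)"

text \<open>\<open>torus_op a u\<close> is meaningful for \<open>a\<close> of at most polynomial growth.\<close>

definition torus_op :: "(int^'n \<Rightarrow> 'e \<Rightarrow> 'e) \<Rightarrow>
    ('n::finite, 'e::complex_banach) distribution \<Rightarrow> ('n, 'e) distribution" where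
  "torus_op a u = Distribution
     (\<lambda>\<phi>. if \<phi> \<in> test_functions
          then \<Sum>\<^sub>\<infinity>k. test_fourier_coeff \<phi> (- k) *\<^sub>C a k (fourier_coeff u k) else 0)"

section \<open>Besov spaces\<close>

definition torus_norm :: "ennreal \<Rightarrow> (real^'n \<Rightarrow> 'e::real_normed_vector) \<Rightarrow> ennreal" where
  "torus_norm p f = Lebesgue_norm p torus_measure (\<lambda>x. ennreal (norm (f x)))"

definition torus_Lp :: "ennreal \<Rightarrow> (real^'n \<Rightarrow> 'e::real_normed_vector) set" where
  "torus_Lp p = {f. periodic f \<and> strongly_measurable torus_measure f \<and> torus_norm p f < \<infinity>}"

definition represents ::
  "(real^'n \<Rightarrow> 'e) \<Rightarrow> ('n::finite, 'e::complex_banach) distribution \<Rightarrow> bool" where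
  "represents f u \<longleftrightarrow>
     (\<forall>\<phi>\<in>test_functions. pairing u \<phi> = strong_bochner_integral torus_measure (\<lambda>x. \<phi> x *\<^sub>C f x))"

text \<open>The function representing a distribution is unique almost everywhere, so the infimum is
  over a single value, or it is infinite if there is no such function.\<close>

definition distribution_norm ::
  "ennreal \<Rightarrow> ('n::finite, 'e::complex_banach) distribution \<Rightarrow> ennreal" where
  "distribution_norm p u = (INF f\<in>{f \<in> torus_Lp p. represents f u}. torus_norm p f)"

definition dyadic_decomposition :: "(nat \<Rightarrow> real^'n \<Rightarrow> complex) \<Rightarrow> bool" where
  "dyadic_decomposition \<phi> \<longleftrightarrow>
     (\<forall>j. schwartz (\<phi> j)) \<and>
     closure {\<xi>. \<phi> 0 \<xi> \<noteq> 0} \<subseteq> {\<xi>. norm \<xi> \<le> 2} \<and>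
     (\<forall>j\<ge>1. closure {\<xi>. \<phi> j \<xi> \<noteq> 0} \<subseteq> {\<xi>. 2 ^ (j - 1) \<le> norm \<xi> \<and> norm \<xi> \<le> 2 ^ (j + 1)}) \<and>
     (\<forall>\<xi>. (\<lambda>j. \<phi> j \<xi>) sums 1) \<and>
     (\<forall>\<alpha>. \<exists>c>0. \<forall>j \<xi>. norm (multi_derivative \<alpha> (\<phi> j) \<xi>) \<le> c * 2 powr (- real (j * order_of \<alpha>)))"

definition besov_enorm :: "(nat \<Rightarrow> real^'n \<Rightarrow> complex) \<Rightarrow> real \<Rightarrow> ennreal \<Rightarrow> ennreal \<Rightarrow>
    ('n::finite, 'e::complex_banach) distribution \<Rightarrow> ennreal" where
  "besov_enorm \<phi> s p q u = Lebesgue_norm q (count_space UNIV)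
     (\<lambda>j. ennreal (2 powr (real j * s)) *
          distribution_norm p (torus_op (\<lambda>k x. \<phi> j (real_vec k) *\<^sub>C x) u))"

definition besov_space :: "(nat \<Rightarrow> real^'n \<Rightarrow> complex) \<Rightarrow> real \<Rightarrow> ennreal \<Rightarrow> ennreal \<Rightarrow>
    ('n::finite, 'e::complex_banach) distribution set" where
  "besov_space \<phi> s p q = {u. besov_enorm \<phi> s p q u < \<infinity>}"

definition besov_norm :: "(nat \<Rightarrow> real^'n \<Rightarrow> complex) \<Rightarrow> real \<Rightarrow> ennreal \<Rightarrow> ennreal \<Rightarrow>
    ('n::finite, 'e::complex_banach) distribution \<Rightarrow> real" where
  "besov_norm \<phi> s p q u = enn2real (besov_enorm \<phi> s p q u)"

section \<open>Symbols and parabolicity\<close>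

definition symbol_norm ::
  "real \<Rightarrow> nat \<Rightarrow> (int^'n \<Rightarrow> 'e \<Rightarrow>\<^sub>L 'e::real_normed_vector) \<Rightarrow> ennreal" where
  "symbol_norm m \<rho> a = (MAX \<alpha>\<in>{\<alpha>. order_of \<alpha> \<le> \<rho>}. SUP k.
     ennreal (sqrt (1 + (norm (real_vec k))\<^sup>2) powr (real (order_of \<alpha>) - m) *
              norm (multi_difference \<alpha> a k)))"

text \<open>The library type of bounded linear maps is over the reals, so that complex homogeneity has
  to be required.\<close>

definition symbol_class ::
  "real \<Rightarrow> nat \<Rightarrow> (int^'n \<Rightarrow> 'e \<Rightarrow>\<^sub>L 'e::complex_banach) set" where
  "symbol_class m \<rho> =
     {a. (\<forall>k c x. blinfun_apply (a k) (c *\<^sub>C x) = c *\<^sub>C blinfun_apply (a k) x) \<and>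
         symbol_norm m \<rho> a < \<infinity>}"

definition parabolic_with ::
  "real \<Rightarrow> real \<Rightarrow> real \<Rightarrow> (int^'n \<Rightarrow> 'e \<Rightarrow>\<^sub>L 'e::complex_banach) \<Rightarrow> bool" where
  "parabolic_with m \<omega> \<kappa> a \<longleftrightarrow>
     (\<forall>k \<mu>. Re \<mu> \<ge> 0 \<and> sqrt ((norm (real_vec k))\<^sup>2 + cmod \<mu> powr (2 / m)) \<ge> \<omega> \<longrightarrow>
        (let T = \<lambda>x. blinfun_apply (a k) x + \<mu> *\<^sub>C x in
          bij T \<and> bounded_linear (inv T) \<and>
          onorm (inv T) \<le> \<kappa> * sqrt (1 + (norm (real_vec k))\<^sup>2 + cmod \<mu> powr (2 / m)) powr (- m)))"

definition parabolic :: "real \<Rightarrow> (int^'n \<Rightarrow> 'e \<Rightarrow>\<^sub>L 'e::complex_banach) \<Rightarrow> bool" where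
  "parabolic m a \<longleftrightarrow> (\<exists>\<omega>\<ge>0. \<exists>\<kappa>>0. parabolic_with m \<omega> \<kappa> a)"

section \<open>Unbounded operators and analytic semigroups\<close>

text \<open>An unbounded operator is a pair of its domain and a map that is relevant only on the domain.
  The underlying normed space is a subspace \<open>X\<close> of a complex vector space with a norm \<open>N\<close> on it;
  it is not mentioned in the definitions that it is complete. The bounds \<open>N (T v) \<le> C * N v\<close>
  below say that the operator norm of \<open>T\<close> on \<open>X\<close> is at most \<open>C\<close>.\<close>

type_synonym 'v operator = "'v set \<times> ('v \<Rightarrow> 'v)"

definition complex_subspace :: "'v::complex_vector set \<Rightarrow> bool" where
  "complex_subspace D \<longleftrightarrow>
     0 \<in> D \<and> (\<forall>u\<in>D. \<forall>v\<in>D. u + v \<in> D) \<and> (\<forall>c. \<forall>u\<in>D. c *\<^sub>C u \<in> D)"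

definition linear_operator_in :: "'v::complex_vector set \<Rightarrow> 'v operator \<Rightarrow> bool" where
  "linear_operator_in X = (\<lambda>(D, B).
     complex_subspace D \<and> D \<subseteq> X \<and> B ` D \<subseteq> X \<and>
     (\<forall>u\<in>D. \<forall>v\<in>D. B (u + v) = B u + B v) \<and> (\<forall>c. \<forall>u\<in>D. B (c *\<^sub>C u) = c *\<^sub>C B u))"

definition resolvent :: "'v::complex_vector operator \<Rightarrow> complex \<Rightarrow> 'v \<Rightarrow> 'v" where
  "resolvent = (\<lambda>(D, B) \<mu>. inv_into D (\<lambda>u. \<mu> *\<^sub>C u - B u))"

definition resolvent_set ::
  "'v::complex_vector set \<Rightarrow> ('v \<Rightarrow> real) \<Rightarrow> 'v operator \<Rightarrow> complex set" where
  "resolvent_set X N = (\<lambda>(D, B).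
     {\<mu>. bij_betw (\<lambda>u. \<mu> *\<^sub>C u - B u) D X \<and>
         (\<exists>C. \<forall>v\<in>X. N (resolvent (D, B) \<mu> v) \<le> C * N v)})"

definition generates_analytic_semigroup ::
  "'v::complex_vector set \<Rightarrow> ('v \<Rightarrow> real) \<Rightarrow> 'v operator \<Rightarrow> bool" where
  "generates_analytic_semigroup X N B \<longleftrightarrow>
     linear_operator_in X B \<and>
     (\<exists>(\<omega>::real) \<theta> M. \<theta> \<in> {pi / 2<..<pi} \<and> M > 0 \<and>
        (\<forall>\<mu>. \<mu> \<noteq> complex_of_real \<omega> \<and> \<bar>Arg (\<mu> - complex_of_real \<omega>)\<bar> < \<theta> \<longrightarrow>
           \<mu> \<in> resolvent_set X N B \<and>
           (\<forall>v\<in>X. N (resolvent B \<mu> v) \<le> M / cmod (\<mu> - complex_of_real \<omega>) * N v)))"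

definition neg_operator :: "'v::complex_vector operator \<Rightarrow> 'v operator" where
  "neg_operator = (\<lambda>(D, B). (D, \<lambda>u. - B u))"

definition besov_realization :: "(nat \<Rightarrow> real^'n \<Rightarrow> complex) \<Rightarrow> real \<Rightarrow> ennreal \<Rightarrow> ennreal \<Rightarrow>
    real \<Rightarrow> (int^'n \<Rightarrow> 'e \<Rightarrow>\<^sub>L 'e) \<Rightarrow> ('n::finite, 'e::complex_banach) distribution operator" where
  "besov_realization \<phi> s p q m a =
     (besov_space \<phi> (s + m) p q, torus_op (\<lambda>k. blinfun_apply (a k)))"

end

theory Submission
  imports Defs
begin

text \<open>
  The resolvent of \<open>- A\<close> at \<open>\<mu>\<close> is the Fourier multiplier with the symbol \<open>(a(k) + \<mu>)\<^sup>-\<^sup>1\<close>. A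
  distribution is determined by its Fourier coefficients (\<open>distribution_eqI\<close>), so identities
  between multipliers may be checked on symbols, and the theorem reduces to two estimates.

  The first is a multiplier theorem (\<open>besov_multiplier\<close>): if a symbol is of order \<open>\<sigma>\<close> with respect to
  \<open>n + 1\<close> differences in each coordinate direction, then it maps the Besov space of order
  \<open>s + \<sigma>\<close> to that of order \<open>s\<close>, with a norm that is linear in the constant of the symbol estimate. On
  the dyadic block \<open>j\<close> the operator is convolution with a trigonometric polynomial. A difference
  of the symbol in the direction \<open>l\<close> multiplies this kernel by a factor of modulus
  \<open>|exp(i x\<^sub>l) - 1|\<close> and makes the symbol smaller by the factor \<open>2 ^ (- j)\<close>. With \<open>n + 1\<close> differences
  in the direction of the largest coordinate, the kernel is bounded by \<open>2 ^ (j * \<sigma>)\<close> times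
  an integrable function whose integral does not depend on \<open>j\<close> (\<open>fourier_sum_decay\<close>,
  \<open>nn_integral_decay\<close>). Young's inequality turns this into a bound in \<open>L\<^sup>p\<close> for all exponents,
  including 1 and \<open>\<infinity>\<close> (\<open>distribution_norm_torus_op_le\<close>). Only neighbouring blocks interact, which
  gives the bound in the norm of the sequence space.

  The second is a symbol estimate for the resolvent that is uniform in \<open>\<mu>\<close>
  (\<open>resolvent_symbol\<close>). Parabolicity bounds the inverse \<open>b\<close> of \<open>f = a + \<mu>\<close> by the weight
  \<open>\<langle>k, \<mu>\<rangle> ^ (- m)\<close>, and the identity \<open>\<Delta>b = - b(\<cdot> + e) \<cdot> \<Delta>f \<cdot> b\<close> extends this bound by induction to all
  differences of \<open>b\<close> (\<open>symbol_bound_inverse\<close>), each of which gains a power of \<open>\<langle>k\<rangle>\<close>. The weight is at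
  most \<open>1 / |\<mu>|\<close>, which together with the multiplier theorem of order 0 is the sectorial estimate. It is
  also at most \<open>\<langle>k\<rangle> ^ (- m)\<close>, so the multiplier theorem of order \<open>- m\<close> shows that the resolvent takes
  its values in the domain. Parabolicity covers the right half-plane outside a ball; moving the vertex
  to the right avoids the ball, and a perturbation argument opens the half-plane to a sector of
  angle larger than \<open>\<pi> / 2\<close>.

  The range space is an arbitrary Banach space, so the integral for strongly measurable functions
  and the Fourier inversion formula for test functions are developed along the way.
\<close>

section \<open>The Bochner integral in arbitrary Banach spaces\<close>

text \<open>The integral is only sensitive to values outside a null set, and outside a suitable null set
  \<open>f\<close> is a limit of simple functions everywhere. Such limits are Borel measurable even when the
  range space is not separable.\<close>

lemma strongly_measurableE:
  fixes f :: "'a \<Rightarrow> 'b::real_normed_vector"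
  assumes "strongly_measurable M f"
  obtains g s where "AE x in M. f x = g x" "\<And>i::nat. simple_function M (s i)"
    "\<And>x. x \<in> space M \<Longrightarrow> (\<lambda>i. s i x) \<longlonglongrightarrow> g x"
proof -
  obtain t where t: "\<And>i::nat. simple_function M (t i)" "AE x in M. (\<lambda>i. t i x) \<longlonglongrightarrow> f x"
    using assms unfolding strongly_measurable_def by blast
  then obtain N where N: "{x\<in>space M. \<not> (\<lambda>i. t i x) \<longlonglongrightarrow> f x} \<subseteq> N" "N \<in> null_sets M"
    unfolding eventually_ae_filter by blast
  define s where "s i x = (if x \<in> N then 0 else t i x)" for i x
  define g where "g x = (if x \<in> N then 0 else f x)" for x
  have "AE x in M. f x = g x"
    using AE_not_in[OF N(2)] by eventually_elim (simp add: g_def)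
  moreover have "simple_function M (s i)" for i
    unfolding s_def using N(2) by (intro simple_function_If_set t(1) simple_function_const)
      (auto intro: sets.Int)
  moreover have "(\<lambda>i. s i x) \<longlonglongrightarrow> g x" if "x \<in> space M" for x
    using that N(1) by (cases "x \<in> N") (auto simp: s_def g_def)
  ultimately show thesis by (rule that)
qed

lemma strongly_measurableI:
  assumes "AE x in M. f x = g x" "\<And>i::nat. simple_function M (s i)"
    "\<And>x. x \<in> space M \<Longrightarrow> (\<lambda>i. s i x) \<longlonglongrightarrow> g x"
  shows "strongly_measurable M f"
  unfolding strongly_measurable_def
proof (intro exI[of _ s] conjI allI assms(2))
  show "AE x in M. (\<lambda>i. s i x) \<longlonglongrightarrow> f x"
    using assms(1) AE_space by eventually_elim (use assms(3) in auto)
qed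

lemma strongly_measurable_norm_diff:
  fixes f :: "'a \<Rightarrow> 'b::real_normed_vector"
  assumes f: "strongly_measurable M f" and t: "simple_function M t"
  obtains h where "h \<in> borel_measurable M" "AE x in M. norm (f x - t x) = h x" "\<And>x. 0 \<le> h x"
proof -
  obtain g s where g: "AE x in M. f x = g x" and s: "\<And>i::nat. simple_function M (s i)"
    and lim: "\<And>x. x \<in> space M \<Longrightarrow> (\<lambda>i. s i x) \<longlonglongrightarrow> g x"
    by (rule strongly_measurableE[OF f]) (rule that)
  have "(\<lambda>x. norm (g x - t x)) \<in> borel_measurable M"
  proof (rule borel_measurable_LIMSEQ_metric)
    show "(\<lambda>x. norm (s i x - t x)) \<in> borel_measurable M" for i
      using simple_function_compose2[OF s t, where h="\<lambda>x y. norm (x - y)"]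
      by (rule borel_measurable_simple_function)
    show "(\<lambda>i. norm (s i x - t x)) \<longlonglongrightarrow> norm (g x - t x)" if "x \<in> space M" for x
      by (intro tendsto_intros lim that)
  qed
  moreover have "AE x in M. norm (f x - t x) = norm (g x - t x)"
    using g by eventually_elim simp
  ultimately show thesis using that[of "\<lambda>x. norm (g x - t x)"] by simp
qed

lemma strongly_measurable_compose2:
  fixes f :: "'a \<Rightarrow> 'b::real_normed_vector" and g :: "'a \<Rightarrow> 'c::real_normed_vector"
    and p :: "'b \<Rightarrow> 'c \<Rightarrow> 'd::real_normed_vector"
  assumes f: "strongly_measurable M f" and g: "strongly_measurable M g"
    and p: "continuous_on UNIV (\<lambda>z. p (fst z) (snd z))"
  shows "strongly_measurable M (\<lambda>x. p (f x) (g x))"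
proof -
  obtain s where s: "\<And>i::nat. simple_function M (s i)" "AE x in M. (\<lambda>i. s i x) \<longlonglongrightarrow> f x"
    using f unfolding strongly_measurable_def by blast
  obtain t where t: "\<And>i::nat. simple_function M (t i)" "AE x in M. (\<lambda>i. t i x) \<longlonglongrightarrow> g x"
    using g unfolding strongly_measurable_def by blast
  have "AE x in M. (\<lambda>i. p (s i x) (t i x)) \<longlonglongrightarrow> p (f x) (g x)"
    using s(2) t(2)
  proof eventually_elim
    case (elim x)
    have "isCont (\<lambda>z. p (fst z) (snd z)) (f x, g x)"
      using p by (simp add: continuous_on_eq_continuous_at)
    from isCont_tendsto_compose[OF this tendsto_Pair[OF elim]] show ?case by simp
  qed
  moreover have "simple_function M (\<lambda>x. p (s i x) (t i x))" for i
    using s(1) t(1) by (rule simple_function_compose2)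
  ultimately show ?thesis
    unfolding strongly_measurable_def by (intro exI[of _ "\<lambda>i x. p (s i x) (t i x)"]) simp
qed

lemma strongly_measurable_compose:
  fixes f :: "'a \<Rightarrow> 'b::real_normed_vector" and p :: "'b \<Rightarrow> 'd::real_normed_vector"
  assumes "strongly_measurable M f" and "continuous_on UNIV p"
  shows "strongly_measurable M (\<lambda>x. p (f x))"
  by (rule strongly_measurable_compose2[where p="\<lambda>x y. p x", OF assms(1) assms(1)])
    (intro continuous_on_compose2[OF assms(2)] continuous_intros; simp)

lemma strongly_measurable_borel:
  fixes f :: "'a \<Rightarrow> 'b::{real_normed_vector, second_countable_topology}"
  assumes "f \<in> borel_measurable M"
  shows "strongly_measurable M f"
  using borel_measurable_implies_sequence_metric[OF assms, of 0]
  unfolding strongly_measurable_def by (auto intro!: AE_I2)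

lemma strongly_measurable_norm:
  fixes f :: "'a \<Rightarrow> 'b::real_normed_vector"
  assumes f: "strongly_measurable M f"
  obtains h where "h \<in> borel_measurable M" "AE x in M. norm (f x) = h x" "\<And>x. 0 \<le> h x"
proof -
  obtain h where "h \<in> borel_measurable M" "AE x in M. norm (f x - 0) = h x" "\<And>x. 0 \<le> h x"
    by (rule strongly_measurable_norm_diff[OF f simple_function_const[of M 0]]) (rule that)
  then show thesis using that[of h] by simp
qed

lemma ennreal_tendsto_0_mono:
  fixes f g :: "nat \<Rightarrow> ennreal"
  assumes "g \<longlonglongrightarrow> 0" "\<And>i. f i \<le> g i"
  shows "f \<longlonglongrightarrow> 0"
  by (rule tendsto_sandwich[OF _ _ tendsto_const assms(1)]) (use assms(2) in auto)

lemma simple_bochner_integrableD: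
  "Bochner_Integration.simple_bochner_integrable M s \<Longrightarrow> simple_function M s"
  by (auto elim: simple_bochner_integrable.cases)

text \<open>The integrals of two simple functions are compared through \<open>f\<close>. This gives both the uniqueness of
  the integral and the Cauchy property of approximating integrals.\<close>

lemma norm_integral_simple_diff_le:
  fixes f :: "'a \<Rightarrow> 'b::real_normed_vector"
  assumes f: "strongly_measurable M f"
    and s: "Bochner_Integration.simple_bochner_integrable M s"
    and t: "Bochner_Integration.simple_bochner_integrable M t"
  shows "ennreal (norm (Bochner_Integration.simple_bochner_integral M s
      - Bochner_Integration.simple_bochner_integral M t)) \<le>
    (\<integral>\<^sup>+ x. norm (f x - s x) \<partial>M) + (\<integral>\<^sup>+ x. norm (f x - t x) \<partial>M)"
proof -
  have sf: "simple_function M s" "simple_function M t"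
    using s t by (auto elim: simple_bochner_integrable.cases)
  obtain h1 where h1: "h1 \<in> borel_measurable M" "AE x in M. norm (f x - s x) = h1 x" "\<And>x. 0 \<le> h1 x"
    by (rule strongly_measurable_norm_diff[OF f sf(1)]) (rule that)
  obtain h2 where h2: "h2 \<in> borel_measurable M" "AE x in M. norm (f x - t x) = h2 x" "\<And>x. 0 \<le> h2 x"
    by (rule strongly_measurable_norm_diff[OF f sf(2)]) (rule that)
  let ?I = "Bochner_Integration.simple_bochner_integral M"
  have "ennreal (norm (?I s - ?I t)) = norm (?I (\<lambda>x. s x - t x))"
    using s t by (subst simple_bochner_integral_diff) auto
  also have "\<dots> \<le> ?I (\<lambda>x. norm (s x - t x))"
    using simple_bochner_integrable_compose2[of "(-)" M "s" "t"] s t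
    by (auto intro!: simple_bochner_integral_norm_bound)
  also have "\<dots> = (\<integral>\<^sup>+x. norm (s x - t x) \<partial>M)"
    using simple_bochner_integrable_compose2[of "\<lambda>x y. norm (x - y)" M "s" "t"] s t
    by (auto intro!: simple_bochner_integral_eq_nn_integral)
  also have "\<dots> \<le> (\<integral>\<^sup>+x. ennreal (h1 x) + ennreal (h2 x) \<partial>M)"
  proof (rule nn_integral_mono_AE)
    show "AE x in M. ennreal (norm (s x - t x)) \<le> ennreal (h1 x) + ennreal (h2 x)"
      using h1(2) h2(2)
    proof eventually_elim
      case (elim x)
      have "norm (s x - t x) \<le> norm (f x - s x) + norm (f x - t x)"
        by (metis dual_order.refl norm_diff_triangle_le norm_minus_commute)
      then show ?case using elim h1(3) h2(3) by (simp flip: ennreal_plus)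
    qed
  qed
  also have "\<dots> = (\<integral>\<^sup>+ x. h1 x \<partial>M) + (\<integral>\<^sup>+ x. h2 x \<partial>M)"
    using h1(1) h2(1) by (intro nn_integral_add) auto
  also have "(\<integral>\<^sup>+ x. h1 x \<partial>M) = (\<integral>\<^sup>+ x. norm (f x - s x) \<partial>M)"
    using h1(2) by (intro nn_integral_cong_AE) auto
  also have "(\<integral>\<^sup>+ x. h2 x \<partial>M) = (\<integral>\<^sup>+ x. norm (f x - t x) \<partial>M)"
    using h2(2) by (intro nn_integral_cong_AE) auto
  finally show ?thesis .
qed

lemma has_strong_bochner_integral_unique:
  fixes f :: "'a \<Rightarrow> 'b::real_normed_vector"
  assumes I: "has_strong_bochner_integral M f I" and J: "has_strong_bochner_integral M f J"
  shows "I = J"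
proof -
  let ?I = "Bochner_Integration.simple_bochner_integral M"
  have f: "strongly_measurable M f" using I by (simp add: has_strong_bochner_integral_def)
  obtain s where s: "\<And>i::nat. Bochner_Integration.simple_bochner_integrable M (s i)"
    "(\<lambda>i. \<integral>\<^sup>+x. ennreal (norm (f x - s i x)) \<partial>M) \<longlonglongrightarrow> 0" "(\<lambda>i. ?I (s i)) \<longlonglongrightarrow> I"
    using I by (auto simp: has_strong_bochner_integral_def)
  obtain t where t: "\<And>i::nat. Bochner_Integration.simple_bochner_integrable M (t i)"
    "(\<lambda>i. \<integral>\<^sup>+x. ennreal (norm (f x - t i x)) \<partial>M) \<longlonglongrightarrow> 0" "(\<lambda>i. ?I (t i)) \<longlonglongrightarrow> J"
    using J by (auto simp: has_strong_bochner_integral_def)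
  have "(\<lambda>i. ennreal (norm (?I (s i) - ?I (t i)))) \<longlonglongrightarrow> ennreal (norm (I - J))"
    by (intro tendsto_intros tendsto_ennrealI s(3) t(3))
  moreover have "(\<lambda>i. ennreal (norm (?I (s i) - ?I (t i)))) \<longlonglongrightarrow> 0"
  proof (rule ennreal_tendsto_0_mono)
    show "(\<lambda>i. (\<integral>\<^sup>+x. ennreal (norm (f x - s i x)) \<partial>M) + (\<integral>\<^sup>+x. ennreal (norm (f x - t i x)) \<partial>M))
      \<longlonglongrightarrow> 0"
      using tendsto_add[OF s(2) t(2)] by simp
    show "ennreal (norm (?I (s i) - ?I (t i))) \<le>
        (\<integral>\<^sup>+x. ennreal (norm (f x - s i x)) \<partial>M) + (\<integral>\<^sup>+x. ennreal (norm (f x - t i x)) \<partial>M)" for i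
      by (intro norm_integral_simple_diff_le f s(1) t(1))
  qed
  ultimately have "ennreal (norm (I - J)) = 0" by (rule LIMSEQ_unique)
  then show ?thesis by (simp add: ennreal_eq_0_iff)
qed

lemma strong_bochner_integral_eq:
  "has_strong_bochner_integral M f I \<Longrightarrow> strong_bochner_integral M f = I"
  unfolding strong_bochner_integral_def
  by (rule the_equality) (auto intro: has_strong_bochner_integral_unique)

text \<open>Truncating the simple approximations at twice the norm of the limit makes dominated
  convergence applicable, and completeness gives the limit of the integrals.\<close>

lemma has_strong_bochner_integral_exists:
  fixes f :: "'a \<Rightarrow> 'b::banach"
  assumes f: "strongly_measurable M f" and fin: "(\<integral>\<^sup>+x. norm (f x) \<partial>M) < \<infinity>"
  shows "has_strong_bochner_integral M f (strong_bochner_integral M f)"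
proof -
  let ?I = "Bochner_Integration.simple_bochner_integral M"
  obtain g s where g: "AE x in M. f x = g x" and s: "\<And>i::nat. simple_function M (s i)"
    and lim: "\<And>x. x \<in> space M \<Longrightarrow> (\<lambda>i. s i x) \<longlonglongrightarrow> g x"
    by (rule strongly_measurableE[OF f]) (rule that)
  have g_meas: "strongly_measurable M g"
    by (rule strongly_measurableI[OF _ s lim]) auto
  have s_meas [measurable]: "(\<lambda>x. norm (s i x)) \<in> borel_measurable M" for i
    using simple_function_compose1[OF s, of norm] by (rule borel_measurable_simple_function)
  have [measurable]: "(\<lambda>x. norm (g x)) \<in> borel_measurable M"
    by (rule borel_measurable_LIMSEQ_metric[where f="\<lambda>i x. norm (s i x)"])
      (auto intro!: tendsto_intros lim)
  have fing: "(\<integral>\<^sup>+x. norm (g x) \<partial>M) < \<infinity>"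
    using fin g by (subst nn_integral_cong_AE[where v="\<lambda>x. norm (f x)"]) auto
  define t where "t i x = (if norm (s i x) \<le> 2 * norm (g x) then s i x else 0)" for i x
  have t_simple: "simple_function M (t i)" for i
    unfolding t_def by (intro simple_function_If s simple_function_const) measurable
  have t_norm: "norm (t i x) \<le> 2 * norm (g x)" for i x
    by (simp add: t_def)
  have t_lim: "(\<lambda>i. t i x) \<longlonglongrightarrow> g x" if x: "x \<in> space M" for x
  proof (cases "g x = 0")
    case True
    have "t i x = 0" for i by (simp add: t_def True)
    then show ?thesis using True by simp
  next
    case False
    have "(\<lambda>i. norm (s i x)) \<longlonglongrightarrow> norm (g x)" by (intro tendsto_intros lim x)
    then have "\<forall>\<^sub>F i in sequentially. norm (s i x) < 2 * norm (g x)"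
      by (rule order_tendstoD) (use False in simp)
    then have "\<forall>\<^sub>F i in sequentially. s i x = t i x"
      by eventually_elim (simp add: t_def)
    then show ?thesis using lim[OF x] by (rule Lim_transform_eventually[rotated])
  qed
  have t_fin: "(\<integral>\<^sup>+x. norm (t i x) \<partial>M) < \<infinity>" for i
  proof -
    have "(\<integral>\<^sup>+x. norm (t i x) \<partial>M) \<le> (\<integral>\<^sup>+x. 2 * ennreal (norm (g x)) \<partial>M)"
      by (intro nn_integral_mono) (use t_norm in \<open>auto simp: ennreal_mult'[symmetric] ennreal_leI
        simp flip: ennreal_numeral\<close>)
    also have "\<dots> = 2 * (\<integral>\<^sup>+x. norm (g x) \<partial>M)" by (intro nn_integral_cmult) measurable
    also have "\<dots> < \<infinity>" using fing by (simp add: ennreal_mult_less_top)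
    finally show ?thesis .
  qed
  have t_int: "Bochner_Integration.simple_bochner_integrable M (t i)" for i
    by (rule simple_bochner_integrableI_bounded[OF t_simple t_fin])
  have diff_lim: "(\<lambda>i. \<integral>\<^sup>+x. norm (g x - t i x) \<partial>M) \<longlonglongrightarrow> (\<integral>\<^sup>+x. 0 \<partial>M)"
  proof (rule nn_integral_dominated_convergence[where w="\<lambda>x. 3 * ennreal (norm (g x))"])
    show "(\<lambda>x. ennreal (norm (g x - t i x))) \<in> borel_measurable M" for i
    proof -
      have "(\<lambda>x. norm (g x - t i x)) \<in> borel_measurable M"
      proof (rule borel_measurable_LIMSEQ_metric)
        show "(\<lambda>x. norm (s j x - t i x)) \<in> borel_measurable M" for j
          using simple_function_compose2[OF s t_simple, where h="\<lambda>x y. norm (x - y)"]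
          by (rule borel_measurable_simple_function)
        show "(\<lambda>j. norm (s j x - t i x)) \<longlonglongrightarrow> norm (g x - t i x)" if "x \<in> space M" for x
          by (intro tendsto_intros lim that)
      qed
      then show ?thesis by measurable
    qed
    show "AE x in M. ennreal (norm (g x - t j x)) \<le> 3 * ennreal (norm (g x))" for j
    proof (rule AE_I2)
      fix x
      have "norm (g x - t j x) \<le> 3 * norm (g x)"
        using norm_triangle_ineq4[of "g x" "t j x"] t_norm[of j x] by linarith
      then show "ennreal (norm (g x - t j x)) \<le> 3 * ennreal (norm (g x))"
        by (simp add: ennreal_mult'[symmetric] ennreal_leI flip: ennreal_numeral)
    qed
    show "(\<integral>\<^sup>+x. 3 * ennreal (norm (g x)) \<partial>M) < \<infinity>"
      using fing by (subst nn_integral_cmult) (auto simp: ennreal_mult_less_top)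
    show "AE x in M. (\<lambda>i. ennreal (norm (g x - t i x))) \<longlonglongrightarrow> 0"
    proof (rule AE_I2)
      fix x assume "x \<in> space M"
      then have "(\<lambda>i. ennreal (norm (g x - t i x))) \<longlonglongrightarrow> ennreal (norm (g x - g x))"
        by (intro tendsto_intros tendsto_ennrealI t_lim)
      then show "(\<lambda>i. ennreal (norm (g x - t i x))) \<longlonglongrightarrow> 0" by simp
    qed
  qed measurable
  have "Cauchy (\<lambda>i. ?I (t i))"
  proof (rule metric_CauchyI)
    fix e :: real assume e: "0 < e"
    have "\<forall>\<^sub>F i in sequentially. (\<integral>\<^sup>+x. norm (g x - t i x) \<partial>M) < ennreal (e / 2)"
      using diff_lim e by (intro order_tendstoD(2)[OF diff_lim]) simp
    then obtain n where n: "\<And>i. i \<ge> n \<Longrightarrow> (\<integral>\<^sup>+x. norm (g x - t i x) \<partial>M) < ennreal (e / 2)"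
      unfolding eventually_sequentially by blast
    have "dist (?I (t i)) (?I (t j)) < e" if "i \<ge> n" "j \<ge> n" for i j
    proof -
      have "ennreal (norm (?I (t i) - ?I (t j))) \<le>
          (\<integral>\<^sup>+x. norm (g x - t i x) \<partial>M) + (\<integral>\<^sup>+x. norm (g x - t j x) \<partial>M)"
        by (intro norm_integral_simple_diff_le g_meas t_int)
      also have "\<dots> < ennreal (e / 2) + ennreal (e / 2)"
        by (intro add_strict_mono n that)
      also have "\<dots> = ennreal e" using e by (simp flip: ennreal_plus)
      finally show ?thesis by (simp add: dist_norm ennreal_less_iff)
    qed
    then show "\<exists>M. \<forall>m\<ge>M. \<forall>n\<ge>M. dist (?I (t m)) (?I (t n)) < e" by blast
  qed
  then obtain I where I: "(\<lambda>i. ?I (t i)) \<longlonglongrightarrow> I"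
    using Cauchy_convergent convergent_def by blast
  have "(\<integral>\<^sup>+x. norm (g x - t i x) \<partial>M) = (\<integral>\<^sup>+x. norm (f x - t i x) \<partial>M)" for i
    using g by (intro nn_integral_cong_AE) auto
  then have "has_strong_bochner_integral M f I"
    unfolding has_strong_bochner_integral_def using f I t_int diff_lim by auto
  then show ?thesis by (simp add: strong_bochner_integral_eq)
qed

lemma has_strong_bochner_integral_norm_bound:
  fixes f :: "'a \<Rightarrow> 'b::real_normed_vector"
  assumes I: "has_strong_bochner_integral M f I"
  shows "ennreal (norm I) \<le> (\<integral>\<^sup>+x. norm (f x) \<partial>M)"
proof -
  let ?I = "Bochner_Integration.simple_bochner_integral M"
  have f: "strongly_measurable M f" using I by (simp add: has_strong_bochner_integral_def)
  obtain s where s: "\<And>i::nat. Bochner_Integration.simple_bochner_integrable M (s i)"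
    "(\<lambda>i. \<integral>\<^sup>+x. ennreal (norm (f x - s i x)) \<partial>M) \<longlonglongrightarrow> 0" "(\<lambda>i. ?I (s i)) \<longlonglongrightarrow> I"
    using I by (auto simp: has_strong_bochner_integral_def)
  have zero: "Bochner_Integration.simple_bochner_integrable M (\<lambda>x. 0::'b)"
    by (auto simp: simple_bochner_integrable.simps)
  have "ennreal (norm (?I (s i))) \<le>
      (\<integral>\<^sup>+x. norm (f x - s i x) \<partial>M) + (\<integral>\<^sup>+x. norm (f x) \<partial>M)" for i
    using norm_integral_simple_diff_le[OF f s(1) zero, of i]
    by (simp add: simple_bochner_integral_def image_constant_conv split: if_splits)
  moreover have "(\<lambda>i. ennreal (norm (?I (s i)))) \<longlonglongrightarrow> ennreal (norm I)"
    by (intro tendsto_intros tendsto_ennrealI s(3))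
  moreover have "(\<lambda>i. (\<integral>\<^sup>+x. norm (f x - s i x) \<partial>M) + (\<integral>\<^sup>+x. norm (f x) \<partial>M))
      \<longlonglongrightarrow> 0 + (\<integral>\<^sup>+x. norm (f x) \<partial>M)"
    by (intro tendsto_add s(2) tendsto_const)
  ultimately show ?thesis
    by (metis (no_types, lifting) add_0 LIMSEQ_le)
qed

lemma has_strong_bochner_integral_bounded_linear:
  fixes f :: "'a \<Rightarrow> 'b::real_normed_vector" and T :: "'b \<Rightarrow> 'c::real_normed_vector"
  assumes T: "bounded_linear T" and I: "has_strong_bochner_integral M f I"
  shows "has_strong_bochner_integral M (\<lambda>x. T (f x)) (T I)"
proof -
  interpret T: bounded_linear T by fact
  let ?I = "Bochner_Integration.simple_bochner_integral M"
  have f: "strongly_measurable M f" using I by (simp add: has_strong_bochner_integral_def)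
  obtain s where s: "\<And>i::nat. Bochner_Integration.simple_bochner_integrable M (s i)"
    "(\<lambda>i. \<integral>\<^sup>+x. ennreal (norm (f x - s i x)) \<partial>M) \<longlonglongrightarrow> 0" "(\<lambda>i. ?I (s i)) \<longlonglongrightarrow> I"
    using I by (auto simp: has_strong_bochner_integral_def)
  obtain K where K: "K > 0" "\<And>x. norm (T x) \<le> norm x * K"
    using T.pos_bounded by blast
  have "(\<lambda>i. \<integral>\<^sup>+x. norm (T (f x) - T (s i x)) \<partial>M) \<longlonglongrightarrow> 0"
  proof (rule ennreal_tendsto_0_mono)
    show "(\<lambda>i. ennreal K * (\<integral>\<^sup>+x. norm (f x - s i x) \<partial>M)) \<longlonglongrightarrow> 0"
      using ennreal_tendsto_cmult[OF _ s(2), of "ennreal K"] by simp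
    show "(\<integral>\<^sup>+x. norm (T (f x) - T (s i x)) \<partial>M) \<le>
        ennreal K * (\<integral>\<^sup>+x. norm (f x - s i x) \<partial>M)" for i
    proof -
      obtain h where h: "h \<in> borel_measurable M" "AE x in M. norm (f x - s i x) = h x" "\<And>x. 0 \<le> h x"
        by (rule strongly_measurable_norm_diff[OF f simple_bochner_integrableD[OF s(1)]]) (rule that)
      have "(\<integral>\<^sup>+x. norm (T (f x) - T (s i x)) \<partial>M) \<le> (\<integral>\<^sup>+x. ennreal K * ennreal (h x) \<partial>M)"
      proof (rule nn_integral_mono_AE)
        show "AE x in M. ennreal (norm (T (f x) - T (s i x))) \<le> ennreal K * ennreal (h x)"
          using h(2)
        proof eventually_elim
          case (elim x)
          then show ?case
            using K(2)[of "f x - s i x"] K(1) h(3)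
            by (simp add: T.diff mult.commute ennreal_leI flip: ennreal_mult)
        qed
      qed
      also have "\<dots> = ennreal K * (\<integral>\<^sup>+x. h x \<partial>M)"
        using h(1) by (intro nn_integral_cmult) measurable
      also have "(\<integral>\<^sup>+x. h x \<partial>M) = (\<integral>\<^sup>+x. norm (f x - s i x) \<partial>M)"
        using h(2) by (intro nn_integral_cong_AE) auto
      finally show "(\<integral>\<^sup>+x. norm (T (f x) - T (s i x)) \<partial>M) \<le>
        ennreal K * (\<integral>\<^sup>+x. norm (f x - s i x) \<partial>M)" .
    qed
  qed
  moreover have "Bochner_Integration.simple_bochner_integrable M (\<lambda>x. T (s i x))" for i
    by (rule simple_bochner_integrable_compose2[where p="\<lambda>x y. T x", OF _ s(1) s(1)])
      (simp add: T.zero)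
  moreover have "(\<lambda>i. ?I (\<lambda>x. T (s i x))) \<longlonglongrightarrow> T I"
    using s(1,3) by (auto intro!: T.tendsto simp: simple_bochner_integral_linear T.linear_axioms)
  moreover have "strongly_measurable M (\<lambda>x. T (f x))"
    by (rule strongly_measurable_compose[OF f]) (rule T.continuous_on[OF continuous_on_id])
  ultimately show ?thesis
    unfolding has_strong_bochner_integral_def by (intro conjI exI[of _ "\<lambda>i x. T (s i x)"]) auto
qed

lemma strongly_measurable_add:
  fixes f :: "'a \<Rightarrow> 'b::real_normed_vector"
  assumes "strongly_measurable M f" "strongly_measurable M g"
  shows "strongly_measurable M (\<lambda>x. f x + g x)"
  by (rule strongly_measurable_compose2[OF assms]) (intro continuous_intros)

lemma has_strong_bochner_integral_add:
  fixes f :: "'a \<Rightarrow> 'b::real_normed_vector"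
  assumes I: "has_strong_bochner_integral M f I" and J: "has_strong_bochner_integral M g J"
  shows "has_strong_bochner_integral M (\<lambda>x. f x + g x) (I + J)"
proof -
  let ?I = "Bochner_Integration.simple_bochner_integral M"
  have f: "strongly_measurable M f" and g: "strongly_measurable M g"
    using I J by (simp_all add: has_strong_bochner_integral_def)
  obtain s where s: "\<And>i::nat. Bochner_Integration.simple_bochner_integrable M (s i)"
    "(\<lambda>i. \<integral>\<^sup>+x. ennreal (norm (f x - s i x)) \<partial>M) \<longlonglongrightarrow> 0" "(\<lambda>i. ?I (s i)) \<longlonglongrightarrow> I"
    using I by (auto simp: has_strong_bochner_integral_def)
  obtain t where t: "\<And>i::nat. Bochner_Integration.simple_bochner_integrable M (t i)"
    "(\<lambda>i. \<integral>\<^sup>+x. ennreal (norm (g x - t i x)) \<partial>M) \<longlonglongrightarrow> 0" "(\<lambda>i. ?I (t i)) \<longlonglongrightarrow> J"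
    using J by (auto simp: has_strong_bochner_integral_def)
  have "(\<lambda>i. \<integral>\<^sup>+x. norm ((f x + g x) - (s i x + t i x)) \<partial>M) \<longlonglongrightarrow> 0"
  proof (rule ennreal_tendsto_0_mono)
    show "(\<lambda>i. (\<integral>\<^sup>+x. norm (f x - s i x) \<partial>M) + (\<integral>\<^sup>+x. norm (g x - t i x) \<partial>M)) \<longlonglongrightarrow> 0"
      using tendsto_add[OF s(2) t(2)] by simp
    show "(\<integral>\<^sup>+x. norm ((f x + g x) - (s i x + t i x)) \<partial>M) \<le>
        (\<integral>\<^sup>+x. norm (f x - s i x) \<partial>M) + (\<integral>\<^sup>+x. norm (g x - t i x) \<partial>M)" for i
    proof -
      obtain h where h: "h \<in> borel_measurable M" "AE x in M. norm (f x - s i x) = h x" "\<And>x. 0 \<le> h x"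
        by (rule strongly_measurable_norm_diff[OF f simple_bochner_integrableD[OF s(1)]]) (rule that)
      obtain k where k: "k \<in> borel_measurable M" "AE x in M. norm (g x - t i x) = k x" "\<And>x. 0 \<le> k x"
        by (rule strongly_measurable_norm_diff[OF g simple_bochner_integrableD[OF t(1)]]) (rule that)
      have "(\<integral>\<^sup>+x. norm ((f x + g x) - (s i x + t i x)) \<partial>M) \<le>
          (\<integral>\<^sup>+x. ennreal (h x) + ennreal (k x) \<partial>M)"
      proof (rule nn_integral_mono_AE)
        show "AE x in M. ennreal (norm ((f x + g x) - (s i x + t i x))) \<le>
            ennreal (h x) + ennreal (k x)"
          using h(2) k(2)
        proof eventually_elim
          case (elim x)
          then show ?case
            using norm_diff_triangle_ineq[of "f x" "g x" "s i x" "t i x"] h(3) k(3)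
            by (simp add: ennreal_leI flip: ennreal_plus)
        qed
      qed
      also have "\<dots> = (\<integral>\<^sup>+x. h x \<partial>M) + (\<integral>\<^sup>+x. k x \<partial>M)"
        using h(1) k(1) by (intro nn_integral_add) auto
      also have "(\<integral>\<^sup>+x. h x \<partial>M) = (\<integral>\<^sup>+x. norm (f x - s i x) \<partial>M)"
        using h(2) by (intro nn_integral_cong_AE) auto
      also have "(\<integral>\<^sup>+x. k x \<partial>M) = (\<integral>\<^sup>+x. norm (g x - t i x) \<partial>M)"
        using k(2) by (intro nn_integral_cong_AE) auto
      finally show "(\<integral>\<^sup>+x. norm ((f x + g x) - (s i x + t i x)) \<partial>M) \<le>
        (\<integral>\<^sup>+x. norm (f x - s i x) \<partial>M) + (\<integral>\<^sup>+x. norm (g x - t i x) \<partial>M)" .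
    qed
  qed
  moreover have "Bochner_Integration.simple_bochner_integrable M (\<lambda>x. s i x + t i x)" for i
    using s(1) t(1) by (simp add: simple_bochner_integrable_compose2)
  moreover have "(\<lambda>i. ?I (\<lambda>x. s i x + t i x)) \<longlonglongrightarrow> I + J"
    using s(1,3) t(1,3) by (auto intro!: tendsto_add simp: simple_bochner_integral_add)
  moreover have "strongly_measurable M (\<lambda>x. f x + g x)"
    by (rule strongly_measurable_add[OF f g])
  ultimately show ?thesis
    unfolding has_strong_bochner_integral_def by (intro conjI exI[of _ "\<lambda>i x. s i x + t i x"]) auto
qed

lemma has_strong_bochner_integral_of_bochner:
  fixes f :: "'a \<Rightarrow> 'b::{real_normed_vector, second_countable_topology}"
  assumes "has_bochner_integral M f I"
  shows "has_strong_bochner_integral M f I"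
  using assms
proof (cases rule: has_bochner_integral.cases)
  case (1 s)
  then show ?thesis
    unfolding has_strong_bochner_integral_def
    by (intro conjI strongly_measurable_borel exI[of _ s]) auto
qed

lemma has_strong_bochner_integral_zero:
  "has_strong_bochner_integral M (\<lambda>x. 0::'b::real_normed_vector) 0"
proof -
  have "strongly_measurable M (\<lambda>x. 0::'b)"
    unfolding strongly_measurable_def by (intro exI[of _ "\<lambda>_ _. 0"]) simp
  then show ?thesis
    unfolding has_strong_bochner_integral_def
    by (intro conjI exI[of _ "\<lambda>_ _. 0"])
      (simp_all add: simple_bochner_integrable.simps simple_bochner_integral_def
        image_constant_conv)
qed

lemma has_strong_bochner_integral_sum:
  fixes f :: "'i \<Rightarrow> 'a \<Rightarrow> 'b::real_normed_vector"
  assumes "\<And>i. i \<in> F \<Longrightarrow> has_strong_bochner_integral M (f i) (I i)"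
  shows "has_strong_bochner_integral M (\<lambda>x. \<Sum>i\<in>F. f i x) (\<Sum>i\<in>F. I i)"
  using assms by (induction F rule: infinite_finite_induct)
    (auto intro: has_strong_bochner_integral_add has_strong_bochner_integral_zero)

section \<open>Translation invariance of the torus measure\<close>

lemma real_vec_nth [simp]: "real_vec k $ i = real_of_int (k $ i)"
  by (simp add: real_vec_def)

lemma real_vec_simps [simp]:
  "real_vec 0 = 0" "real_vec (k + l) = real_vec k + real_vec l"
  "real_vec (k - l) = real_vec k - real_vec l" "real_vec (- k) = - real_vec k"
  "real_vec (axis j 1) = axis j 1"
  by (simp_all add: vec_eq_iff axis_def)

text \<open>Half-open, so that the translates by the lattice are disjoint.\<close>

definition cell :: "(real^'n) set" where
  "cell = {x. \<forall>i. 0 \<le> x $ i \<and> x $ i < 2 * pi}"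

lemma periodicD: "periodic f \<Longrightarrow> f (x + axis j (2 * pi)) = f x"
  by (simp add: periodic_def)

lemma periodic_axis_multiple:
  fixes f :: "real^'n \<Rightarrow> 'b"
  assumes f: "periodic f"
  shows "f (x + axis j (2 * pi * real_of_int k)) = f x"
proof -
  have up: "f (x + axis j (2 * pi * real n)) = f x" for n and x :: "real^'n"
  proof (induction n)
    case (Suc n)
    have "x + axis j (2 * pi * real (Suc n)) = (x + axis j (2 * pi * real n)) + axis j (2 * pi)"
      by (simp add: vec_eq_iff axis_def algebra_simps)
    then show ?case by (simp only: Suc periodicD[OF f])
  next
    case 0
    have "axis j 0 = (0::real^'n)" by (simp add: vec_eq_iff axis_def)
    then show ?case by (simp only: of_nat_0 mult_zero_right add_0_right)
  qed
  show ?thesis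
  proof (cases "k \<ge> 0")
    case True
    then show ?thesis using up[of x "nat k"] by simp
  next
    case False
    then have "(x + axis j (2 * pi * real_of_int k)) + axis j (2 * pi * real (nat (- k))) = x"
      by (simp add: vec_eq_iff axis_def algebra_simps)
    then show ?thesis
      using up[of "x + axis j (2 * pi * real_of_int k)" "nat (- k)"] by (simp only:)
  qed
qed

lemma periodic_lattice:
  fixes f :: "real^'n \<Rightarrow> 'b"
  assumes f: "periodic f"
  shows "f (x + (2 * pi) *\<^sub>R real_vec k) = f x"
proof -
  have "f (x + (\<Sum>j\<in>F. axis j (2 * pi * real_of_int (k $ j)))) = f x" if "finite F" for F
    using that
  proof (induction F)
    case (insert j F)
    have "f (x + (\<Sum>j\<in>insert j F. axis j (2 * pi * real_of_int (k $ j)))) =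
      f ((x + (\<Sum>j\<in>F. axis j (2 * pi * real_of_int (k $ j)))) + axis j (2 * pi * real_of_int (k $ j)))"
      using insert.hyps by (simp add: algebra_simps)
    then show ?case by (simp only: insert.IH periodic_axis_multiple[OF f])
  qed simp
  from this[of UNIV]
  have "f (x + (\<Sum>j\<in>UNIV. axis j (2 * pi * real_of_int (k $ j)))) = f x" by simp
  moreover have "(\<Sum>j\<in>UNIV. axis j (2 * pi * real_of_int (k $ j))) = (2 * pi) *\<^sub>R real_vec k"
    by (simp add: vec_eq_iff axis_def if_distrib[of "\<lambda>z. z = _"] cong: if_cong)
  ultimately show ?thesis by simp
qed

lemma cell_translate_unique:
  fixes x :: "real^'n"
  obtains k where "\<And>l. x + (2 * pi) *\<^sub>R real_vec l \<in> cell \<longleftrightarrow> l = k"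
proof
  fix l
  define k where "k = (\<chi> i. - \<lfloor>x $ i / (2 * pi)\<rfloor>)"
  have "0 \<le> x $ i + 2 * pi * real_of_int m \<and> x $ i + 2 * pi * real_of_int m < 2 * pi \<longleftrightarrow> m = k $ i"
    for i and m :: int
  proof -
    have pi: "(0::real) < 2 * pi" by simp
    have "m = k $ i \<longleftrightarrow> \<lfloor>x $ i / (2 * pi)\<rfloor> = - m" by (auto simp: k_def)
    also have "\<dots> \<longleftrightarrow> real_of_int (- m) \<le> x $ i / (2 * pi) \<and> x $ i / (2 * pi) < real_of_int (- m) + 1"
      by (simp add: floor_eq_iff)
    also have "\<dots> \<longleftrightarrow> 0 \<le> x $ i + 2 * pi * real_of_int m \<and> x $ i + 2 * pi * real_of_int m < 2 * pi"
      using pi by (auto simp: field_simps)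
    finally show ?thesis by simp
  qed
  then show "x + (2 * pi) *\<^sub>R real_vec l \<in> cell \<longleftrightarrow> l = (\<chi> i. - \<lfloor>x $ i / (2 * pi)\<rfloor>)"
    by (simp add: cell_def vec_eq_iff k_def)
qed

lemma cell_subset: "cell \<subseteq> cbox 0 (\<chi> i. 2 * pi)"
  by (auto simp: cell_def mem_box_cart less_imp_le)

lemma cell_borel [measurable]: "cell \<in> sets borel"
  unfolding cell_def by measurable

lemma box_2pi_volume:
  "emeasure lborel (cbox 0 (\<chi> i. 2 * pi) :: (real^'n) set) = ennreal ((2 * pi) ^ CARD('n))"
  "emeasure lborel (box 0 (\<chi> i. 2 * pi) :: (real^'n) set) = ennreal ((2 * pi) ^ CARD('n))"
proof -
  have *: "(\<Prod>b\<in>Basis. ((\<chi> i. 2 * pi) - 0 :: real^'n) \<bullet> b) = (2 * pi) ^ CARD('n)"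
  proof -
    have "(\<Prod>b\<in>Basis. ((\<chi> i. 2 * pi) - 0 :: real^'n) \<bullet> b) = (\<Prod>b\<in>(Basis :: (real^'n) set). 2 * pi)"
      by (rule prod.cong) (auto simp: Basis_vec_def inner_axis)
    then show ?thesis by simp
  qed
  have le: "\<And>b. b \<in> Basis \<Longrightarrow> 0 \<bullet> b \<le> ((\<chi> i. 2 * pi) :: real^'n) \<bullet> b"
    by (auto simp: Basis_vec_def inner_axis)
  show "emeasure lborel (cbox 0 (\<chi> i. 2 * pi) :: (real^'n) set) = ennreal ((2 * pi) ^ CARD('n))"
    by (subst emeasure_lborel_cbox) (use le * in auto)
  show "emeasure lborel (box 0 (\<chi> i. 2 * pi) :: (real^'n) set) = ennreal ((2 * pi) ^ CARD('n))"
    by (subst emeasure_lborel_box) (use le * in auto)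
qed

lemma AE_cell:
  "AE x in lborel. (x :: real^'n) \<in> cbox 0 (\<chi> i. 2 * pi) \<longleftrightarrow> x \<in> cell"
proof -
  let ?C = "cbox 0 (\<chi> i. 2 * pi) :: (real^'n) set" and ?B = "box 0 (\<chi> i. 2 * pi) :: (real^'n) set"
  have "emeasure lborel (?C - ?B) = emeasure lborel ?C - emeasure lborel ?B"
    by (rule emeasure_Diff) (auto simp: box_2pi_volume box_subset_cbox)
  then have "?C - ?B \<in> null_sets lborel"
    by (intro null_setsI) (auto simp: box_2pi_volume)
  moreover have "?B \<subseteq> cell" by (auto simp: cell_def mem_box_cart less_imp_le)
  ultimately show ?thesis
    using cell_subset by (intro AE_I'[where N="?C - ?B"]) auto
qed

lemma sets_torus_measure [simp, measurable_cong]: "sets torus_measure = sets borel"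
  by (simp add: torus_measure_def)

lemma space_torus_measure [simp]: "space torus_measure = UNIV"
  by (simp add: torus_measure_def)

lemma prob_space_torus: "emeasure (torus_measure :: (real^'n) measure) UNIV = 1"
proof -
  let ?v = "emeasure lborel (cbox 0 (\<chi> i. 2 * pi) :: (real^'n) set)"
  have "?v / ?v = 1"
    by (intro ennreal_divide_self) (simp_all add: box_2pi_volume)
  then show ?thesis
    unfolding torus_measure_def by (subst emeasure_uniform_measure) auto
qed

interpretation torus: finite_measure torus_measure
  by (rule finite_measureI) (simp add: prob_space_torus)

lemma measure_torus [simp]: "measure torus_measure UNIV = 1"
  by (simp add: measure_def prob_space_torus)

lemma nn_integral_torus:
  fixes f :: "real^'n \<Rightarrow> ennreal"
  assumes [measurable]: "f \<in> borel_measurable borel"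
  shows "(\<integral>\<^sup>+x. f x \<partial>torus_measure) =
    (\<integral>\<^sup>+x. indicator cell x * f x \<partial>lborel) / ennreal ((2 * pi) ^ CARD('n))"
proof -
  have "(\<integral>\<^sup>+x. f x \<partial>torus_measure) =
      (\<integral>\<^sup>+x. f x * indicator (cbox 0 (\<chi> i. 2 * pi)) x \<partial>lborel) / ennreal ((2 * pi) ^ CARD('n))"
    unfolding torus_measure_def by (subst nn_integral_uniform_measure) (auto simp: box_2pi_volume)
  also have "(\<integral>\<^sup>+x. f x * indicator (cbox 0 (\<chi> i. 2 * pi)) x \<partial>lborel) =
      (\<integral>\<^sup>+x. indicator cell x * f x \<partial>lborel)"
    using AE_cell by (intro nn_integral_cong_AE) (auto simp: indicator_def elim: eventually_mono)
  finally show ?thesis .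
qed

lemma nn_integral_lborel_translate:
  fixes f :: "real^'n \<Rightarrow> ennreal"
  assumes [measurable]: "f \<in> borel_measurable borel"
  shows "(\<integral>\<^sup>+x. f (x + c) \<partial>lborel) = (\<integral>\<^sup>+x. f x \<partial>lborel)"
proof -
  have "(\<integral>\<^sup>+x. f x \<partial>lborel) = (\<integral>\<^sup>+x. f x \<partial>distr lborel borel ((+) c))"
    by (simp add: lborel_distr_plus)
  also have "\<dots> = (\<integral>\<^sup>+x. f (c + x) \<partial>lborel)"
    by (subst nn_integral_distr) auto
  finally show ?thesis by (simp add: add.commute)
qed

text \<open>The translates of the half-open cell by the lattice partition the space. Cutting a translate
  of the cell along this partition and moving the pieces back reassembles the cell.\<close>

lemma nn_integral_torus_translate:
  fixes f :: "real^'n \<Rightarrow> ennreal"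
  assumes [measurable]: "f \<in> borel_measurable borel" and f: "periodic f"
  shows "(\<integral>\<^sup>+x. f (x + y) \<partial>torus_measure) = (\<integral>\<^sup>+x. f x \<partial>torus_measure)"
proof -
  let ?t = "\<lambda>k::int^'n. (2 * pi) *\<^sub>R real_vec k"
  have one: "(\<integral>\<^sup>+k. indicator cell (x + ?t k) \<partial>count_space UNIV) = 1" for x :: "real^'n"
  proof -
    obtain k where k: "\<And>l. x + ?t l \<in> cell \<longleftrightarrow> l = k" using cell_translate_unique[of x] by blast
    have "(\<integral>\<^sup>+l. indicator cell (x + ?t l) \<partial>count_space UNIV) =
        (\<integral>\<^sup>+l. indicator {k} l \<partial>count_space UNIV)"
      by (intro nn_integral_cong) (auto simp: indicator_def k)
    then show ?thesis by simp
  qed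
  have "(\<integral>\<^sup>+x. indicator cell x * f (x + y) \<partial>lborel) =
      (\<integral>\<^sup>+x. indicator cell (x + (- y)) * f (x + (- y) + y) \<partial>lborel)"
    by (subst nn_integral_lborel_translate[where f="\<lambda>x. indicator cell x * f (x + y)"]) auto
  also have "\<dots> = (\<integral>\<^sup>+x. (\<integral>\<^sup>+k. indicator cell (x - y) * (indicator cell (x + ?t k) * f x)
      \<partial>count_space UNIV) \<partial>lborel)"
    using one by (simp add: nn_integral_cmult nn_integral_multc)
  also have "\<dots> = (\<integral>\<^sup>+k. (\<integral>\<^sup>+x. indicator cell (x - y) * (indicator cell (x + ?t k) * f x) \<partial>lborel)
      \<partial>count_space UNIV)"
    by (subst nn_integral_count_space_nn_integral) auto
  also have "\<dots> = (\<integral>\<^sup>+k. (\<integral>\<^sup>+x. indicator cell ((x - y) + ?t (- k)) * (indicator cell x * f x) \<partial>lborel)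
      \<partial>count_space UNIV)"
  proof (rule nn_integral_cong)
    fix k :: "int^'n"
    have per: "f (x + ?t l) = f x" for x l by (rule periodic_lattice[OF f])
    have "(\<integral>\<^sup>+x. indicator cell (x - y) * (indicator cell (x + ?t k) * f x) \<partial>lborel) =
      (\<integral>\<^sup>+x. indicator cell ((x + ?t (- k)) - y) *
        (indicator cell ((x + ?t (- k)) + ?t k) * f (x + ?t (- k))) \<partial>lborel)"
      by (subst nn_integral_lborel_translate[where c="?t (- k)" and
          f="\<lambda>x. indicator cell (x - y) * (indicator cell (x + ?t k) * f x)"]) auto
    then show "(\<integral>\<^sup>+x. indicator cell (x - y) * (indicator cell (x + ?t k) * f x) \<partial>lborel) =
      (\<integral>\<^sup>+x. indicator cell ((x - y) + ?t (- k)) * (indicator cell x * f x) \<partial>lborel)"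
      by (simp only: per) (simp add: algebra_simps)
  qed
  also have "\<dots> = (\<integral>\<^sup>+x. (\<integral>\<^sup>+k. indicator cell ((x - y) + ?t (- k)) * (indicator cell x * f x)
      \<partial>count_space UNIV) \<partial>lborel)"
    by (subst nn_integral_count_space_nn_integral) auto
  also have "\<dots> = (\<integral>\<^sup>+x. indicator cell x * f x \<partial>lborel)"
  proof (rule nn_integral_cong)
    fix x :: "real^'n"
    have "(\<integral>\<^sup>+k. indicator cell ((x - y) + ?t (- k)) * (indicator cell x * f x) \<partial>count_space UNIV) =
        (\<integral>\<^sup>+k. indicator cell ((x - y) + ?t (- k)) \<partial>count_space UNIV) * (indicator cell x * f x)"
      by (intro nn_integral_multc) auto
    also have "(\<integral>\<^sup>+k. indicator cell ((x - y) + ?t (- k)) \<partial>count_space UNIV) =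
        (\<integral>\<^sup>+k. indicator cell ((x - y) + ?t k) \<partial>count_space UNIV)"
      by (rule nn_integral_bij_count_space[where g="uminus"
            and f="\<lambda>k. indicator cell ((x - y) + ?t k)"]) (simp add: bij_uminus)
    finally show "(\<integral>\<^sup>+k. indicator cell ((x - y) + ?t (- k)) * (indicator cell x * f x)
        \<partial>count_space UNIV) = indicator cell x * f x"
      by (simp only: one mult_1)
  qed
  finally show ?thesis
    by (simp add: nn_integral_torus)
qed

lemma periodic_bounded:
  fixes f :: "real^'n \<Rightarrow> 'b::real_normed_vector"
  assumes f: "periodic f" and c: "continuous_on UNIV f"
  obtains B where "B > 0" "\<And>x. norm (f x) \<le> B"
proof -
  have "compact (f ` cbox 0 (\<chi> i. 2 * pi))"
    by (intro compact_continuous_image compact_cbox continuous_on_subset[OF c]) auto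
  then have "bounded (f ` cbox 0 (\<chi> i. 2 * pi))" by (rule compact_imp_bounded)
  then obtain B where B: "B > 0" "\<And>x. x \<in> cbox 0 (\<chi> i. 2 * pi) \<Longrightarrow> norm (f x) \<le> B"
    unfolding bounded_pos by blast
  have "norm (f x) \<le> B" for x
  proof -
    obtain k where "\<And>l. x + (2 * pi) *\<^sub>R real_vec l \<in> cell \<longleftrightarrow> l = k"
      using cell_translate_unique[of x] by blast
    then have "x + (2 * pi) *\<^sub>R real_vec k \<in> cbox 0 (\<chi> i. 2 * pi)"
      using cell_subset by blast
    from B(2)[OF this] show ?thesis by (simp add: periodic_lattice[OF f])
  qed
  then show thesis using that B(1) by blast
qed

lemma integrable_torus_bounded:
  fixes f :: "real^'n \<Rightarrow> 'b::{banach, second_countable_topology}"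
  assumes "f \<in> borel_measurable borel" "\<And>x. norm (f x) \<le> B"
  shows "integrable torus_measure f"
  by (rule torus.integrable_const_bound[where B=B]) (use assms in auto)

lemma integrable_torus_continuous:
  fixes f :: "real^'n \<Rightarrow> 'b::{banach, second_countable_topology}"
  assumes "periodic f" "continuous_on UNIV f"
  shows "integrable torus_measure f"
proof -
  obtain B where "\<And>x. norm (f x) \<le> B" using periodic_bounded[OF assms] by blast
  then show ?thesis
    by (intro integrable_torus_bounded[where B=B] borel_measurable_continuous_onI assms(2))
qed

lemma periodic_compose: "periodic f \<Longrightarrow> periodic (\<lambda>x. g (f x))"
  by (simp add: periodic_def)

lemma periodic_compose2: "periodic f \<Longrightarrow> periodic g \<Longrightarrow> periodic (\<lambda>x. h (f x) (g x))"
  by (simp add: periodic_def)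

lemma periodic_translate: "periodic f \<Longrightarrow> periodic (\<lambda>x. f (x + y))"
  by (simp add: periodic_def add.assoc add.commute[of _ y]) (simp flip: add.assoc)

lemma continuous_on_translate:
  fixes f :: "real^'n \<Rightarrow> 'b::real_normed_vector"
  shows "continuous_on UNIV f \<Longrightarrow> continuous_on UNIV (\<lambda>x. f (x + y))"
  by (erule continuous_on_compose2) (auto intro: continuous_intros)

lemma integral_torus_translate_real:
  fixes f :: "real^'n \<Rightarrow> real"
  assumes f: "periodic f" "continuous_on UNIV f"
  shows "(\<integral>x. f (x + y) \<partial>torus_measure) = (\<integral>x. f x \<partial>torus_measure)"
proof -
  have [measurable]: "f \<in> borel_measurable borel"
    by (rule borel_measurable_continuous_onI[OF f(2)])
  have "integrable torus_measure f" "integrable torus_measure (\<lambda>x. f (x + y))"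
    using f by (auto intro!: integrable_torus_continuous periodic_translate continuous_on_translate)
  then show ?thesis
    using nn_integral_torus_translate[of "\<lambda>x. ennreal (f x)" y]
      nn_integral_torus_translate[of "\<lambda>x. ennreal (- f x)" y]
    by (simp add: real_lebesgue_integral_def periodic_compose[OF f(1)]
        periodic_compose[OF f(1), where g="\<lambda>t. ennreal (- t)"])
qed

lemma integral_torus_translate:
  fixes f :: "real^'n \<Rightarrow> complex"
  assumes f: "periodic f" "continuous_on UNIV f"
  shows "(\<integral>x. f (x + y) \<partial>torus_measure) = (\<integral>x. f x \<partial>torus_measure)"
proof -
  have i: "integrable torus_measure f" "integrable torus_measure (\<lambda>x. f (x + y))"
    using f by (auto intro!: integrable_torus_continuous periodic_translate continuous_on_translate)
  have "(\<integral>x. Re (f (x + y)) \<partial>torus_measure) = (\<integral>x. Re (f x) \<partial>torus_measure)"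
    by (rule integral_torus_translate_real[where f="\<lambda>x. Re (f x)"])
      (auto intro: periodic_compose f continuous_intros)
  moreover have "(\<integral>x. Im (f (x + y)) \<partial>torus_measure) = (\<integral>x. Im (f x) \<partial>torus_measure)"
    by (rule integral_torus_translate_real[where f="\<lambda>x. Im (f x)"])
      (auto intro: periodic_compose f continuous_intros)
  ultimately show ?thesis
    using i by (intro complex_eqI) simp_all
qed

section \<open>Smooth functions and their derivatives\<close>

lemma smooth_differentiable: "smooth f \<Longrightarrow> f differentiable (at x)"
  unfolding smooth_def by (metis foldr.simps(1) id_apply)

lemma smooth_continuous: "smooth f \<Longrightarrow> continuous_on UNIV f"
  by (simp add: continuous_at_imp_continuous_on differentiable_imp_continuous_within
      smooth_differentiable)

lemma smooth_foldr_partial: "smooth f \<Longrightarrow> smooth (foldr partial_derivative js f)"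
  unfolding smooth_def by (metis foldr_append comp_apply)

lemma smooth_partial: "smooth f \<Longrightarrow> smooth (partial_derivative j f)"
  using smooth_foldr_partial[of f "[j]"] by simp

lemma partial_derivative_eqI:
  assumes "\<And>x. ((\<lambda>t. f (x + t *\<^sub>R axis j 1)) has_vector_derivative g x) (at 0)"
  shows "partial_derivative j f = g"
  unfolding partial_derivative_def using assms by (auto intro: vector_derivative_at)

lemma smooth_has_partial:
  fixes f :: "real^'n \<Rightarrow> 'b::real_normed_vector"
  assumes "smooth f"
  shows "((\<lambda>t. f (x + t *\<^sub>R axis j 1)) has_vector_derivative
    partial_derivative j f (x + t *\<^sub>R axis j 1)) (at t)"
proof -
  have 0: "((\<lambda>t. f (y + t *\<^sub>R axis j 1)) has_vector_derivative partial_derivative j f y) (at 0)" for y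
  proof -
    have "(f \<circ> (\<lambda>t. y + t *\<^sub>R axis j 1)) differentiable (at (0::real))"
      by (intro differentiable_chain_at) (auto simp: smooth_differentiable[OF assms])
    then show ?thesis
      unfolding partial_derivative_def o_def by (simp add: vector_derivative_works)
  qed
  have "((\<lambda>u. f ((x + t *\<^sub>R axis j 1) + u *\<^sub>R axis j 1)) \<circ> (\<lambda>v. v - t) has_vector_derivative
      1 *\<^sub>R partial_derivative j f (x + t *\<^sub>R axis j 1)) (at t)"
    by (rule vector_diff_chain_at) (auto intro!: derivative_eq_intros 0)
  then show ?thesis by (simp add: o_def algebra_simps flip: scaleR_add_left)
qed

lemma smooth_has_partial_0:
  fixes f :: "real^'n \<Rightarrow> 'b::real_normed_vector"
  assumes "smooth f"
  shows "((\<lambda>t. f (x + t *\<^sub>R axis j 1)) has_vector_derivative partial_derivative j f x) (at 0)"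
  using smooth_has_partial[OF assms, of x j 0] by simp

lemma foldr_partial_linear:
  fixes f g :: "real^'n \<Rightarrow> complex"
  assumes f: "smooth f" and g: "smooth g"
  shows "foldr partial_derivative js (\<lambda>x. c * f x + d * g x) =
    (\<lambda>x. c * foldr partial_derivative js f x + d * foldr partial_derivative js g x)"
proof (induction js)
  case (Cons j js)
  have "partial_derivative j (\<lambda>x. c * foldr partial_derivative js f x +
        d * foldr partial_derivative js g x) =
      (\<lambda>x. c * partial_derivative j (foldr partial_derivative js f) x +
        d * partial_derivative j (foldr partial_derivative js g) x)"
    by (rule partial_derivative_eqI)
      (auto intro!: derivative_eq_intros smooth_has_partial_0 smooth_foldr_partial f g)
  then show ?case by (simp add: Cons)
qed simp

lemma smooth_linear:
  fixes f g :: "real^'n \<Rightarrow> complex"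
  assumes "smooth f" "smooth g"
  shows "smooth (\<lambda>x. c * f x + d * g x)"
  unfolding smooth_def foldr_partial_linear[OF assms]
  by (intro allI differentiable_add differentiable_mult differentiable_const
      smooth_differentiable smooth_foldr_partial assms)

lemma foldr_partial_translate:
  fixes f :: "real^'n \<Rightarrow> 'b::real_normed_vector"
  shows "foldr partial_derivative js (\<lambda>x. f (x + y)) = (\<lambda>x. foldr partial_derivative js f (x + y))"
proof (induction js)
  case (Cons j js)
  then show ?case by (simp add: partial_derivative_def fun_eq_iff add_ac)
qed simp

lemma smooth_translate:
  fixes f :: "real^'n \<Rightarrow> 'b::real_normed_vector"
  assumes "smooth f" shows "smooth (\<lambda>x. f (x + y))"
  unfolding smooth_def foldr_partial_translate
proof (intro allI)
  fix js and x :: "real^'n"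
  have "(\<lambda>x. x + y) differentiable (at x)" by (intro derivative_intros)
  from differentiable_chain_at[OF this smooth_differentiable[OF smooth_foldr_partial[OF assms]]]
  have "(foldr partial_derivative js f \<circ> (\<lambda>x. x + y)) differentiable (at x)" .
  then show "(\<lambda>x. foldr partial_derivative js f (x + y)) differentiable (at x)"
    by (simp add: o_def)
qed

lemma periodic_partial:
  assumes "periodic f" shows "periodic (partial_derivative j f)"
proof -
  have "f ((x + axis i (2 * pi)) + t *\<^sub>R axis j 1) = f (x + t *\<^sub>R axis j 1)" for i x t
    using periodicD[OF assms, of "x + t *\<^sub>R axis j 1" i] by (simp add: add_ac)
  then show ?thesis by (simp add: periodic_def partial_derivative_def)
qed

lemma periodic_foldr_partial: "periodic f \<Longrightarrow> periodic (foldr partial_derivative js f)"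
  by (induction js) (auto intro: periodic_partial)

subsection \<open>Multi-indices as lists of coordinates\<close>

lemma coordinates: "distinct (coordinates :: 'n::finite list)" "set (coordinates :: 'n list) = UNIV"
proof -
  have "\<exists>js :: 'n list. distinct js \<and> set js = UNIV"
    using finite_distinct_list[of "UNIV :: 'n set"] by auto
  from someI_ex[OF this] show "distinct (coordinates :: 'n list)" "set (coordinates :: 'n list) = UNIV"
    by (auto simp: coordinates_def)
qed

text \<open>Reading a multi-index as a list of directions turns iterated operators into folds over lists,
  for which list induction is available.\<close>

definition index_list :: "('n::finite \<Rightarrow> nat) \<Rightarrow> 'n list" where
  "index_list \<alpha> = concat (map (\<lambda>j. replicate (\<alpha> j) j) coordinates)"

lemma foldr_replicate: "foldr T (replicate n j) x = (T j ^^ n) x"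
  by (induction n) auto

lemma multi_power_foldr: "multi_power T \<alpha> x = foldr T (index_list \<alpha>) x"
proof -
  have "foldr (\<lambda>j. T j ^^ \<alpha> j) js x = foldr T (concat (map (\<lambda>j. replicate (\<alpha> j) j) js)) x" for js
    by (induction js) (auto simp: foldr_replicate)
  then show ?thesis by (simp add: multi_power_def index_list_def)
qed

lemma length_index_list: "length (index_list \<alpha>) = order_of \<alpha>"
proof -
  have "length (concat (map (\<lambda>j. replicate (\<alpha> j) j) js)) = sum_list (map \<alpha> js)" for js
    by (induction js) auto
  then show ?thesis
    using sum.distinct_set_conv_list[OF coordinates(1), of \<alpha>]
    by (simp add: index_list_def coordinates(2))
qed

definition single_index :: "'n \<Rightarrow> nat \<Rightarrow> 'n \<Rightarrow> nat" where
  "single_index j r = (\<lambda>i. if i = j then r else 0)"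

lemma order_single_index [simp]: "order_of (single_index j r) = r"
  by (simp add: single_index_def)

lemma multi_power_single_index: "multi_power T (single_index j r) x = (T j ^^ r) x"
proof -
  have "foldr (\<lambda>i. T i ^^ single_index j r i) js x = (if j \<in> set js then (T j ^^ r) x else x)"
    if "distinct js" for js
    using that by (induction js) (auto simp: single_index_def)
  then show ?thesis by (simp add: multi_power_def coordinates)
qed

lemma multi_derivative_foldr: "multi_derivative \<alpha> f = foldr partial_derivative (index_list \<alpha>) f"
  by (simp add: multi_derivative_def multi_power_foldr)

lemma finite_order_le [simp]: "finite {\<alpha> :: 'n::finite \<Rightarrow> nat. order_of \<alpha> \<le> N}"
proof (rule finite_subset)
  have "\<alpha> i \<le> order_of \<alpha>" for \<alpha> :: "'n \<Rightarrow> nat" and i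
    by (rule member_le_sum) auto
  then show "{\<alpha> :: 'n \<Rightarrow> nat. order_of \<alpha> \<le> N} \<subseteq> PiE UNIV (\<lambda>_. {..N})"
    by (auto simp: PiE_def) (metis order_trans)
qed (auto intro: finite_PiE)

subsection \<open>The seminorms of test functions\<close>

lemma test_functionsD: "\<phi> \<in> test_functions \<Longrightarrow> smooth \<phi>" "\<phi> \<in> test_functions \<Longrightarrow> periodic \<phi>"
  by (simp_all add: test_functions_def)

lemma test_functions_linear:
  "\<phi> \<in> test_functions \<Longrightarrow> \<psi> \<in> test_functions \<Longrightarrow> (\<lambda>x. c * \<phi> x + d * \<psi> x) \<in> test_functions"
  by (simp add: test_functions_def smooth_linear periodic_compose2[where h="\<lambda>x y. c * x + d * y"])

lemma test_functions_add:
  "\<phi> \<in> test_functions \<Longrightarrow> \<psi> \<in> test_functions \<Longrightarrow> (\<lambda>x. \<phi> x + \<psi> x) \<in> test_functions"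
  using test_functions_linear[of \<phi> \<psi> 1 1] by simp

lemma test_functions_diff:
  "\<phi> \<in> test_functions \<Longrightarrow> \<psi> \<in> test_functions \<Longrightarrow> (\<lambda>x. \<phi> x - \<psi> x) \<in> test_functions"
  using test_functions_linear[of \<phi> \<psi> 1 "-1"] by simp

lemma test_functions_mult: "\<phi> \<in> test_functions \<Longrightarrow> (\<lambda>x. c * \<phi> x) \<in> test_functions"
  using test_functions_linear[of \<phi> \<phi> c 0] by simp

lemma test_functions_foldr: "\<phi> \<in> test_functions \<Longrightarrow> foldr partial_derivative js \<phi> \<in> test_functions"
  by (simp add: test_functions_def smooth_foldr_partial periodic_foldr_partial)

lemma test_derivative_bounded:
  assumes "\<phi> \<in> test_functions"
  shows "bdd_above (range (\<lambda>x. norm (multi_derivative \<alpha> \<phi> x)))"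
proof -
  have "foldr partial_derivative (index_list \<alpha>) \<phi> \<in> test_functions"
    by (rule test_functions_foldr[OF assms])
  then obtain B where "\<And>x. norm (multi_derivative \<alpha> \<phi> x) \<le> B"
    unfolding multi_derivative_foldr
    using periodic_bounded test_functionsD smooth_continuous by metis
  then show ?thesis by (intro bdd_aboveI2[where M=B])
qed

lemma test_seminorm_upper:
  fixes \<phi> :: "real^'n \<Rightarrow> complex"
  assumes "\<phi> \<in> test_functions" "order_of \<alpha> \<le> N"
  shows "norm (multi_derivative \<alpha> \<phi> x) \<le> test_seminorm N \<phi>"
proof -
  have "norm (multi_derivative \<alpha> \<phi> x) \<le> (SUP x. norm (multi_derivative \<alpha> \<phi> x))"
    by (rule cSUP_upper[OF _ test_derivative_bounded[OF assms(1)]]) simp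
  also have "\<dots> \<le> test_seminorm N \<phi>"
    unfolding test_seminorm_def by (intro Max_ge) (use assms in auto)
  finally show ?thesis .
qed

lemma test_seminorm_least:
  fixes \<phi> :: "real^'n \<Rightarrow> complex"
  assumes "\<And>\<alpha> x. order_of \<alpha> \<le> N \<Longrightarrow> norm (multi_derivative \<alpha> \<phi> x) \<le> B"
  shows "test_seminorm N \<phi> \<le> B"
proof -
  have "order_of (\<lambda>_::'n. 0::nat) \<le> N" by simp
  then have "{\<alpha> :: 'n \<Rightarrow> nat. order_of \<alpha> \<le> N} \<noteq> {}" by blast
  then show ?thesis
    unfolding test_seminorm_def using assms by (intro Max.boundedI) (auto intro!: cSUP_least)
qed

lemma test_seminorm_nonneg:
  assumes "\<phi> \<in> test_functions" shows "0 \<le> test_seminorm N \<phi>"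
proof -
  have "norm (multi_derivative (\<lambda>_. 0) \<phi> 0) \<le> test_seminorm N \<phi>"
    by (rule test_seminorm_upper[OF assms]) simp
  then show ?thesis using norm_ge_zero order_trans by blast
qed

lemma test_seminorm_linear:
  fixes \<phi> \<psi> :: "real^'n \<Rightarrow> complex"
  assumes \<phi>: "\<phi> \<in> test_functions" and \<psi>: "\<psi> \<in> test_functions"
  shows "test_seminorm N (\<lambda>x. c * \<phi> x + d * \<psi> x) \<le>
    norm c * test_seminorm N \<phi> + norm d * test_seminorm N \<psi>"
proof (rule test_seminorm_least)
  fix \<alpha> :: "'n \<Rightarrow> nat" and x assume \<alpha>: "order_of \<alpha> \<le> N"
  have "norm (c * multi_derivative \<alpha> \<phi> x + d * multi_derivative \<alpha> \<psi> x) \<le>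
      norm (c * multi_derivative \<alpha> \<phi> x) + norm (d * multi_derivative \<alpha> \<psi> x)"
    by (rule norm_triangle_ineq)
  also have "\<dots> \<le> norm c * test_seminorm N \<phi> + norm d * test_seminorm N \<psi>"
    unfolding norm_mult by (intro add_mono mult_left_mono test_seminorm_upper assms \<alpha>) auto
  finally show "norm (multi_derivative \<alpha> (\<lambda>x. c * \<phi> x + d * \<psi> x) x) \<le>
      norm c * test_seminorm N \<phi> + norm d * test_seminorm N \<psi>"
    by (simp add: multi_derivative_foldr foldr_partial_linear test_functionsD assms)
qed

lemma test_seminorm_mono:
  "\<phi> \<in> test_functions \<Longrightarrow> N \<le> N' \<Longrightarrow> test_seminorm N \<phi> \<le> test_seminorm N' \<phi>"
  by (rule test_seminorm_least) (auto intro: test_seminorm_upper)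

subsection \<open>Characters and Fourier coefficients of test functions\<close>

lemma character_0 [simp]: "character k 0 = 1" "character 0 x = 1"
  by (simp_all add: character_def)

lemma character_add: "character (k + l) x = character k x * character l x"
  by (simp add: character_def inner_add_left ring_distribs exp_add)

lemma character_add_arg: "character k (x + y) = character k x * character k y"
  by (simp add: character_def inner_add_right ring_distribs exp_add)

lemma norm_character [simp]: "norm (character k x) = 1"
  by (simp add: character_def)

lemma character_uminus: "character (- k) x = character k (- x)"
  by (simp add: character_def)

lemma character_has_partial:
  "((\<lambda>t. character k (x + t *\<^sub>R axis j 1)) has_vector_derivative
    \<i> * of_int (k $ j) * character k x) (at 0)"
proof -
  have "((\<lambda>t. exp (of_real t * (\<i> * of_int (k $ j)))) has_vector_derivative
      (\<i> * of_int (k $ j)) * exp (of_real 0 * (\<i> * of_int (k $ j)))) (at 0)"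
    by (rule has_vector_derivative_real_field)
      (auto intro!: derivative_eq_intros)
  moreover have "character k (x + t *\<^sub>R axis j 1) =
      exp (of_real t * (\<i> * of_int (k $ j))) * character k x" for t
    by (simp add: character_add_arg) (simp add: character_def inner_axis mult_ac)
  ultimately show ?thesis
    by (auto intro!: derivative_eq_intros)
qed

lemma foldr_partial_character:
  "foldr partial_derivative js (character k) = (\<lambda>x. (\<Prod>j\<leftarrow>js. \<i> * of_int (k $ j)) * character k x)"
proof (induction js)
  case (Cons j js)
  have "partial_derivative j (\<lambda>x. c * character k x) =
      (\<lambda>x. (\<i> * of_int (k $ j)) * c * character k x)" for c
    by (rule partial_derivative_eqI) (auto intro!: derivative_eq_intros character_has_partial)
  then show ?case by (simp add: Cons)
qed simp

lemma character_differentiable: "character k differentiable (at x)"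
proof -
  have "((\<lambda>x. \<i> * complex_of_real (real_vec k \<bullet> x)) has_derivative
      (\<lambda>h. \<i> * complex_of_real (real_vec k \<bullet> h))) (at x)"
    by (auto intro!: derivative_eq_intros)
  from has_derivative_compose[OF this DERIV_exp[unfolded has_field_derivative_def]]
  show ?thesis unfolding character_def[abs_def] differentiable_def by blast
qed

lemma smooth_character: "smooth (character k)"
  unfolding smooth_def foldr_partial_character
  by (intro allI differentiable_mult differentiable_const character_differentiable)

lemma character_test: "character k \<in> test_functions"
proof -
  have "character k (x + axis j (2 * pi)) = character k x" for x j
  proof -
    have "character k (axis j (2 * pi)) = 1"
      unfolding character_def exp_eq_1 by (auto simp: inner_axis intro!: exI[of _ "k $ j"])
    then show ?thesis by (simp add: character_add_arg)
  qed
  then show ?thesis by (simp add: test_functions_def smooth_character periodic_def)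
qed

lemma continuous_character: "continuous_on UNIV (character k)"
  by (rule smooth_continuous[OF smooth_character])

lemma periodic_character: "periodic (character k)"
  using character_test test_functionsD by blast

lemma test_seminorm_character:
  "test_seminorm N (character k) \<le> (1 + norm (real_vec k)) ^ N"
proof (rule test_seminorm_least)
  fix \<alpha> :: "'a \<Rightarrow> nat" and x assume \<alpha>: "order_of \<alpha> \<le> N"
  have le: "norm (\<i> * of_int (k $ j) :: complex) \<le> 1 + norm (real_vec k)" for j
    using component_le_norm_cart[of "real_vec k" j] by (simp add: norm_mult)
  have "norm (\<Prod>j\<leftarrow>js. \<i> * of_int (k $ j) :: complex) \<le> (1 + norm (real_vec k)) ^ length js" for js
    by (induction js) (use le in \<open>auto simp: norm_mult intro!: mult_mono\<close>)
  from this[of "index_list \<alpha>"]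
  have "norm (multi_derivative \<alpha> (character k) x) \<le> (1 + norm (real_vec k)) ^ order_of \<alpha>"
    by (simp add: multi_derivative_foldr foldr_partial_character norm_mult length_index_list)
  also have "\<dots> \<le> (1 + norm (real_vec k)) ^ N"
    using \<alpha> by (intro power_increasing) auto
  finally show "norm (multi_derivative \<alpha> (character k) x) \<le> (1 + norm (real_vec k)) ^ N" .
qed

text \<open>By translation invariance the integral of a difference quotient vanishes, and the difference
  quotients converge boundedly.\<close>

lemma integral_torus_derivative:
  fixes g h :: "real^'n \<Rightarrow> complex"
  assumes g: "periodic g" "continuous_on UNIV g" and h: "periodic h" "continuous_on UNIV h"
    and deriv: "\<And>x. ((\<lambda>t. g (x + t *\<^sub>R axis j 1)) has_vector_derivative h x) (at 0)"
  shows "(\<integral>x. h x \<partial>torus_measure) = 0"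
proof -
  obtain B where B: "\<And>x. norm (h x) \<le> B" using periodic_bounded[OF h] by blast
  let ?q = "\<lambda>(i::nat) x. of_nat (Suc i) * (g (x + (1 / real (Suc i)) *\<^sub>R axis j 1) - g x)"
  have [measurable]: "g \<in> borel_measurable borel" "h \<in> borel_measurable borel"
    using g h by (auto intro: borel_measurable_continuous_onI)
  have deriv': "((\<lambda>t. g (x + t *\<^sub>R axis j 1)) has_vector_derivative h (x + t *\<^sub>R axis j 1)) (at t)"
    for x t
  proof -
    have "((\<lambda>u. g ((x + t *\<^sub>R axis j 1) + u *\<^sub>R axis j 1)) \<circ> (\<lambda>v. v - t) has_vector_derivative
        1 *\<^sub>R h (x + t *\<^sub>R axis j 1)) (at t)"
      by (rule vector_diff_chain_at) (auto intro!: derivative_eq_intros deriv)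
    then show ?thesis by (simp add: o_def algebra_simps flip: scaleR_add_left)
  qed
  have "(\<lambda>i. \<integral>x. ?q i x \<partial>torus_measure) \<longlonglongrightarrow> (\<integral>x. h x \<partial>torus_measure)"
  proof (rule integral_dominated_convergence[where w="\<lambda>_. B"])
    show "AE x in torus_measure. (\<lambda>i. ?q i x) \<longlonglongrightarrow> h x"
    proof (rule AE_I2)
      fix x
      have "((\<lambda>t. norm (g (x + t *\<^sub>R axis j 1) - g x - t *\<^sub>R h x) / \<bar>t\<bar>) \<longlongrightarrow> 0) (at 0)"
        using deriv[of x] by (simp add: has_vector_derivative_def has_derivative_at)
      moreover have "norm (g (x + t *\<^sub>R axis j 1) - g x - t *\<^sub>R h x) / \<bar>t\<bar> =
          norm ((g (x + t *\<^sub>R axis j 1) - g x) /\<^sub>R t - h x)" if "t \<noteq> 0" for t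
      proof -
        have "g (x + t *\<^sub>R axis j 1) - g x - t *\<^sub>R h x =
            t *\<^sub>R ((g (x + t *\<^sub>R axis j 1) - g x) /\<^sub>R t - h x)"
          using that by (simp add: scaleR_diff_right)
        then show ?thesis using that by (simp only: norm_scaleR) simp
      qed
      ultimately have "((\<lambda>t. norm ((g (x + t *\<^sub>R axis j 1) - g x) /\<^sub>R t - h x)) \<longlongrightarrow> 0) (at 0)"
        by (subst (asm) tendsto_cong) (auto simp: eventually_at_filter)
      then have "((\<lambda>t. (g (x + t *\<^sub>R axis j 1) - g x) /\<^sub>R t) \<longlongrightarrow> h x) (at 0)"
        by (rule LIM_zero_cancel[OF tendsto_norm_zero_cancel])
      moreover have "filterlim (\<lambda>i. 1 / real (Suc i)) (at 0) sequentially"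
        using LIMSEQ_inverse_real_of_nat by (intro filterlim_atI) (auto simp: inverse_eq_divide)
      ultimately have "(\<lambda>i. (g (x + (1 / real (Suc i)) *\<^sub>R axis j 1) - g x) /\<^sub>R (1 / real (Suc i)))
          \<longlonglongrightarrow> h x"
        by (rule filterlim_compose)
      then show "(\<lambda>i. ?q i x) \<longlonglongrightarrow> h x"
        by (simp add: scaleR_conv_of_real)
    qed
    show "AE x in torus_measure. norm (?q i x) \<le> B" for i
    proof (rule AE_I2)
      fix x
      have "norm (g (x + (1 / real (Suc i)) *\<^sub>R axis j 1) - g (x + 0 *\<^sub>R axis j 1)) \<le>
          B * \<bar>1 / real (Suc i) - 0\<bar>"
        using deriv' B
        by (intro differentiable_bound[where f="\<lambda>t. g (x + t *\<^sub>R axis j 1)" and S=UNIV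
            and f'="\<lambda>t u. u *\<^sub>R h (x + t *\<^sub>R axis j 1)", unfolded real_norm_def])
          (auto simp: has_vector_derivative_def intro!: onorm_le mult_left_mono
            simp: mult.commute[of B])
      then have "real (Suc i) * norm (g (x + (1 / real (Suc i)) *\<^sub>R axis j 1) - g x) \<le> B"
        by (simp add: field_simps del: of_nat_Suc)
      then show "norm (?q i x) \<le> B"
        by (simp only: norm_mult norm_of_nat)
    qed
  qed simp_all
  moreover have "(\<integral>x. ?q i x \<partial>torus_measure) = 0" for i
    using g integral_torus_translate[OF g]
    by (simp add: integrable_torus_continuous periodic_translate continuous_on_translate
        del: of_nat_Suc)
  ultimately have "(\<lambda>i. 0) \<longlonglongrightarrow> (\<integral>x. h x \<partial>torus_measure)" by (simp only:)
  then show ?thesis by (simp add: LIMSEQ_const_iff)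
qed

lemma test_fourier_coeff_partial:
  assumes \<phi>: "\<phi> \<in> test_functions"
  shows "test_fourier_coeff (partial_derivative j \<phi>) k = \<i> * of_int (k $ j) * test_fourier_coeff \<phi> k"
proof -
  have s: "smooth \<phi>" "periodic \<phi>" using test_functionsD[OF \<phi>] by auto
  let ?e = "character (- k)"
  have c: "continuous_on UNIV \<phi>" "continuous_on UNIV (partial_derivative j \<phi>)"
    using s by (auto intro: smooth_continuous smooth_partial)
  note per = periodic_compose2[where h="(*)"]
  have p1: "periodic (\<lambda>x. ?e x * \<phi> x)" "periodic (\<lambda>x. ?e x * partial_derivative j \<phi> x)"
    using s by (auto intro: per periodic_character periodic_partial)
  have c1: "continuous_on UNIV (\<lambda>x. ?e x * \<phi> x)"
    "continuous_on UNIV (\<lambda>x. ?e x * partial_derivative j \<phi> x)"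
    by (intro continuous_on_mult continuous_character c)+
  let ?h = "\<lambda>x. ?e x * partial_derivative j \<phi> x + (\<i> * of_int ((- k) $ j)) * (?e x * \<phi> x)"
  have "(\<integral>x. ?h x \<partial>torus_measure) = 0"
  proof (rule integral_torus_derivative[where g="\<lambda>x. ?e x * \<phi> x" and j=j])
    show "periodic ?h" using p1 by (simp add: periodic_def)
    show "continuous_on UNIV ?h" by (intro continuous_intros c1)
    show "((\<lambda>t. ?e (x + t *\<^sub>R axis j 1) * \<phi> (x + t *\<^sub>R axis j 1)) has_vector_derivative ?h x) (at 0)" for x
      by (auto intro!: derivative_eq_intros character_has_partial smooth_has_partial_0 s)
  qed (fact p1 c1)+
  then show ?thesis
    using integrable_torus_continuous[OF p1(1) c1(1)] integrable_torus_continuous[OF p1(2) c1(2)]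
    by (simp add: test_fourier_coeff_def)
qed

lemma test_fourier_coeff_foldr:
  assumes \<phi>: "\<phi> \<in> test_functions"
  shows "test_fourier_coeff (foldr partial_derivative js \<phi>) k =
    (\<Prod>j\<leftarrow>js. \<i> * of_int (k $ j)) * test_fourier_coeff \<phi> k"
  by (induction js) (simp_all add: test_fourier_coeff_partial test_functions_foldr[OF \<phi>])

lemma test_integrable:
  "\<phi> \<in> test_functions \<Longrightarrow> integrable torus_measure (\<lambda>x. character k x * \<phi> x)"
  by (intro integrable_torus_continuous periodic_compose2[where h="(*)"] periodic_character
      continuous_on_mult continuous_character smooth_continuous) (auto simp: test_functionsD)

lemma norm_test_fourier_coeff_le:
  fixes \<phi> :: "real^'n \<Rightarrow> complex"
  assumes \<phi>: "\<phi> \<in> test_functions" and B: "\<And>x. norm (\<phi> x) \<le> B"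
  shows "norm (test_fourier_coeff \<phi> k) \<le> B"
proof -
  have "norm (test_fourier_coeff \<phi> k) \<le> (\<integral>x. norm (character (- k) x * \<phi> x) \<partial>torus_measure)"
    unfolding test_fourier_coeff_def by (rule integral_norm_bound)
  also have "\<dots> \<le> (\<integral>(x::real^'n). B \<partial>torus_measure)"
    by (rule integral_mono[OF integrable_norm[OF test_integrable[OF \<phi>]]])
      (auto simp: norm_mult B)
  finally show ?thesis by simp
qed

text \<open>Each derivative turns into a factor \<open>k\<^sub>j\<close>, so the coefficients decay faster than any power,
  at a rate that is controlled by the seminorms.\<close>

lemma test_fourier_coeff_decay:
  fixes \<phi> :: "real^'n \<Rightarrow> complex"
  assumes \<phi>: "\<phi> \<in> test_functions"
  shows "(1 + norm (real_vec k)) ^ r * norm (test_fourier_coeff \<phi> k) \<le>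
    (1 + real CARD('n)) ^ r * test_seminorm r \<phi>"
proof -
  define M where "M = (MAX j\<in>UNIV. \<bar>real_of_int (k $ j)\<bar>)"
  have Mge: "\<bar>real_of_int (k $ j)\<bar> \<le> M" for j
    unfolding M_def by (intro Max_ge) auto
  have "M \<in> range (\<lambda>j. \<bar>real_of_int (k $ j)\<bar>)"
    unfolding M_def by (intro Max_in) auto
  then obtain j where j: "M = \<bar>real_of_int (k $ j)\<bar>" by blast
  have "norm (real_vec k) \<le> (\<Sum>j\<in>UNIV. \<bar>real_of_int (k $ j)\<bar>)"
    using norm_le_l1_cart[of "real_vec k"] by simp
  also have "\<dots> \<le> (\<Sum>j\<in>(UNIV::'n set). M)" by (intro sum_mono Mge)
  finally have "1 + norm (real_vec k) \<le> 1 + real CARD('n) * M" by simp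
  also have "\<dots> \<le> (1 + real CARD('n)) * max 1 M"
    by (cases "M \<le> 1") (auto simp: max_def algebra_simps mult_left_mono)
  finally have "(1 + norm (real_vec k)) ^ r \<le> ((1 + real CARD('n)) * max 1 M) ^ r"
    by (rule power_mono) auto
  then have "(1 + norm (real_vec k)) ^ r * norm (test_fourier_coeff \<phi> k) \<le>
      (1 + real CARD('n)) ^ r * ((max 1 M) ^ r * norm (test_fourier_coeff \<phi> k))"
    by (simp add: power_mult_distrib mult.assoc[symmetric] mult_right_mono)
  also have "(max 1 M) ^ r * norm (test_fourier_coeff \<phi> k) \<le> test_seminorm r \<phi>"
  proof (cases "M \<le> 1")
    case True
    have "norm (\<phi> x) \<le> test_seminorm r \<phi>" for x
      using test_seminorm_upper[OF \<phi>, of "single_index j 0" r x]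
      by (simp add: multi_derivative_def multi_power_single_index del: order_single_index)
        (simp add: single_index_def)
    then show ?thesis using True norm_test_fourier_coeff_le[OF \<phi>] by (simp add: max_def)
  next
    case False
    let ?js = "replicate r j"
    have "norm (foldr partial_derivative ?js \<phi> x) \<le> test_seminorm r \<phi>" for x
      using test_seminorm_upper[OF \<phi>, of "single_index j r" r x]
      by (simp add: multi_derivative_def multi_power_single_index foldr_replicate)
    from norm_test_fourier_coeff_le[OF test_functions_foldr[OF \<phi>] this]
    have "norm (test_fourier_coeff (foldr partial_derivative ?js \<phi>) k) \<le> test_seminorm r \<phi>" .
    then have "norm ((\<Prod>j\<leftarrow>?js. \<i> * of_int (k $ j)) * test_fourier_coeff \<phi> k) \<le> test_seminorm r \<phi>"
      by (simp only: test_fourier_coeff_foldr[OF \<phi>])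
    then show ?thesis
      using False j by (simp add: norm_mult norm_power max_def)
  qed
  finally show ?thesis by (simp add: mult_left_mono)
qed

section \<open>Fourier series of test functions\<close>

lemma sum_int_inverse_square_bounded:
  obtains C :: real where "\<And>M. (\<Sum>m\<in>{-M..M::int}. 1 / (1 + \<bar>real_of_int m\<bar>)\<^sup>2) \<le> C"
proof
  fix M :: int
  let ?g = "\<lambda>m::int. 1 / (1 + \<bar>real_of_int m\<bar>)\<^sup>2"
  let ?h = "\<lambda>i::nat. 1 / (1 + real i)\<^sup>2"
  have sm: "summable ?h"
    using inverse_power_summable[of 2] summable_Suc_iff[of "\<lambda>i. inverse (real i ^ 2)"]
    by (simp add: inverse_eq_divide add.commute)
  have "{-M..M} \<subseteq> int ` {..nat M} \<union> (\<lambda>i. - int i) ` {..nat M}"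
  proof
    fix m assume "m \<in> {-M..M}"
    then show "m \<in> int ` {..nat M} \<union> (\<lambda>i. - int i) ` {..nat M}"
      by (cases m) (auto simp: image_iff intro!: bexI[of _ "nat \<bar>m\<bar>"])
  qed
  then have "(\<Sum>m\<in>{-M..M}. ?g m) \<le> (\<Sum>m\<in>int ` {..nat M} \<union> (\<lambda>i. - int i) ` {..nat M}. ?g m)"
    by (intro sum_mono2) auto
  also have "\<dots> \<le> (\<Sum>m\<in>int ` {..nat M}. ?g m) + (\<Sum>m\<in>(\<lambda>i. - int i) ` {..nat M}. ?g m)"
    by (subst sum_Un) (auto intro: sum_nonneg)
  also have "\<dots> = 2 * (\<Sum>i\<le>nat M. ?h i)"
    by (simp add: sum.reindex inj_on_def)
  also have "(\<Sum>i\<le>nat M. ?h i) \<le> suminf ?h"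
    by (rule sum_le_suminf[OF sm]) auto
  finally show "(\<Sum>m\<in>{-M..M}. ?g m) \<le> 2 * suminf ?h" by simp
qed

text \<open>The weight is dominated by the product of the one-dimensional weights
  \<open>1 / (1 + |k\<^sub>i|)\<^sup>2\<close>, and each of these is summable.\<close>

lemma summable_lattice_weight:
  "(\<lambda>k::int^'n. 1 / (1 + norm (real_vec k)) ^ (2 * CARD('n))) summable_on UNIV"
proof (rule nonneg_bdd_above_summable_on)
  let ?g = "\<lambda>m::int. 1 / (1 + \<bar>real_of_int m\<bar>)\<^sup>2"
  let ?f = "\<lambda>k::int^'n. 1 / (1 + norm (real_vec k)) ^ (2 * CARD('n))"
  show "0 \<le> ?f k" for k by simp
  obtain C where C: "\<And>M. (\<Sum>m\<in>{-M..M::int}. ?g m) \<le> C"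
    by (rule sum_int_inverse_square_bounded) (rule that)
  have le: "?f k \<le> (\<Prod>i\<in>UNIV. ?g (k $ i))" for k :: "int^'n"
  proof -
    have "(\<Prod>i\<in>(UNIV::'n set). (1 + \<bar>real_of_int (k $ i)\<bar>)\<^sup>2) \<le>
        (\<Prod>i\<in>(UNIV::'n set). (1 + norm (real_vec k))\<^sup>2)"
      using component_le_norm_cart[of "real_vec k"]
      by (intro prod_mono conjI power_mono) auto
    also have "\<dots> = (1 + norm (real_vec k)) ^ (2 * CARD('n))"
      by (simp add: power_mult)
    finally have "1 / (1 + norm (real_vec k)) ^ (2 * CARD('n)) \<le>
        1 / (\<Prod>i\<in>(UNIV::'n set). (1 + \<bar>real_of_int (k $ i)\<bar>)\<^sup>2)"
      by (intro divide_left_mono mult_pos_pos prod_pos) (auto intro!: zero_less_power add_pos_nonneg)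
    then show ?thesis by (simp add: prod_dividef)
  qed
  show "bdd_above (sum ?f ` {F. F \<subseteq> UNIV \<and> finite F})"
  proof (rule bdd_aboveI2)
    fix F assume "F \<in> {F::(int^'n) set. F \<subseteq> UNIV \<and> finite F}"
    then have F: "finite F" by simp
    define M where "M = Max (insert 0 ((\<lambda>(k, i). \<bar>k $ i\<bar>) ` (F \<times> UNIV)))"
    have M: "\<bar>k $ i\<bar> \<le> M" if "k \<in> F" for k i
      unfolding M_def using F that by (intro Max_ge) (auto simp: image_iff)
    have "(\<Sum>k\<in>F. ?f k) \<le> (\<Sum>k\<in>F. \<Prod>i\<in>UNIV. ?g (k $ i))"
      by (intro sum_mono le)
    also have "\<dots> = (\<Sum>x\<in>vec_nth ` F. \<Prod>i\<in>UNIV. ?g (x i))"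
      by (subst sum.reindex) (auto simp: inj_on_def vec_nth_inject)
    also have "\<dots> \<le> (\<Sum>x\<in>PiE UNIV (\<lambda>_. {-M..M}). \<Prod>i\<in>(UNIV::'n set). ?g (x i))"
    proof (rule sum_mono2)
      show "vec_nth ` F \<subseteq> PiE UNIV (\<lambda>_. {-M..M})"
      proof
        fix x assume "x \<in> vec_nth ` F"
        then obtain k where "k \<in> F" "x = vec_nth k" by blast
        then show "x \<in> PiE UNIV (\<lambda>_. {-M..M})" using M[of k] by (auto simp: abs_le_iff minus_le_iff)
      qed
      show "finite (PiE (UNIV::'n set) (\<lambda>_. {-M..M}))" by (intro finite_PiE) auto
    qed (auto intro: prod_nonneg)
    also have "\<dots> = (\<Prod>i\<in>(UNIV::'n set). \<Sum>m\<in>{-M..M}. ?g m)"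
      by (subst prod_sum_PiE) auto
    also have "\<dots> \<le> (\<Prod>i\<in>(UNIV::'n set). C)"
      by (intro prod_mono conjI sum_nonneg C) auto
    finally show "(\<Sum>k\<in>F. ?f k) \<le> C ^ CARD('n)" by simp
  qed
qed

lemma abs_summable_lattice:
  fixes f :: "int^'n \<Rightarrow> 'b::real_normed_vector"
  assumes "\<And>k. (1 + norm (real_vec k)) ^ (2 * CARD('n)) * norm (f k) \<le> C"
  shows "(\<lambda>k. norm (f k)) summable_on UNIV"
proof -
  have "(\<lambda>k::int^'n. C * (1 / (1 + norm (real_vec k)) ^ (2 * CARD('n)))) summable_on UNIV"
    by (intro summable_on_cmult_right summable_lattice_weight)
  moreover have "norm (f k) \<le> C * (1 / (1 + norm (real_vec k)) ^ (2 * CARD('n)))" for k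
  proof -
    have pos: "0 < (1 + norm (real_vec k)) ^ (2 * CARD('n))"
      by (intro zero_less_power add_pos_nonneg) auto
    then show ?thesis using assms[of k] by (simp add: field_simps)
  qed
  ultimately show ?thesis
    by (rule summable_on_comparison_test) auto
qed

lemma summable_test_fourier_coeff:
  fixes \<phi> :: "real^'n \<Rightarrow> complex"
  assumes \<phi>: "\<phi> \<in> test_functions"
  shows "(\<lambda>k. norm (test_fourier_coeff \<phi> k)) summable_on UNIV"
  using test_fourier_coeff_decay[OF \<phi>, where r="2 * CARD('n)"] by (rule abs_summable_lattice)

lemma cos_product_character:
  "2 * complex_of_real (cos (x $ i)) * character k x =
    character (k + axis i 1) x + character (k - axis i 1) x"
proof -
  have "character (axis i 1) x + character (- axis i 1) x = 2 * complex_of_real (cos (x $ i))"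
    by (simp add: character_def inner_axis' flip: cos_of_real) (simp add: cos_exp_eq)
  then have "2 * complex_of_real (cos (x $ i)) * character k x =
      character k x * (character (axis i 1) x + character (- axis i 1) x)"
    by simp
  also have "\<dots> = character (k + axis i 1) x + character (k + - axis i 1) x"
    by (simp only: character_add ring_distribs)
  finally show ?thesis by simp
qed

text \<open>The trigonometric polynomial \<open>T\<close> below satisfies \<open>0 \<le> T \<le> 1\<close> and equals 1 exactly on the
  lattice. Its powers concentrate there, so integration against them detects the sign of the value
  at the origin.\<close>

lemma Re_nonpos_of_fourier_zero:
  fixes g :: "real^'n \<Rightarrow> complex"
  assumes g: "periodic g" "continuous_on UNIV g"
    and zero: "\<And>k. (\<integral>x. character k x * g x \<partial>torus_measure) = 0"
  shows "Re (g 0) \<le> 0"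
proof (rule ccontr)
  assume "\<not> Re (g 0) \<le> 0"
  define c where "c = Re (g 0)"
  have c: "c > 0" using \<open>\<not> Re (g 0) \<le> 0\<close> by (simp add: c_def)
  define n where "n = real CARD('n)"
  have n: "n > 0" by (simp add: n_def)
  define T where "T x = (\<Sum>i\<in>UNIV. 1 + cos (x $ i)) / (2 * n)" for x :: "real^'n"
  have T_cont: "continuous_on UNIV T"
    unfolding T_def using n by (intro continuous_intros) auto
  have T_per: "periodic T"
  proof -
    have "cos ((x + axis j (2 * pi)) $ i) = cos (x $ i)" for x :: "real^'n" and i j
      by (simp add: axis_def)
    then show ?thesis by (simp only: periodic_def T_def) simp
  qed
  have cos0: "0 \<le> 1 + cos z" for z :: real using cos_ge_minus_one[of z] by linarith
  have T0: "0 \<le> T x" for x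
    unfolding T_def using n
    by (intro divide_nonneg_nonneg sum_nonneg cos0) auto
  have T1: "T x \<le> 1" for x
  proof -
    have "(\<Sum>i\<in>UNIV. 1 + cos (x $ i)) \<le> (\<Sum>i\<in>(UNIV::'n set). 2)"
      by (intro sum_mono) (use cos_le_one in \<open>simp add: algebra_simps\<close>)
    then show ?thesis using n by (simp add: T_def n_def)
  qed
  have T_at_0: "T 0 = 1" using n by (simp add: T_def n_def)
  have g_lattice: "Re (g x) = c" if "T x = 1" for x
  proof -
    have "cos (x $ i) = 1" for i
    proof (rule ccontr)
      assume "cos (x $ i) \<noteq> 1"
      then have "1 + cos (x $ i) < 2" using cos_le_one[of "x $ i"] by linarith
      then have "(\<Sum>i\<in>UNIV. 1 + cos (x $ i)) < (\<Sum>i\<in>(UNIV::'n set). 2)"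
        by (intro sum_strict_mono_ex1) (use cos_le_one in \<open>auto simp: algebra_simps intro!: exI[of _ i]\<close>)
      then show False using that n by (simp add: T_def n_def field_simps)
    qed
    then have "\<exists>m::int. x $ i = of_int m * 2 * pi" for i
      using cos_one_2pi_int by blast
    then obtain m where "\<And>i. x $ i = of_int (m i) * 2 * pi" by metis
    then have "x = 0 + (2 * pi) *\<^sub>R real_vec (\<chi> i. m i)"
      by (simp add: vec_eq_iff)
    then have "g x = g 0" by (simp only: periodic_lattice[OF g(1)])
    then show ?thesis by (simp add: c_def)
  qed
  \<comment> \<open>\<open>T\<close> stays away from 1 wherever \<open>Re g\<close> is small.\<close>
  define Z where "Z = {x \<in> cbox 0 (\<chi> i. 2 * pi) :: (real^'n) set. Re (g x) \<le> c / 2}"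
  have "compact Z"
  proof -
    have "closed {x. Re (g x) \<le> c / 2}"
      by (intro closed_Collect_le continuous_intros g(2))
    then have "compact (cbox 0 (\<chi> i. 2 * pi) \<inter> {x. Re (g x) \<le> c / 2})"
      by (intro compact_Int_closed compact_cbox)
    then show ?thesis by (simp add: Z_def Collect_conj_eq)
  qed
  have "\<exists>r\<ge>1/2. r < 1 \<and> (\<forall>x\<in>Z. T x \<le> r)"
  proof (cases "Z = {}")
    case False
    obtain y where y: "y \<in> Z" "\<And>x. x \<in> Z \<Longrightarrow> T x \<le> T y"
      using continuous_attains_sup[OF \<open>compact Z\<close> False continuous_on_subset[OF T_cont]] by blast
    have "T y \<noteq> 1" using g_lattice[of y] y(1) c by (auto simp: Z_def)
    then show ?thesis using T1[of y] y(2) by (intro exI[of _ "max (1/2) (T y)"]) (auto simp: le_max_iff_disj)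
  qed (auto intro!: exI[of _ "1/2"])
  then obtain r where r: "r \<ge> 1/2" "r < 1" "\<And>x. x \<in> Z \<Longrightarrow> T x \<le> r" by blast
  obtain B where B: "B > 0" "\<And>x. norm (g x) \<le> B" using periodic_bounded[OF g] by blast
  have lower: "Re (g x) * T x ^ N \<ge> c / 2 * T x ^ N - (B + c) * r ^ N" for x N
  proof -
    obtain k where k: "x + (2 * pi) *\<^sub>R real_vec k \<in> cell"
      using cell_translate_unique[of x] by blast
    define y where "y = x + (2 * pi) *\<^sub>R real_vec k"
    have eq: "g x = g y" "T x = T y"
      by (simp_all add: y_def periodic_lattice g(1) T_per)
    have y: "y \<in> cbox 0 (\<chi> i. 2 * pi)" using k cell_subset by (auto simp: y_def)
    have rN: "r ^ N \<ge> 0" using r by simp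
    show ?thesis
    proof (cases "Re (g y) \<le> c / 2")
      case True
      then have "T y \<le> r" using y r(3) by (simp add: Z_def)
      then have TN: "T y ^ N \<le> r ^ N" "0 \<le> T y ^ N" using T0 by (auto intro: power_mono)
      have "- B \<le> Re (g y)" using B(2)[of y] abs_Re_le_cmod[of "g y"] by linarith
      then have "- (B + c / 2) * T y ^ N \<le> (Re (g y) - c / 2) * T y ^ N"
        by (intro mult_right_mono) (use TN in auto)
      moreover have "(B + c / 2) * T y ^ N \<le> (B + c / 2) * r ^ N"
        using B c TN by (intro mult_left_mono) auto
      moreover have "(B + c / 2) * r ^ N \<le> (B + c) * r ^ N"
        using c rN by (intro mult_right_mono) auto
      ultimately show ?thesis by (simp add: eq algebra_simps)
    next
      case False
      then have "c / 2 * T y ^ N \<le> Re (g y) * T y ^ N"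
        using T0 by (intro mult_right_mono) auto
      moreover have "0 \<le> (B + c) * r ^ N" using B c rN by simp
      ultimately show ?thesis by (simp add: eq)
    qed
  qed
  have TN_cont: "continuous_on UNIV (\<lambda>x. T x ^ N)" for N
    by (intro continuous_intros T_cont)
  have TN_per: "periodic (\<lambda>x. T x ^ N)" for N
    using T_per by (simp add: periodic_def)
  have F_int: "integrable torus_measure (\<lambda>x. complex_of_real (T x ^ N) * (character k x * g x))" for N k
  proof (rule integrable_torus_continuous)
    show "periodic (\<lambda>x. complex_of_real (T x ^ N) * (character k x * g x))"
      using T_per g(1) periodic_character[of k] by (simp add: periodic_def)
    show "continuous_on UNIV (\<lambda>x. complex_of_real (T x ^ N) * (character k x * g x))"
      by (intro continuous_intros T_cont g(2) continuous_character)
  qed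
  have "(\<integral>x. complex_of_real (T x ^ N) * (character k x * g x) \<partial>torus_measure) = 0" for N k
  proof (induction N arbitrary: k)
    case 0
    then show ?case using zero by simp
  next
    case (Suc N)
    let ?F = "\<lambda>k x. complex_of_real (T x ^ N) * (character k x * g x)"
    have "complex_of_real (T x ^ Suc N) * (character k x * g x) =
        (\<Sum>i\<in>UNIV. (2 * ?F k x + (?F (k + axis i 1) x + ?F (k - axis i 1) x)) / (4 * n))" for x
    proof -
      have "complex_of_real (T x) * character k x =
          (\<Sum>i\<in>UNIV. (1 + complex_of_real (cos (x $ i))) * character k x / (2 * n))"
        by (simp add: T_def sum_divide_distrib sum_distrib_right sum_distrib_left field_simps)
      also have "\<dots> = (\<Sum>i\<in>UNIV. (2 * character k x +
          (character (k + axis i 1) x + character (k - axis i 1) x)) / (4 * n))"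
        by (rule sum.cong[OF refl], subst cos_product_character[symmetric])
          (use n in \<open>simp add: field_simps\<close>)
      finally have *: "complex_of_real (T x) * character k x = \<dots>" .
      have "complex_of_real (T x ^ Suc N) * (character k x * g x) =
          complex_of_real (T x ^ N) * g x * (complex_of_real (T x) * character k x)"
        by simp
      also have "\<dots> = (\<Sum>i\<in>UNIV. (2 * ?F k x + (?F (k + axis i 1) x + ?F (k - axis i 1) x)) / (4 * n))"
        unfolding * sum_distrib_left by (rule sum.cong) (simp_all add: field_simps)
      finally show ?thesis .
    qed
    then show ?case
      using F_int by (simp add: Suc.IH[simplified] Bochner_Integration.integral_sum)
  qed
  from this[of _ 0] have "(\<integral>x. complex_of_real (T x ^ N) * g x \<partial>torus_measure) = 0" for N
    by simp
  moreover have int1: "integrable torus_measure (\<lambda>x. complex_of_real (T x ^ N) * g x)" for N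
    using F_int[of N 0] by simp
  ultimately have zeroR: "(\<integral>x. Re (g x) * T x ^ N \<partial>torus_measure) = 0" for N
    using integral_Re[OF int1[of N]] by (simp add: mult.commute)
  have intR: "integrable torus_measure (\<lambda>x. Re (g x) * T x ^ N)" for N
    using integrable_Re[OF int1[of N]] by (simp add: mult.commute)
  have intT: "integrable torus_measure (\<lambda>x. T x ^ N)" for N
    by (rule integrable_torus_continuous[OF TN_per TN_cont])
  have upper: "c / 2 * (\<integral>x. T x ^ N \<partial>torus_measure) \<le> (B + c) * r ^ N" for N
  proof -
    have "(\<integral>x. c / 2 * T x ^ N - (B + c) * r ^ N \<partial>torus_measure) \<le>
        (\<integral>x. Re (g x) * T x ^ N \<partial>torus_measure)"
      using lower intR intT by (intro integral_mono) auto
    then show ?thesis using intT by (simp add: zeroR)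
  qed
  \<comment> \<open>Near the origin \<open>T\<close> exceeds a number \<open>t\<close> larger than \<open>r\<close>.\<close>
  define t where "t = (1 + r) / 2"
  have t: "r < t" "t < 1" "0 < t" using r by (auto simp: t_def)
  define U where "U = {x. t < T x} \<inter> box 0 (\<chi> i. 2 * pi)"
  define d where "d = measure torus_measure U"
  have "open {x. t < T x}" by (intro open_Collect_less continuous_intros T_cont)
  then have U_open: "open U" by (simp add: U_def open_Int open_box)
  have "U \<noteq> {}"
  proof -
    have "(T \<longlongrightarrow> T 0) (at 0)" using T_cont by (simp add: continuous_on_def)
    then have "\<forall>\<^sub>F x in at 0. t < T x"
      by (rule order_tendstoD) (use T_at_0 t in simp)
    then obtain e where e: "e > 0" "\<And>x. x \<noteq> 0 \<Longrightarrow> dist x 0 < e \<Longrightarrow> t < T x"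
      unfolding eventually_at by blast
    define y :: "real^'n" where "y = (\<chi> i. min (e / (2 * n)) pi)"
    have y0: "y \<noteq> 0" using e(1) n pi_gt_zero by (auto simp: y_def vec_eq_iff min_def)
    have "norm y \<le> (\<Sum>i\<in>UNIV. \<bar>y $ i\<bar>)" by (rule norm_le_l1_cart)
    also have "\<dots> \<le> (\<Sum>i\<in>(UNIV::'n set). e / (2 * n))"
      using e(1) n by (intro sum_mono) (auto simp: y_def min_def)
    also have "\<dots> < e" using e(1) n by (simp add: n_def)
    finally have "t < T y" using e(2)[OF y0] by simp
    moreover have "y \<in> box 0 (\<chi> i. 2 * pi)"
    proof -
      have "0 < y $ i" for i using e(1) n by (simp add: y_def)
      moreover have "y $ i < 2 * pi" for i
        using min.cobounded2[of "e / (2 * n)" pi] pi_gt_zero unfolding y_def vec_lambda_beta by linarith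
      ultimately show ?thesis by (simp add: mem_box_cart)
    qed
    ultimately show ?thesis by (auto simp: U_def)
  qed
  have "d > 0"
  proof (rule ccontr)
    assume "\<not> d > 0"
    then have "d = 0" using measure_nonneg[of torus_measure U] by (simp add: d_def)
    then have "emeasure torus_measure U = 0"
      using torus.emeasure_eq_measure[of U] by (simp add: d_def)
    moreover have "emeasure torus_measure U =
        emeasure lborel (cbox 0 (\<chi> i. 2 * pi) \<inter> U) / emeasure lborel (cbox 0 (\<chi> i. 2 * pi) :: (real^'n) set)"
      unfolding torus_measure_def using U_open by (subst emeasure_uniform_measure) auto
    ultimately have "emeasure lborel (cbox 0 (\<chi> i. 2 * pi) \<inter> U) = 0"
      by (simp add: box_2pi_volume ennreal_divide_eq_0_iff)
    moreover have "cbox 0 (\<chi> i. 2 * pi) \<inter> U = U"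
      using box_subset_cbox by (auto simp: U_def)
    ultimately have "U \<in> null_sets lborel" using U_open by (intro null_setsI) auto
    then have "negligible U" by (simp add: negligible_iff_null_sets null_sets_completionI)
    then show False using open_not_negligible[OF U_open \<open>U \<noteq> {}\<close>] by simp
  qed
  have "c / 2 * (t ^ N * d) \<le> (B + c) * r ^ N" for N
  proof -
    have "(\<integral>x. t ^ N * indicator U x \<partial>torus_measure) \<le> (\<integral>x. T x ^ N \<partial>torus_measure)"
    proof (rule integral_mono[OF _ intT])
      show "integrable torus_measure (\<lambda>x. t ^ N * indicator U x)"
      proof (rule integrable_torus_bounded[where B="t ^ N"])
        have [measurable]: "U \<in> sets borel" using U_open by simp
        show "(\<lambda>x. t ^ N * indicator U x) \<in> borel_measurable borel" by measurable
      qed (use t in \<open>auto simp: indicator_def\<close>)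
      show "t ^ N * indicator U x \<le> T x ^ N" for x
        using T0[of x] t by (cases "x \<in> U") (auto simp: U_def intro!: power_mono)
    qed
    then have "t ^ N * d \<le> (\<integral>x. T x ^ N \<partial>torus_measure)"
      using U_open by (simp add: d_def)
    then have "c / 2 * (t ^ N * d) \<le> c / 2 * (\<integral>x. T x ^ N \<partial>torus_measure)"
      using c by (intro mult_left_mono) auto
    then show ?thesis using upper[of N] by linarith
  qed
  then have le: "(t / r) ^ N \<le> (B + c) / (c / 2 * d)" for N
  proof -
    have "0 < r ^ N" using r by simp
    moreover have "0 < c / 2 * d" using c \<open>d > 0\<close> by simp
    ultimately show ?thesis
      using \<open>\<And>N. c / 2 * (t ^ N * d) \<le> (B + c) * r ^ N\<close>[of N]
      by (simp add: power_divide field_simps)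
  qed
  have "1 < t / r" using t r by simp
  then obtain N where "(B + c) / (c / 2 * d) < (t / r) ^ N"
    using real_arch_pow by blast
  then show False using le[of N] by simp
qed

text \<open>The one-sided statement is applied to \<open>cnj (g y) * g (x + y)\<close>, whose value at the origin
  is \<open>|g y|\<^sup>2\<close>.\<close>

lemma fourier_uniqueness:
  fixes g :: "real^'n \<Rightarrow> complex"
  assumes g: "periodic g" "continuous_on UNIV g"
    and zero: "\<And>k. (\<integral>x. character k x * g x \<partial>torus_measure) = 0"
  shows "g y = 0"
proof -
  let ?h = "\<lambda>x. cnj (g y) * g (x + y)"
  have "Re (?h 0) \<le> 0"
  proof (rule Re_nonpos_of_fourier_zero)
    show "periodic ?h"
      using periodic_translate[OF g(1), of y] by (simp add: periodic_def)
    show "continuous_on UNIV ?h" by (intro continuous_intros continuous_on_translate g(2))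
    fix k :: "int^'n"
    have "character k x * ?h x = (cnj (g y) * character k (- y)) * (character k (x + y) * g (x + y))" for x
      by (simp add: character_add_arg mult_ac) (simp add: mult.assoc[symmetric] flip: character_add_arg)
    then have "(\<integral>x. character k x * ?h x \<partial>torus_measure) =
        (cnj (g y) * character k (- y)) * (\<integral>x. character k (x + y) * g (x + y) \<partial>torus_measure)"
      by (simp only: integral_mult_right_zero)
    also have "(\<integral>x. character k (x + y) * g (x + y) \<partial>torus_measure) =
        (\<integral>x. character k x * g x \<partial>torus_measure)"
      using periodic_character[of k] g(1)
      by (intro integral_torus_translate[where f="\<lambda>x. character k x * g x"]
          continuous_on_mult continuous_character g(2)) (simp add: periodic_def)
    finally show "(\<integral>x. character k x * ?h x \<partial>torus_measure) = 0" by (simp add: zero)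
  qed
  moreover have "Re (?h 0) = (norm (g y))\<^sup>2"
    using cmod_power2[of "g y"] by (simp add: power2_eq_square)
  ultimately show ?thesis by simp
qed

lemma integral_character:
  "(\<integral>x. character (k :: int^'n) x \<partial>torus_measure) = (if k = 0 then 1 else 0)"
proof (cases "k = 0")
  case True
  have "character 0 = (\<lambda>x::real^'n. 1)" by (simp add: fun_eq_iff)
  then show ?thesis using True by simp
next
  case False
  then obtain j where j: "k $ j \<noteq> 0" by (auto simp: vec_eq_iff)
  have "\<i> * of_int (k $ j) * (\<integral>x. character k x \<partial>torus_measure) =
      (\<integral>x. \<i> * of_int (k $ j) * character k x \<partial>torus_measure)" by simp
  also have "\<dots> = 0"
  proof (rule integral_torus_derivative[where g="character k" and j=j])
    show "periodic (\<lambda>x. \<i> * of_int (k $ j) * character k x)"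
      by (rule periodic_compose[OF periodic_character])
  qed (intro periodic_character continuous_intros continuous_character character_has_partial)+
  finally show ?thesis using j False by simp
qed

lemma test_fourier_coeff_character:
  "test_fourier_coeff (character l) k = (if k = l then 1 else 0)"
  unfolding test_fourier_coeff_def by (simp add: integral_character flip: character_add)

text \<open>The finite set depends on the dominating family only, which makes the convergence of series uniform
  in a parameter.\<close>

lemma infsum_tail:
  fixes f :: "'a \<Rightarrow> 'b::banach"
  assumes f: "(\<lambda>k. norm (f k)) summable_on UNIV" and e: "(e::real) > 0"
  shows "\<exists>F0. finite F0 \<and> (\<forall>F (g :: 'a \<Rightarrow> 'b). finite F \<longrightarrow> F0 \<subseteq> F \<longrightarrow>
    (\<forall>k. norm (g k) \<le> norm (f k)) \<longrightarrow> norm (infsum g UNIV - sum g F) \<le> e)"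
proof -
  let ?n = "\<lambda>k. norm (f k)"
  obtain F0 where F0: "finite F0" "dist (sum ?n F0) (infsum ?n UNIV) \<le> e"
    using infsum_finite_approximation[OF f e] by auto
  have "norm (infsum g UNIV - sum g F) \<le> e"
    if F: "finite F" "F0 \<subseteq> F" and g: "\<And>k. norm (g k) \<le> ?n k" for F and g :: "'a \<Rightarrow> 'b"
  proof -
    have gs: "(\<lambda>k. norm (g k)) summable_on UNIV"
      by (rule summable_on_comparison_test[OF f]) (use g in auto)
    have g1: "g summable_on A" for A
      using abs_summable_summable[OF gs] summable_on_subset_banach by blast
    have g2: "(\<lambda>k. norm (g k)) summable_on A" for A
      using gs summable_on_subset_banach by blast
    have f2: "?n summable_on A" for A
      using f summable_on_subset_banach by blast
    have "infsum g UNIV = infsum g F + infsum g (- F)"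
      using infsum_Un_disjoint[OF g1[of F] g1[of "- F"]] by simp
    then have "norm (infsum g UNIV - sum g F) = norm (infsum g (- F))" using F by simp
    also have "\<dots> \<le> (\<Sum>\<^sub>\<infinity>k\<in>-F. norm (g k))" by (rule norm_infsum_bound[OF g2])
    also have "\<dots> \<le> infsum ?n (- F)" by (rule infsum_mono[OF g2 f2]) (rule g)
    also have "\<dots> = infsum ?n UNIV - sum ?n F"
      using infsum_Un_disjoint[OF f2[of F] f2[of "- F"]] F by simp
    also have "\<dots> \<le> infsum ?n UNIV - sum ?n F0"
      using F by (simp add: sum_mono2)
    also have "\<dots> \<le> e" using F0 by (simp add: dist_real_def)
    finally show ?thesis .
  qed
  then show ?thesis using F0(1) by (intro exI[of _ F0]) simp
qed

text \<open>The series converges uniformly, so its sum is continuous and has the same Fourier coefficients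
  as \<open>\<phi>\<close>. By uniqueness the sum is \<open>\<phi>\<close>.\<close>

lemma fourier_series_uniform:
  fixes \<phi> :: "real^'n \<Rightarrow> complex"
  assumes \<phi>: "\<phi> \<in> test_functions" and e: "e > 0"
  obtains F0 where "finite F0" "\<And>F x. finite F \<Longrightarrow> F0 \<subseteq> F \<Longrightarrow>
    norm (\<phi> x - (\<Sum>k\<in>F. test_fourier_coeff \<phi> k * character k x)) \<le> e"
proof -
  let ?c = "test_fourier_coeff \<phi>"
  let ?t = "\<lambda>x k. ?c k * character k x"
  define S where "S x = infsum (?t x) UNIV" for x
  note sm = summable_test_fourier_coeff[OF \<phi>]
  have tail: "\<exists>F0. finite F0 \<and> (\<forall>F x. finite F \<longrightarrow> F0 \<subseteq> F \<longrightarrow> norm (S x - sum (?t x) F) \<le> d)"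
    if "d > 0" for d
  proof -
    obtain F0 where F0: "finite F0" "\<forall>F (g :: int^'n \<Rightarrow> complex). finite F \<longrightarrow> F0 \<subseteq> F \<longrightarrow>
        (\<forall>k. norm (g k) \<le> norm (?c k)) \<longrightarrow> norm (infsum g UNIV - sum g F) \<le> d"
      using infsum_tail[OF sm \<open>d > 0\<close>] by auto
    have "norm (S x - sum (?t x) F) \<le> d" if "finite F" "F0 \<subseteq> F" for F x
      unfolding S_def by (rule F0(2)[rule_format, OF that]) (simp add: norm_mult)
    then show ?thesis using F0(1) by blast
  qed
  have S_cont: "continuous_on UNIV S"
  proof (rule uniform_limit_theorem)
    show "\<forall>\<^sub>F F in finite_subsets_at_top UNIV. continuous_on UNIV (\<lambda>x. sum (?t x) F)"
      by (intro always_eventually allI continuous_intros continuous_character)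
    show "uniform_limit UNIV (\<lambda>F x. sum (?t x) F) S (finite_subsets_at_top UNIV)"
    proof (rule uniform_limitI)
      fix d :: real assume "d > 0"
      then obtain F0 where F0: "finite F0"
        "\<forall>F x. finite F \<longrightarrow> F0 \<subseteq> F \<longrightarrow> norm (S x - sum (?t x) F) \<le> d / 2"
        using tail[of "d / 2"] by auto
      show "\<forall>\<^sub>F F in finite_subsets_at_top UNIV. \<forall>x\<in>UNIV. dist (sum (?t x) F) (S x) < d"
        unfolding eventually_finite_subsets_at_top
      proof (intro exI[of _ F0] conjI allI impI ballI)
        fix F x assume "finite F \<and> F0 \<subseteq> F \<and> F \<subseteq> UNIV"
        then have "norm (S x - sum (?t x) F) \<le> d / 2" using F0 by blast
        then show "dist (sum (?t x) F) (S x) < d" using \<open>d > 0\<close> by (simp add: dist_norm norm_minus_commute)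
      qed (use F0 in auto)
    qed
  qed simp
  have S_per: "periodic S"
    unfolding periodic_def S_def by (simp add: periodicD[OF periodic_character])
  have sum_int: "integrable torus_measure (\<lambda>x. character k x * sum (?t x) F)" for F k
  proof (rule integrable_torus_continuous)
    show "periodic (\<lambda>x. character k x * sum (?t x) F)"
      by (simp add: periodic_def periodicD[OF periodic_character])
    show "continuous_on UNIV (\<lambda>x. character k x * sum (?t x) F)"
      by (intro continuous_intros continuous_character)
  qed
  have S_int: "integrable torus_measure (\<lambda>x. character k x * S x)" for k
    by (intro integrable_torus_continuous periodic_compose2[where h="(*)"] S_per periodic_character
        continuous_on_mult continuous_character S_cont)
  have S_coeff: "(\<integral>x. character k x * S x \<partial>torus_measure) = ?c (- k)" for k
  proof -
    have "norm ((\<integral>x. character k x * S x \<partial>torus_measure) - ?c (- k)) \<le> d" if "d > 0" for d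
    proof -
      obtain F0 where F0: "finite F0"
        "\<forall>F x. finite F \<longrightarrow> F0 \<subseteq> F \<longrightarrow> norm (S x - sum (?t x) F) \<le> d"
        using tail[OF \<open>d > 0\<close>] by auto
      let ?F = "insert (- k) F0"
      have le: "norm (S x - sum (?t x) ?F) \<le> d" for x using F0 by blast
      have "(\<integral>x. character k x * sum (?t x) ?F \<partial>torus_measure) =
          (\<integral>x. (\<Sum>l\<in>?F. ?c l * character (k + l) x) \<partial>torus_measure)"
        by (simp add: sum_distrib_left character_add mult_ac)
      also have "\<dots> = (\<Sum>l\<in>?F. ?c l * (if k + l = 0 then 1 else 0))"
        by (subst Bochner_Integration.integral_sum)
          (auto simp: integral_character intro!: integrable_mult_right integrable_torus_continuous
            periodic_character continuous_character)
      also have "\<dots> = (\<Sum>l\<in>?F. if l = - k then ?c l else 0)"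
        by (rule sum.cong) (auto simp: eq_neg_iff_add_eq_0 add.commute)
      also have "\<dots> = ?c (- k)" using F0(1) by (subst sum.delta) auto
      finally have "(\<integral>x. character k x * S x \<partial>torus_measure) - ?c (- k) =
          (\<integral>x. character k x * (S x - sum (?t x) ?F) \<partial>torus_measure)"
        using S_int[of k] sum_int[of k ?F] by (simp add: right_diff_distrib)
      also have "norm \<dots> \<le> (\<integral>x. norm (character k x * (S x - sum (?t x) ?F)) \<partial>torus_measure)"
        by (rule integral_norm_bound)
      also have "\<dots> \<le> (\<integral>(x::real^'n). d \<partial>torus_measure)"
      proof (rule integral_mono)
        have "integrable torus_measure (\<lambda>x. character k x * (S x - sum (?t x) ?F))"
          unfolding right_diff_distrib by (intro Bochner_Integration.integrable_diff S_int sum_int)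
        then show "integrable torus_measure (\<lambda>x. norm (character k x * (S x - sum (?t x) ?F)))"
          by (rule integrable_norm)
      qed (use le in \<open>auto simp: norm_mult simp del: sum.insert\<close>)
      finally show ?thesis by simp
    qed
    then have "norm ((\<integral>x. character k x * S x \<partial>torus_measure) - ?c (- k)) \<le> 0 + d" if "d > 0" for d
      using that by simp
    then have "norm ((\<integral>x. character k x * S x \<partial>torus_measure) - ?c (- k)) \<le> 0"
      by (rule field_le_epsilon)
    then show ?thesis by simp
  qed
  have "\<phi> x - S x = 0" for x
  proof (rule fourier_uniqueness[where g="\<lambda>x. \<phi> x - S x"])
    show "periodic (\<lambda>x. \<phi> x - S x)"
      by (rule periodic_compose2[OF test_functionsD(2)[OF \<phi>] S_per])
    show "continuous_on UNIV (\<lambda>x. \<phi> x - S x)"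
      by (intro continuous_on_diff S_cont smooth_continuous test_functionsD \<phi>)
    show "(\<integral>x. character k x * (\<phi> x - S x) \<partial>torus_measure) = 0" for k
      using S_int[of k] test_integrable[OF \<phi>, of k] S_coeff[of k]
      by (simp add: right_diff_distrib test_fourier_coeff_def)
  qed
  then have "\<phi> = S" by (simp add: fun_eq_iff)
  moreover obtain F0 where "finite F0"
      "\<forall>F x. finite F \<longrightarrow> F0 \<subseteq> F \<longrightarrow> norm (S x - sum (?t x) F) \<le> e"
    using tail[OF e] by auto
  ultimately show thesis using that[of F0] by simp
qed

lemma test_functions_sum_characters:
  "(\<lambda>x. \<Sum>k\<in>F. c k * character k x) \<in> test_functions"
proof (induction F rule: infinite_finite_induct)
  case (insert k F)
  then show ?case using test_functions_linear[OF character_test insert.IH, of "c k" k 1] by simp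
qed (use test_functions_mult[OF character_test, of 0] in auto)

lemma foldr_partial_sum_characters:
  "foldr partial_derivative js (\<lambda>x. \<Sum>k\<in>F. c k * character k x) =
    (\<lambda>x. \<Sum>k\<in>F. (\<Prod>j\<leftarrow>js. \<i> * of_int (k $ j)) * c k * character k x)"
proof (induction F rule: infinite_finite_induct)
  case (insert k F)
  have s: "smooth (\<lambda>x. \<Sum>k\<in>F. c k * character k x)"
    using test_functions_sum_characters test_functionsD by blast
  have "(\<lambda>x. \<Sum>k\<in>insert k F. c k * character k x) =
      (\<lambda>x. c k * character k x + 1 * (\<Sum>k\<in>F. c k * character k x))"
    using insert.hyps by simp
  then show ?case
    using insert by (simp only: foldr_partial_linear[OF smooth_character s] foldr_partial_character)
      (simp add: mult_ac)
qed (use foldr_partial_linear[OF smooth_character smooth_character, of js 0 0 0 0] in simp_all)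

text \<open>Derivatives of the partial sums are partial sums of the derivatives, so uniform convergence
  for all test functions is convergence in all seminorms.\<close>

lemma fourier_series_seminorm:
  fixes \<phi> :: "real^'n \<Rightarrow> complex"
  assumes \<phi>: "\<phi> \<in> test_functions" and e: "e > 0"
  obtains F0 where "finite F0" "\<And>F. finite F \<Longrightarrow> F0 \<subseteq> F \<Longrightarrow>
    test_seminorm N (\<lambda>x. \<phi> x - (\<Sum>k\<in>F. test_fourier_coeff \<phi> k * character k x)) \<le> e"
proof -
  have "\<exists>F0. finite F0 \<and> (\<forall>F x. finite F \<longrightarrow> F0 \<subseteq> F \<longrightarrow>
      norm (multi_derivative \<alpha> (\<lambda>x. \<phi> x - (\<Sum>k\<in>F. test_fourier_coeff \<phi> k * character k x)) x) \<le> e)"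
    for \<alpha> :: "'n \<Rightarrow> nat"
  proof -
    let ?js = "index_list \<alpha>"
    obtain F0 where F0: "finite F0" "\<And>F x. finite F \<Longrightarrow> F0 \<subseteq> F \<Longrightarrow>
      norm (foldr partial_derivative ?js \<phi> x -
        (\<Sum>k\<in>F. test_fourier_coeff (foldr partial_derivative ?js \<phi>) k * character k x)) \<le> e"
      by (rule fourier_series_uniform[OF test_functions_foldr[OF \<phi>] e]) (rule that)
    have s: "smooth (\<lambda>x. \<Sum>k\<in>F. test_fourier_coeff \<phi> k * character k x)" for F
      using test_functions_sum_characters test_functionsD by blast
    have "multi_derivative \<alpha> (\<lambda>x. \<phi> x - (\<Sum>k\<in>F. test_fourier_coeff \<phi> k * character k x)) x =
      foldr partial_derivative ?js \<phi> x -
        (\<Sum>k\<in>F. test_fourier_coeff (foldr partial_derivative ?js \<phi>) k * character k x)" for F x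
      using foldr_partial_linear[OF test_functionsD(1)[OF \<phi>] s[of F], of ?js 1 "-1"]
      by (simp add: multi_derivative_foldr foldr_partial_sum_characters test_fourier_coeff_foldr[OF \<phi>])
    then show ?thesis using F0 by (intro exI[of _ F0]) simp
  qed
  then have "\<forall>\<alpha>::'n \<Rightarrow> nat. \<exists>F0. finite F0 \<and> (\<forall>F x. finite F \<longrightarrow> F0 \<subseteq> F \<longrightarrow>
      norm (multi_derivative \<alpha> (\<lambda>x. \<phi> x - (\<Sum>k\<in>F. test_fourier_coeff \<phi> k * character k x)) x) \<le> e)"
    by (rule allI)
  from choice[OF this] obtain F0 where "\<forall>\<alpha>::'n \<Rightarrow> nat. finite (F0 \<alpha>) \<and> (\<forall>F x. finite F \<longrightarrow> F0 \<alpha> \<subseteq> F \<longrightarrow>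
      norm (multi_derivative \<alpha> (\<lambda>x. \<phi> x - (\<Sum>k\<in>F. test_fourier_coeff \<phi> k * character k x)) x) \<le> e)"
    by (rule exE)
  note F0 = this[rule_format, THEN conjunct1] this[rule_format, THEN conjunct2, rule_format]
  show thesis
  proof
    show "finite (\<Union>\<alpha>\<in>{\<alpha>. order_of \<alpha> \<le> N}. F0 \<alpha>)" using F0(1) by auto
    fix F assume F: "finite F" "(\<Union>\<alpha>\<in>{\<alpha>. order_of \<alpha> \<le> N}. F0 \<alpha>) \<subseteq> F"
    show "test_seminorm N (\<lambda>x. \<phi> x - (\<Sum>k\<in>F. test_fourier_coeff \<phi> k * character k x)) \<le> e"
    proof (rule test_seminorm_least)
      fix \<alpha> :: "'n \<Rightarrow> nat" and x assume "order_of \<alpha> \<le> N"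
      then have "F0 \<alpha> \<subseteq> F" using F(2) by auto
      then show "norm (multi_derivative \<alpha>
          (\<lambda>x. \<phi> x - (\<Sum>k\<in>F. test_fourier_coeff \<phi> k * character k x)) x) \<le> e"
        by (rule F0(2)[OF F(1)])
    qed
  qed
qed

section \<open>Distributions and their Fourier coefficients\<close>

lemma scaleC_zero_left [simp]: "0 *\<^sub>C (x::'e::complex_vector) = 0"
  using scaleC_of_real[of 0 x] by simp

lemma scaleC_minus_left: "(- c) *\<^sub>C (x::'e::complex_vector) = - (c *\<^sub>C x)"
  using scaleC_add_left[of c "- c" x] by (simp add: eq_neg_iff_add_eq_0 add.commute)

lemma scaleR_scaleC_left: "(r *\<^sub>R c) *\<^sub>C (x::'e::complex_vector) = r *\<^sub>R (c *\<^sub>C x)"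
  by (simp add: scaleR_conv_of_real flip: scaleC_scaleC scaleC_of_real)

lemma bounded_bilinear_scaleC:
  "bounded_bilinear (\<lambda>c (x::'e::complex_banach). c *\<^sub>C x)"
proof
  show "\<exists>K. \<forall>a (b::'e). norm (a *\<^sub>C b) \<le> norm a * norm b * K"
    by (intro exI[of _ 1]) (simp add: norm_scaleC)
next
  fix r :: real and c :: complex and x :: 'e
  show "c *\<^sub>C r *\<^sub>R x = r *\<^sub>R c *\<^sub>C x"
    by (simp add: scaleC_left_commute flip: scaleC_of_real)
qed (simp_all add: scaleC_add_right scaleC_add_left scaleR_scaleC_left)

lemma scaleC_sum_right: "c *\<^sub>C (\<Sum>k\<in>F. f k) = (\<Sum>k\<in>F. c *\<^sub>C (f k :: 'e::complex_vector))"
  by (induction F rule: infinite_finite_induct) (simp_all add: scaleC_add_right)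

definition test_ball :: "nat \<Rightarrow> (real^'n \<Rightarrow> complex) \<Rightarrow> real \<Rightarrow> (real^'n \<Rightarrow> complex) set" where
  "test_ball N \<phi> \<delta> = {\<psi> \<in> test_functions. test_seminorm N (\<lambda>x. \<psi> x - \<phi> x) < \<delta>}"

definition test_balls :: "(real^'n \<Rightarrow> complex) set set" where
  "test_balls = {test_ball N \<phi> \<delta> | N \<phi> \<delta>. \<phi> \<in> test_functions \<and> \<delta> > 0}"

lemma test_ball_in_balls:
  assumes "\<phi> \<in> test_functions" "\<delta> > 0"
  shows "test_ball N \<phi> \<delta> \<in> test_balls"
  unfolding test_balls_def
proof (rule CollectI)
  show "\<exists>N' \<phi>' \<delta>'. test_ball N \<phi> \<delta> = test_ball N' \<phi>' \<delta>' \<and> \<phi>' \<in> test_functions \<and> \<delta>' > 0"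
    using assms by (intro exI[of _ N] exI[of _ \<phi>] exI[of _ \<delta>]) simp
qed

lemma test_topology_balls: "test_topology = topology_generated_by test_balls"
  by (simp add: test_topology_def test_balls_def test_ball_def)

lemma test_ballI:
  "\<psi> \<in> test_functions \<Longrightarrow> test_seminorm N (\<lambda>x. \<psi> x - \<phi> x) < \<delta> \<Longrightarrow> \<psi> \<in> test_ball N \<phi> \<delta>"
  by (simp add: test_ball_def)

lemma test_ballD:
  assumes "\<psi> \<in> test_ball N \<phi> \<delta>"
  shows "\<psi> \<in> test_functions" "test_seminorm N (\<lambda>x. \<psi> x - \<phi> x) < \<delta>"
  using assms by (simp_all add: test_ball_def)

lemma test_seminorm_triangle:
  assumes "\<phi> \<in> test_functions" "\<psi> \<in> test_functions" "\<eta> \<in> test_functions"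
  shows "test_seminorm N (\<lambda>x. \<phi> x - \<eta> x) \<le>
    test_seminorm N (\<lambda>x. \<phi> x - \<psi> x) + test_seminorm N (\<lambda>x. \<psi> x - \<eta> x)"
  using test_seminorm_linear[OF test_functions_diff[OF assms(1,2)] test_functions_diff[OF assms(2,3)],
      of N 1 1] by simp

lemma test_ball_center:
  assumes "\<phi> \<in> test_functions" "\<delta> > 0" shows "\<phi> \<in> test_ball N \<phi> \<delta>"
  using test_seminorm_linear[OF assms(1) assms(1), of N 0 0] assms by (intro test_ballI) auto

lemma test_ball_inside:
  assumes "\<psi> \<in> test_ball N \<phi> \<delta>" "\<phi> \<in> test_functions"
  shows "\<exists>\<epsilon>>0. test_ball N \<psi> \<epsilon> \<subseteq> test_ball N \<phi> \<delta>"
proof (intro exI conjI)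
  show "0 < \<delta> - test_seminorm N (\<lambda>x. \<psi> x - \<phi> x)" using test_ballD(2)[OF assms(1)] by simp
  show "test_ball N \<psi> (\<delta> - test_seminorm N (\<lambda>x. \<psi> x - \<phi> x)) \<subseteq> test_ball N \<phi> \<delta>"
  proof
    fix \<eta> assume "\<eta> \<in> test_ball N \<psi> (\<delta> - test_seminorm N (\<lambda>x. \<psi> x - \<phi> x))"
    note \<eta> = test_ballD[OF this]
    show "\<eta> \<in> test_ball N \<phi> \<delta>"
      using test_seminorm_triangle[OF \<eta>(1) test_ballD(1)[OF assms(1)] assms(2), of N] \<eta>
      by (intro test_ballI) auto
  qed
qed

lemma test_ball_mono:
  assumes "\<phi> \<in> test_functions" "N \<le> N'" "\<delta>' \<le> \<delta>"
  shows "test_ball N' \<phi> \<delta>' \<subseteq> test_ball N \<phi> \<delta>"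
proof
  fix \<psi> assume "\<psi> \<in> test_ball N' \<phi> \<delta>'"
  note \<psi> = test_ballD[OF this]
  show "\<psi> \<in> test_ball N \<phi> \<delta>"
    using test_seminorm_mono[OF test_functions_diff[OF \<psi>(1) assms(1)] assms(2)] \<psi> assms(3)
    by (intro test_ballI) auto
qed

lemma topspace_test_topology [simp]:
  "topspace (test_topology :: (real^'n \<Rightarrow> complex) topology) = test_functions"
proof -
  have "\<Union> test_balls = (test_functions :: (real^'n \<Rightarrow> complex) set)"
  proof
    show "\<Union> test_balls \<subseteq> (test_functions :: (real^'n \<Rightarrow> complex) set)"
      unfolding test_balls_def using test_ballD(1) by auto
    show "(test_functions :: (real^'n \<Rightarrow> complex) set) \<subseteq> \<Union> test_balls"
    proof
      fix \<phi> :: "real^'n \<Rightarrow> complex" assume \<phi>: "\<phi> \<in> test_functions"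
      then have "test_ball 0 \<phi> 1 \<in> test_balls"
        by (rule test_ball_in_balls[OF _ zero_less_one])
      then show "\<phi> \<in> \<Union> test_balls"
        using test_ball_center[OF \<phi> zero_less_one] by (rule UnionI)
    qed
  qed
  then show ?thesis
    unfolding test_topology_balls topology_generated_by_topspace .
qed

text \<open>The seminorms increase with their order, so a finite intersection of balls contains a single ball
  around each of its points.\<close>

lemma openin_test_topologyD:
  assumes "openin test_topology U" "\<phi> \<in> U"
  shows "\<exists>N \<delta>. \<delta> > 0 \<and> test_ball N \<phi> \<delta> \<subseteq> U"
proof -
  have "generate_topology_on test_balls U"
    using assms(1) by (simp add: test_topology_balls openin_topology_generated_by_iff)
  then show ?thesis
    using assms(2)
  proof (induction arbitrary: \<phi> rule: generate_topology_on.induct)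
    case (Int a b)
    have "openin test_topology a"
      unfolding test_topology_balls openin_topology_generated_by_iff by (rule Int.hyps)
    then have \<phi>: "\<phi> \<in> test_functions"
      using openin_subset Int.prems topspace_test_topology by blast
    obtain N1 d1 where 1: "d1 > 0" "test_ball N1 \<phi> d1 \<subseteq> a" using Int.IH(1) Int.prems by blast
    obtain N2 d2 where 2: "d2 > 0" "test_ball N2 \<phi> d2 \<subseteq> b" using Int.IH(2) Int.prems by blast
    have "test_ball (max N1 N2) \<phi> (min d1 d2) \<subseteq> test_ball N1 \<phi> d1"
      "test_ball (max N1 N2) \<phi> (min d1 d2) \<subseteq> test_ball N2 \<phi> d2"
      by (intro test_ball_mono \<phi>; simp)+
    then have "test_ball (max N1 N2) \<phi> (min d1 d2) \<subseteq> a \<inter> b" using 1(2) 2(2) by blast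
    moreover have "min d1 d2 > 0" using 1 2 by simp
    ultimately show ?case by blast
  next
    case (UN K)
    then show ?case by blast
  next
    case (Basis s)
    then obtain N \<eta> d where "s = test_ball N \<eta> d" "\<eta> \<in> test_functions"
      unfolding test_balls_def by (elim CollectE exE conjE)
    then show ?case using test_ball_inside[of \<phi> N \<eta> d] Basis.prems by blast
  qed simp
qed

lemma openin_test_topologyI:
  assumes "U \<subseteq> test_functions"
    and "\<And>\<phi>. \<phi> \<in> U \<Longrightarrow> \<exists>N \<delta>. \<delta> > 0 \<and> test_ball N \<phi> \<delta> \<subseteq> U"
  shows "openin test_topology U"
proof (subst openin_subopen, intro ballI)
  fix \<phi> assume \<phi>: "\<phi> \<in> U"
  then have \<phi>': "\<phi> \<in> test_functions" using assms(1) by blast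
  obtain N d where d: "d > 0" "test_ball N \<phi> d \<subseteq> U"
    using assms(2)[OF \<phi>] by blast
  have "test_ball N \<phi> d \<in> test_balls"
    by (rule test_ball_in_balls[OF \<phi>' d(1)])
  then have "openin test_topology (test_ball N \<phi> d)"
    unfolding test_topology_balls by (rule topology_generated_by_Basis)
  then show "\<exists>T. openin test_topology T \<and> \<phi> \<in> T \<and> T \<subseteq> U"
    using test_ball_center[OF \<phi>' d(1)] d(2) by blast
qed

lemma pairing_add:
  "\<phi> \<in> test_functions \<Longrightarrow> \<psi> \<in> test_functions \<Longrightarrow>
    pairing u (\<lambda>x. \<phi> x + \<psi> x) = pairing u \<phi> + pairing u \<psi>"
  using pairing[of u] by blast

lemma pairing_mult: "\<phi> \<in> test_functions \<Longrightarrow> pairing u (\<lambda>x. c * \<phi> x) = c *\<^sub>C pairing u \<phi>"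
  using pairing[of u] by blast

lemma pairing_continuous: "continuous_map test_topology euclidean (pairing u)"
  using pairing[of u] by blast

lemma pairing_outside: "\<phi> \<notin> test_functions \<Longrightarrow> pairing u \<phi> = 0"
  using pairing[of u] by blast

text \<open>Continuity at the origin gives a bound on a ball, and homogeneity extends it.\<close>

lemma pairing_bounded:
  fixes u :: "('n::finite, 'e::complex_banach) distribution"
  obtains C N where "C > 0" "\<And>\<phi>. \<phi> \<in> test_functions \<Longrightarrow> norm (pairing u \<phi>) \<le> C * test_seminorm N \<phi>"
proof -
  let ?U = "{\<phi> \<in> test_functions. pairing u \<phi> \<in> ball 0 1}"
  have z: "(\<lambda>x. 0) \<in> test_functions" using test_functions_mult[OF character_test, of 0] by simp
  have z0: "pairing u (\<lambda>x. 0) = 0" using pairing_mult[OF z, of u 0] by simp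
  have "openin test_topology ?U"
    using openin_continuous_map_preimage[OF pairing_continuous[of u], of "ball 0 1"]
    by (simp del: mem_ball mem_ball_0 add: open_ball)
  then obtain N d where d: "d > 0" "test_ball N (\<lambda>x. 0) d \<subseteq> ?U"
    using openin_test_topologyD[of ?U "\<lambda>x. 0"] z z0 by auto
  have "norm (pairing u \<phi>) \<le> 2 / d * test_seminorm N \<phi>" if \<phi>: "\<phi> \<in> test_functions" for \<phi>
  proof (rule field_le_epsilon)
    fix e :: real assume e: "e > 0"
    define s where "s = test_seminorm N \<phi> + d / 2 * e"
    have s: "test_seminorm N \<phi> < s" "s > 0"
      using e d(1) test_seminorm_nonneg[OF \<phi>, of N] by (simp_all add: s_def add_nonneg_pos)
    define c where "c = d / (2 * s)"
    have c: "c > 0" using d(1) s by (simp add: c_def)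
    have "test_seminorm N (\<lambda>x. of_real c * \<phi> x) \<le> c * test_seminorm N \<phi>"
      using test_seminorm_linear[OF \<phi> \<phi>, of N "of_real c" 0] c by simp
    also have "\<dots> \<le> c * s" using s c by simp
    also have "\<dots> < d" using s d(1) by (simp add: c_def)
    finally have "(\<lambda>x. of_real c * \<phi> x) \<in> test_ball N (\<lambda>x. 0) d"
      using test_functions_mult[OF \<phi>] by (intro test_ballI) simp_all
    then have "pairing u (\<lambda>x. of_real c * \<phi> x) \<in> ball 0 1"
      using d(2) by blast
    then have "c * norm (pairing u \<phi>) < 1"
      using c by (simp add: pairing_mult[OF \<phi>] norm_scaleC)
    then have "norm (pairing u \<phi>) < 1 / c" using c by (simp add: field_simps)
    also have "1 / c = 2 / d * test_seminorm N \<phi> + e"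
      using d(1) s by (simp add: c_def s_def field_simps)
    finally show "norm (pairing u \<phi>) \<le> 2 / d * test_seminorm N \<phi> + e" by simp
  qed
  then show thesis using that[of "2 / d" N] d(1) by simp
qed

definition polynomially_bounded :: "(int^'n \<Rightarrow> 'e::real_normed_vector) \<Rightarrow> bool" where
  "polynomially_bounded d \<longleftrightarrow> (\<exists>C\<ge>0. \<exists>N. \<forall>k. norm (d k) \<le> C * (1 + norm (real_vec k)) ^ N)"

lemma fourier_coeff_polynomially_bounded:
  fixes u :: "('n::finite, 'e::complex_banach) distribution"
  shows "polynomially_bounded (fourier_coeff u)"
proof -
  obtain C N where C: "C > 0"
    "\<And>\<phi>. \<phi> \<in> test_functions \<Longrightarrow> norm (pairing u \<phi>) \<le> C * test_seminorm N \<phi>"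
    by (rule pairing_bounded[of u]) (rule that)
  have "norm (fourier_coeff u k) \<le> C * (1 + norm (real_vec k)) ^ N" for k
  proof -
    have "norm (fourier_coeff u k) \<le> C * test_seminorm N (character (- k))"
      unfolding fourier_coeff_def by (rule C(2)[OF character_test])
    also have "\<dots> \<le> C * (1 + norm (real_vec (- k))) ^ N"
      using C(1) by (intro mult_left_mono test_seminorm_character) auto
    finally show ?thesis by simp
  qed
  then show ?thesis using C(1) unfolding polynomially_bounded_def by (intro exI[of _ C]) auto
qed

lemma series_decay:
  fixes d :: "int^'n \<Rightarrow> 'e::complex_banach"
  assumes d: "\<And>k. norm (d k) \<le> C * (1 + norm (real_vec k)) ^ N" and C: "C \<ge> 0"
    and \<phi>: "\<phi> \<in> test_functions"
  shows "(1 + norm (real_vec k)) ^ (2 * CARD('n)) * norm (test_fourier_coeff \<phi> (- k) *\<^sub>C d k) \<le>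
    C * (1 + real CARD('n)) ^ (N + 2 * CARD('n)) * test_seminorm (N + 2 * CARD('n)) \<phi>"
proof -
  let ?w = "1 + norm (real_vec k)" and ?r = "N + 2 * CARD('n)"
  have "?w ^ (2 * CARD('n)) * norm (test_fourier_coeff \<phi> (- k) *\<^sub>C d k) \<le>
      ?w ^ (2 * CARD('n)) * (norm (test_fourier_coeff \<phi> (- k)) * (C * ?w ^ N))"
    unfolding norm_scaleC by (intro mult_left_mono d) auto
  also have "\<dots> = C * (?w ^ ?r * norm (test_fourier_coeff \<phi> (- k)))"
    by (simp add: power_add mult_ac)
  also have "\<dots> \<le> C * ((1 + real CARD('n)) ^ ?r * test_seminorm ?r \<phi>)"
    using test_fourier_coeff_decay[OF \<phi>, of "- k" ?r] C by (intro mult_left_mono) auto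
  finally show ?thesis by (simp add: mult_ac)
qed

lemma series_summable:
  fixes d :: "int^'n \<Rightarrow> 'e::complex_banach"
  assumes d: "polynomially_bounded d" and \<phi>: "\<phi> \<in> test_functions"
  shows "(\<lambda>k. norm (test_fourier_coeff \<phi> (- k) *\<^sub>C d k)) summable_on UNIV"
    "(\<lambda>k. test_fourier_coeff \<phi> (- k) *\<^sub>C d k) summable_on UNIV"
proof -
  obtain C N where C: "C \<ge> 0" "\<And>k. norm (d k) \<le> C * (1 + norm (real_vec k)) ^ N"
    using d unfolding polynomially_bounded_def by blast
  show *: "(\<lambda>k. norm (test_fourier_coeff \<phi> (- k) *\<^sub>C d k)) summable_on UNIV"
    using series_decay[OF C(2,1) \<phi>] by (rule abs_summable_lattice)
  show "(\<lambda>k. test_fourier_coeff \<phi> (- k) *\<^sub>C d k) summable_on UNIV"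
    by (rule abs_summable_summable[OF *])
qed

lemma test_fourier_coeff_add:
  "\<phi> \<in> test_functions \<Longrightarrow> \<psi> \<in> test_functions \<Longrightarrow>
    test_fourier_coeff (\<lambda>x. \<phi> x + \<psi> x) k = test_fourier_coeff \<phi> k + test_fourier_coeff \<psi> k"
  using test_integrable[of \<phi> "- k"] test_integrable[of \<psi> "- k"]
  by (simp add: test_fourier_coeff_def ring_distribs)

lemma test_fourier_coeff_mult:
  "test_fourier_coeff (\<lambda>x. c * \<phi> x) k = c * test_fourier_coeff \<phi> k"
proof -
  have "character (- k) x * (c * \<phi> x) = c * (character (- k) x * \<phi> x)" for x by simp
  then show ?thesis unfolding test_fourier_coeff_def by (simp only: integral_mult_right_zero)
qed

text \<open>The distribution with the Fourier coefficients \<open>d\<close>. The coefficients of test functions decay rapidly,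
  so polynomial growth of \<open>d\<close> makes the series converge and bounds it by a seminorm.\<close>

definition fourier_distribution :: "(int^'n \<Rightarrow> 'e) \<Rightarrow> ('n::finite, 'e::complex_banach) distribution" where
  "fourier_distribution d = Distribution
     (\<lambda>\<phi>. if \<phi> \<in> test_functions then \<Sum>\<^sub>\<infinity>k. test_fourier_coeff \<phi> (- k) *\<^sub>C d k else 0)"

lemma torus_op_fourier_distribution:
  "torus_op a u = fourier_distribution (\<lambda>k. a k (fourier_coeff u k))"
  by (simp add: torus_op_def fourier_distribution_def)

lemma pairing_fourier_distribution:
  fixes d :: "int^'n \<Rightarrow> 'e::complex_banach"
  assumes d: "polynomially_bounded d"
  shows "pairing (fourier_distribution d) \<phi> =
    (if \<phi> \<in> test_functions then \<Sum>\<^sub>\<infinity>k. test_fourier_coeff \<phi> (- k) *\<^sub>C d k else 0)"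
proof -
  define G where "G = (\<lambda>\<phi>. if \<phi> \<in> test_functions
    then \<Sum>\<^sub>\<infinity>k. test_fourier_coeff \<phi> (- k) *\<^sub>C d k else 0)"
  have add: "G (\<lambda>x. \<phi> x + \<psi> x) = G \<phi> + G \<psi>"
    if "\<phi> \<in> test_functions" "\<psi> \<in> test_functions" for \<phi> \<psi>
    using that series_summable(2)[OF d]
    by (simp add: G_def test_functions_add test_fourier_coeff_add scaleC_add_left infsum_add)
  have mult: "G (\<lambda>x. c * \<phi> x) = c *\<^sub>C G \<phi>" if \<phi>: "\<phi> \<in> test_functions" for c \<phi>
  proof -
    have "(\<Sum>\<^sub>\<infinity>k. c *\<^sub>C (test_fourier_coeff \<phi> (- k) *\<^sub>C d k)) =
        c *\<^sub>C (\<Sum>\<^sub>\<infinity>k. test_fourier_coeff \<phi> (- k) *\<^sub>C d k)"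
      by (intro infsumI has_sum_bounded_linear[OF bounded_linear_scaleC] has_sum_infsum
          series_summable(2)[OF d \<phi>])
    then show ?thesis
      using \<phi> by (simp add: G_def test_functions_mult test_fourier_coeff_mult scaleC_scaleC)
  qed
  obtain C N where C: "C \<ge> 0" "\<And>k. norm (d k) \<le> C * (1 + norm (real_vec k)) ^ N"
    using d unfolding polynomially_bounded_def by blast
  let ?r = "N + 2 * CARD('n)"
  let ?W = "\<Sum>\<^sub>\<infinity>k::int^'n. 1 / (1 + norm (real_vec k)) ^ (2 * CARD('n))"
  define K where "K = C * (1 + real CARD('n)) ^ ?r * ?W"
  have W0: "?W \<ge> 0" by (intro infsum_nonneg) auto
  have K: "K \<ge> 0" using C(1) W0 by (simp add: K_def)
  have bound: "norm (G \<phi>) \<le> K * test_seminorm ?r \<phi>" if \<phi>: "\<phi> \<in> test_functions" for \<phi>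
  proof -
    let ?M = "C * (1 + real CARD('n)) ^ ?r * test_seminorm ?r \<phi>"
    have "norm (G \<phi>) \<le> (\<Sum>\<^sub>\<infinity>k. norm (test_fourier_coeff \<phi> (- k) *\<^sub>C d k))"
      using \<phi> norm_infsum_bound[OF series_summable(1)[OF d \<phi>]] by (simp add: G_def)
    also have "\<dots> \<le> (\<Sum>\<^sub>\<infinity>k::int^'n. ?M * (1 / (1 + norm (real_vec k)) ^ (2 * CARD('n))))"
    proof (rule infsum_mono[OF series_summable(1)[OF d \<phi>]])
      show "(\<lambda>k::int^'n. ?M * (1 / (1 + norm (real_vec k)) ^ (2 * CARD('n)))) summable_on UNIV"
        by (intro summable_on_cmult_right summable_lattice_weight)
      fix k :: "int^'n"
      have "0 < (1 + norm (real_vec k)) ^ (2 * CARD('n))"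
        by (intro zero_less_power add_pos_nonneg) auto
      then show "norm (test_fourier_coeff \<phi> (- k) *\<^sub>C d k) \<le>
          ?M * (1 / (1 + norm (real_vec k)) ^ (2 * CARD('n)))"
        using series_decay[OF C(2,1) \<phi>, of k] by (simp add: field_simps)
    qed
    also have "\<dots> = ?M * ?W" by (rule infsum_cmult_right) (rule summable_lattice_weight)
    finally show ?thesis by (simp add: K_def mult_ac)
  qed
  have "continuous_map test_topology euclidean G"
    unfolding continuous_map_def topspace_test_topology
  proof (intro conjI allI impI funcsetI)
    fix U :: "'e set" assume "openin euclidean U"
    then have U: "open U" by simp
    show "openin test_topology {\<phi> \<in> test_functions. G \<phi> \<in> U}"
    proof (rule openin_test_topologyI)
      fix \<phi> assume "\<phi> \<in> {\<phi> \<in> test_functions. G \<phi> \<in> U}"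
      then have \<phi>: "\<phi> \<in> test_functions" and "G \<phi> \<in> U" by auto
      then obtain e where e: "e > 0" "ball (G \<phi>) e \<subseteq> U" using U open_contains_ball by blast
      have "G \<psi> \<in> U" if "\<psi> \<in> test_ball ?r \<phi> (e / (K + 1))" for \<psi>
      proof -
        note \<psi> = test_ballD(1)[OF that] and lt = test_ballD(2)[OF that]
        have dt: "(\<lambda>x. \<psi> x - \<phi> x) \<in> test_functions" by (rule test_functions_diff[OF \<psi> \<phi>])
        have "G \<psi> = G (\<lambda>x. \<psi> x - \<phi> x) + G \<phi>" using add[OF dt \<phi>] by simp
        then have "dist (G \<phi>) (G \<psi>) = norm (G (\<lambda>x. \<psi> x - \<phi> x))"
          by (simp add: dist_norm norm_minus_commute)
        also have "\<dots> \<le> K * test_seminorm ?r (\<lambda>x. \<psi> x - \<phi> x)" by (rule bound[OF dt])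
        also have "\<dots> \<le> (K + 1) * test_seminorm ?r (\<lambda>x. \<psi> x - \<phi> x)"
          using test_seminorm_nonneg[OF dt] by (simp add: mult_right_mono)
        also have "\<dots> < e" using lt K by (simp add: field_simps)
        finally show ?thesis using e(2) by auto
      qed
      moreover have "e / (K + 1) > 0" using e(1) K by simp
      ultimately show "\<exists>N \<delta>. \<delta> > 0 \<and> test_ball N \<phi> \<delta> \<subseteq> {\<phi> \<in> test_functions. G \<phi> \<in> U}"
        using test_ballD(1) by (intro exI[of _ ?r] exI[of _ "e / (K + 1)"] conjI subsetI CollectI)
    qed blast
  qed simp
  then have "G \<in> {u. (\<forall>\<phi>\<in>test_functions. \<forall>\<psi>\<in>test_functions. u (\<lambda>x. \<phi> x + \<psi> x) = u \<phi> + u \<psi>) \<and>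
      (\<forall>c. \<forall>\<phi>\<in>test_functions. u (\<lambda>x. c * \<phi> x) = c *\<^sub>C u \<phi>) \<and>
      continuous_map test_topology euclidean u \<and> (\<forall>\<phi>. \<phi> \<notin> test_functions \<longrightarrow> u \<phi> = 0)}"
    using add mult by (auto simp: G_def)
  from Distribution_inverse[OF this] have "pairing (fourier_distribution d) = G"
    by (simp add: fourier_distribution_def G_def)
  then show ?thesis by (simp add: G_def)
qed

lemma fourier_coeff_fourier_distribution:
  fixes d :: "int^'n \<Rightarrow> 'e::complex_banach"
  assumes d: "polynomially_bounded d"
  shows "fourier_coeff (fourier_distribution d) k = d k"
proof -
  have "fourier_coeff (fourier_distribution d) k =
      (\<Sum>\<^sub>\<infinity>l. test_fourier_coeff (character (- k)) (- l) *\<^sub>C d l)"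
    unfolding fourier_coeff_def by (simp add: pairing_fourier_distribution[OF d] character_test)
  also have "\<dots> = (\<Sum>\<^sub>\<infinity>l\<in>{k}. d l)"
    by (rule infsum_cong_neutral) (auto simp: test_fourier_coeff_character scaleC_one)
  finally show ?thesis by simp
qed

lemma pairing_sum_characters:
  "pairing u (\<lambda>x. \<Sum>k\<in>F. c k * character k x) = (\<Sum>k\<in>F. c k *\<^sub>C fourier_coeff u (- k))"
proof (induction F rule: infinite_finite_induct)
  case (insert k F)
  then show ?case
    by (simp add: pairing_add[OF test_functions_mult[OF character_test] test_functions_sum_characters]
        pairing_mult[OF character_test] fourier_coeff_def)
next
  case (infinite A)
  then show ?case using pairing_mult[OF character_test, of u 0] by simp
next
  case empty
  then show ?case using pairing_mult[OF character_test, of u 0] by simp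
qed

text \<open>A distribution is the sum of its Fourier series, because the Fourier series of a test function
  converges in all seminorms.\<close>

lemma pairing_fourier_series:
  fixes u :: "('n::finite, 'e::complex_banach) distribution"
  assumes \<phi>: "\<phi> \<in> test_functions"
  shows "pairing u \<phi> = (\<Sum>\<^sub>\<infinity>k. test_fourier_coeff \<phi> (- k) *\<^sub>C fourier_coeff u k)"
proof -
  obtain C N where C: "C > 0"
    "\<And>\<phi>. \<phi> \<in> test_functions \<Longrightarrow> norm (pairing u \<phi>) \<le> C * test_seminorm N \<phi>"
    by (rule pairing_bounded[of u]) (rule that)
  let ?f = "\<lambda>k. test_fourier_coeff \<phi> k *\<^sub>C fourier_coeff u (- k)"
  have "((\<lambda>k. test_fourier_coeff \<phi> k *\<^sub>C fourier_coeff u (- k)) has_sum pairing u \<phi>) UNIV"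
    unfolding has_sum_def
  proof (rule tendstoI)
    fix e :: real assume e: "e > 0"
    have e': "e / (2 * C) > 0" using e C by simp
    obtain F0 where F0: "finite F0" "\<And>F. finite F \<Longrightarrow> F0 \<subseteq> F \<Longrightarrow>
        test_seminorm N (\<lambda>x. \<phi> x - (\<Sum>k\<in>F. test_fourier_coeff \<phi> k * character k x)) \<le> e / (2 * C)"
      by (rule fourier_series_seminorm[OF \<phi> e', of N]) (rule that)
    show "\<forall>\<^sub>F F in finite_subsets_at_top UNIV. dist (sum ?f F) (pairing u \<phi>) < e"
      unfolding eventually_finite_subsets_at_top
    proof (intro exI[of _ F0] conjI allI impI)
      fix F assume F: "finite F \<and> F0 \<subseteq> F \<and> F \<subseteq> UNIV"
      let ?P = "\<lambda>x. \<Sum>k\<in>F. test_fourier_coeff \<phi> k * character k x"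
      have P: "?P \<in> test_functions" by (rule test_functions_sum_characters)
      have d: "(\<lambda>x. \<phi> x - ?P x) \<in> test_functions" by (rule test_functions_diff[OF \<phi> P])
      have "pairing u \<phi> - sum ?f F = pairing u (\<lambda>x. \<phi> x - ?P x)"
        using pairing_add[OF d P, of u] by (simp add: pairing_sum_characters)
      also have "norm \<dots> \<le> C * test_seminorm N (\<lambda>x. \<phi> x - ?P x)" by (rule C(2)[OF d])
      also have "\<dots> \<le> C * (e / (2 * C))" using F F0(2)[of F] C(1) by (intro mult_left_mono) auto
      also have "\<dots> < e" using C(1) e by (simp add: field_simps)
      finally show "dist (sum ?f F) (pairing u \<phi>) < e" by (simp add: dist_norm norm_minus_commute)
    qed (use F0 in auto)
  qed
  then have "pairing u \<phi> = infsum ?f UNIV" by (simp add: infsumI)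
  also have "\<dots> = (\<Sum>\<^sub>\<infinity>k. ?f (- k))"
    by (rule infsum_reindex_bij_betw[symmetric]) (rule bij_uminus)
  finally show ?thesis by simp
qed

lemma distribution_eqI:
  fixes u v :: "('n::finite, 'e::complex_banach) distribution"
  assumes "\<And>k. fourier_coeff u k = fourier_coeff v k"
  shows "u = v"
proof -
  have "pairing u \<phi> = pairing v \<phi>" for \<phi>
    by (cases "\<phi> \<in> test_functions") (simp_all add: pairing_fourier_series assms pairing_outside)
  then show ?thesis by (metis pairing_inject ext)
qed

lemma fourier_coeff_linear [simp]:
  fixes u v :: "('n::finite, 'e::complex_banach) distribution"
  shows "fourier_coeff 0 k = (0 :: 'e)" "fourier_coeff (u + v) k = fourier_coeff u k + fourier_coeff v k"
    "fourier_coeff (- u) k = - fourier_coeff u k"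
    "fourier_coeff (u - v) k = fourier_coeff u k - fourier_coeff v k"
    "fourier_coeff (c *\<^sub>C u) k = c *\<^sub>C fourier_coeff u k"
  by (simp_all add: fourier_coeff_def zero_distribution.rep_eq plus_distribution.rep_eq
      uminus_distribution.rep_eq minus_distribution.rep_eq scaleC_distribution.rep_eq)

text \<open>Polynomial growth of the operator norm in the frequency, under which \<open>torus_op a\<close> is given by
  convergent series.\<close>

definition tempered :: "(int^'n \<Rightarrow> 'e \<Rightarrow> 'e::complex_banach) \<Rightarrow> bool" where
  "tempered a \<longleftrightarrow> (\<exists>C\<ge>0. \<exists>N. \<forall>k x. norm (a k x) \<le> C * (1 + norm (real_vec k)) ^ N * norm x)"

lemma tempered_polynomially_bounded:
  fixes d :: "int^'n \<Rightarrow> 'e::complex_banach"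
  assumes "tempered a" and "polynomially_bounded d"
  shows "polynomially_bounded (\<lambda>k. a k (d k))"
proof -
  obtain C N where C: "C \<ge> 0" "\<And>k x. norm (a k x) \<le> C * (1 + norm (real_vec k)) ^ N * norm x"
    using assms(1) unfolding tempered_def by blast
  obtain B M where B: "B \<ge> 0" "\<And>k. norm (d k) \<le> B * (1 + norm (real_vec k)) ^ M"
    using assms(2) unfolding polynomially_bounded_def by blast
  have "norm (a k (d k)) \<le> (C * B) * (1 + norm (real_vec k)) ^ (N + M)" for k
  proof -
    have "norm (a k (d k)) \<le> C * (1 + norm (real_vec k)) ^ N * norm (d k)" by (rule C(2))
    also have "\<dots> \<le> C * (1 + norm (real_vec k)) ^ N * (B * (1 + norm (real_vec k)) ^ M)"
      using C(1) by (intro mult_left_mono B(2)) auto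
    finally show ?thesis by (simp add: power_add mult_ac)
  qed
  then show ?thesis
    unfolding polynomially_bounded_def using B(1) C(1) by (intro exI[of _ "C * B"]) auto
qed

lemma pairing_torus_op:
  fixes u :: "('n::finite, 'e::complex_banach) distribution"
  assumes "tempered a" and "\<phi> \<in> test_functions"
  shows "pairing (torus_op a u) \<phi> = (\<Sum>\<^sub>\<infinity>k. test_fourier_coeff \<phi> (- k) *\<^sub>C a k (fourier_coeff u k))"
  using tempered_polynomially_bounded[OF assms(1) fourier_coeff_polynomially_bounded[of u]] assms(2)
  by (simp add: torus_op_fourier_distribution pairing_fourier_distribution)

lemma fourier_coeff_torus_op:
  fixes u :: "('n::finite, 'e::complex_banach) distribution"
  assumes "tempered a"
  shows "fourier_coeff (torus_op a u) k = a k (fourier_coeff u k)"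
  using tempered_polynomially_bounded[OF assms(1) fourier_coeff_polynomially_bounded[of u]]
  by (simp add: torus_op_fourier_distribution fourier_coeff_fourier_distribution)

section \<open>Lebesgue norms and Young's inequality\<close>

lemma ennreal_powr_ennreal [simp]: "0 \<le> t \<Longrightarrow> ennreal_powr (ennreal t) r = ennreal (t powr r)"
  by (simp add: ennreal_powr_def)

lemma ennreal_powr_top [simp]: "ennreal_powr top r = top"
  by (simp add: ennreal_powr_def)

lemma ennreal_powr_mono:
  assumes "x \<le> y" "0 < r" shows "ennreal_powr x r \<le> ennreal_powr y r"
proof (cases "y = top")
  case False
  then have "x < top" "y < top" using assms(1) by (auto simp: less_top order_le_less_trans)
  then show ?thesis
    using assms by (cases x; cases y) (auto intro!: ennreal_leI powr_mono2)
qed simp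

lemma ennreal_powr_powr:
  assumes "0 < r" "0 < s" shows "ennreal_powr (ennreal_powr x r) s = ennreal_powr x (r * s)"
  by (cases x) (simp_all add: powr_powr)

lemma ennreal_powr_one [simp]: "ennreal_powr x 1 = x"
  by (cases x) simp_all

lemma ennreal_powr_mult:
  assumes "0 \<le> c" "0 < r"
  shows "ennreal_powr (ennreal c * x) r = ennreal (c powr r) * ennreal_powr x r"
proof (cases "c = 0")
  case True
  then show ?thesis using assms(2) ennreal_powr_ennreal[of 0 r] by simp
next
  case False
  then show ?thesis using assms
    by (cases x) (simp_all add: ennreal_mult[symmetric] powr_mult ennreal_mult_top)
qed

lemma ennreal_powr_le_iff:
  assumes "0 < r" shows "ennreal_powr x (1 / r) \<le> y \<longleftrightarrow> x \<le> ennreal_powr y r"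
proof
  assume "ennreal_powr x (1 / r) \<le> y"
  from ennreal_powr_mono[OF this assms] show "x \<le> ennreal_powr y r"
    using assms by (simp add: ennreal_powr_powr)
next
  assume "x \<le> ennreal_powr y r"
  from ennreal_powr_mono[OF this, of "1 / r"] show "ennreal_powr x (1 / r) \<le> y"
    using assms by (simp add: ennreal_powr_powr)
qed

lemma ennreal_powr_add_le:
  assumes "0 < r"
  shows "ennreal_powr (x + y) r \<le> ennreal (2 powr r) * (ennreal_powr x r + ennreal_powr y r)"
proof -
  have "x + y \<le> ennreal 2 * max x y"
    using add_mono[OF max.cobounded1[of x y] max.cobounded2[of y x]] by (simp add: mult_2)
  from ennreal_powr_mono[OF this assms]
  have "ennreal_powr (x + y) r \<le> ennreal (2 powr r) * ennreal_powr (max x y) r"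
    using assms by (simp only: ennreal_powr_mult)
  also have "ennreal_powr (max x y) r \<le> ennreal_powr x r + ennreal_powr y r"
    by (simp add: max_def)
  finally show ?thesis by (simp add: mult_left_mono)
qed

lemma ennreal_powr_measurable [measurable]:
  assumes [measurable]: "f \<in> borel_measurable M"
  shows "(\<lambda>x. ennreal_powr (f x) r) \<in> borel_measurable M"
  unfolding ennreal_powr_def by measurable

lemma Lebesgue_norm_top_le_iff: "Lebesgue_norm top M g \<le> C \<longleftrightarrow> (AE x in M. g x \<le> C)"
proof
  assume "AE x in M. g x \<le> C"
  then show "Lebesgue_norm top M g \<le> C" by (simp add: Lebesgue_norm_def Inf_lower)
next
  let ?I = "Lebesgue_norm top M g"
  assume C: "?I \<le> C"
  have "AE x in M. g x \<le> ?I"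
  proof (cases "?I = top")
    case False
    have "AE x in M. g x \<le> ?I + ennreal (1 / Suc n)" for n
    proof -
      have "?I < ?I + ennreal (1 / Suc n)"
        using False by (simp add: ennreal_add_left_cancel_less less_top)
      then obtain D where "AE x in M. g x \<le> D" "D < ?I + ennreal (1 / Suc n)"
        unfolding Lebesgue_norm_def by (auto simp: Inf_less_iff)
      then show ?thesis by (auto elim!: eventually_mono intro: order_trans less_imp_le)
    qed
    then have "AE x in M. \<forall>n. g x \<le> ?I + ennreal (1 / Suc n)" by (simp add: AE_all_countable)
    then show ?thesis
    proof eventually_elim
      case (elim x)
      show ?case
      proof (rule ennreal_le_epsilon)
        fix e :: real assume "e > 0"
        then obtain n where "1 / real (Suc n) < e" using nat_approx_posE by blast
        then have "?I + ennreal (1 / Suc n) \<le> ?I + ennreal e"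
          by (intro add_left_mono ennreal_leI) simp
        then show "g x \<le> ?I + ennreal e" using elim order_trans by blast
      qed
    qed
  qed simp
  then show "AE x in M. g x \<le> C" using C by (auto elim!: eventually_mono intro: order_trans)
qed

lemma exponent_cases:
  assumes "1 \<le> (p::ennreal)"
  obtains "p = top" | r where "p = ennreal r" "1 \<le> r"
  using assms by (cases p) (auto simp: top_unique)

lemma Lebesgue_norm_le_iff:
  assumes "1 \<le> r"
  shows "Lebesgue_norm (ennreal r) M g \<le> C \<longleftrightarrow> (\<integral>\<^sup>+x. ennreal_powr (g x) r \<partial>M) \<le> ennreal_powr C r"
  using assms ennreal_powr_le_iff[of r] by (simp add: Lebesgue_norm_def)

lemma Lebesgue_norm_mono_AE:
  assumes p: "1 \<le> p" and le: "AE x in M. f x \<le> g x"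
  shows "Lebesgue_norm p M f \<le> Lebesgue_norm p M g"
  using p
proof (cases rule: exponent_cases)
  case 1
  have "AE x in M. g x \<le> Lebesgue_norm p M g"
    using Lebesgue_norm_top_le_iff[of M g] 1 by blast
  with le have "AE x in M. f x \<le> Lebesgue_norm p M g" by eventually_elim (rule order_trans)
  then show ?thesis using 1 Lebesgue_norm_top_le_iff by blast
next
  case (2 r)
  have "(\<integral>\<^sup>+x. ennreal_powr (f x) r \<partial>M) \<le> (\<integral>\<^sup>+x. ennreal_powr (g x) r \<partial>M)"
  proof (rule nn_integral_mono_AE)
    show "AE x in M. ennreal_powr (f x) r \<le> ennreal_powr (g x) r"
      using le by eventually_elim (use 2 in \<open>auto intro: ennreal_powr_mono\<close>)
  qed
  also have "\<dots> \<le> ennreal_powr (Lebesgue_norm p M g) r"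
    using Lebesgue_norm_le_iff[of r M g] 2 by blast
  finally show ?thesis using Lebesgue_norm_le_iff[of r M f] 2 by blast
qed

lemma Lebesgue_norm_cong_AE:
  assumes "1 \<le> p" and "AE x in M. f x = g x"
  shows "Lebesgue_norm p M f = Lebesgue_norm p M g"
  using assms by (intro antisym Lebesgue_norm_mono_AE) (auto elim: eventually_mono)

lemma Lebesgue_norm_cmult:
  assumes p: "1 \<le> p" and c: "0 \<le> c" and [measurable]: "f \<in> borel_measurable M"
  shows "Lebesgue_norm p M (\<lambda>x. ennreal c * f x) \<le> ennreal c * Lebesgue_norm p M f"
  using p
proof (cases rule: exponent_cases)
  case 1
  have "AE x in M. f x \<le> Lebesgue_norm p M f"
    using Lebesgue_norm_top_le_iff[of M f] 1 by blast
  then have "AE x in M. ennreal c * f x \<le> ennreal c * Lebesgue_norm p M f"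
    by eventually_elim (rule mult_left_mono, auto)
  then show ?thesis using 1 Lebesgue_norm_top_le_iff by blast
next
  case (2 r)
  have "(\<integral>\<^sup>+x. ennreal_powr (ennreal c * f x) r \<partial>M) =
      ennreal (c powr r) * (\<integral>\<^sup>+x. ennreal_powr (f x) r \<partial>M)"
    using 2 c by (simp add: ennreal_powr_mult nn_integral_cmult)
  also have "\<dots> \<le> ennreal (c powr r) * ennreal_powr (Lebesgue_norm p M f) r"
    using Lebesgue_norm_le_iff[of r M f] 2 by (intro mult_left_mono) auto
  also have "\<dots> = ennreal_powr (ennreal c * Lebesgue_norm p M f) r"
    using 2 c by (simp add: ennreal_powr_mult)
  finally show ?thesis using Lebesgue_norm_le_iff[of r M] 2 by blast
qed

text \<open>Minkowski's inequality with a crude constant, which follows from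
  \<open>(x + y) ^ r \<le> 2 ^ r * (x ^ r + y ^ r)\<close>. The constants only enter bounds of operators.\<close>

lemma Lebesgue_norm_add:
  assumes p: "1 \<le> p" and [measurable]: "f \<in> borel_measurable M" "g \<in> borel_measurable M"
  shows "Lebesgue_norm p M (\<lambda>x. f x + g x) \<le> 4 * (Lebesgue_norm p M f + Lebesgue_norm p M g)"
  using p
proof (cases rule: exponent_cases)
  case 1
  have "AE x in M. f x \<le> Lebesgue_norm p M f" "AE x in M. g x \<le> Lebesgue_norm p M g"
    using Lebesgue_norm_top_le_iff[of M f] Lebesgue_norm_top_le_iff[of M g] 1 by blast+
  then have "AE x in M. f x + g x \<le> 4 * (Lebesgue_norm p M f + Lebesgue_norm p M g)"
  proof eventually_elim
    case (elim x)
    then have "f x + g x \<le> 1 * (Lebesgue_norm p M f + Lebesgue_norm p M g)" by (simp add: add_mono)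
    also have "\<dots> \<le> 4 * (Lebesgue_norm p M f + Lebesgue_norm p M g)" by (intro mult_right_mono) auto
    finally show ?case .
  qed
  then show ?thesis using 1 Lebesgue_norm_top_le_iff by blast
next
  case (2 r)
  let ?A = "Lebesgue_norm p M f" and ?B = "Lebesgue_norm p M g"
  let ?P = "\<lambda>x. ennreal_powr x r"
  have "(\<integral>\<^sup>+x. ?P (f x + g x) \<partial>M) \<le> (\<integral>\<^sup>+x. ennreal (2 powr r) * (?P (f x) + ?P (g x)) \<partial>M)"
    using 2 by (intro nn_integral_mono ennreal_powr_add_le) simp
  also have "\<dots> = ennreal (2 powr r) * ((\<integral>\<^sup>+x. ?P (f x) \<partial>M) + (\<integral>\<^sup>+x. ?P (g x) \<partial>M))"
    by (simp add: nn_integral_cmult nn_integral_add)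
  also have "\<dots> \<le> ennreal (2 powr r) * (?P ?A + ?P ?B)"
    using Lebesgue_norm_le_iff[of r M f ?A] Lebesgue_norm_le_iff[of r M g ?B] 2
    by (intro mult_left_mono add_mono) auto
  also have "?P ?A + ?P ?B \<le> ?P (?A + ?B) + ?P (?A + ?B)"
    using 2 by (intro add_mono ennreal_powr_mono) auto
  also have "\<dots> = ennreal 2 * ?P (?A + ?B)" by (simp add: mult_2)
  also have "\<dots> \<le> ennreal (2 powr r) * ?P (?A + ?B)"
    using 2 powr_mono[of 1 r 2] by (intro mult_right_mono ennreal_leI) auto
  also have "ennreal (2 powr r) * (ennreal (2 powr r) * ?P (?A + ?B)) = ?P (4 * (?A + ?B))"
  proof -
    have "?P (ennreal 4 * (?A + ?B)) = ennreal (4 powr r) * ?P (?A + ?B)"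
      using 2 by (intro ennreal_powr_mult) auto
    moreover have "(4::real) powr r = 2 powr r * 2 powr r"
      by (simp flip: powr_mult)
    ultimately show ?thesis by (simp add: ennreal_mult mult.assoc)
  qed
  finally show ?thesis using Lebesgue_norm_le_iff[of r M] 2 by (simp add: mult_left_mono)
qed

text \<open>Jensen's inequality up to a constant. It follows from the elementary bound
  \<open>t \<le> u powr (1 - r) * t powr r + u\<close>, which distinguishes \<open>t \<le> u\<close> from \<open>t > u\<close>, with the choice of
  \<open>u\<close> that balances the integrals of both terms.\<close>

lemma nn_integral_powr_le:
  fixes k G :: "'a \<Rightarrow> ennreal"
  assumes [measurable]: "k \<in> borel_measurable M" "G \<in> borel_measurable M"
    and k: "(\<integral>\<^sup>+y. k y \<partial>M) \<le> ennreal B" and B: "B > 0" and r: "1 \<le> r"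
  shows "ennreal_powr (\<integral>\<^sup>+y. k y * G y \<partial>M) r \<le>
    ennreal (2 powr r * B powr (r - 1)) * (\<integral>\<^sup>+y. k y * ennreal_powr (G y) r \<partial>M)"
proof -
  let ?I = "\<integral>\<^sup>+y. k y * G y \<partial>M" and ?J = "\<integral>\<^sup>+y. k y * ennreal_powr (G y) r \<partial>M"
  have u: "?I \<le> ennreal (u powr (1 - r)) * ?J + ennreal (u * B)" if u: "u > 0" for u
  proof -
    have pw: "t \<le> ennreal (u powr (1 - r)) * ennreal_powr t r + ennreal u" for t :: ennreal
    proof (cases t)
      case (real s)
      have "s \<le> u powr (1 - r) * s powr r + u"
      proof (cases "s \<le> u")
        case False
        then have "u powr (r - 1) \<le> s powr (r - 1)" using r u by (intro powr_mono2) auto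
        then have "u powr (1 - r) * u powr (r - 1) * s \<le> u powr (1 - r) * s powr (r - 1) * s"
          using False u by (intro mult_right_mono mult_left_mono) auto
        moreover have "u powr (1 - r) * u powr (r - 1) = 1" using u by (simp flip: powr_add)
        moreover have "s powr (r - 1) * s = s powr r" using False u by (simp add: powr_diff)
        ultimately show ?thesis using u by (simp add: mult.assoc)
      qed (use u in \<open>simp add: add_increasing\<close>)
      then show ?thesis using real u by (simp flip: ennreal_mult ennreal_plus add: ennreal_leI)
    qed (use u in \<open>simp add: ennreal_mult_top\<close>)
    have "?I \<le> (\<integral>\<^sup>+y. k y * (ennreal (u powr (1 - r)) * ennreal_powr (G y) r + ennreal u) \<partial>M)"
      by (intro nn_integral_mono mult_left_mono pw) auto
    also have "\<dots> = (\<integral>\<^sup>+y. ennreal (u powr (1 - r)) * (k y * ennreal_powr (G y) r) + ennreal u * k y \<partial>M)"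
      by (simp add: distrib_left mult_ac)
    also have "\<dots> = ennreal (u powr (1 - r)) * ?J + ennreal u * (\<integral>\<^sup>+y. k y \<partial>M)"
      by (simp add: nn_integral_add nn_integral_cmult)
    also have "\<dots> \<le> ennreal (u powr (1 - r)) * ?J + ennreal u * ennreal B"
      by (intro add_left_mono mult_left_mono k) auto
    finally show ?thesis using u B by (simp add: ennreal_mult)
  qed
  show ?thesis
  proof (cases ?J)
    case top
    then show ?thesis using B by (simp add: ennreal_mult_top)
  next
    case (real j)
    show ?thesis
    proof (cases "j = 0")
      case True
      have "?I \<le> 0"
      proof (rule ennreal_le_epsilon)
        fix e :: real assume "e > 0"
        then show "?I \<le> 0 + ennreal e" using u[of "e / B"] B real True by simp
      qed
      then show ?thesis using ennreal_powr_ennreal[of 0 r] by simp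
    next
      case False
      then have j: "j > 0" using real by simp
      define u where "u = (j / B) powr (1 / r)"
      have u0: "u > 0" using j B by (simp add: u_def)
      have ur: "u powr r = j / B" using j B r by (simp add: u_def powr_powr)
      have "u powr (1 - r) * j = u * B"
        using j B u0 ur by (simp add: powr_diff field_simps)
      then have "?I \<le> ennreal (2 * (u * B))"
        using u[OF u0] real u0 B by (simp flip: ennreal_mult ennreal_plus add: mult.commute)
      then have "ennreal_powr ?I r \<le> ennreal ((2 * (u * B)) powr r)"
        using ennreal_powr_mono[of ?I "ennreal (2 * (u * B))" r] r u0 B by simp
      also have "(2 * (u * B)) powr r = 2 powr r * B powr (r - 1) * j"
        using u0 B ur by (simp add: powr_mult powr_diff field_simps)
      finally show ?thesis using real by (simp add: ennreal_mult)
    qed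
  qed
qed

text \<open>Young's inequality. The kernel \<open>\<kappa> (x - y)\<close> has mass at most \<open>B\<close> in each variable. For finite
  exponents, Jensen's inequality in \<open>y\<close> and an interchange of the integrals use this once for
  each variable. The function \<open>H\<close> stands for the norm of a vector-valued convolution, which the
  scalar one dominates.\<close>

lemma Lebesgue_norm_convolution:
  fixes \<kappa> :: "real^'n \<Rightarrow> real" and G H :: "real^'n \<Rightarrow> ennreal"
  assumes p: "1 \<le> p" and [measurable]: "\<kappa> \<in> borel_measurable borel" "G \<in> borel_measurable borel"
    and \<kappa>: "periodic \<kappa>" "\<And>x. \<kappa> (- x) = \<kappa> x" "(\<integral>\<^sup>+x. \<kappa> x \<partial>torus_measure) \<le> ennreal B" "B > 0"
    and H: "\<And>x. H x \<le> (\<integral>\<^sup>+y. ennreal (\<kappa> (x - y)) * G y \<partial>torus_measure)"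
  shows "Lebesgue_norm p torus_measure H \<le> ennreal (2 * B) * Lebesgue_norm p torus_measure G"
proof -
  let ?T = "torus_measure :: (real^'n) measure"
  have mass: "(\<integral>\<^sup>+x. \<kappa> (x - y) \<partial>?T) \<le> ennreal B" for y
    using nn_integral_torus_translate[of "\<lambda>x. ennreal (\<kappa> x)" "- y"] \<kappa>
    by (simp add: periodic_compose[of \<kappa>])
  have mass': "(\<integral>\<^sup>+y. \<kappa> (x - y) \<partial>?T) \<le> ennreal B" for x
    using mass[of x] \<kappa>(2)[of "x - y" for y] by simp
  show ?thesis
    using p
  proof (cases rule: exponent_cases)
    case 1
    let ?C = "Lebesgue_norm p ?T G"
    have G: "AE y in ?T. G y \<le> ?C" using Lebesgue_norm_top_le_iff[of ?T G] 1 by blast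
    have "H x \<le> ennreal (2 * B) * ?C" for x
    proof -
      have "H x \<le> (\<integral>\<^sup>+y. ennreal (\<kappa> (x - y)) * G y \<partial>?T)" by (rule H)
      also have "\<dots> \<le> (\<integral>\<^sup>+y. ennreal (\<kappa> (x - y)) * ?C \<partial>?T)"
        by (intro nn_integral_mono_AE) (use G in \<open>auto elim!: eventually_mono intro: mult_left_mono\<close>)
      also have "\<dots> = (\<integral>\<^sup>+y. \<kappa> (x - y) \<partial>?T) * ?C" by (intro nn_integral_multc) simp
      also have "\<dots> \<le> ennreal B * ?C" by (intro mult_right_mono mass') simp
      also have "\<dots> \<le> ennreal (2 * B) * ?C" using \<kappa>(4) by (intro mult_right_mono ennreal_leI) auto
      finally show ?thesis .
    qed
    then show ?thesis using 1 Lebesgue_norm_top_le_iff[of ?T H] by simp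
  next
    case (2 r)
    let ?P = "\<lambda>x. ennreal_powr x r" and ?A = "Lebesgue_norm p ?T G"
    let ?c = "2 powr r * B powr (r - 1)"
    interpret pair_sigma_finite ?T ?T ..
    have "(\<integral>\<^sup>+x. ?P (H x) \<partial>?T) \<le> (\<integral>\<^sup>+x. ?P (\<integral>\<^sup>+y. ennreal (\<kappa> (x - y)) * G y \<partial>?T) \<partial>?T)"
      using 2 by (intro nn_integral_mono ennreal_powr_mono H) auto
    also have "\<dots> \<le> (\<integral>\<^sup>+x. ennreal ?c * (\<integral>\<^sup>+y. ennreal (\<kappa> (x - y)) * ?P (G y) \<partial>?T) \<partial>?T)"
      using 2 mass' \<kappa>(4) by (intro nn_integral_mono nn_integral_powr_le) auto
    also have "\<dots> = ennreal ?c * (\<integral>\<^sup>+x. (\<integral>\<^sup>+y. ennreal (\<kappa> (x - y)) * ?P (G y) \<partial>?T) \<partial>?T)"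
      by (intro nn_integral_cmult) measurable
    also have "(\<integral>\<^sup>+x. (\<integral>\<^sup>+y. ennreal (\<kappa> (x - y)) * ?P (G y) \<partial>?T) \<partial>?T) =
        (\<integral>\<^sup>+y. (\<integral>\<^sup>+x. ennreal (\<kappa> (x - y)) * ?P (G y) \<partial>?T) \<partial>?T)"
      by (rule Fubini'[symmetric]) measurable
    also have "\<dots> = (\<integral>\<^sup>+y. (\<integral>\<^sup>+x. \<kappa> (x - y) \<partial>?T) * ?P (G y) \<partial>?T)"
      by (intro nn_integral_cong nn_integral_multc) simp
    also have "\<dots> \<le> (\<integral>\<^sup>+y. ennreal B * ?P (G y) \<partial>?T)"
      by (intro nn_integral_mono mult_right_mono mass) auto
    also have "\<dots> = ennreal B * (\<integral>\<^sup>+y. ?P (G y) \<partial>?T)" by (intro nn_integral_cmult) simp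
    also have "\<dots> \<le> ennreal B * ?P ?A"
      using Lebesgue_norm_le_iff[of r ?T G ?A] 2 by (intro mult_left_mono) auto
    also have "ennreal ?c * (ennreal B * ?P ?A) = ?P (ennreal (2 * B) * ?A)"
    proof -
      have "?P (ennreal (2 * B) * ?A) = ennreal ((2 * B) powr r) * ?P ?A"
        using 2 \<kappa>(4) by (intro ennreal_powr_mult) auto
      moreover have "(2 * B) powr r = ?c * B"
        using \<kappa>(4) by (simp add: powr_mult powr_diff)
      ultimately show ?thesis using \<kappa>(4) by (simp add: ennreal_mult mult.assoc)
    qed
    finally have "(\<integral>\<^sup>+x. ?P (H x) \<partial>?T) \<le> ?P (ennreal (2 * B) * ?A)" by (simp add: mult_left_mono)
    then show ?thesis using Lebesgue_norm_le_iff[of r ?T H] 2 by blast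
  qed
qed

subsection \<open>Functions representing a distribution\<close>

lemma torus_Lp_measurable: "f \<in> torus_Lp p \<Longrightarrow> strongly_measurable torus_measure f"
  by (simp add: torus_Lp_def)

lemma torus_Lp_integrable:
  fixes f :: "real^'n \<Rightarrow> 'e::banach"
  assumes p: "1 \<le> p" and f: "f \<in> torus_Lp p"
  shows "(\<integral>\<^sup>+x. norm (f x) \<partial>torus_measure) < \<infinity>"
proof -
  let ?T = "torus_measure :: (real^'n) measure"
  have fin: "Lebesgue_norm p ?T (\<lambda>x. ennreal (norm (f x))) < \<infinity>"
    using f by (simp add: torus_Lp_def torus_norm_def)
  obtain h where h: "h \<in> borel_measurable ?T" "AE x in ?T. norm (f x) = h x" "\<And>x. 0 \<le> h x"
    by (rule strongly_measurable_norm[OF torus_Lp_measurable[OF f]]) (rule that)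
  have fin': "Lebesgue_norm p ?T (\<lambda>x. ennreal (h x)) < \<infinity>"
  proof -
    have "AE x in ?T. ennreal (norm (f x)) = ennreal (h x)"
      using h(2) by eventually_elim simp
    from Lebesgue_norm_cong_AE[OF p this] show ?thesis using fin by simp
  qed
  have "(\<integral>\<^sup>+x. h x \<partial>?T) < \<infinity>"
    using p
  proof (cases rule: exponent_cases)
    case 1
    let ?C = "Lebesgue_norm p ?T (\<lambda>x. ennreal (h x))"
    have "AE x in ?T. ennreal (h x) \<le> ?C" using Lebesgue_norm_top_le_iff[of ?T "\<lambda>x. ennreal (h x)"] 1 by blast
    then have "(\<integral>\<^sup>+x. h x \<partial>?T) \<le> (\<integral>\<^sup>+(x::real^'n). ?C \<partial>?T)" by (rule nn_integral_mono_AE)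
    also have "\<dots> = ?C" by (simp add: prob_space_torus)
    finally show ?thesis using fin' by simp
  next
    case (2 r)
    let ?C = "Lebesgue_norm p ?T (\<lambda>x. ennreal (h x))"
    have "ennreal (h x) \<le> ennreal_powr (ennreal (h x)) r + 1" for x
    proof (cases "h x \<le> 1")
      case True
      then have "ennreal (h x) \<le> 1" using h(3) by (simp add: ennreal_le_1)
      then show ?thesis using add_increasing[of "ennreal_powr (ennreal (h x)) r"] by simp
    next
      case False
      then have "h x powr 1 \<le> h x powr r" using 2 by (intro powr_mono) auto
      then have "ennreal (h x) \<le> ennreal_powr (ennreal (h x)) r" using h(3) by (simp add: ennreal_leI)
      then show ?thesis using add_increasing2[of 1 "ennreal (h x)"] by simp
    qed
    then have "(\<integral>\<^sup>+x. h x \<partial>?T) \<le> (\<integral>\<^sup>+x. ennreal_powr (ennreal (h x)) r + 1 \<partial>?T)"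
      by (intro nn_integral_mono)
    also have "\<dots> = (\<integral>\<^sup>+x. ennreal_powr (ennreal (h x)) r \<partial>?T) + 1"
      using h(1) by (subst nn_integral_add) (auto simp: prob_space_torus)
    also have "\<dots> \<le> ennreal_powr ?C r + 1"
      using Lebesgue_norm_le_iff[of r ?T "\<lambda>x. ennreal (h x)" ?C] 2 by (intro add_right_mono) auto
    also have "\<dots> < \<infinity>"
      using fin' by (cases ?C) (auto simp: less_top)
    finally show ?thesis .
  qed
  moreover have "(\<integral>\<^sup>+x. norm (f x) \<partial>?T) = (\<integral>\<^sup>+x. h x \<partial>?T)"
    by (rule nn_integral_cong_AE) (use h(2) in auto)
  ultimately show ?thesis by simp
qed

lemma continuous_on_scaleC_pair:
  "continuous_on UNIV (\<lambda>z. fst z *\<^sub>C (snd z :: 'e::complex_banach))"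
  by (rule bounded_bilinear.continuous_on[OF bounded_bilinear_scaleC]) (intro continuous_intros)+

lemma has_integral_test_times_Lp:
  fixes f :: "real^'n \<Rightarrow> 'e::complex_banach"
  assumes p: "1 \<le> p" and f: "f \<in> torus_Lp p" and \<phi>: "\<phi> \<in> test_functions"
  shows "has_strong_bochner_integral torus_measure (\<lambda>x. \<phi> x *\<^sub>C f x)
    (strong_bochner_integral torus_measure (\<lambda>x. \<phi> x *\<^sub>C f x))"
proof (rule has_strong_bochner_integral_exists)
  let ?T = "torus_measure :: (real^'n) measure"
  have c: "continuous_on UNIV \<phi>" by (intro smooth_continuous test_functionsD \<phi>)
  have "strongly_measurable ?T \<phi>"
    using borel_measurable_continuous_onI[OF c] by (intro strongly_measurable_borel) simp
  then show "strongly_measurable ?T (\<lambda>x. \<phi> x *\<^sub>C f x)"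
    using f by (intro strongly_measurable_compose2[OF _ _ continuous_on_scaleC_pair])
      (auto simp: torus_Lp_def)
  obtain B where B: "B > 0" "\<And>x. norm (\<phi> x) \<le> B"
    using periodic_bounded[OF test_functionsD(2)[OF \<phi>] c] by blast
  obtain h where h: "h \<in> borel_measurable ?T" "AE x in ?T. norm (f x) = h x" "\<And>x. 0 \<le> h x"
    by (rule strongly_measurable_norm[OF torus_Lp_measurable[OF f]]) (rule that)
  have "(\<integral>\<^sup>+x. norm (\<phi> x *\<^sub>C f x) \<partial>?T) \<le> (\<integral>\<^sup>+x. ennreal B * ennreal (h x) \<partial>?T)"
  proof (rule nn_integral_mono_AE)
    show "AE x in ?T. ennreal (norm (\<phi> x *\<^sub>C f x)) \<le> ennreal B * ennreal (h x)"
      using h(2)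
    proof eventually_elim
      case (elim x)
      have "norm (\<phi> x) * h x \<le> B * h x" using B(2) h(3) by (intro mult_right_mono)
      then show ?case using elim h(3) B(1) by (simp add: norm_scaleC ennreal_leI flip: ennreal_mult)
    qed
  qed
  also have "\<dots> = ennreal B * (\<integral>\<^sup>+x. h x \<partial>?T)" using h(1) by (intro nn_integral_cmult) auto
  also have "(\<integral>\<^sup>+x. h x \<partial>?T) = (\<integral>\<^sup>+x. norm (f x) \<partial>?T)"
    by (rule nn_integral_cong_AE) (use h(2) in auto)
  also have "ennreal B * (\<integral>\<^sup>+x. norm (f x) \<partial>?T) < \<infinity>"
    using torus_Lp_integrable[OF p f] by (simp add: ennreal_mult_less_top)
  finally show "(\<integral>\<^sup>+x. norm (\<phi> x *\<^sub>C f x) \<partial>?T) < \<infinity>" .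
qed

lemma represents_has_integral:
  fixes u :: "('n::finite, 'e::complex_banach) distribution"
  assumes "1 \<le> p" and "f \<in> torus_Lp p" and "\<phi> \<in> test_functions" and "represents f u"
  shows "has_strong_bochner_integral torus_measure (\<lambda>x. \<phi> x *\<^sub>C f x) (pairing u \<phi>)"
  using has_integral_test_times_Lp[OF assms(1-3)] assms(3,4) by (simp add: represents_def)

lemma distribution_norm_le:
  assumes "f \<in> torus_Lp p" and "represents f u"
  shows "distribution_norm p u \<le> torus_norm p f"
  unfolding distribution_norm_def by (rule INF_lower) (use assms in simp)

lemma distribution_norm_add:
  fixes u v :: "('n::finite, 'e::complex_banach) distribution"
  assumes p: "1 \<le> p"
  shows "distribution_norm p (u + v) \<le> 4 * (distribution_norm p u + distribution_norm p v)"
proof (cases "distribution_norm p u = top \<or> distribution_norm p v = top")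
  case True
  then show ?thesis by (auto simp: ennreal_mult_top)
next
  case False
  let ?T = "torus_measure :: (real^'n) measure"
  have step: "distribution_norm p (u + v) \<le> 4 * (torus_norm p f + torus_norm p g)"
    if f: "f \<in> torus_Lp p" "represents f u" and g: "g \<in> torus_Lp p" "represents g v" for f g
  proof -
    obtain h where h: "h \<in> borel_measurable ?T" "AE x in ?T. norm (f x) = h x" "\<And>x. 0 \<le> h x"
      by (rule strongly_measurable_norm[OF torus_Lp_measurable[OF f(1)]]) (rule that)
    obtain k where k: "k \<in> borel_measurable ?T" "AE x in ?T. norm (g x) = k x" "\<And>x. 0 \<le> k x"
      by (rule strongly_measurable_norm[OF torus_Lp_measurable[OF g(1)]]) (rule that)
    have "torus_norm p (\<lambda>x. f x + g x) \<le> Lebesgue_norm p ?T (\<lambda>x. ennreal (h x) + ennreal (k x))"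
      unfolding torus_norm_def
    proof (rule Lebesgue_norm_mono_AE[OF p])
      show "AE x in ?T. ennreal (norm (f x + g x)) \<le> ennreal (h x) + ennreal (k x)"
        using h(2) k(2)
      proof eventually_elim
        case (elim x)
        then show ?case using norm_triangle_ineq[of "f x" "g x"] h(3) k(3)
          by (simp add: ennreal_leI flip: ennreal_plus)
      qed
    qed
    also have "\<dots> \<le> 4 * (Lebesgue_norm p ?T (\<lambda>x. ennreal (h x)) + Lebesgue_norm p ?T (\<lambda>x. ennreal (k x)))"
      using h(1) k(1) by (intro Lebesgue_norm_add[OF p]) auto
    also have "Lebesgue_norm p ?T (\<lambda>x. ennreal (h x)) = torus_norm p f"
      unfolding torus_norm_def by (rule Lebesgue_norm_cong_AE[OF p]) (use h(2) in eventually_elim, simp)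
    also have "Lebesgue_norm p ?T (\<lambda>x. ennreal (k x)) = torus_norm p g"
      unfolding torus_norm_def by (rule Lebesgue_norm_cong_AE[OF p]) (use k(2) in eventually_elim, simp)
    finally have le: "torus_norm p (\<lambda>x. f x + g x) \<le> 4 * (torus_norm p f + torus_norm p g)" .
    have fin: "torus_norm p f < \<infinity>" "torus_norm p g < \<infinity>"
      using f(1) g(1) by (simp_all add: torus_Lp_def)
    have "(\<lambda>x. f x + g x) \<in> torus_Lp p"
      using f(1) g(1) order_le_less_trans[OF le] fin
      by (auto simp: torus_Lp_def ennreal_mult_less_top intro: strongly_measurable_add
          periodic_compose2[where h="(+)"])
    moreover have "represents (\<lambda>x. f x + g x) (u + v)"
      unfolding represents_def
    proof
      fix \<phi> :: "real^'n \<Rightarrow> complex" assume \<phi>: "\<phi> \<in> test_functions"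
      have "has_strong_bochner_integral ?T (\<lambda>x. \<phi> x *\<^sub>C f x + \<phi> x *\<^sub>C g x) (pairing u \<phi> + pairing v \<phi>)"
        by (intro has_strong_bochner_integral_add represents_has_integral[OF p] f g \<phi>)
      from strong_bochner_integral_eq[OF this]
      show "pairing (u + v) \<phi> = strong_bochner_integral ?T (\<lambda>x. \<phi> x *\<^sub>C (f x + g x))"
        by (simp add: scaleC_add_right plus_distribution.rep_eq)
    qed
    ultimately show ?thesis using le distribution_norm_le order_trans by blast
  qed
  show ?thesis
  proof (rule ennreal_le_epsilon)
    fix e :: real assume e: "e > 0"
    obtain f where f: "f \<in> torus_Lp p" "represents f u"
        "torus_norm p f \<le> distribution_norm p u + ennreal (e / 8)"
      using INF_approx_ennreal[of "e / 8" "distribution_norm p u" "torus_norm p"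
          "{f \<in> torus_Lp p. represents f u}"] e False
      by (auto simp: distribution_norm_def less_imp_le)
    obtain g where g: "g \<in> torus_Lp p" "represents g v"
        "torus_norm p g \<le> distribution_norm p v + ennreal (e / 8)"
      using INF_approx_ennreal[of "e / 8" "distribution_norm p v" "torus_norm p"
          "{f \<in> torus_Lp p. represents f v}"] e False
      by (auto simp: distribution_norm_def less_imp_le)
    have "distribution_norm p (u + v) \<le> 4 * (torus_norm p f + torus_norm p g)"
      by (rule step) fact+
    also have "\<dots> \<le> 4 * ((distribution_norm p u + ennreal (e / 8)) + (distribution_norm p v + ennreal (e / 8)))"
      by (intro mult_left_mono add_mono f g) auto
    also have "\<dots> = 4 * (distribution_norm p u + distribution_norm p v) + 4 * (ennreal (e / 8) + ennreal (e / 8))"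
      by (simp add: distrib_left add_ac)
    also have "4 * (ennreal (e / 8) + ennreal (e / 8)) = ennreal e"
    proof -
      have "ennreal (e / 8) + ennreal (e / 8) = ennreal (e / 4)"
        using e by (simp flip: ennreal_plus)
      moreover have "ennreal 4 * ennreal (e / 4) = ennreal e"
        using e by (subst ennreal_mult[symmetric]) auto
      ultimately show ?thesis by simp
    qed
    finally show "distribution_norm p (u + v) \<le>
        4 * (distribution_norm p u + distribution_norm p v) + ennreal e" .
  qed
qed

lemma distribution_norm_zero:
  assumes p: "1 \<le> p"
  shows "distribution_norm p (0 :: ('n::finite, 'e::complex_banach) distribution) = 0"
proof -
  let ?z = "\<lambda>_::real^'n. 0::'e"
  have "Lebesgue_norm p (torus_measure :: (real^'n) measure) (\<lambda>x. 0) \<le> 0"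
    using p
  proof (cases rule: exponent_cases)
    case 1
    then show ?thesis using Lebesgue_norm_top_le_iff[of torus_measure "\<lambda>_::real^'n. 0" 0] by simp
  next
    case (2 r)
    then show ?thesis
      using Lebesgue_norm_le_iff[of r torus_measure "\<lambda>_::real^'n. 0" 0]
      by (simp add: ennreal_powr_def)
  qed
  then have tn: "torus_norm p ?z = 0" by (simp add: torus_norm_def)
  have zero: "has_strong_bochner_integral (torus_measure :: (real^'n) measure) (\<lambda>x. 0::'e) 0"
    by (rule has_strong_bochner_integral_zero)
  then have "strongly_measurable (torus_measure :: (real^'n) measure) ?z"
    by (simp add: has_strong_bochner_integral_def)
  then have "?z \<in> torus_Lp p" using tn by (simp add: torus_Lp_def periodic_def)
  moreover have "represents ?z 0"
    using strong_bochner_integral_eq[OF zero] by (simp add: represents_def zero_distribution.rep_eq)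
  ultimately have "distribution_norm p (0 :: ('n, 'e) distribution) \<le> 0"
    using distribution_norm_le[of ?z p 0] tn by simp
  then show ?thesis by simp
qed

text \<open>If only finitely many values of \<open>c\<close> are non-zero, then \<open>torus_op c u\<close> is represented by a
  trigonometric polynomial. If \<open>f\<close> represents \<open>u\<close>, this polynomial is the convolution of \<open>f\<close> with the
  operator-valued kernel with Fourier coefficients \<open>c\<close>. The estimate
  holds for every function \<open>f\<close> representing \<open>u\<close>, and hence for the infimum over all of them.\<close>

lemma distribution_norm_torus_op_le:
  fixes c :: "int^'n \<Rightarrow> 'e::complex_banach \<Rightarrow>\<^sub>L 'e" and \<kappa> :: "real^'n \<Rightarrow> real"
  assumes p: "1 \<le> p" and F: "finite F" "\<And>k. k \<notin> F \<Longrightarrow> c k = 0"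
    and lin: "\<And>k z v. c k (z *\<^sub>C v) = z *\<^sub>C c k v"
    and \<kappa>: "\<kappa> \<in> borel_measurable borel" "periodic \<kappa>" "\<And>x. \<kappa> (- x) = \<kappa> x" "\<And>x. 0 \<le> \<kappa> x"
      "(\<integral>\<^sup>+x. \<kappa> x \<partial>torus_measure) \<le> ennreal B" "B > 0"
    and bound: "\<And>x v. norm (\<Sum>k\<in>F. character k x *\<^sub>C c k v) \<le> \<kappa> x * norm v"
  shows "distribution_norm p (torus_op (\<lambda>k. c k) u) \<le> ennreal (2 * B) * distribution_norm p u"
proof -
  let ?T = "torus_measure :: (real^'n) measure"
  define h where "h x = (\<Sum>k\<in>F. character k x *\<^sub>C c k (fourier_coeff u k))" for x
  have temp: "tempered (\<lambda>k. c k)"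
  proof -
    have "norm (c k v) \<le> (\<Sum>k\<in>F. norm (c k)) * (1 + norm (real_vec k)) ^ 0 * norm v" for k v
    proof (cases "k \<in> F")
      case True
      have "norm (c k v) \<le> norm (c k) * norm v" by (rule norm_blinfun)
      also have "\<dots> \<le> (\<Sum>k\<in>F. norm (c k)) * norm v"
        using F(1) True by (intro mult_right_mono member_le_sum) auto
      finally show ?thesis by simp
    qed (simp add: F(2) sum_nonneg)
    then show ?thesis
      unfolding tempered_def by (intro exI[of _ "\<Sum>k\<in>F. norm (c k)"] conjI exI[of _ 0]) (auto intro: sum_nonneg)
  qed
  have h_per: "periodic h"
    unfolding h_def periodic_def by (simp add: periodicD[OF periodic_character])
  have h_int: "has_strong_bochner_integral ?T (\<lambda>x. \<phi> x *\<^sub>C h x) (pairing (torus_op (\<lambda>k. c k) u) \<phi>)"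
    if \<phi>: "\<phi> \<in> test_functions" for \<phi>
  proof -
    let ?v = "\<lambda>k. c k (fourier_coeff u k)"
    have "has_strong_bochner_integral ?T (\<lambda>x. character k x * \<phi> x) (test_fourier_coeff \<phi> (- k))" for k
      using test_integrable[OF \<phi>, of k]
      by (intro has_strong_bochner_integral_of_bochner)
        (simp add: test_fourier_coeff_def has_bochner_integral_integrable)
    from has_strong_bochner_integral_bounded_linear[OF
        bounded_bilinear.bounded_linear_left[OF bounded_bilinear_scaleC] this]
    have "has_strong_bochner_integral ?T (\<lambda>x. \<Sum>k\<in>F. (character k x * \<phi> x) *\<^sub>C ?v k)
        (\<Sum>k\<in>F. test_fourier_coeff \<phi> (- k) *\<^sub>C ?v k)"
      by (rule has_strong_bochner_integral_sum)
    moreover have "(\<lambda>x. \<Sum>k\<in>F. (character k x * \<phi> x) *\<^sub>C ?v k) = (\<lambda>x. \<phi> x *\<^sub>C h x)"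
      by (simp add: h_def fun_eq_iff scaleC_sum_right scaleC_scaleC mult.commute)
    moreover have "(\<Sum>k\<in>F. test_fourier_coeff \<phi> (- k) *\<^sub>C ?v k) = pairing (torus_op (\<lambda>k. c k) u) \<phi>"
    proof -
      have "(\<Sum>\<^sub>\<infinity>k. test_fourier_coeff \<phi> (- k) *\<^sub>C ?v k) = (\<Sum>\<^sub>\<infinity>k\<in>F. test_fourier_coeff \<phi> (- k) *\<^sub>C ?v k)"
        by (rule infsum_cong_neutral) (auto simp: F(2))
      then show ?thesis by (simp add: pairing_torus_op[OF temp \<phi>] F(1))
    qed
    ultimately show ?thesis by simp
  qed
  have h_rep: "represents h (torus_op (\<lambda>k. c k) u)"
    unfolding represents_def using strong_bochner_integral_eq[OF h_int] by simp
  have h_meas: "strongly_measurable ?T h"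
    using h_int[OF character_test[of 0]] by (simp add: has_strong_bochner_integral_def scaleC_one)
  have main: "distribution_norm p (torus_op (\<lambda>k. c k) u) \<le> ennreal (2 * B) * torus_norm p f"
    if f: "f \<in> torus_Lp p" "represents f u" for f
  proof -
    obtain g where g: "g \<in> borel_measurable ?T" "AE x in ?T. norm (f x) = g x" "\<And>x. 0 \<le> g x"
      by (rule strongly_measurable_norm[OF torus_Lp_measurable[OF f(1)]]) (rule that)
    have le: "ennreal (norm (h x)) \<le> (\<integral>\<^sup>+y. ennreal (\<kappa> (x - y)) * ennreal (g y) \<partial>?T)" for x
    proof -
      have "has_strong_bochner_integral ?T (\<lambda>y. character k x *\<^sub>C c k (character (- k) y *\<^sub>C f y))
          (character k x *\<^sub>C c k (fourier_coeff u k))" for k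
      proof -
        have "bounded_linear (\<lambda>v. character k x *\<^sub>C c k v)"
          by (rule bounded_linear_compose[OF bounded_linear_scaleC blinfun.bounded_linear_right])
        from has_strong_bochner_integral_bounded_linear[OF this
            represents_has_integral[OF p f(1) character_test[of "- k"] f(2)]]
        show ?thesis by (simp add: fourier_coeff_def)
      qed
      then have "has_strong_bochner_integral ?T
          (\<lambda>y. \<Sum>k\<in>F. character k x *\<^sub>C c k (character (- k) y *\<^sub>C f y)) (h x)"
        unfolding h_def by (rule has_strong_bochner_integral_sum)
      moreover have "(\<Sum>k\<in>F. character k x *\<^sub>C c k (character (- k) y *\<^sub>C f y)) =
          (\<Sum>k\<in>F. character k (x - y) *\<^sub>C c k (f y))" for y
        by (rule sum.cong)
          (simp_all add: lin scaleC_scaleC character_uminus flip: character_add_arg)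
      ultimately have "has_strong_bochner_integral ?T
          (\<lambda>y. \<Sum>k\<in>F. character k (x - y) *\<^sub>C c k (f y)) (h x)"
        by simp
      from has_strong_bochner_integral_norm_bound[OF this]
      have "ennreal (norm (h x)) \<le> (\<integral>\<^sup>+y. norm (\<Sum>k\<in>F. character k (x - y) *\<^sub>C c k (f y)) \<partial>?T)" .
      also have "\<dots> \<le> (\<integral>\<^sup>+y. ennreal (\<kappa> (x - y)) * ennreal (g y) \<partial>?T)"
      proof (rule nn_integral_mono_AE)
        show "AE y in ?T. ennreal (norm (\<Sum>k\<in>F. character k (x - y) *\<^sub>C c k (f y))) \<le>
            ennreal (\<kappa> (x - y)) * ennreal (g y)"
          using g(2)
        proof eventually_elim
          case (elim y)
          then show ?case using bound[of "x - y" "f y"] \<kappa>(4) g(3)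
            by (simp add: ennreal_leI flip: ennreal_mult)
        qed
      qed
      finally show ?thesis .
    qed
    have "torus_norm p h \<le> ennreal (2 * B) * Lebesgue_norm p ?T (\<lambda>x. ennreal (g x))"
      unfolding torus_norm_def
      using g(1) by (intro Lebesgue_norm_convolution[OF p \<kappa>(1) _ \<kappa>(2,3,5,6) le]) auto
    also have "Lebesgue_norm p ?T (\<lambda>x. ennreal (g x)) = torus_norm p f"
      unfolding torus_norm_def by (rule Lebesgue_norm_cong_AE[OF p]) (use g(2) in eventually_elim, simp)
    finally have tn: "torus_norm p h \<le> ennreal (2 * B) * torus_norm p f" .
    moreover have "torus_norm p f < \<infinity>" using f(1) by (simp add: torus_Lp_def)
    ultimately have "torus_norm p h < \<infinity>"
      by (auto simp: ennreal_mult_less_top elim: order_le_less_trans)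
    then have "h \<in> torus_Lp p" using h_per h_meas by (simp add: torus_Lp_def)
    from distribution_norm_le[OF this h_rep] show ?thesis using tn by (rule order_trans)
  qed
  have inv: "ennreal (1 / (2 * B)) * ennreal (2 * B) = 1"
    using \<kappa>(6) by (simp flip: ennreal_mult)
  have "ennreal (1 / (2 * B)) * distribution_norm p (torus_op (\<lambda>k. c k) u) \<le> distribution_norm p u"
    unfolding distribution_norm_def[of p u]
  proof (rule INF_greatest)
    fix f assume "f \<in> {f \<in> torus_Lp p. represents f u}"
    then have "ennreal (1 / (2 * B)) * distribution_norm p (torus_op (\<lambda>k. c k) u) \<le>
        ennreal (1 / (2 * B)) * (ennreal (2 * B) * torus_norm p f)"
      by (intro mult_left_mono main) auto
    then show "ennreal (1 / (2 * B)) * distribution_norm p (torus_op (\<lambda>k. c k) u) \<le> torus_norm p f"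
      by (simp add: inv flip: mult.assoc)
  qed
  then have "ennreal (2 * B) * (ennreal (1 / (2 * B)) * distribution_norm p (torus_op (\<lambda>k. c k) u)) \<le>
      ennreal (2 * B) * distribution_norm p u"
    by (rule mult_left_mono) simp
  moreover have "ennreal (2 * B) * (ennreal (1 / (2 * B)) * X) = X" for X
    by (simp only: mult.assoc[symmetric] mult.commute[of "ennreal (2 * B)" "ennreal (1 / (2 * B))"]
        inv mult_1)
  ultimately show ?thesis by simp
qed

section \<open>Differences of operator-valued symbols\<close>

definition bracket :: "int^'n \<Rightarrow> real" where
  "bracket k = sqrt (1 + (norm (real_vec k))\<^sup>2)"

lemma bracket_ge_1: "1 \<le> bracket k"
  by (simp add: bracket_def)

lemma bracket_pos [simp]: "0 < bracket k" "0 \<le> bracket k" "bracket k \<noteq> 0"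
  using bracket_ge_1[of k] by linarith+

lemma bracket_bounds: "norm (real_vec k) \<le> bracket k" "bracket k \<le> 1 + norm (real_vec k)"
proof -
  show "norm (real_vec k) \<le> bracket k" unfolding bracket_def by (rule real_le_rsqrt) simp
  have "1 + (norm (real_vec k))\<^sup>2 \<le> (1 + norm (real_vec k))\<^sup>2" by (simp add: power2_sum)
  then show "bracket k \<le> 1 + norm (real_vec k)"
    unfolding bracket_def by (intro real_le_lsqrt) auto
qed

lemma bracket_shift:
  "bracket (k + axis l 1) \<le> 2 * bracket k" "bracket k \<le> 2 * bracket (k + axis l 1)"
proof -
  have *: "sqrt (1 + x\<^sup>2) \<le> 2 * sqrt (1 + y\<^sup>2)" if "x \<le> y + 1" "0 \<le> x" "0 \<le> y" for x y :: real
  proof -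
    have "x\<^sup>2 \<le> (y + 1)\<^sup>2" using that by (intro power_mono) auto
    then have "x\<^sup>2 \<le> y\<^sup>2 + 2 * y + 1" by (simp add: power2_sum)
    moreover have "2 * y \<le> y\<^sup>2 + 1" using zero_le_power2[of "y - 1"] by (simp add: power2_diff)
    moreover have "0 \<le> y\<^sup>2" by simp
    moreover have "1 + a \<le> 4 * (1 + b)" if "a \<le> b + 2 * y + 1" "2 * y \<le> b + 1" "0 \<le> b" for a b
      using that by argo
    ultimately have "1 + x\<^sup>2 \<le> 4 * (1 + y\<^sup>2)" by blast
    then have "sqrt (1 + x\<^sup>2) \<le> sqrt (4 * (1 + y\<^sup>2))" by (rule real_sqrt_le_mono)
    also have "\<dots> = 2 * sqrt (1 + y\<^sup>2)" by (subst real_sqrt_mult) simp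
    finally show ?thesis .
  qed
  have n: "norm (axis l 1 :: real^'b) = 1" for l by simp
  show "bracket (k + axis l 1) \<le> 2 * bracket k"
    unfolding bracket_def using norm_triangle_ineq[of "real_vec k" "axis l 1"]
    by (intro *) auto
  show "bracket k \<le> 2 * bracket (k + axis l 1)"
    unfolding bracket_def using norm_triangle_ineq4[of "real_vec k + axis l 1" "axis l 1"]
    by (intro *) auto
qed

lemma bracket_powr_shift: "bracket (k + axis l 1) powr t \<le> 2 powr \<bar>t\<bar> * bracket k powr t"
proof (cases "t \<ge> 0")
  case True
  then have "bracket (k + axis l 1) powr t \<le> (2 * bracket k) powr t"
    by (intro powr_mono2 bracket_shift) auto
  then show ?thesis using True by (simp add: powr_mult)
next
  case False
  have "bracket k powr (- t) \<le> (2 * bracket (k + axis l 1)) powr (- t)"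
    using False by (intro powr_mono2 bracket_shift) auto
  then have "bracket k powr (- t) \<le> 2 powr (- t) * bracket (k + axis l 1) powr (- t)"
    by (simp add: powr_mult)
  then show ?thesis using False by (simp add: powr_minus field_simps)
qed

lemma funpow_difference_Suc:
  "(difference l ^^ Suc r) f = (difference l ^^ r) (difference l f)"
  by (simp add: funpow_swap1)

lemma funpow_difference_shift:
  "(difference l ^^ r) (\<lambda>k. f (k + h)) k = (difference l ^^ r) f (k + h)"
proof (induction r arbitrary: k)
  case (Suc r)
  then show ?case by (simp add: difference_def add_ac)
qed simp

lemma funpow_difference_add:
  "(difference l ^^ r) (\<lambda>k. f k + g k) k = (difference l ^^ r) f k + (difference l ^^ r) g k"
  by (induction r arbitrary: k) (simp_all add: difference_def algebra_simps)

lemma funpow_difference_uminus: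
  "(difference l ^^ r) (\<lambda>k. - f k) k = - (difference l ^^ r) f k"
  by (induction r arbitrary: k) (simp_all add: difference_def algebra_simps)

lemma funpow_difference_linear:
  assumes "\<And>x y. T (x - y) = T x - T y"
  shows "(difference l ^^ r) (\<lambda>k. T (f k)) k = T ((difference l ^^ r) f k)"
  by (induction r arbitrary: k) (simp_all add: difference_def assms)

lemma funpow_difference_const:
  "(difference l ^^ r) (\<lambda>k. c) k = (if r = 0 then c else 0)"
  by (induction r arbitrary: k) (simp_all add: difference_def)

lemma funpow_difference_support:
  fixes f :: "int^'n \<Rightarrow> 'b::ab_group_add"
  assumes "(difference l ^^ r) f k \<noteq> 0"
  shows "\<exists>i\<le>r. f (k + axis l (int i)) \<noteq> 0"
  using assms
proof (induction r arbitrary: k)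
  case 0
  have *: "axis l 0 = (0 :: int^'n)" by (simp add: axis_def vec_eq_iff)
  show ?case using 0 by (intro exI[of _ 0]) (simp add: *)
next
  case (Suc r)
  have "(difference l ^^ Suc r) f k = (difference l ^^ r) f (k + axis l 1) - (difference l ^^ r) f k"
    by (simp add: difference_def[of l "(difference l ^^ r) f"])
  then consider "(difference l ^^ r) f (k + axis l 1) \<noteq> 0" | "(difference l ^^ r) f k \<noteq> 0"
    using Suc.prems by fastforce
  then show ?case
  proof cases
    case 1
    from Suc.IH[OF this] obtain i where i: "i \<le> r" "f ((k + axis l 1) + axis l (int i)) \<noteq> 0" by blast
    have eq: "(k + axis l 1) + axis l (int i) = k + axis l (int (Suc i))"
      by (simp add: axis_def vec_eq_iff)
    show ?thesis using i(1) i(2)[unfolded eq] by (intro exI[of _ "Suc i"] conjI) auto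
  next
    case 2
    from Suc.IH[OF this] show ?thesis using le_SucI by blast
  qed
qed

text \<open>Symbols with respect to differences in the fixed direction \<open>l\<close>, of the order that is given by
  a weight \<open>w\<close> in place of a power of the bracket. The kernel
  estimate treats each direction separately. The weight may depend on the spectral parameter, which makes the estimates
  for resolvents uniform.\<close>

definition symbol_bound ::
  "'n \<Rightarrow> (int^'n \<Rightarrow> real) \<Rightarrow> nat \<Rightarrow> real \<Rightarrow> (int^'n \<Rightarrow> 'b::real_normed_vector) \<Rightarrow> bool" where
  "symbol_bound l w N A f \<longleftrightarrow>
     (\<forall>r\<le>N. \<forall>k. norm ((difference l ^^ r) f k) \<le> A * w k * bracket k powr (- real r))"

text \<open>Weights that control their own shift, so that shifted symbols obey the same estimates up to a
  constant.\<close>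

definition moderate :: "'n \<Rightarrow> real \<Rightarrow> (int^'n \<Rightarrow> real) \<Rightarrow> bool" where
  "moderate l c w \<longleftrightarrow> (\<forall>k. 0 < w k \<and> w (k + axis l 1) \<le> c * w k)"

lemma symbol_boundD:
  "symbol_bound l w N A f \<Longrightarrow> r \<le> N \<Longrightarrow>
    norm ((difference l ^^ r) f k) \<le> A * w k * bracket k powr (- real r)"
  by (simp add: symbol_bound_def)

lemma symbol_bound_0: "symbol_bound l w N A f \<Longrightarrow> norm (f k) \<le> A * w k"
  using symbol_boundD[of l w N A f 0 k] by simp

text \<open>The recursion in the number of differences, on which the inductions below are based.\<close>

lemma symbol_bound_Suc_iff:
  "symbol_bound l w (Suc N) A f \<longleftrightarrow>
    (\<forall>k. norm (f k) \<le> A * w k) \<and> symbol_bound l (\<lambda>k. w k / bracket k) N A (difference l f)"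
proof -
  have eq: "A * w k * bracket k powr (- real (Suc r)) = A * (w k / bracket k) * bracket k powr (- real r)"
    for k :: "int^'a" and r
  proof -
    have "- real (Suc r) = - real r - 1" by simp
    then have "bracket k powr (- real (Suc r)) = bracket k powr (- real r) / bracket k"
      by (simp only: powr_diff powr_one bracket_pos)
    then show ?thesis by simp
  qed
  show ?thesis
  proof
    assume f: "symbol_bound l w (Suc N) A f"
    show "(\<forall>k. norm (f k) \<le> A * w k) \<and> symbol_bound l (\<lambda>k. w k / bracket k) N A (difference l f)"
    proof
      show "\<forall>k. norm (f k) \<le> A * w k" using symbol_bound_0[OF f] by blast
      show "symbol_bound l (\<lambda>k. w k / bracket k) N A (difference l f)"
        unfolding symbol_bound_def
      proof (intro allI impI)
        fix r k assume "r \<le> N"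
        then show "norm ((difference l ^^ r) (difference l f) k) \<le>
            A * (w k / bracket k) * bracket k powr (- real r)"
          using symbol_boundD[OF f, of "Suc r" k] unfolding funpow_difference_Suc eq by simp
      qed
    qed
  next
    assume f: "(\<forall>k. norm (f k) \<le> A * w k) \<and> symbol_bound l (\<lambda>k. w k / bracket k) N A (difference l f)"
    show "symbol_bound l w (Suc N) A f"
      unfolding symbol_bound_def
    proof (intro allI impI)
      fix r k assume r: "r \<le> Suc N"
      show "norm ((difference l ^^ r) f k) \<le> A * w k * bracket k powr (- real r)"
      proof (cases r)
        case 0
        then show ?thesis using f by simp
      next
        case (Suc r')
        then show ?thesis
          using symbol_boundD[of l "\<lambda>k. w k / bracket k" N A "difference l f" r' k] f r
          unfolding Suc funpow_difference_Suc eq by simp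
      qed
    qed
  qed
qed

lemma symbol_bound_less: "symbol_bound l w N A f \<Longrightarrow> M \<le> N \<Longrightarrow> symbol_bound l w M A f"
  by (simp add: symbol_bound_def)

lemma symbol_bound_weaken:
  assumes f: "symbol_bound l w N A f" and le: "\<And>k. A * w k \<le> B * v k"
  shows "symbol_bound l v N B f"
  unfolding symbol_bound_def
proof (intro allI impI)
  fix r k assume "r \<le> N"
  then have "norm ((difference l ^^ r) f k) \<le> A * w k * bracket k powr (- real r)"
    by (rule symbol_boundD[OF f])
  also have "\<dots> \<le> B * v k * bracket k powr (- real r)" by (intro mult_right_mono le) simp
  finally show "norm ((difference l ^^ r) f k) \<le> B * v k * bracket k powr (- real r)" .
qed

lemma symbol_bound_add:
  assumes f: "symbol_bound l w N A f" and g: "symbol_bound l w N B g"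
  shows "symbol_bound l w N (A + B) (\<lambda>k. f k + g k)"
  unfolding symbol_bound_def
proof (intro allI impI)
  fix r k assume r: "r \<le> N"
  show "norm ((difference l ^^ r) (\<lambda>k. f k + g k) k) \<le> (A + B) * w k * bracket k powr (- real r)"
    unfolding funpow_difference_add
    using norm_triangle_ineq[of "(difference l ^^ r) f k" "(difference l ^^ r) g k"]
      symbol_boundD[OF f r, of k] symbol_boundD[OF g r, of k]
    by (simp add: distrib_right)
qed

lemma symbol_bound_uminus:
  "symbol_bound l w N A f \<Longrightarrow> symbol_bound l w N A (\<lambda>k. - f k)"
  by (simp add: symbol_bound_def funpow_difference_uminus)

lemma symbol_bound_shift:
  fixes w :: "int^'n \<Rightarrow> real" and f :: "int^'n \<Rightarrow> 'b::real_normed_vector"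
  assumes f: "symbol_bound l w N A f" and w: "moderate l c w" and A: "0 \<le> A" and c: "0 \<le> c"
  shows "symbol_bound l w N (A * c * 2 ^ N) (\<lambda>k. f (k + axis l 1))"
  unfolding symbol_bound_def
proof (intro allI impI)
  fix r and k :: "int^'n" assume r: "r \<le> N"
  let ?k = "k + axis l 1"
  have w': "0 < w k" "0 < w ?k" "w ?k \<le> c * w k" using w by (auto simp: moderate_def)
  have "norm ((difference l ^^ r) f ?k) \<le> A * w ?k * bracket ?k powr (- real r)"
    by (rule symbol_boundD[OF f r])
  also have "\<dots> \<le> A * (c * w k) * (2 powr \<bar>- real r\<bar> * bracket k powr (- real r))"
    using A c w' by (intro mult_mono bracket_powr_shift) auto
  also have "2 powr \<bar>- real r\<bar> = (2::real) ^ r" by (simp add: powr_realpow)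
  also have "A * (c * w k) * (2 ^ r * bracket k powr (- real r)) \<le>
      A * (c * w k) * (2 ^ N * bracket k powr (- real r))"
    using A c w' r by (intro mult_left_mono mult_right_mono power_increasing) auto
  finally show "norm ((difference l ^^ r) (\<lambda>k. f (k + axis l 1)) k) \<le>
      A * c * 2 ^ N * w k * bracket k powr (- real r)"
    by (simp add: funpow_difference_shift mult_ac)
qed

lemma moderate_divide_bracket:
  assumes "moderate l c w" and "0 \<le> c"
  shows "moderate l (2 * c) (\<lambda>k. w k / bracket k)"
  unfolding moderate_def
proof (intro allI conjI)
  fix k
  have w: "0 < w k" "0 < w (k + axis l 1)" "w (k + axis l 1) \<le> c * w k"
    using assms by (auto simp: moderate_def)
  show "0 < w k / bracket k" using w by simp
  have "w (k + axis l 1) / bracket (k + axis l 1) \<le> (c * w k) / bracket (k + axis l 1)"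
    using w by (intro divide_right_mono) auto
  also have "\<dots> \<le> (c * w k) / (bracket k / 2)"
    using w assms(2) bracket_shift(2)[of k l] by (intro divide_left_mono) auto
  finally show "w (k + axis l 1) / bracket (k + axis l 1) \<le> 2 * c * (w k / bracket k)" by (simp add: mult_ac)
qed

text \<open>The Leibniz rule \<open>\<Delta>(fg) = \<Delta>f \<cdot> g(\<cdot> + e) + f \<cdot> \<Delta>g\<close> reduces the order by one and the weight
  by one power of the bracket, whence the induction.\<close>

lemma difference_blinfun_compose:
  "difference l (\<lambda>k. f k o\<^sub>L g k) k =
    (difference l f k o\<^sub>L g (k + axis l 1)) + (f k o\<^sub>L difference l g k)"
  by (simp add: difference_def blinfun.bilinear_simps
      bounded_bilinear.diff_left[OF bounded_bilinear_blinfun_compose]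
      bounded_bilinear.diff_right[OF bounded_bilinear_blinfun_compose])

text \<open>The constant depends on \<open>c\<close> and \<open>N\<close> only, so the estimate is uniform in the weights.\<close>

lemma symbol_bound_compose:
  assumes "0 \<le> c"
  shows "\<exists>K\<ge>0. \<forall>w v A B (f :: int^'n \<Rightarrow> 'b::real_normed_vector \<Rightarrow>\<^sub>L 'd::real_normed_vector)
    (g :: int^'n \<Rightarrow> 'a::real_normed_vector \<Rightarrow>\<^sub>L 'b).
    (\<forall>k. 0 < w k) \<longrightarrow> moderate l c v \<longrightarrow> 0 \<le> A \<longrightarrow> 0 \<le> B \<longrightarrow>
    symbol_bound l w N A f \<longrightarrow> symbol_bound l v N B g \<longrightarrow>
    symbol_bound l (\<lambda>k. w k * v k) N (K * A * B) (\<lambda>k. f k o\<^sub>L g k)"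
  using assms
proof (induction N arbitrary: c)
  have zero: "norm (f k o\<^sub>L g k) \<le> A * B * (w k * v k)"
    if "\<forall>k. 0 < w k" "moderate l c v" "0 \<le> A" "0 \<le> B" "symbol_bound l w N A f" "symbol_bound l v N B g"
    for c w v A B N k and f :: "int^'n \<Rightarrow> 'b \<Rightarrow>\<^sub>L 'd" and g :: "int^'n \<Rightarrow> 'a \<Rightarrow>\<^sub>L 'b"
  proof -
    have "norm (f k o\<^sub>L g k) \<le> norm (f k) * norm (g k)" by (rule norm_blinfun_compose)
    also have "\<dots> \<le> (A * w k) * (B * v k)"
      using symbol_bound_0[OF that(5), of k] symbol_bound_0[OF that(6), of k] that(1,3)
      by (intro mult_mono) (auto intro: mult_nonneg_nonneg less_imp_le)
    finally show ?thesis by (simp add: mult_ac)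
  qed
  {
    case 0
    show ?case
      using zero[of _ c _ _ _ 0] by (intro exI[of _ 1]) (simp add: symbol_bound_def)
  next
    case (Suc N)
    obtain K1 where K1: "K1 \<ge> 0" "\<forall>w v A B (f :: int^'n \<Rightarrow> 'b \<Rightarrow>\<^sub>L 'd) (g :: int^'n \<Rightarrow> 'a \<Rightarrow>\<^sub>L 'b).
        (\<forall>k. 0 < w k) \<longrightarrow> moderate l c v \<longrightarrow> 0 \<le> A \<longrightarrow> 0 \<le> B \<longrightarrow>
        symbol_bound l w N A f \<longrightarrow> symbol_bound l v N B g \<longrightarrow>
        symbol_bound l (\<lambda>k. w k * v k) N (K1 * A * B) (\<lambda>k. f k o\<^sub>L g k)"
      using Suc.IH[OF Suc.prems] by (elim exE conjE)
    have "0 \<le> 2 * c" using Suc.prems by simp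
    from Suc.IH[OF this]
    obtain K2 where K2: "K2 \<ge> 0" "\<forall>w v A B (f :: int^'n \<Rightarrow> 'b \<Rightarrow>\<^sub>L 'd) (g :: int^'n \<Rightarrow> 'a \<Rightarrow>\<^sub>L 'b).
        (\<forall>k. 0 < w k) \<longrightarrow> moderate l (2 * c) v \<longrightarrow> 0 \<le> A \<longrightarrow> 0 \<le> B \<longrightarrow>
        symbol_bound l w N A f \<longrightarrow> symbol_bound l v N B g \<longrightarrow>
        symbol_bound l (\<lambda>k. w k * v k) N (K2 * A * B) (\<lambda>k. f k o\<^sub>L g k)"
      by (elim exE conjE)
    define K where "K = 1 + K1 * c * 2 ^ N + K2"
    have K: "K \<ge> 0" "1 \<le> K" using K1(1) K2(1) Suc.prems by (simp_all add: K_def)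
    show ?case
    proof (intro exI[of _ K] conjI K(1) allI impI)
      fix w v A B and f :: "int^'n \<Rightarrow> 'b \<Rightarrow>\<^sub>L 'd" and g :: "int^'n \<Rightarrow> 'a \<Rightarrow>\<^sub>L 'b"
      assume w: "\<forall>k. 0 < w k" and v: "moderate l c v" and A: "0 \<le> A" and B: "0 \<le> B"
        and f: "symbol_bound l w (Suc N) A f" and g: "symbol_bound l v (Suc N) B g"
      have vpos: "0 < v k" for k using v by (simp add: moderate_def)
      have df: "symbol_bound l (\<lambda>k. w k / bracket k) N A (difference l f)"
        and dg: "symbol_bound l (\<lambda>k. v k / bracket k) N B (difference l g)"
        using f g by (simp_all add: symbol_bound_Suc_iff)
      have f': "symbol_bound l w N A f" and g': "symbol_bound l v N B g"
        using f g by (auto intro: symbol_bound_less)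
      have "symbol_bound l (\<lambda>k. (w k / bracket k) * v k) N (K1 * A * (B * c * 2 ^ N))
          (\<lambda>k. difference l f k o\<^sub>L g (k + axis l 1))"
        using w Suc.prems A B
        by (intro K1(2)[rule_format, OF _ v _ _ df symbol_bound_shift[OF g' v]]) auto
      then have 1: "symbol_bound l (\<lambda>k. (w k * v k) / bracket k) N (K1 * A * (B * c * 2 ^ N))
          (\<lambda>k. difference l f k o\<^sub>L g (k + axis l 1))"
        by simp
      have "symbol_bound l (\<lambda>k. w k * (v k / bracket k)) N (K2 * A * B) (\<lambda>k. f k o\<^sub>L difference l g k)"
        using w Suc.prems A B
        by (intro K2(2)[rule_format, OF _ moderate_divide_bracket[OF v] _ _ f' dg]) auto
      then have 2: "symbol_bound l (\<lambda>k. (w k * v k) / bracket k) N (K2 * A * B)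
          (\<lambda>k. f k o\<^sub>L difference l g k)"
        by simp
      have "difference l (\<lambda>k. f k o\<^sub>L g k) =
          (\<lambda>k. (difference l f k o\<^sub>L g (k + axis l 1)) + (f k o\<^sub>L difference l g k))"
        by (rule ext) (rule difference_blinfun_compose)
      with symbol_bound_add[OF 1 2]
      have "symbol_bound l (\<lambda>k. (w k * v k) / bracket k) N
          (K1 * A * (B * c * 2 ^ N) + K2 * A * B) (difference l (\<lambda>k. f k o\<^sub>L g k))"
        by simp
      then have "symbol_bound l (\<lambda>k. (w k * v k) / bracket k) N (K * A * B)
          (difference l (\<lambda>k. f k o\<^sub>L g k))"
      proof (rule symbol_bound_weaken)
        fix k
        have "K1 * A * (B * c * 2 ^ N) + K2 * A * B \<le> K * A * B"
          using A B by (simp add: K_def algebra_simps)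
        then show "(K1 * A * (B * c * 2 ^ N) + K2 * A * B) * (w k * v k / bracket k) \<le>
            K * A * B * (w k * v k / bracket k)"
          using w vpos by (intro mult_right_mono) (auto intro: less_imp_le)
      qed
      moreover have "norm (f k o\<^sub>L g k) \<le> K * A * B * (w k * v k)" for k
      proof -
        have "norm (f k o\<^sub>L g k) \<le> A * B * (w k * v k)" by (rule zero[OF w v A B f g])
        also have "\<dots> \<le> K * (A * B * (w k * v k))"
        proof -
          have "0 \<le> A * B * (w k * v k)"
            using A B w vpos by (intro mult_nonneg_nonneg) (auto intro: less_imp_le)
          from mult_right_mono[OF K(2) this] show ?thesis by simp
        qed
        finally show ?thesis by (simp add: mult_ac)
      qed
      ultimately show "symbol_bound l (\<lambda>k. w k * v k) (Suc N) (K * A * B) (\<lambda>k. f k o\<^sub>L g k)"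
        by (simp add: symbol_bound_Suc_iff)
    qed
  }
qed

text \<open>The identity \<open>\<Delta>b = - b(\<cdot> + e) \<cdot> \<Delta>f \<cdot> b\<close> for the pointwise inverse \<open>b\<close> of \<open>f\<close> gives one
  difference of \<open>b\<close> from lower differences of \<open>b\<close>.\<close>

lemma difference_blinfun_inverse:
  assumes "\<And>k. b k o\<^sub>L f k = id_blinfun" and "\<And>k. f k o\<^sub>L b k = id_blinfun"
  shows "difference l b k = - ((b (k + axis l 1) o\<^sub>L difference l f k) o\<^sub>L b k)"
proof (rule blinfun_eqI)
  fix x
  have 1: "b k (f k y) = y" for k y
    using arg_cong[OF assms(1)[of k], of "\<lambda>T. blinfun_apply T y"] by simp
  have 2: "f k (b k y) = y" for k y
    using arg_cong[OF assms(2)[of k], of "\<lambda>T. blinfun_apply T y"] by simp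
  show "difference l b k x = (- ((b (k + axis l 1) o\<^sub>L difference l f k) o\<^sub>L b k)) x"
    by (simp add: difference_def blinfun.bilinear_simps 1 2)
qed

text \<open>In the identity for the difference of \<open>b\<close>, the right-hand side has the weight
  \<open>v * (w / bracket) * v\<close>, and \<open>v * w \<le> 1\<close> reduces this to \<open>v / bracket\<close>, as one more difference
  of a symbol with the weight \<open>v\<close> requires. The constant is again uniform in the weights.\<close>

lemma symbol_bound_inverse:
  assumes c: "0 \<le> c" and A: "0 \<le> A" and C: "0 \<le> C"
  shows "\<exists>K\<ge>0. \<forall>w v (f :: int^'n \<Rightarrow> 'e::real_normed_vector \<Rightarrow>\<^sub>L 'e) b.
    moderate l c w \<longrightarrow> moderate l c v \<longrightarrow> (\<forall>k. v k * w k \<le> 1) \<longrightarrow> symbol_bound l w N A f \<longrightarrow>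
    (\<forall>k. b k o\<^sub>L f k = id_blinfun) \<longrightarrow> (\<forall>k. f k o\<^sub>L b k = id_blinfun) \<longrightarrow>
    (\<forall>k. norm (b k) \<le> C * v k) \<longrightarrow> symbol_bound l v N K b"
proof (induction N)
  case 0
  show ?case using C by (intro exI[of _ C]) (simp add: symbol_bound_def)
next
  case (Suc N)
  obtain K0 where K0: "K0 \<ge> 0" "\<forall>w v (f :: int^'n \<Rightarrow> 'e \<Rightarrow>\<^sub>L 'e) b.
    moderate l c w \<longrightarrow> moderate l c v \<longrightarrow> (\<forall>k. v k * w k \<le> 1) \<longrightarrow> symbol_bound l w N A f \<longrightarrow>
    (\<forall>k. b k o\<^sub>L f k = id_blinfun) \<longrightarrow> (\<forall>k. f k o\<^sub>L b k = id_blinfun) \<longrightarrow>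
    (\<forall>k. norm (b k) \<le> C * v k) \<longrightarrow> symbol_bound l v N K0 b"
    using Suc.IH by (elim exE conjE)
  have c2: "0 \<le> 2 * c" using c by simp
  obtain P where P: "P \<ge> 0" "\<forall>w v A B (f :: int^'n \<Rightarrow> 'e \<Rightarrow>\<^sub>L 'e) (g :: int^'n \<Rightarrow> 'e \<Rightarrow>\<^sub>L 'e).
    (\<forall>k. 0 < w k) \<longrightarrow> moderate l (2 * c) v \<longrightarrow> 0 \<le> A \<longrightarrow> 0 \<le> B \<longrightarrow>
    symbol_bound l w N A f \<longrightarrow> symbol_bound l v N B g \<longrightarrow>
    symbol_bound l (\<lambda>k. w k * v k) N (P * A * B) (\<lambda>k. f k o\<^sub>L g k)"
    using symbol_bound_compose[OF c2, of l N] by (elim exE conjE)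
  define Q where "Q = P * (P * (K0 * c * 2 ^ N) * A) * K0"
  have Q: "Q \<ge> 0" using P(1) K0(1) A c by (simp add: Q_def)
  show ?case
  proof (intro exI[of _ "max C Q"] conjI allI impI)
    show "0 \<le> max C Q" using C by simp
    fix w v and f b :: "int^'n \<Rightarrow> 'e \<Rightarrow>\<^sub>L 'e"
    assume w: "moderate l c w" and v: "moderate l c v" and vw: "\<forall>k. v k * w k \<le> 1"
      and f: "symbol_bound l w (Suc N) A f"
      and inv: "\<forall>k. b k o\<^sub>L f k = id_blinfun" "\<forall>k. f k o\<^sub>L b k = id_blinfun"
      and b: "\<forall>k. norm (b k) \<le> C * v k"
    have pos: "0 < w k" "0 < v k" for k using v w by (simp_all add: moderate_def)
    have v2: "moderate l (2 * c) v"
      unfolding moderate_def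
    proof (intro allI conjI)
      fix k
      have "v (k + axis l 1) \<le> c * v k" using v by (simp add: moderate_def)
      also have "\<dots> \<le> 2 * c * v k" using c pos(2)[of k] by (intro mult_right_mono) auto
      finally show "v (k + axis l 1) \<le> 2 * c * v k" .
    qed (rule pos)
    have f': "symbol_bound l w N A f" using f by (rule symbol_bound_less) simp
    have b': "symbol_bound l v N K0 b"
      by (rule K0(2)[rule_format, OF w v _ f']) (use vw inv b in auto)
    have df: "symbol_bound l (\<lambda>k. w k / bracket k) N A (difference l f)"
      using f by (simp add: symbol_bound_Suc_iff)
    have bs: "symbol_bound l v N (K0 * c * 2 ^ N) (\<lambda>k. b (k + axis l 1))"
      by (rule symbol_bound_shift[OF b' v K0(1) c])
    have "symbol_bound l (\<lambda>k. v k * (w k / bracket k)) N (P * (K0 * c * 2 ^ N) * A)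
        (\<lambda>k. b (k + axis l 1) o\<^sub>L difference l f k)"
      using pos K0(1) c A
      by (intro P(2)[rule_format, OF _ moderate_divide_bracket[OF w c] _ _ bs df]) auto
    from P(2)[rule_format, OF _ v2 _ _ this b']
    have "symbol_bound l (\<lambda>k. (v k * (w k / bracket k)) * v k) N Q
        (\<lambda>k. (b (k + axis l 1) o\<^sub>L difference l f k) o\<^sub>L b k)"
      unfolding Q_def using pos K0(1) P(1) c A by simp
    then have "symbol_bound l (\<lambda>k. (v k * (w k / bracket k)) * v k) N Q
        (\<lambda>k. - ((b (k + axis l 1) o\<^sub>L difference l f k) o\<^sub>L b k))"
      by (rule symbol_bound_uminus)
    moreover have "(\<lambda>k. - ((b (k + axis l 1) o\<^sub>L difference l f k) o\<^sub>L b k)) = difference l b"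
      by (rule ext) (use difference_blinfun_inverse[of b f] inv in simp)
    ultimately have "symbol_bound l (\<lambda>k. (v k * (w k / bracket k)) * v k) N Q (difference l b)"
      by simp
    then have "symbol_bound l (\<lambda>k. v k / bracket k) N (max C Q) (difference l b)"
    proof (rule symbol_bound_weaken)
      fix k
      have "(v k * w k) * (v k / bracket k) \<le> 1 * (v k / bracket k)"
        using vw pos(2)[of k] by (intro mult_right_mono) auto
      then have "Q * ((v k * (w k / bracket k)) * v k) \<le> Q * (v k / bracket k)"
        using Q by (intro mult_left_mono) (simp_all add: field_simps)
      also have "\<dots> \<le> max C Q * (v k / bracket k)"
        using pos(2)[of k] by (intro mult_right_mono) auto
      finally show "Q * ((v k * (w k / bracket k)) * v k) \<le> max C Q * (v k / bracket k)" .
    qed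
    moreover have "norm (b k) \<le> max C Q * v k" for k
      using b pos(2)[of k] by (meson max.cobounded1 less_imp_le mult_right_mono order_trans)
    ultimately show "symbol_bound l v (Suc N) (max C Q) b"
      by (simp add: symbol_bound_Suc_iff)
  qed
qed

subsection \<open>Differences of smooth functions on the lattice\<close>

lemma partial_derivative_bound_difference:
  fixes f :: "real^'n \<Rightarrow> complex"
  assumes f: "smooth f" and B: "\<And>x. norm (partial_derivative l f x) \<le> B"
  shows "norm (f (x + axis l 1) - f x) \<le> B"
proof -
  have "norm (f (x + 1 *\<^sub>R axis l 1) - f (x + 0 *\<^sub>R axis l 1)) \<le> B * \<bar>1 - 0\<bar>"
    using smooth_has_partial[OF f, of x l] B
    by (intro differentiable_bound[where f="\<lambda>t. f (x + t *\<^sub>R axis l 1)" and S=UNIV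
        and f'="\<lambda>t u. u *\<^sub>R partial_derivative l f (x + t *\<^sub>R axis l 1)", unfolded real_norm_def])
      (auto simp: has_vector_derivative_def intro!: onorm_le mult_left_mono simp: mult.commute[of B])
  then show ?thesis by simp
qed

lemma funpow_partial_foldr: "(partial_derivative l ^^ r) f = foldr partial_derivative (replicate r l) f"
  by (simp add: foldr_replicate)

text \<open>The mean value inequality bounds the derivatives of order \<open>r\<close> of \<open>f(\<cdot> + e) - f\<close> by those of
  order \<open>r + 1\<close> of \<open>f\<close>, whence the induction.\<close>

lemma difference_smooth_le:
  fixes f :: "real^'n \<Rightarrow> complex"
  assumes "smooth f" and "\<And>x. norm ((partial_derivative l ^^ r) f x) \<le> B"
  shows "norm ((difference l ^^ r) (\<lambda>k. f (real_vec k)) k) \<le> B"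
  using assms
proof (induction r arbitrary: f)
  case (Suc r)
  let ?g = "\<lambda>x. f (x + axis l 1) - f x"
  have tr: "smooth (\<lambda>x. f (x + axis l 1))" by (rule smooth_translate[OF Suc.prems(1)])
  have g: "smooth ?g" using smooth_linear[OF tr Suc.prems(1), of 1 "-1"] by simp
  let ?D = "(partial_derivative l ^^ r) f"
  have "norm ((partial_derivative l ^^ r) ?g x) \<le> B" for x
  proof -
    have "(partial_derivative l ^^ r) ?g x = ?D (x + axis l 1) - ?D x"
      using fun_cong[OF foldr_partial_linear[OF tr Suc.prems(1), of "replicate r l" 1 "-1"], of x]
      unfolding funpow_partial_foldr
        foldr_partial_translate[where f=f and y="axis l 1" and js="replicate r l"]
      by (simp only: mult_1 mult_minus_left diff_conv_add_uminus)
    moreover have "norm (?D (x + axis l 1) - ?D x) \<le> B"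
    proof (rule partial_derivative_bound_difference)
      show "smooth ?D" unfolding funpow_partial_foldr by (rule smooth_foldr_partial[OF Suc.prems(1)])
      show "norm (partial_derivative l ?D x) \<le> B" for x using Suc.prems(2)[of x] by simp
    qed
    ultimately show ?thesis by simp
  qed
  from Suc.IH[OF g this]
  have "norm ((difference l ^^ r) (\<lambda>k. ?g (real_vec k)) k) \<le> B" .
  moreover have "(\<lambda>k. ?g (real_vec k)) = difference l (\<lambda>k. f (real_vec k))"
    by (simp add: difference_def fun_eq_iff)
  ultimately show ?case by (simp only: funpow_difference_Suc)
qed simp

section \<open>Integrable bounds for convolution kernels\<close>

text \<open>The distance from \<open>exp(i t)\<close> to 1, which is comparable to the distance from \<open>t\<close> to the
  multiples of \<open>2 * pi\<close>.\<close>

definition gap :: "real \<Rightarrow> real" where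
  "gap t = 2 * \<bar>sin (t / 2)\<bar>"

lemma gap_nonneg [simp]: "0 \<le> gap t"
  by (simp add: gap_def)

lemma norm_character_minus_1: "norm (character (- axis l 1) x - 1) = gap (x $ l)"
proof -
  have "character (- axis l 1) x = exp (\<i> * of_real (- (x $ l)))"
    by (simp add: character_def inner_axis')
  then show ?thesis using dist_exp_i_1[of "- (x $ l)"] by (simp add: gap_def)
qed

lemma quarter_le_sin:
  fixes u :: real
  assumes "0 \<le> u" "u \<le> pi / 2"
  shows "u / 4 \<le> sin u"
proof (cases "u \<le> pi / 3")
  case True
  show ?thesis
  proof (cases "u = 0")
    case False
    then have "0 < u" using assms by simp
    have "\<exists>z. 0 < z \<and> z < u \<and> sin u - sin 0 = (u - 0) * cos z"
      by (rule MVT2[OF \<open>0 < u\<close>]) (auto intro!: derivative_eq_intros)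
    then obtain z where z: "0 < z" "z < u" "sin u = u * cos z" by auto
    have "cos (pi / 3) \<le> cos z" using z True pi_gt_zero by (intro cos_monotone_0_pi_le) auto
    then have "1 / 4 \<le> cos z" by (simp add: cos_60)
    then have "u * (1 / 4) \<le> u * cos z" using assms by (intro mult_left_mono)
    then show ?thesis using z by simp
  qed simp
next
  case False
  have "sin (pi / 6) \<le> sin u" using False assms pi_gt_zero by (intro sin_monotone_2pi_le) auto
  then show ?thesis using assms pi_less_4 by (simp add: sin_30)
qed

lemma gap_ge:
  assumes "0 \<le> t" "t \<le> 2 * pi"
  shows "t / 4 \<le> gap t \<or> (2 * pi - t) / 4 \<le> gap t"
proof (cases "t \<le> pi")
  case True
  then have "t / 2 / 4 \<le> sin (t / 2)" using assms by (intro quarter_le_sin) auto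
  then have "t / 4 \<le> 2 * sin (t / 2)" by simp
  then have "t / 4 \<le> gap t" unfolding gap_def by (rule order_trans) simp
  then show ?thesis ..
next
  case False
  then have "(pi - t / 2) / 4 \<le> sin (pi - t / 2)" using assms by (intro quarter_le_sin) auto
  then have "(pi - t / 2) / 4 \<le> sin (t / 2)" by (simp only: sin_pi_minus)
  then have "(2 * pi - t) / 4 \<le> 2 * sin (t / 2)" by (simp add: field_simps)
  then have "(2 * pi - t) / 4 \<le> gap t" unfolding gap_def by (rule order_trans) simp
  then show ?thesis ..
qed

lemma nn_integral_powr_decay:
  fixes T n :: real
  assumes T: "0 < T" and n: "0 < n"
  shows "(\<integral>\<^sup>+t. ennreal ((1 + T * t) powr (- (1 + 1 / n))) * indicator {0..2 * pi} t \<partial>lborel) \<le> ennreal (n / T)"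
    "(\<integral>\<^sup>+t. ennreal ((1 + T * (2 * pi - t)) powr (- (1 + 1 / n))) * indicator {0..2 * pi} t \<partial>lborel)
      \<le> ennreal (n / T)"
proof -
  let ?q = "1 + 1 / n"
  have q: "- (1 / n) - 1 = - ?q" by simp
  have pos: "0 < 1 + T * t" if "0 \<le> t" for t using T that by (simp add: add_pos_nonneg)
  let ?F = "\<lambda>t. - (n / T) * (1 + T * t) powr (- (1 / n))"
  have F: "(?F has_real_derivative (1 + T * t) powr (- ?q)) (at t)" if "0 \<le> t" for t
  proof -
    have "((\<lambda>t. (1 + T * t) powr (- (1 / n))) has_real_derivative
        (- (1 / n)) * (1 + T * t) powr (- (1 / n) - 1) * T) (at t)"
      using pos[OF that] by (auto intro!: derivative_eq_intros DERIV_powr simp: powr_diff)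
    from DERIV_cmult[OF this, of "- (n / T)"] show ?thesis
      using T n unfolding q by simp
  qed
  let ?G = "\<lambda>t. (n / T) * (1 + T * (2 * pi - t)) powr (- (1 / n))"
  have G: "(?G has_real_derivative (1 + T * (2 * pi - t)) powr (- ?q)) (at t)" if "t \<le> 2 * pi" for t
  proof -
    have "(?F \<circ> (\<lambda>t. 2 * pi - t) has_real_derivative (1 + T * (2 * pi - t)) powr (- ?q) * (- 1)) (at t)"
      using that by (intro DERIV_chain F) (auto intro!: derivative_eq_intros)
    from DERIV_cmult[OF this, of "-1"] show ?thesis by (simp add: o_def)
  qed
  have "(\<integral>\<^sup>+t. ennreal ((1 + T * t) powr (- ?q)) * indicator {0..2 * pi} t \<partial>lborel) = ?F (2 * pi) - ?F 0"
    by (rule nn_integral_FTC_Icc) (use F in \<open>auto intro: DERIV_subset\<close>)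
  also have "\<dots> \<le> ennreal (n / T)"
    using T n by (intro ennreal_leI) simp
  finally show "(\<integral>\<^sup>+t. ennreal ((1 + T * t) powr (- ?q)) * indicator {0..2 * pi} t \<partial>lborel) \<le> ennreal (n / T)" .
  have "(\<integral>\<^sup>+t. ennreal ((1 + T * (2 * pi - t)) powr (- ?q)) * indicator {0..2 * pi} t \<partial>lborel) = ?G (2 * pi) - ?G 0"
    by (rule nn_integral_FTC_Icc) (use G in \<open>auto intro: DERIV_subset\<close>)
  also have "\<dots> \<le> ennreal (n / T)"
    using T n by (intro ennreal_leI) simp
  finally show "(\<integral>\<^sup>+t. ennreal ((1 + T * (2 * pi - t)) powr (- ?q)) * indicator {0..2 * pi} t \<partial>lborel) \<le> ennreal (n / T)" .
qed

lemma nn_integral_gap_decay: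
  fixes R n :: real
  assumes R: "0 < R" and n: "0 < n"
  shows "(\<integral>\<^sup>+t. ennreal ((1 + R * gap t) powr (- (1 + 1 / n))) * indicator {0..2 * pi} t \<partial>lborel)
    \<le> ennreal (8 * n / R)"
proof -
  let ?q = "1 + 1 / n"
  have q: "?q > 0" using n by (simp add: add_pos_pos)
  let ?a = "\<lambda>t. (1 + (R / 4) * t) powr (- ?q)" and ?b = "\<lambda>t. (1 + (R / 4) * (2 * pi - t)) powr (- ?q)"
  have le: "(1 + R * gap t) powr (- ?q) \<le> ?a t + ?b t" if t: "0 \<le> t" "t \<le> 2 * pi" for t
    using gap_ge[OF t]
  proof
    assume g: "t / 4 \<le> gap t"
    have "(1 + R * gap t) powr (- ?q) \<le> ?a t"
      using mult_left_mono[OF g, of R] R q t by (intro powr_mono2') (auto simp: add_pos_nonneg)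
    then show ?thesis by (simp add: add_increasing2)
  next
    assume g: "(2 * pi - t) / 4 \<le> gap t"
    have "(1 + R * gap t) powr (- ?q) \<le> ?b t"
      using mult_left_mono[OF g, of R] R q t by (intro powr_mono2') (auto simp: add_pos_nonneg)
    then show ?thesis by (simp add: add_increasing)
  qed
  have "(\<integral>\<^sup>+t. ennreal ((1 + R * gap t) powr (- ?q)) * indicator {0..2 * pi} t \<partial>lborel) \<le>
      (\<integral>\<^sup>+t. ennreal (?a t) * indicator {0..2 * pi} t + ennreal (?b t) * indicator {0..2 * pi} t \<partial>lborel)"
    using le by (intro nn_integral_mono) (auto simp: indicator_def simp flip: ennreal_plus intro: ennreal_leI)
  also have "\<dots> = (\<integral>\<^sup>+t. ennreal (?a t) * indicator {0..2 * pi} t \<partial>lborel) +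
      (\<integral>\<^sup>+t. ennreal (?b t) * indicator {0..2 * pi} t \<partial>lborel)"
    by (rule nn_integral_add) measurable
  also have "\<dots> \<le> ennreal (n / (R / 4)) + ennreal (n / (R / 4))"
    using R n by (intro add_mono nn_integral_powr_decay) auto
  also have "\<dots> = ennreal (8 * n / R)" using R n by (simp flip: ennreal_plus add: field_simps)
  finally show ?thesis .
qed

text \<open>The exponent \<open>1 + 1/n\<close> makes the factor in each coordinate integrable, and the exponents of the
  \<open>n\<close> coordinates add up to \<open>n + 1\<close>, the order of the differences in \<open>fourier_sum_decay\<close>.\<close>

definition decay :: "real \<Rightarrow> real^'n \<Rightarrow> real" where
  "decay R x = (\<Prod>i\<in>UNIV. (1 + R * gap (x $ i)) powr (- (1 + 1 / real CARD('n))))"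

lemma decay_nonneg [simp]: "0 \<le> decay R x"
  unfolding decay_def by (intro prod_nonneg) auto

lemma decay_measurable [measurable]: "decay R \<in> borel_measurable borel"
  unfolding decay_def[abs_def] gap_def by measurable

lemma decay_uminus: "decay R (- x) = decay R x"
  by (simp add: decay_def gap_def)

lemma decay_periodic: "periodic (decay R :: real^'n \<Rightarrow> real)"
proof -
  have "gap (t + 2 * pi) = gap t" for t
  proof -
    have "sin ((t + 2 * pi) / 2) = - sin (t / 2)" by (simp add: add_divide_distrib)
    then show ?thesis by (simp add: gap_def)
  qed
  then have "gap ((x + axis j (2 * pi)) $ i) = gap (x $ i)" for x :: "real^'n" and i j
    by (cases "i = j") (simp_all add: axis_def)
  then show ?thesis by (simp only: periodic_def decay_def) simp
qed

lemma prod_Basis_cart: "(\<Prod>b\<in>(Basis :: (real^'n) set). f (x \<bullet> b)) = (\<Prod>i\<in>UNIV. f (x $ i))"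
proof -
  have B: "(Basis :: (real^'n) set) = range (\<lambda>i. axis i 1)" by (auto simp: Basis_vec_def)
  show ?thesis unfolding B
    by (subst prod.reindex) (auto simp: inj_on_def axis_eq_axis inner_axis)
qed

lemma ennreal_power_mono: "a \<le> b \<Longrightarrow> a ^ n \<le> (b :: ennreal) ^ n"
  by (induction n) (auto intro: mult_mono)

lemma nn_integral_decay:
  assumes R: "0 < R"
  shows "(\<integral>\<^sup>+(x::real^'n). decay R x \<partial>torus_measure) \<le>
    ennreal ((8 * real CARD('n) / R) ^ CARD('n) / (2 * pi) ^ CARD('n))"
proof -
  let ?n = "real CARD('n)"
  let ?f = "\<lambda>t. ennreal ((1 + R * gap t) powr (- (1 + 1 / ?n))) * indicator {0..2 * pi} t"
  have [measurable]: "gap \<in> borel_measurable borel" unfolding gap_def[abs_def] by measurable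
  have "(\<integral>\<^sup>+(x::real^'n). indicator cell x * ennreal (decay R x) \<partial>lborel) \<le>
      (\<integral>\<^sup>+(x::real^'n). (\<Prod>b\<in>Basis. ?f (x \<bullet> b)) \<partial>lborel)"
  proof (rule nn_integral_mono)
    fix x :: "real^'n"
    show "indicator cell x * ennreal (decay R x) \<le> (\<Prod>b\<in>Basis. ?f (x \<bullet> b))"
    proof (cases "x \<in> cell")
      case True
      then have "\<And>i. x $ i \<in> {0..2 * pi}" by (auto simp: cell_def less_imp_le)
      then have "(\<Prod>i\<in>UNIV. ?f (x $ i)) = ennreal (decay R x)"
        unfolding decay_def by (simp add: prod_ennreal)
      moreover have "(\<Prod>b\<in>Basis. ?f (x \<bullet> b)) = (\<Prod>i\<in>UNIV. ?f (x $ i))"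
        by (rule prod_Basis_cart)
      ultimately show ?thesis using True by simp
    qed simp
  qed
  also have "\<dots> = (\<Prod>b\<in>(Basis :: (real^'n) set). integral\<^sup>N lborel ?f)"
    by (rule nn_integral_lborel_prod) auto
  also have "\<dots> \<le> (\<Prod>b\<in>(Basis :: (real^'n) set). ennreal (8 * ?n / R))"
    using R nn_integral_gap_decay[of R ?n] by (simp add: ennreal_power_mono)
  also have "\<dots> = ennreal ((8 * ?n / R) ^ CARD('n))"
    using R by (simp add: ennreal_power)
  finally have "(\<integral>\<^sup>+(x::real^'n). indicator cell x * ennreal (decay R x) \<partial>lborel) / ennreal ((2 * pi) ^ CARD('n))
      \<le> ennreal ((8 * ?n / R) ^ CARD('n)) / ennreal ((2 * pi) ^ CARD('n))"
    by (rule divide_right_mono_ennreal)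
  also have "\<dots> = ennreal ((8 * ?n / R) ^ CARD('n) / (2 * pi) ^ CARD('n))"
    using R by (intro divide_ennreal) auto
  finally show ?thesis by (subst nn_integral_torus) auto
qed

subsection \<open>Summation by parts\<close>

definition fourier_sum :: "(int^'n \<Rightarrow> 'e::complex_banach) \<Rightarrow> real^'n \<Rightarrow> 'e" where
  "fourier_sum d x = (\<Sum>\<^sub>\<infinity>k. character k x *\<^sub>C d k)"

lemma has_sum_finite_support:
  fixes f :: "'a \<Rightarrow> 'b::banach"
  assumes "finite F" "\<And>k. k \<notin> F \<Longrightarrow> f k = 0"
  shows "(f has_sum sum f F) UNIV"
  using assms by (intro has_sum_finite_neutralI) auto

lemma fourier_sum_eq:
  assumes "finite F" "\<And>k. k \<notin> F \<Longrightarrow> d k = 0"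
  shows "fourier_sum d x = (\<Sum>k\<in>F. character k x *\<^sub>C d k)"
  unfolding fourier_sum_def using assms by (intro infsumI has_sum_finite_support) auto

text \<open>A shift of the summation index moves the difference from the coefficients to the characters.\<close>

lemma fourier_sum_difference:
  fixes d :: "int^'n \<Rightarrow> 'e::complex_banach"
  assumes "finite {k. d k \<noteq> 0}"
  shows "fourier_sum (difference l d) x = (character (- axis l 1) x - 1) *\<^sub>C fourier_sum d x"
proof -
  let ?t = "\<lambda>k. character k x *\<^sub>C d k"
  have s: "(?t has_sum fourier_sum d x) UNIV"
    unfolding fourier_sum_def
    by (rule has_sum_infsum, rule has_sum_imp_summable, rule has_sum_finite_support[OF assms]) auto
  have b: "bij_betw (\<lambda>k. k + axis l 1) UNIV (UNIV :: (int^'n) set)"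
    by (rule bij_betw_byWitness[where f'="\<lambda>k. k - axis l 1"]) auto
  have "((\<lambda>k. ?t (k + axis l 1)) has_sum fourier_sum d x) UNIV"
    using s has_sum_reindex_bij_betw[OF b, of ?t] by simp
  from has_sum_bounded_linear[OF bounded_linear_scaleC[of "character (- axis l 1) x"] this]
  have "((\<lambda>k. character (- axis l 1) x *\<^sub>C ?t (k + axis l 1)) has_sum
      character (- axis l 1) x *\<^sub>C fourier_sum d x) UNIV" .
  moreover have "character (- axis l 1) x *\<^sub>C ?t (k + axis l 1) = character k x *\<^sub>C d (k + axis l 1)" for k
    by (simp add: scaleC_scaleC flip: character_add)
  ultimately have s1: "((\<lambda>k. character k x *\<^sub>C d (k + axis l 1)) has_sum
      character (- axis l 1) x *\<^sub>C fourier_sum d x) UNIV" by simp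
  have s2: "((\<lambda>k. - ?t k) has_sum - fourier_sum d x) UNIV"
    using s by (simp add: has_sum_uminus)
  have "((\<lambda>k. character k x *\<^sub>C difference l d k) has_sum
      (character (- axis l 1) x - 1) *\<^sub>C fourier_sum d x) UNIV"
    using has_sum_add[OF s1 s2]
    by (simp add: difference_def scaleC_diff_right scaleC_add_left scaleC_one
        diff_conv_add_uminus[of _ "1::complex"] scaleC_minus_left del: add_uminus_conv_diff)
      (simp add: scaleC_one)
  then show ?thesis unfolding fourier_sum_def by (rule infsumI)
qed

lemma fourier_sum_funpow_difference:
  fixes d :: "int^'n \<Rightarrow> 'e::complex_banach"
  assumes F: "finite F" "\<And>r k. r \<le> N \<Longrightarrow> k \<notin> F \<Longrightarrow> (difference l ^^ r) d k = 0"
  shows "norm (fourier_sum ((difference l ^^ N) d) x) = gap (x $ l) ^ N * norm (fourier_sum d x)"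
  using F(2)
proof (induction N)
  case (Suc N)
  have "finite {k. (difference l ^^ N) d k \<noteq> 0}"
    by (rule finite_subset[OF _ F(1)]) (use Suc.prems[of N] in auto)
  from fourier_sum_difference[OF this]
  show ?case
    using Suc by (simp add: norm_scaleC norm_character_minus_1)
qed simp

text \<open>Without differences the kernel is bounded, and with \<open>N\<close> differences in the direction
  \<open>l\<close> it decays like the power \<open>N\<close> of the distance in that coordinate. Taking the best
  coordinate gives decay in all of them.\<close>

lemma fourier_sum_decay:
  fixes d :: "int^'n \<Rightarrow> 'e::complex_banach"
  assumes F: "finite F" "\<And>l r k. r \<le> N \<Longrightarrow> k \<notin> F \<Longrightarrow> (difference l ^^ r) d k = 0"
    and N: "N = CARD('n) + 1" and R: "0 < R" and M: "0 \<le> M"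
    and b0: "\<And>k. norm (d k) \<le> M"
    and bN: "\<And>l k. norm ((difference l ^^ N) d k) \<le> M / R ^ N"
  shows "norm (\<Sum>k\<in>F. character k x *\<^sub>C d k) \<le> 2 ^ N * real (card F) * M * decay R x"
proof -
  let ?n = "real CARD('n)" and ?K = "norm (fourier_sum d x)"
  define B where "B = real (card F) * M"
  have B: "0 \<le> B" using M by (simp add: B_def)
  have sum_le: "norm (fourier_sum e x) \<le> real (card F) * C"
    if "\<And>k. k \<notin> F \<Longrightarrow> e k = 0" "\<And>k. norm (e k) \<le> C" for e :: "int^'n \<Rightarrow> 'e" and C
  proof -
    have "fourier_sum e x = (\<Sum>k\<in>F. character k x *\<^sub>C e k)"
      by (rule fourier_sum_eq[OF F(1)]) (rule that(1))
    also have "norm \<dots> \<le> (\<Sum>k\<in>F. norm (character k x *\<^sub>C e k))"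
      by (rule norm_sum)
    also have "\<dots> \<le> (\<Sum>k\<in>F. C)" by (intro sum_mono) (simp add: norm_scaleC that(2))
    finally show ?thesis by simp
  qed
  have K0: "?K \<le> B" unfolding B_def using F(2)[of 0] b0 by (intro sum_le) auto
  have KN: "(R * gap (x $ l)) ^ N * ?K \<le> B" for l
  proof -
    have "norm (fourier_sum ((difference l ^^ N) d) x) = gap (x $ l) ^ N * ?K"
      by (rule fourier_sum_funpow_difference[OF F(1)]) (rule F(2))
    moreover have "norm (fourier_sum ((difference l ^^ N) d) x) \<le> real (card F) * (M / R ^ N)"
      using F(2)[of N] bN by (intro sum_le) auto
    ultimately have "gap (x $ l) ^ N * ?K \<le> real (card F) * (M / R ^ N)" by simp
    then have "R ^ N * (gap (x $ l) ^ N * ?K) \<le> R ^ N * (real (card F) * (M / R ^ N))"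
      using R by (intro mult_left_mono) auto
    then show ?thesis using R by (simp add: B_def power_mult_distrib mult.assoc)
  qed
  define g where "g = Max (range (\<lambda>l. gap (x $ l)))"
  have "g \<in> range (\<lambda>l. gap (x $ l))" unfolding g_def by (intro Max_in) auto
  then obtain l where l: "g = gap (x $ l)" by blast
  have g: "gap (x $ i) \<le> g" for i unfolding g_def by (intro Max_ge) auto
  have g0: "0 \<le> R * g" using R l by simp
  have "(1 + R * g) ^ N * ?K \<le> 2 ^ N * B"
  proof (cases "R * g \<le> 1")
    case True
    have "(1 + R * g) ^ N * ?K \<le> 2 ^ N * ?K"
      using True g0 by (intro mult_right_mono power_mono) auto
    also have "\<dots> \<le> 2 ^ N * B" using K0 by simp
    finally show ?thesis .
  next
    case False
    have "(1 + R * g) ^ N * ?K \<le> (2 * (R * g)) ^ N * ?K"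
      using False g0 by (intro mult_right_mono power_mono) auto
    also have "\<dots> = 2 ^ N * ((R * g) ^ N * ?K)" by (simp add: power_mult_distrib mult.assoc)
    also have "\<dots> \<le> 2 ^ N * B" using KN[of l] l by simp
    finally show ?thesis .
  qed
  moreover have "inverse ((1 + R * g) ^ N) \<le> decay R x"
  proof -
    have "inverse ((1 + R * g) ^ N) = (\<Prod>i\<in>(UNIV::'n set). (1 + R * g) powr (- (1 + 1 / ?n)))"
    proof -
      have pos: "0 < 1 + R * g" using g0 by simp
      have "(\<Prod>i\<in>(UNIV::'n set). (1 + R * g) powr (- (1 + 1 / ?n))) =
          ((1 + R * g) powr (- (1 + 1 / ?n))) powr ?n"
        using pos by (simp add: powr_realpow)
      also have "\<dots> = (1 + R * g) powr (- real N)"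
      proof -
        have "(- (1 + 1 / ?n)) * ?n = - real N" by (simp add: N field_simps)
        then show ?thesis by (simp only: powr_powr)
      qed
      also have "\<dots> = inverse ((1 + R * g) ^ N)"
        using pos by (simp add: powr_minus powr_realpow)
      finally show ?thesis by simp
    qed
    also have "\<dots> \<le> decay R x"
      unfolding decay_def using R g g0 order_trans[of "-1::real" 0 "1 / ?n"]
      by (intro prod_mono conjI powr_mono2') (auto intro: add_pos_nonneg)
    finally show ?thesis .
  qed
  ultimately have "?K \<le> 2 ^ N * B * decay R x"
  proof -
    assume 1: "(1 + R * g) ^ N * ?K \<le> 2 ^ N * B" and 2: "inverse ((1 + R * g) ^ N) \<le> decay R x"
    have "?K = inverse ((1 + R * g) ^ N) * ((1 + R * g) ^ N * ?K)"
      using g0 by simp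
    also have "\<dots> \<le> decay R x * (2 ^ N * B)"
      by (rule mult_mono[OF 2 1]) (use g0 in auto)
    finally show ?thesis by (simp add: mult.commute)
  qed
  moreover have "fourier_sum d x = (\<Sum>k\<in>F. character k x *\<^sub>C d k)"
    using F(2)[of 0] by (intro fourier_sum_eq F(1)) auto
  ultimately show ?thesis by (simp add: B_def mult.assoc)
qed

section \<open>Fourier multipliers on Besov spaces\<close>

subsection \<open>Dyadic decompositions on the lattice\<close>

lemma dyadic_smooth: "dyadic_decomposition \<phi> \<Longrightarrow> smooth (\<phi> j)"
  by (simp add: dyadic_decomposition_def schwartz_def)

text \<open>The bound is strict because the set where \<open>\<phi> j\<close> is non-zero is open.\<close>

lemma dyadic_upper:
  fixes \<phi> :: "nat \<Rightarrow> real^'n \<Rightarrow> complex"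
  assumes dy: "dyadic_decomposition \<phi>" and nz: "\<phi> j \<xi> \<noteq> 0"
  shows "norm \<xi> < 2 ^ (j + 1)"
proof -
  let ?S = "{\<xi>. \<phi> j \<xi> \<noteq> 0}"
  have "open ?S"
    by (rule open_Collect_neq) (auto intro: smooth_continuous dyadic_smooth[OF dy])
  moreover have "?S \<subseteq> cball 0 (2 ^ (j + 1))"
  proof (cases "j = 0")
    case True
    have "closure ?S \<subseteq> {\<xi>. norm \<xi> \<le> 2}"
      using dy True unfolding dyadic_decomposition_def by simp
    then show ?thesis using closure_subset[of ?S] True by auto
  next
    case False
    then have "j \<ge> 1" by simp
    then have "closure ?S \<subseteq> {\<xi>. 2 ^ (j - 1) \<le> norm \<xi> \<and> norm \<xi> \<le> 2 ^ (j + 1)}"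
      using dy unfolding dyadic_decomposition_def by blast
    then show ?thesis using closure_subset[of ?S] by auto
  qed
  ultimately have "?S \<subseteq> interior (cball 0 (2 ^ (j + 1)))" by (rule interior_maximal[rotated])
  then show ?thesis using nz by (auto simp: interior_cball)
qed

lemma dyadic_lower:
  assumes dy: "dyadic_decomposition \<phi>" and nz: "\<phi> j \<xi> \<noteq> 0" and j: "j \<ge> 1"
  shows "2 ^ (j - 1) \<le> norm \<xi>"
proof -
  have "closure {\<xi>. \<phi> j \<xi> \<noteq> 0} \<subseteq> {\<xi>. 2 ^ (j - 1) \<le> norm \<xi> \<and> norm \<xi> \<le> 2 ^ (j + 1)}"
    using dy j unfolding dyadic_decomposition_def by blast
  then show ?thesis using closure_subset[of "{\<xi>. \<phi> j \<xi> \<noteq> 0}"] nz by auto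
qed

lemma dyadic_disjoint:
  assumes dy: "dyadic_decomposition \<phi>" and nz: "\<phi> j \<xi> \<noteq> 0" and i: "i \<noteq> j" "i \<noteq> Suc j" "Suc i \<noteq> j"
  shows "\<phi> i \<xi> = 0"
proof (rule ccontr)
  assume nz': "\<phi> i \<xi> \<noteq> 0"
  have *: False if "\<phi> a \<xi> \<noteq> 0" "\<phi> b \<xi> \<noteq> 0" "a + 2 \<le> b" for a b
  proof -
    have "norm \<xi> < 2 ^ (a + 1)" by (rule dyadic_upper[OF dy that(1)])
    also have "(2::real) ^ (a + 1) \<le> 2 ^ (b - 1)" using that(3) by (intro power_increasing) auto
    also have "\<dots> \<le> norm \<xi>" using that(3) by (intro dyadic_lower[OF dy that(2)]) auto
    finally show False by simp
  qed
  show False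
  proof (cases "i < j")
    case True
    then show False using *[OF nz' nz] i by simp
  next
    case False
    then show False using *[OF nz nz'] i by simp
  qed
qed

lemma dyadic_partition:
  assumes dy: "dyadic_decomposition \<phi>" and nz: "\<phi> j \<xi> \<noteq> 0"
  shows "(if j = 0 then 0 else \<phi> (j - 1) \<xi>) + \<phi> j \<xi> + \<phi> (Suc j) \<xi> = 1"
proof -
  let ?I = "{j - 1, j, Suc j}"
  have "(\<lambda>i. \<phi> i \<xi>) sums 1" using dy by (simp add: dyadic_decomposition_def)
  moreover have "(\<lambda>i. \<phi> i \<xi>) sums (\<Sum>i\<in>?I. \<phi> i \<xi>)"
  proof (rule sums_finite)
    fix i assume "i \<notin> ?I"
    then have "i \<noteq> j" "i \<noteq> Suc j" "Suc i \<noteq> j" by auto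
    then show "\<phi> i \<xi> = 0" by (rule dyadic_disjoint[OF dy nz])
  qed simp
  ultimately have "(\<Sum>i\<in>?I. \<phi> i \<xi>) = 1" using sums_unique2 by blast
  then show ?thesis by (cases j) (simp_all add: add.assoc)
qed

lemma dyadic_derivative:
  assumes dy: "dyadic_decomposition \<phi>"
  shows "\<exists>c>0. \<forall>j \<xi>. norm ((partial_derivative l ^^ r) (\<phi> j) \<xi>) \<le> c * 2 powr (- real (j * r))"
proof -
  have "\<exists>c>0. \<forall>j \<xi>. norm (multi_derivative (single_index l r) (\<phi> j) \<xi>) \<le>
      c * 2 powr (- real (j * order_of (single_index l r)))"
    using dy unfolding dyadic_decomposition_def by blast
  then show ?thesis by (simp add: multi_derivative_def multi_power_single_index)
qed

definition cscale :: "complex \<Rightarrow> 'e::complex_banach \<Rightarrow>\<^sub>L 'e" where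
  "cscale z = Blinfun (\<lambda>x. z *\<^sub>C x)"

lemma cscale_apply [simp]: "blinfun_apply (cscale z) x = z *\<^sub>C x"
  unfolding cscale_def by (simp add: bounded_linear_Blinfun_apply bounded_linear_scaleC)

lemma norm_cscale_le: "norm (cscale z :: 'e::complex_banach \<Rightarrow>\<^sub>L 'e) \<le> norm z"
  by (rule norm_blinfun_bound) (simp_all add: norm_scaleC)

lemma cscale_diff: "cscale (z - w) = (cscale z - cscale w :: 'e::complex_banach \<Rightarrow>\<^sub>L 'e)"
  by (rule blinfun_eqI)
    (simp add: blinfun.diff_left diff_conv_add_uminus[of z] scaleC_add_left scaleC_minus_left
      del: add_uminus_conv_diff)

lemma norm_shift_le:
  fixes k :: "int^'n"
  shows "norm (real_vec k) \<le> norm (real_vec (k + axis l (int i))) + real i"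
  "norm (real_vec (k + axis l (int i))) \<le> norm (real_vec k) + real i"
proof -
  have e: "real_vec (k + axis l (int i)) = real_vec k + axis l (real i)"
    by (simp add: vec_eq_iff axis_def)
  have n: "norm (axis l (real i) :: real^'n) = real i"
  proof -
    have "axis l (real i) = real i *\<^sub>R (axis l 1 :: real^'n)" by (simp add: vec_eq_iff axis_def)
    then show ?thesis by simp
  qed
  show "norm (real_vec (k + axis l (int i))) \<le> norm (real_vec k) + real i"
    unfolding e using norm_triangle_ineq[of "real_vec k" "axis l (real i)"] n by simp
  show "norm (real_vec k) \<le> norm (real_vec (k + axis l (int i))) + real i"
    unfolding e using norm_triangle_ineq4[of "real_vec k + axis l (real i)" "axis l (real i)"] n by simp
qed

text \<open>Where differences of \<open>\<phi> j\<close> on the lattice do not vanish, the bracket is comparable to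
  \<open>2 ^ j\<close>.\<close>

lemma dyadic_bracket:
  assumes dy: "dyadic_decomposition \<phi>" and nz: "\<phi> j (real_vec (k + axis l (int i))) \<noteq> 0" and i: "i \<le> N"
  shows "bracket k \<le> (4 * real N + 4) * 2 ^ j" "2 ^ j \<le> (4 * real N + 4) * bracket k"
    "norm (real_vec k) \<le> 2 ^ (j + 1) + real N"
proof -
  let ?y = "real_vec (k + axis l (int i))"
  have two: "(1::real) \<le> 2 ^ j" by simp
  have Nj: "real N * 1 \<le> real N * 2 ^ j" by (intro mult_left_mono two) simp
  have up: "norm ?y < 2 ^ (j + 1)" by (rule dyadic_upper[OF dy nz])
  show k: "norm (real_vec k) \<le> 2 ^ (j + 1) + real N"
    using norm_shift_le(1)[of k l i] up i by linarith
  have "bracket k \<le> 1 + (2 ^ (j + 1) + real N)" using bracket_bounds(2)[of k] k by linarith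
  moreover have "(4 * real N + 4) * 2 ^ j = 4 * (real N * 2 ^ j) + 4 * 2 ^ j"
    by (simp add: algebra_simps)
  moreover have "0 \<le> real N * 2 ^ j" by simp
  moreover have "(2::real) ^ (j + 1) = 2 * 2 ^ j" by simp
  ultimately show "bracket k \<le> (4 * real N + 4) * 2 ^ j" using two Nj by linarith
  show "2 ^ j \<le> (4 * real N + 4) * bracket k"
  proof (cases "2 ^ j \<le> 4 * real N + 4")
    case True
    then have "2 ^ j \<le> (4 * real N + 4) * 1" by simp
    also have "\<dots> \<le> (4 * real N + 4) * bracket k" by (intro mult_left_mono bracket_ge_1) simp
    finally show ?thesis .
  next
    case False
    then have "j \<noteq> 0" by (cases j) auto
    then have j: "j \<ge> 1" by simp
    have pj: "(2::real) ^ j = 2 * 2 ^ (j - 1)" using j by (cases j) auto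
    have "2 ^ (j - 1) \<le> norm ?y" by (rule dyadic_lower[OF dy nz j])
    also have "\<dots> \<le> norm (real_vec k) + real N" using norm_shift_le(2)[of k l i] i by linarith
    also have "\<dots> \<le> bracket k + real N" using bracket_bounds(1)[of k] by simp
    finally have "2 ^ j \<le> 2 * bracket k + 2 * real N" using pj by simp
    then have "2 ^ j \<le> 4 * bracket k" using False by linarith
    also have "\<dots> \<le> (4 * real N + 4) * bracket k" by (intro mult_right_mono) auto
    finally show ?thesis .
  qed
qed

text \<open>Derivatives of order \<open>r\<close> of \<open>\<phi> j\<close> are of size \<open>2 ^ (- j * r)\<close>, which is the power \<open>- r\<close> of the
  bracket wherever the difference does not vanish. All constants are uniform in \<open>j\<close>.\<close>

lemma dyadic_symbol_bound:
  fixes \<phi> :: "nat \<Rightarrow> real^'n \<Rightarrow> complex"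
  assumes dy: "dyadic_decomposition \<phi>"
  shows "\<exists>C\<ge>0. \<forall>l j. symbol_bound l (\<lambda>_. 1) N C
    (\<lambda>k. cscale (\<phi> j (real_vec k)) :: 'e::complex_banach \<Rightarrow>\<^sub>L 'e)"
proof -
  have "\<forall>lr. \<exists>c>0. \<forall>j \<xi>. norm ((partial_derivative (fst lr) ^^ snd lr) (\<phi> j) \<xi>) \<le>
      c * 2 powr (- real (j * snd lr))"
    using dyadic_derivative[OF dy] by blast
  from choice[OF this] obtain c where c0: "\<And>lr. c lr > 0"
    and c: "\<And>l r j \<xi>. norm ((partial_derivative l ^^ r) (\<phi> j) \<xi>) \<le> c (l, r) * 2 powr (- real (j * r))"
    by (metis fst_conv snd_conv)
  let ?D = "4 * real N + 4"
  define C where "C = (\<Sum>lr\<in>UNIV \<times> {..N}. c lr) * ?D ^ N"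
  have C: "C \<ge> 0" unfolding C_def using c0 by (intro mult_nonneg_nonneg sum_nonneg) (auto intro: less_imp_le)
  have "norm ((difference l ^^ r) (\<lambda>k. cscale (\<phi> j (real_vec k)) :: 'e \<Rightarrow>\<^sub>L 'e) k) \<le>
      C * 1 * bracket k powr (- real r)" if r: "r \<le> N" for l j r k
  proof -
    let ?d = "(difference l ^^ r) (\<lambda>k. \<phi> j (real_vec k)) k"
    have "norm ((difference l ^^ r) (\<lambda>k. cscale (\<phi> j (real_vec k)) :: 'e \<Rightarrow>\<^sub>L 'e) k) \<le> norm ?d"
      unfolding funpow_difference_linear[where T=cscale, OF cscale_diff] by (rule norm_cscale_le)
    also have "\<dots> \<le> C * bracket k powr (- real r)"
    proof (cases "?d = 0")
      case False
      from funpow_difference_support[OF this] obtain i where i: "i \<le> r"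
        "\<phi> j (real_vec (k + axis l (int i))) \<noteq> 0" by blast
      have b: "bracket k \<le> ?D * 2 ^ j" using dyadic_bracket(1)[OF dy i(2)] i(1) r by simp
      have "norm ?d \<le> c (l, r) * 2 powr (- real (j * r))"
        by (rule difference_smooth_le[OF dyadic_smooth[OF dy] c])
      also have "2 powr (- real (j * r)) = (2 ^ j) powr (- real r)"
        by (simp add: powr_powr flip: powr_realpow)
      also have "\<dots> \<le> (bracket k / ?D) powr (- real r)"
        using b by (intro powr_mono2') (auto simp: field_simps)
      also have "\<dots> = ?D ^ r * bracket k powr (- real r)"
        by (simp add: powr_divide powr_minus powr_realpow field_simps)
      also have "\<dots> \<le> ?D ^ N * bracket k powr (- real r)"
        using r by (intro mult_right_mono power_increasing) auto
      also have "c (l, r) * (?D ^ N * bracket k powr (- real r)) \<le>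
          (\<Sum>lr\<in>UNIV \<times> {..N}. c lr) * (?D ^ N * bracket k powr (- real r))"
        using r c0 by (intro mult_right_mono member_le_sum) (auto intro: less_imp_le)
      finally show ?thesis using c0[of "(l, r)"] by (simp add: C_def mult.assoc mult_left_mono)
    qed (use C in simp)
    finally show ?thesis by simp
  qed
  then show ?thesis using C unfolding symbol_bound_def by blast
qed

subsection \<open>Estimates for single blocks\<close>

lemma card_lattice_box:
  "finite {k::int^'n. \<forall>i. \<bar>k $ i\<bar> \<le> int M}"
  "card {k::int^'n. \<forall>i. \<bar>k $ i\<bar> \<le> int M} \<le> (2 * M + 1) ^ CARD('n)"
proof -
  let ?P = "PiE (UNIV::'n set) (\<lambda>_. {- int M..int M})"
  have fin: "finite ?P" by (intro finite_PiE) auto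
  have "vec_nth ` {k::int^'n. \<forall>i. \<bar>k $ i\<bar> \<le> int M} \<subseteq> ?P"
    by (auto simp: abs_le_iff minus_le_iff)
  then have *: "inj_on vec_nth {k::int^'n. \<forall>i. \<bar>k $ i\<bar> \<le> int M}"
    "vec_nth ` {k::int^'n. \<forall>i. \<bar>k $ i\<bar> \<le> int M} \<subseteq> ?P"
    by (auto simp: inj_on_def vec_nth_inject)
  show "finite {k::int^'n. \<forall>i. \<bar>k $ i\<bar> \<le> int M}" by (rule inj_on_finite[OF * fin])
  have "card {k::int^'n. \<forall>i. \<bar>k $ i\<bar> \<le> int M} \<le> card ?P" by (rule card_inj_on_le[OF * fin])
  also have "card ?P = (2 * M + 1) ^ CARD('n)"
    by (subst card_PiE) (auto simp: nat_add_distrib nat_mult_distrib)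
  finally show "card {k::int^'n. \<forall>i. \<bar>k $ i\<bar> \<le> int M} \<le> (2 * M + 1) ^ CARD('n)" .
qed

lemma powr_comparable:
  fixes x y D t :: real
  assumes "0 < x" "0 < y" "1 \<le> D" "x \<le> D * y" "y \<le> D * x"
  shows "x powr t \<le> D powr \<bar>t\<bar> * y powr t"
proof (cases "t \<ge> 0")
  case True
  then have "x powr t \<le> (D * y) powr t" using assms by (intro powr_mono2) auto
  then show ?thesis using True assms by (simp add: powr_mult)
next
  case False
  then have "y powr (- t) \<le> (D * x) powr (- t)" using assms by (intro powr_mono2) auto
  then have "y powr (- t) \<le> D powr (- t) * x powr (- t)" using assms by (simp add: powr_mult)
  then show ?thesis using False assms by (simp add: powr_minus field_simps)
qed

lemma moderate_bracket_powr: "moderate l (2 powr \<bar>t\<bar>) (\<lambda>k. bracket k powr t)"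
  unfolding moderate_def using bracket_powr_shift by auto

text \<open>In the block \<open>j\<close> the symbol lives on about \<open>2 ^ (j * n)\<close> frequencies, where it is of size
  \<open>A * 2 ^ (j * \<sigma>)\<close>, and each difference gains a factor \<open>2 ^ (- j)\<close>. The kernel is thus bounded by
  the product of these two numbers with \<open>decay (2 ^ j)\<close>. The integral of the latter is
  of size \<open>2 ^ (- j * n)\<close>, which cancels the number of frequencies.\<close>

lemma dyadic_block_bound:
  fixes \<phi> :: "nat \<Rightarrow> real^'n \<Rightarrow> complex"
  assumes dy: "dyadic_decomposition \<phi>" and p: "1 \<le> p" and N: "N = CARD('n) + 1"
  shows "\<exists>K>0. \<forall>A>0. \<forall>(b :: int^'n \<Rightarrow> 'e::complex_banach \<Rightarrow>\<^sub>L 'e).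
    (\<forall>k z v. blinfun_apply (b k) (z *\<^sub>C v) = z *\<^sub>C blinfun_apply (b k) v) \<longrightarrow>
    (\<forall>l. symbol_bound l (\<lambda>k. bracket k powr \<sigma>) N A b) \<longrightarrow>
    (\<forall>j u. distribution_norm p (torus_op (\<lambda>k. cscale (\<phi> j (real_vec k)) o\<^sub>L b k) u) \<le>
      ennreal (K * A * 2 powr (real j * \<sigma>)) * distribution_norm p u)"
proof -
  let ?n = "CARD('n)"
  obtain C where C: "C \<ge> 0" "\<And>l j. symbol_bound l (\<lambda>_. 1) N C
      (\<lambda>k. cscale (\<phi> j (real_vec k)) :: 'e \<Rightarrow>\<^sub>L 'e)"
    using dyadic_symbol_bound[OF dy, of N] by blast
  have c0: "0 \<le> 2 powr \<bar>\<sigma>\<bar>" by simp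
  have "\<forall>l::'n. \<exists>K\<ge>0. \<forall>w v A B (f :: int^'n \<Rightarrow> 'e \<Rightarrow>\<^sub>L 'e) (g :: int^'n \<Rightarrow> 'e \<Rightarrow>\<^sub>L 'e).
    (\<forall>k. 0 < w k) \<longrightarrow> moderate l (2 powr \<bar>\<sigma>\<bar>) v \<longrightarrow> 0 \<le> A \<longrightarrow> 0 \<le> B \<longrightarrow>
    symbol_bound l w N A f \<longrightarrow> symbol_bound l v N B g \<longrightarrow>
    symbol_bound l (\<lambda>k. w k * v k) N (K * A * B) (\<lambda>k. f k o\<^sub>L g k)"
    using symbol_bound_compose[OF c0] by (intro allI)
  from choice[OF this] obtain K1 where K1:
    "\<forall>l::'n. 0 \<le> K1 l \<and> (\<forall>w v A B (f :: int^'n \<Rightarrow> 'e \<Rightarrow>\<^sub>L 'e) (g :: int^'n \<Rightarrow> 'e \<Rightarrow>\<^sub>L 'e).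
    (\<forall>k. 0 < w k) \<longrightarrow> moderate l (2 powr \<bar>\<sigma>\<bar>) v \<longrightarrow> 0 \<le> A \<longrightarrow> 0 \<le> B \<longrightarrow>
    symbol_bound l w N A f \<longrightarrow> symbol_bound l v N B g \<longrightarrow>
    symbol_bound l (\<lambda>k. w k * v k) N (K1 l * A * B) (\<lambda>k. f k o\<^sub>L g k))" by (elim exE)
  define K2 where "K2 = (\<Sum>l\<in>UNIV. K1 l) * C"
  have K2: "K2 \<ge> 0" unfolding K2_def using K1 C(1) by (intro mult_nonneg_nonneg sum_nonneg) auto
  define D where "D = 4 * real N + 4"
  have D: "D \<ge> 1" by (simp add: D_def)
  define K where "K = 2 * (1 + 2 ^ N * (2 * real N + 5) ^ ?n * K2 * D powr (\<bar>\<sigma>\<bar> + real N) *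
    ((8 * real ?n) ^ ?n / (2 * pi) ^ ?n))"
  have Kpos: "K > 0" unfolding K_def using K2 by (intro mult_pos_pos add_pos_nonneg mult_nonneg_nonneg) auto
  show ?thesis
  proof (intro exI[of _ K] conjI allI impI Kpos)
    fix A and b :: "int^'n \<Rightarrow> 'e \<Rightarrow>\<^sub>L 'e" and j u
    assume A: "0 < A" and lin: "\<forall>k z v. b k (z *\<^sub>C v) = z *\<^sub>C b k v"
      and b: "\<forall>l. symbol_bound l (\<lambda>k. bracket k powr \<sigma>) N A b"
    define R :: real where "R = 2 ^ j"
    have R: "R > 0" by (simp add: R_def)
    define c where "c k = (cscale (\<phi> j (real_vec k)) :: 'e \<Rightarrow>\<^sub>L 'e) o\<^sub>L b k" for k
    define M where "M = 2 ^ (j + 1) + N"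
    define F where "F = {k::int^'n. \<forall>i. \<bar>k $ i\<bar> \<le> int M}"
    have F: "finite F" unfolding F_def by (rule card_lattice_box)
    have sb: "symbol_bound l (\<lambda>k. bracket k powr \<sigma>) N (K2 * A) c" for l
    proof -
      have "symbol_bound l (\<lambda>k. 1 * bracket k powr \<sigma>) N (K1 l * C * A) c"
        unfolding c_def using C(1) A b
        by (intro K1[rule_format, THEN conjunct2, rule_format, OF _ moderate_bracket_powr _ _ C(2)]) auto
      then show ?thesis
      proof (rule symbol_bound_weaken)
        fix k
        have "K1 l \<le> (\<Sum>l\<in>UNIV. K1 l)" using K1 by (intro member_le_sum) auto
        then have "K1 l * C * A \<le> K2 * A"
          unfolding K2_def using C(1) A by (intro mult_right_mono) auto
        then show "K1 l * C * A * (1 * bracket k powr \<sigma>) \<le> K2 * A * bracket k powr \<sigma>"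
          by (simp add: mult_right_mono)
      qed
    qed
    have supp: "bracket k \<le> D * R \<and> R \<le> D * bracket k \<and> k \<in> F"
      if nz: "(difference l ^^ r) c k \<noteq> 0" and r: "r \<le> N" for l r k
    proof -
      obtain i where i: "i \<le> r" "c (k + axis l (int i)) \<noteq> 0"
        using funpow_difference_support[OF nz] by blast
      have "\<phi> j (real_vec (k + axis l (int i))) \<noteq> 0"
      proof
        assume "\<phi> j (real_vec (k + axis l (int i))) = 0"
        then have "c (k + axis l (int i)) = 0" by (intro blinfun_eqI) (simp add: c_def)
        then show False using i by simp
      qed
      note bd = dyadic_bracket[OF dy this, of N]
      have "k \<in> F"
        unfolding F_def
      proof (intro CollectI allI)
        fix i'
        have "\<bar>real_vec k $ i'\<bar> \<le> norm (real_vec k)" by (rule component_le_norm_cart)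
        also have "\<dots> \<le> 2 ^ (j + 1) + real N" using bd(3) i r by simp
        finally have "real_of_int \<bar>k $ i'\<bar> \<le> real_of_int (int M)" by (simp add: M_def)
        then show "\<bar>k $ i'\<bar> \<le> int M" by (simp only: of_int_le_iff)
      qed
      then show ?thesis using bd(1,2) i r by (simp add: D_def R_def)
    qed
    define G where "G = K2 * A * D powr (\<bar>\<sigma>\<bar> + real N) * R powr \<sigma>"
    have G0: "G \<ge> 0" unfolding G_def using K2 A by simp
    have Gr: "norm ((difference l ^^ r) c k) \<le> G / R ^ r" if r: "r \<le> N" for l r k
    proof (cases "(difference l ^^ r) c k = 0")
      case True
      then show ?thesis using G0 R by simp
    next
      case False
      have "norm ((difference l ^^ r) c k) \<le> K2 * A * bracket k powr \<sigma> * bracket k powr (- real r)"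
        by (rule symbol_boundD[OF sb r])
      also have "\<dots> = K2 * A * bracket k powr (\<sigma> - real r)"
        by (simp add: powr_add[symmetric] mult.assoc)
      also have "\<dots> \<le> K2 * A * (D powr \<bar>\<sigma> - real r\<bar> * R powr (\<sigma> - real r))"
        using K2 A D R supp[OF False r] by (intro mult_left_mono powr_comparable) auto
      also have "\<dots> \<le> K2 * A * (D powr (\<bar>\<sigma>\<bar> + real N) * R powr (\<sigma> - real r))"
        using K2 A D r by (intro mult_left_mono mult_right_mono powr_mono) auto
      also have "R powr (\<sigma> - real r) = R powr \<sigma> / R ^ r"
        using R by (simp add: powr_diff powr_realpow)
      finally show ?thesis by (simp add: G_def mult_ac)
    qed
    define Q where "Q = 2 ^ N * real (card F) * G"
    have Q0: "Q \<ge> 0" using G0 by (simp add: Q_def)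
    \<comment> \<open>The first summand makes \<open>B\<close> positive. It scales like the second one.\<close>
    define B where "B = 1 * A * R powr \<sigma> + 2 ^ N * ((2 * real N + 5) * R) ^ ?n * G *
      ((8 * real ?n / R) ^ ?n / (2 * pi) ^ ?n)"
    have Bpos: "B > 0" unfolding B_def using A R G0
      by (intro add_pos_nonneg mult_nonneg_nonneg mult_pos_pos) auto
    have cardF: "real (card F) \<le> ((2 * real N + 5) * R) ^ ?n"
    proof -
      have "real (card F) \<le> real ((2 * M + 1) ^ ?n)"
        unfolding F_def using card_lattice_box(2) of_nat_mono by blast
      also have "\<dots> = (2 * real M + 1) ^ ?n" by (simp add: add.commute)
      also have "\<dots> \<le> ((2 * real N + 5) * R) ^ ?n"
      proof (rule power_mono)
        have "(1::real) \<le> R" by (simp add: R_def)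
        then have "real N * 1 \<le> real N * R" by (intro mult_left_mono) auto
        moreover have "(2 * real N + 5) * R = 2 * (real N * R) + 5 * R"
          by (simp add: algebra_simps)
        moreover have "real M = 2 * R + real N" by (simp add: M_def R_def)
        ultimately show "2 * real M + 1 \<le> (2 * real N + 5) * R"
          using \<open>1 \<le> R\<close> by linarith
      qed simp
      finally show ?thesis .
    qed
    have lin': "c k (z *\<^sub>C v) = z *\<^sub>C c k v" for k z v
      using lin by (simp add: c_def scaleC_left_commute)
    have "distribution_norm p (torus_op (\<lambda>k. c k) u) \<le> ennreal (2 * B) * distribution_norm p u"
    proof (rule distribution_norm_torus_op_le[OF p F _ lin', where \<kappa>="\<lambda>x. Q * decay R x"])
      show "c k = 0" if "k \<notin> F" for k using supp[of 0 undefined k] that by auto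
      show "(\<lambda>x. Q * decay R x) \<in> borel_measurable borel" by measurable
      show "periodic (\<lambda>x::real^'n. Q * decay R x)" by (rule periodic_compose[OF decay_periodic])
      show "Q * decay R (- x) = Q * decay R x" for x :: "real^'n" by (simp add: decay_uminus)
      show "0 \<le> Q * decay R x" for x :: "real^'n" using Q0 by simp
      show "(\<integral>\<^sup>+(x::real^'n). ennreal (Q * decay R x) \<partial>torus_measure) \<le> ennreal B"
      proof -
        have "(\<integral>\<^sup>+(x::real^'n). ennreal (Q * decay R x) \<partial>torus_measure) =
            ennreal Q * (\<integral>\<^sup>+(x::real^'n). decay R x \<partial>torus_measure)"
          using Q0 by (simp add: ennreal_mult nn_integral_cmult)
        also have "\<dots> \<le> ennreal Q * ennreal ((8 * real ?n / R) ^ ?n / (2 * pi) ^ ?n)"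
          by (intro mult_left_mono nn_integral_decay R) auto
        also have "\<dots> = ennreal (Q * ((8 * real ?n / R) ^ ?n / (2 * pi) ^ ?n))"
          by (rule ennreal_mult[symmetric]) (use Q0 R in auto)
        also have "\<dots> \<le> ennreal B"
        proof (rule ennreal_leI)
          have "Q * ((8 * real ?n / R) ^ ?n / (2 * pi) ^ ?n) \<le>
              (2 ^ N * ((2 * real N + 5) * R) ^ ?n * G) * ((8 * real ?n / R) ^ ?n / (2 * pi) ^ ?n)"
            unfolding Q_def using cardF G0 R by (intro mult_right_mono mult_left_mono) auto
          moreover have "0 \<le> 1 * A * R powr \<sigma>" using A by simp
          ultimately show "Q * ((8 * real ?n / R) ^ ?n / (2 * pi) ^ ?n) \<le> B"
            unfolding B_def by linarith
        qed
        finally show ?thesis .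
      qed
      show "0 < B" by (rule Bpos)
      fix x and v :: 'e
      let ?d = "\<lambda>k. c k v"
      have dd: "(difference l ^^ r) ?d k = (difference l ^^ r) c k v" for l r k
        by (rule funpow_difference_linear) (simp add: blinfun.diff_left)
      have dle: "norm ((difference l ^^ r) ?d k) \<le> G * norm v / R ^ r" if "r \<le> N" for l r k
      proof -
        have "norm ((difference l ^^ r) ?d k) \<le> norm ((difference l ^^ r) c k) * norm v"
          unfolding dd by (rule norm_blinfun)
        also have "\<dots> \<le> G / R ^ r * norm v" by (intro mult_right_mono Gr that) simp
        finally show ?thesis by simp
      qed
      have "norm (\<Sum>k\<in>F. character k x *\<^sub>C ?d k) \<le> 2 ^ N * real (card F) * (G * norm v) * decay R x"
      proof (rule fourier_sum_decay[OF F _ N R])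
        show "(difference l ^^ r) ?d k = 0" if "r \<le> N" "k \<notin> F" for l r k
          using supp[of r l k] that unfolding dd by (metis blinfun.zero_left)
        show "norm (?d k) \<le> G * norm v" for k using dle[of 0 undefined k] by simp
        show "norm ((difference l ^^ N) ?d k) \<le> G * norm v / R ^ N" for l k by (rule dle) simp
      qed (use G0 in simp)
      then show "norm (\<Sum>k\<in>F. character k x *\<^sub>C c k v) \<le> Q * decay R x * norm v"
        by (simp add: Q_def mult_ac)
    qed
    moreover have "2 * B = K * A * 2 powr (real j * \<sigma>)"
    proof -
      have Rs: "R powr \<sigma> = 2 powr (real j * \<sigma>)"
        by (simp add: R_def powr_powr flip: powr_realpow)
      have "((2 * real N + 5) * R) ^ ?n * (8 * real ?n / R) ^ ?n = (2 * real N + 5) ^ ?n * (8 * real ?n) ^ ?n"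
        using R by (simp add: power_mult_distrib power_divide)
      moreover have "a * x * g * (y / z) = a * g * ((x * y) / z)" for a x g y z :: real by simp
      ultimately have B': "B = A * R powr \<sigma> + 2 ^ N * G *
          ((2 * real N + 5) ^ ?n * (8 * real ?n) ^ ?n / (2 * pi) ^ ?n)"
        unfolding B_def by (simp only: mult_1)
      have "2 * (A * S + a * (K2 * A * d * S) * (x * y / z)) =
          2 * (1 + a * x * K2 * d * (y / z)) * A * S" for S a d x y z :: real
        by (simp add: algebra_simps)
      then show ?thesis unfolding B' G_def K_def Rs by (simp only:)
    qed
    ultimately show "distribution_norm p (torus_op (\<lambda>k. cscale (\<phi> j (real_vec k)) o\<^sub>L b k) u) \<le>
      ennreal (K * A * 2 powr (real j * \<sigma>)) * distribution_norm p u"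
      unfolding c_def by simp
  qed
qed

subsection \<open>Shifts of sequences\<close>

lemma Lebesgue_norm_count_Suc:
  assumes q: "1 \<le> q"
  shows "Lebesgue_norm q (count_space UNIV) (\<lambda>j. e (Suc j)) \<le> Lebesgue_norm q (count_space UNIV) e"
  using q
proof (cases rule: exponent_cases)
  case 1
  have "\<forall>j. e j \<le> Lebesgue_norm q (count_space UNIV) e"
    using Lebesgue_norm_top_le_iff[of "count_space UNIV" e "Lebesgue_norm q (count_space UNIV) e"] 1
    by (simp add: AE_count_space)
  then show ?thesis using 1 Lebesgue_norm_top_le_iff[of "count_space UNIV" "\<lambda>j. e (Suc j)"]
    by (simp add: AE_count_space)
next
  case (2 r)
  let ?g = "\<lambda>j. ennreal_powr (e j) r"
  have "(\<integral>\<^sup>+j. ?g (Suc j) \<partial>count_space UNIV) = (\<integral>\<^sup>+j. ?g j \<partial>count_space (range Suc))"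
    by (rule nn_integral_bij_count_space) (simp add: bij_betw_def)
  also have "\<dots> = (\<integral>\<^sup>+j. ?g j * indicator (range Suc) j \<partial>count_space UNIV)"
    by (simp add: nn_integral_count_space_indicator)
  also have "\<dots> \<le> (\<integral>\<^sup>+j. ?g j \<partial>count_space UNIV)"
    by (intro nn_integral_mono) (auto simp: indicator_def)
  also have "\<dots> \<le> ennreal_powr (Lebesgue_norm q (count_space UNIV) e) r"
    using Lebesgue_norm_le_iff[of r "count_space UNIV" e] 2 by blast
  finally show ?thesis
    using Lebesgue_norm_le_iff[of r "count_space UNIV" "\<lambda>j. e (Suc j)"] 2 by blast
qed

lemma Lebesgue_norm_count_pred:
  fixes e :: "nat \<Rightarrow> ennreal"
  assumes q: "1 \<le> q"
  shows "Lebesgue_norm q (count_space UNIV) (\<lambda>j. if j = 0 then 0 else e (j - 1)) \<le>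
    Lebesgue_norm q (count_space UNIV) e"
  using q
proof (cases rule: exponent_cases)
  case 1
  have "\<forall>j. e j \<le> Lebesgue_norm q (count_space UNIV) e"
    using Lebesgue_norm_top_le_iff[of "count_space UNIV" e "Lebesgue_norm q (count_space UNIV) e"] 1
    by (simp add: AE_count_space)
  then show ?thesis
    using 1 Lebesgue_norm_top_le_iff[of "count_space UNIV" "\<lambda>j. if j = 0 then 0 else e (j - 1)"]
    by (simp add: AE_count_space)
next
  case (2 r)
  let ?f = "\<lambda>j. if j = 0 then 0 else e (j - 1)"
  let ?h = "\<lambda>j. ennreal_powr (?f j) r"
  have "(\<integral>\<^sup>+j. ?h j \<partial>count_space UNIV) = (\<integral>\<^sup>+j. ?h j * indicator (range Suc) j \<partial>count_space UNIV)"
    using 2 by (intro nn_integral_cong) (auto simp: indicator_def image_iff ennreal_powr_def gr0_conv_Suc)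
  also have "\<dots> = (\<integral>\<^sup>+j. ?h j \<partial>count_space (range Suc))"
    by (simp add: nn_integral_count_space_indicator)
  also have "\<dots> = (\<integral>\<^sup>+j. ?h (Suc j) \<partial>count_space UNIV)"
    by (rule nn_integral_bij_count_space[symmetric]) (simp add: bij_betw_def)
  also have "\<dots> = (\<integral>\<^sup>+j. ennreal_powr (e j) r \<partial>count_space UNIV)" by simp
  also have "\<dots> \<le> ennreal_powr (Lebesgue_norm q (count_space UNIV) e) r"
    using Lebesgue_norm_le_iff[of r "count_space UNIV" e] 2 by blast
  finally show ?thesis using Lebesgue_norm_le_iff[of r "count_space UNIV" ?f] 2 by blast
qed

subsection \<open>The multiplier theorem\<close>

lemma tempered_compose:
  assumes "tempered a" and "tempered b"
  shows "tempered (\<lambda>k x. a k (b k x))"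
proof -
  obtain C N where C: "C \<ge> 0" "\<And>k x. norm (a k x) \<le> C * (1 + norm (real_vec k)) ^ N * norm x"
    using assms(1) unfolding tempered_def by blast
  obtain B M where B: "B \<ge> 0" "\<And>k x. norm (b k x) \<le> B * (1 + norm (real_vec k)) ^ M * norm x"
    using assms(2) unfolding tempered_def by blast
  have "norm (a k (b k x)) \<le> (C * B) * (1 + norm (real_vec k)) ^ (N + M) * norm x" for k x
  proof -
    have "norm (a k (b k x)) \<le> C * (1 + norm (real_vec k)) ^ N * norm (b k x)" by (rule C(2))
    also have "\<dots> \<le> C * (1 + norm (real_vec k)) ^ N * (B * (1 + norm (real_vec k)) ^ M * norm x)"
      using C(1) by (intro mult_left_mono B(2)) auto
    finally show ?thesis by (simp add: power_add mult_ac)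
  qed
  then show ?thesis
    unfolding tempered_def using B(1) C(1) by (intro exI[of _ "C * B"]) auto
qed

lemma tempered_symbol:
  fixes b :: "int^'n \<Rightarrow> 'e::complex_banach \<Rightarrow>\<^sub>L 'e"
  assumes "\<And>k. norm (b k) \<le> A * bracket k powr \<sigma>" and A: "0 \<le> A"
  shows "tempered (\<lambda>k. blinfun_apply (b k))"
proof -
  define M where "M = nat \<lceil>\<bar>\<sigma>\<bar>\<rceil>"
  have "norm (b k x) \<le> A * (1 + norm (real_vec k)) ^ M * norm x" for k x
  proof -
    have "bracket k powr \<sigma> \<le> bracket k powr (real M)"
      unfolding M_def using bracket_ge_1[of k] by (intro powr_mono) linarith+
    also have "\<dots> = bracket k ^ M" by (simp add: powr_realpow)
    also have "\<dots> \<le> (1 + norm (real_vec k)) ^ M" by (intro power_mono bracket_bounds(2)) simp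
    finally have "bracket k powr \<sigma> \<le> (1 + norm (real_vec k)) ^ M" .
    then have "A * bracket k powr \<sigma> \<le> A * (1 + norm (real_vec k)) ^ M" using A by (intro mult_left_mono)
    then have "norm (b k) \<le> A * (1 + norm (real_vec k)) ^ M" using assms(1)[of k] by linarith
    then have "norm (b k) * norm x \<le> A * (1 + norm (real_vec k)) ^ M * norm x" by (intro mult_right_mono) auto
    then show ?thesis using norm_blinfun[of "b k" x] by linarith
  qed
  then show ?thesis unfolding tempered_def using A by blast
qed

lemma tempered_dyadic:
  assumes dy: "dyadic_decomposition \<phi>"
  shows "tempered (\<lambda>k (x::'e::complex_banach). \<phi> j (real_vec k) *\<^sub>C x)"
proof -
  obtain c where c: "c > 0" "\<forall>j \<xi>. norm ((partial_derivative undefined ^^ 0) (\<phi> j) \<xi>) \<le> c * 2 powr (- real (j * 0))"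
    using dyadic_derivative[OF dy, where l=undefined and r=0] by blast
  have "norm (\<phi> j (real_vec k) *\<^sub>C x) \<le> c * (1 + norm (real_vec k)) ^ 0 * norm x" for k and x :: 'e
    using c(2) by (simp add: norm_scaleC mult_right_mono)
  then show ?thesis unfolding tempered_def using c(1) less_imp_le by blast
qed

definition dyadic_block :: "(nat \<Rightarrow> real^'n \<Rightarrow> complex) \<Rightarrow> nat \<Rightarrow>
    ('n::finite, 'e::complex_banach) distribution \<Rightarrow> ('n, 'e) distribution" where
  "dyadic_block \<phi> j u = torus_op (\<lambda>k x. \<phi> j (real_vec k) *\<^sub>C x) u"

definition block_norm :: "(nat \<Rightarrow> real^'n \<Rightarrow> complex) \<Rightarrow> real \<Rightarrow> ennreal \<Rightarrow>
    ('n::finite, 'e::complex_banach) distribution \<Rightarrow> nat \<Rightarrow> ennreal" where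
  "block_norm \<phi> s p u j = ennreal (2 powr (real j * s)) * distribution_norm p (dyadic_block \<phi> j u)"

lemma besov_enorm_block_norm:
  "besov_enorm \<phi> s p q u = Lebesgue_norm q (count_space UNIV) (block_norm \<phi> s p u)"
  by (simp add: besov_enorm_def block_norm_def[abs_def] dyadic_block_def)

lemma fourier_coeff_dyadic_block:
  fixes u :: "('n::finite, 'e::complex_banach) distribution"
  assumes dy: "dyadic_decomposition \<phi>"
  shows "fourier_coeff (dyadic_block \<phi> j u) k = \<phi> j (real_vec k) *\<^sub>C fourier_coeff u k"
  unfolding dyadic_block_def by (rule fourier_coeff_torus_op[OF tempered_dyadic[OF dy]])

lemma distribution_norm_add3:
  fixes u v w :: "('n::finite, 'e::complex_banach) distribution"
  assumes p: "1 \<le> p"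
  shows "distribution_norm p (u + v + w) \<le>
    16 * (distribution_norm p u + distribution_norm p v + distribution_norm p w)"
proof -
  let ?N = "\<lambda>u::('n, 'e) distribution. distribution_norm p u"
  have "?N (u + v + w) \<le> 4 * (?N (u + v) + ?N w)" by (rule distribution_norm_add[OF p])
  also have "\<dots> \<le> 4 * (4 * (?N u + ?N v) + 4 * ?N w)"
    using mult_right_mono[of 1 "4::ennreal" "?N w"]
    by (intro mult_left_mono add_mono distribution_norm_add[OF p]) auto
  also have "\<dots> = (4 * 4) * (?N u + ?N v + ?N w)" by (simp only: distrib_left mult.assoc)
  finally show ?thesis by simp
qed

text \<open>Only the neighbouring blocks \<open>j - 1, j, j + 1\<close> of \<open>u\<close> contribute to the block \<open>j\<close> of
  \<open>torus_op b u\<close>, and on each of them the operator acts by convolution with an integrable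
  kernel.\<close>

theorem besov_multiplier:
  fixes \<phi> :: "nat \<Rightarrow> real^'n \<Rightarrow> complex"
  assumes dy: "dyadic_decomposition \<phi>" and p: "1 \<le> p" and q: "1 \<le> q" and N: "N = CARD('n) + 1"
  shows "\<exists>K>0. \<forall>A>0. \<forall>(b :: int^'n \<Rightarrow> 'e::complex_banach \<Rightarrow>\<^sub>L 'e).
    (\<forall>k z v. blinfun_apply (b k) (z *\<^sub>C v) = z *\<^sub>C blinfun_apply (b k) v) \<longrightarrow>
    (\<forall>l. symbol_bound l (\<lambda>k. bracket k powr \<sigma>) N A b) \<longrightarrow>
    (\<forall>u. besov_enorm \<phi> s p q (torus_op (\<lambda>k. blinfun_apply (b k)) u) \<le>
      ennreal (K * A) * besov_enorm \<phi> (s + \<sigma>) p q u)"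
proof -
  let ?M = "count_space UNIV :: nat measure"
  obtain K0 where K0: "K0 > 0" "\<forall>A>0. \<forall>(b :: int^'n \<Rightarrow> 'e \<Rightarrow>\<^sub>L 'e).
    (\<forall>k z v. blinfun_apply (b k) (z *\<^sub>C v) = z *\<^sub>C blinfun_apply (b k) v) \<longrightarrow>
    (\<forall>l. symbol_bound l (\<lambda>k. bracket k powr \<sigma>) N A b) \<longrightarrow>
    (\<forall>j u. distribution_norm p (torus_op (\<lambda>k. cscale (\<phi> j (real_vec k)) o\<^sub>L b k) u) \<le>
      ennreal (K0 * A * 2 powr (real j * \<sigma>)) * distribution_norm p u)"
    using dyadic_block_bound[OF dy p N, of \<sigma>] by (elim exE conjE)
  define t where "t = s + \<sigma>"
  define K where "K = 48 * (16 * K0 * 2 powr \<bar>t\<bar>)"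
  have Kpos: "K > 0" using K0(1) by (simp add: K_def)
  show ?thesis
  proof (intro exI[of _ K] conjI allI impI Kpos)
    fix A and b :: "int^'n \<Rightarrow> 'e \<Rightarrow>\<^sub>L 'e" and u :: "('n, 'e) distribution"
    assume A: "0 < A"
      and lin: "\<forall>k z v. blinfun_apply (b k) (z *\<^sub>C v) = z *\<^sub>C blinfun_apply (b k) v"
      and b: "\<forall>l. symbol_bound l (\<lambda>k. bracket k powr \<sigma>) N A b"
    have temp: "tempered (\<lambda>k. blinfun_apply (b k))"
      by (rule tempered_symbol[OF symbol_bound_0[OF b[rule_format, of undefined]]]) (use A in simp)
    define P where "P i = dyadic_block \<phi> i u" for i
    let ?T = "\<lambda>j. torus_op (\<lambda>k. blinfun_apply (cscale (\<phi> j (real_vec k)) o\<^sub>L b k))"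
    have tempT: "tempered (\<lambda>k. blinfun_apply (cscale (\<phi> j (real_vec k)) o\<^sub>L b k))" for j
    proof -
      have "(\<lambda>k. blinfun_apply (cscale (\<phi> j (real_vec k)) o\<^sub>L b k)) =
          (\<lambda>k x. \<phi> j (real_vec k) *\<^sub>C blinfun_apply (b k) x)"
        by (intro ext) simp
      then show ?thesis using tempered_compose[OF tempered_dyadic[OF dy] temp] by simp
    qed
    let ?prev = "\<lambda>j. if j = 0 then 0 else P (j - 1)"
    have split: "dyadic_block \<phi> j (torus_op (\<lambda>k. blinfun_apply (b k)) u) =
        ?T j (?prev j) + ?T j (P j) + ?T j (P (Suc j))" for j
    proof (rule distribution_eqI)
      fix k
      let ?z = "\<phi> j (real_vec k)" and ?y = "fourier_coeff u k"
      let ?w = "(if j = 0 then 0 else \<phi> (j - 1) (real_vec k)) + ?z + \<phi> (Suc j) (real_vec k)"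
      have prev: "fourier_coeff (?prev j) k = (if j = 0 then 0 else \<phi> (j - 1) (real_vec k)) *\<^sub>C ?y"
        by (simp add: P_def fourier_coeff_dyadic_block[OF dy])
      have "fourier_coeff (?T j (?prev j) + ?T j (P j) + ?T j (P (Suc j))) k = ?z *\<^sub>C b k (?w *\<^sub>C ?y)"
        using prev
        by (simp add: fourier_coeff_torus_op[OF tempT] P_def fourier_coeff_dyadic_block[OF dy]
            scaleC_add_left blinfun.add_right scaleC_add_right del: fourier_coeff_linear(1))
      also have "\<dots> = ?z *\<^sub>C b k ?y"
      proof (cases "?z = 0")
        case False
        from dyadic_partition[OF dy False] show ?thesis by (simp add: scaleC_one)
      qed simp
      finally show "fourier_coeff (dyadic_block \<phi> j (torus_op (\<lambda>k. blinfun_apply (b k)) u)) k =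
          fourier_coeff (?T j (?prev j) + ?T j (P j) + ?T j (P (Suc j))) k"
        by (simp add: fourier_coeff_dyadic_block[OF dy] fourier_coeff_torus_op[OF temp])
    qed
    let ?N = "\<lambda>u::('n, 'e) distribution. distribution_norm p u"
    let ?e = "block_norm \<phi> t p u"
    let ?e' = "\<lambda>j. if j = 0 then 0 else ?e (j - 1)" and ?e'' = "\<lambda>j. ?e (Suc j)"
    define c where "c = 16 * K0 * A * 2 powr \<bar>t\<bar>"
    have c0: "c \<ge> 0" using K0(1) A by (simp add: c_def)
    have w: "ennreal (2 powr (real j * t)) * ?N (P i) \<le> ennreal (2 powr \<bar>t\<bar>) * ?e i"
      if "i = j \<or> i = Suc j \<or> Suc i = j" for i j
    proof -
      have "real j * t \<le> \<bar>t\<bar> + real i * t"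
      proof -
        have "(real j - real i) * t \<le> \<bar>(real j - real i) * t\<bar>" by simp
        also have "\<dots> = \<bar>real j - real i\<bar> * \<bar>t\<bar>" by (rule abs_mult)
        also have "\<dots> \<le> 1 * \<bar>t\<bar>" using that by (intro mult_right_mono) auto
        finally show ?thesis by (simp add: left_diff_distrib)
      qed
      then have "2 powr (real j * t) \<le> 2 powr \<bar>t\<bar> * 2 powr (real i * t)"
        by (simp flip: powr_add)
      then have "ennreal (2 powr (real j * t)) \<le> ennreal (2 powr \<bar>t\<bar>) * ennreal (2 powr (real i * t))"
        by (simp add: ennreal_leI flip: ennreal_mult)
      then have "ennreal (2 powr (real j * t)) * ?N (P i) \<le>
          (ennreal (2 powr \<bar>t\<bar>) * ennreal (2 powr (real i * t))) * ?N (P i)"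
        by (rule mult_right_mono) simp
      then show ?thesis by (simp add: block_norm_def P_def mult.assoc)
    qed
    have le: "block_norm \<phi> s p (torus_op (\<lambda>k. blinfun_apply (b k)) u) j \<le>
        ennreal c * (?e' j + ?e j + ?e'' j)" for j
    proof -
      let ?k = "ennreal (K0 * A * 2 powr (real j * \<sigma>))"
      have "?N (?T j (?prev j)) \<le> ?k * ?N (?prev j)" "?N (?T j (P j)) \<le> ?k * ?N (P j)"
        "?N (?T j (P (Suc j))) \<le> ?k * ?N (P (Suc j))"
        by (rule K0(2)[THEN spec, THEN mp, OF A, THEN spec, THEN mp, OF lin, THEN mp, OF b,
            THEN spec, THEN spec])+
      then have "?N (dyadic_block \<phi> j (torus_op (\<lambda>k. blinfun_apply (b k)) u)) \<le>
          16 * (?k * ?N (?prev j) + ?k * ?N (P j) + ?k * ?N (P (Suc j)))"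
        unfolding split by (intro order_trans[OF distribution_norm_add3[OF p]] mult_left_mono add_mono) auto
      also have "\<dots> = (16 * ?k) * (?N (?prev j) + ?N (P j) + ?N (P (Suc j)))"
        by (simp only: distrib_left mult.assoc)
      finally have "block_norm \<phi> s p (torus_op (\<lambda>k. blinfun_apply (b k)) u) j \<le>
          ennreal (2 powr (real j * s)) * ((16 * ?k) * (?N (?prev j) + ?N (P j) + ?N (P (Suc j))))"
        unfolding block_norm_def by (rule mult_left_mono) simp
      also have "\<dots> = ennreal (16 * K0 * A) * (ennreal (2 powr (real j * t)) *
          (?N (?prev j) + ?N (P j) + ?N (P (Suc j))))"
      proof -
        have "ennreal (2 powr (real j * s)) * (16 * ?k) = ennreal (2 powr (real j * s)) * (ennreal 16 * ?k)"
          by simp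
        also have "\<dots> = ennreal (2 powr (real j * s) * (16 * (K0 * A * 2 powr (real j * \<sigma>))))"
          using K0(1) A by (subst ennreal_mult[symmetric]; simp)+
        also have "2 powr (real j * s) * (16 * (K0 * A * 2 powr (real j * \<sigma>))) =
            (16 * K0 * A) * 2 powr (real j * t)"
          by (simp add: t_def distrib_left powr_add)
        also have "ennreal ((16 * K0 * A) * 2 powr (real j * t)) =
            ennreal (16 * K0 * A) * ennreal (2 powr (real j * t))"
          using K0(1) A by (intro ennreal_mult) auto
        finally show ?thesis by (simp only: mult.assoc[symmetric])
      qed
      also have "\<dots> \<le> ennreal (16 * K0 * A) * (ennreal (2 powr \<bar>t\<bar>) * (?e' j + ?e j + ?e'' j))"
      proof (rule mult_left_mono)
        have "ennreal (2 powr (real j * t)) * ?N (?prev j) \<le> ennreal (2 powr \<bar>t\<bar>) * ?e' j"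
          using w[of "j - 1" j] by (simp add: distribution_norm_zero[OF p])
        then show "ennreal (2 powr (real j * t)) * (?N (?prev j) + ?N (P j) + ?N (P (Suc j))) \<le>
            ennreal (2 powr \<bar>t\<bar>) * (?e' j + ?e j + ?e'' j)"
          unfolding distrib_left by (intro add_mono w) auto
      qed simp
      also have "\<dots> = ennreal c * (?e' j + ?e j + ?e'' j)"
      proof -
        have "ennreal c = ennreal (16 * K0 * A) * ennreal (2 powr \<bar>t\<bar>)"
          unfolding c_def using K0(1) A by (intro ennreal_mult) auto
        then show ?thesis by (simp only: mult.assoc)
      qed
      finally show ?thesis .
    qed
    let ?L = "Lebesgue_norm q ?M"
    have "besov_enorm \<phi> s p q (torus_op (\<lambda>k. blinfun_apply (b k)) u) \<le>
        ?L (\<lambda>j. ennreal c * (?e' j + ?e j + ?e'' j))"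
      unfolding besov_enorm_block_norm by (rule Lebesgue_norm_mono_AE[OF q]) (simp add: le AE_count_space)
    also have "\<dots> \<le> ennreal c * ?L (\<lambda>j. ?e' j + ?e j + ?e'' j)"
      by (rule Lebesgue_norm_cmult[OF q c0]) simp
    also have "\<dots> \<le> ennreal c * (48 * ?L ?e)"
    proof (rule mult_left_mono)
      have "?L (\<lambda>j. (?e' j + ?e j) + ?e'' j) \<le> 4 * (?L (\<lambda>j. ?e' j + ?e j) + ?L ?e'')"
        by (rule Lebesgue_norm_add[OF q]) simp_all
      also have "\<dots> \<le> 4 * (4 * (?L ?e' + ?L ?e) + 4 * ?L ?e'')"
        using mult_right_mono[of 1 "4::ennreal" "?L ?e''"]
        by (intro mult_left_mono add_mono Lebesgue_norm_add[OF q]) auto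
      also have "\<dots> \<le> 4 * (4 * (?L ?e + ?L ?e) + 4 * ?L ?e)"
        by (intro mult_left_mono add_mono Lebesgue_norm_count_pred[OF q] Lebesgue_norm_count_Suc[OF q]) auto
      also have "\<dots> = (4 * (4 * (1 + 1) + 4)) * ?L ?e" by (simp only: distrib_right distrib_left mult_1 mult.assoc)
      also have "\<dots> = 48 * ?L ?e" by simp
      finally show "?L (\<lambda>j. ?e' j + ?e j + ?e'' j) \<le> 48 * ?L ?e" .
    qed simp
    also have "\<dots> = ennreal (K * A) * besov_enorm \<phi> (s + \<sigma>) p q u"
    proof -
      have "ennreal c * (48 * X) = ennreal (K * A) * X" for X :: ennreal
      proof -
        have "ennreal (K * A) = ennreal (c * 48)" by (simp add: K_def c_def mult_ac)
        also have "\<dots> = ennreal c * ennreal 48" using c0 by (intro ennreal_mult) auto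
        finally show ?thesis by (simp add: mult.assoc)
      qed
      then show ?thesis by (simp add: besov_enorm_block_norm t_def)
    qed
    finally show "besov_enorm \<phi> s p q (torus_op (\<lambda>k. blinfun_apply (b k)) u) \<le>
        ennreal (K * A) * besov_enorm \<phi> (s + \<sigma>) p q u" .
  qed
qed

lemma dyadic_block_add:
  fixes u v :: "('n::finite, 'e::complex_banach) distribution"
  assumes dy: "dyadic_decomposition \<phi>"
  shows "dyadic_block \<phi> j (u + v) = dyadic_block \<phi> j u + dyadic_block \<phi> j v"
  by (rule distribution_eqI) (simp add: fourier_coeff_dyadic_block[OF dy] scaleC_add_right)

lemma besov_enorm_add:
  fixes u v :: "('n::finite, 'e::complex_banach) distribution"
  assumes dy: "dyadic_decomposition \<phi>" and p: "1 \<le> p" and q: "1 \<le> q"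
  shows "besov_enorm \<phi> s p q (u + v) \<le> 16 * (besov_enorm \<phi> s p q u + besov_enorm \<phi> s p q v)"
proof -
  let ?L = "Lebesgue_norm q (count_space UNIV :: nat measure)"
  have "block_norm \<phi> s p (u + v) j \<le> ennreal 4 * (block_norm \<phi> s p u j + block_norm \<phi> s p v j)" for j
  proof -
    have "block_norm \<phi> s p (u + v) j \<le> ennreal (2 powr (real j * s)) *
        (4 * (distribution_norm p (dyadic_block \<phi> j u) + distribution_norm p (dyadic_block \<phi> j v)))"
      unfolding block_norm_def dyadic_block_add[OF dy]
      by (intro mult_left_mono distribution_norm_add[OF p]) simp
    then show ?thesis by (simp add: block_norm_def distrib_left mult.left_commute)
  qed
  then have "besov_enorm \<phi> s p q (u + v) \<le> ?L (\<lambda>j. ennreal 4 * (block_norm \<phi> s p u j + block_norm \<phi> s p v j))"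
    unfolding besov_enorm_block_norm by (intro Lebesgue_norm_mono_AE[OF q]) (simp add: AE_count_space)
  also have "\<dots> \<le> ennreal 4 * ?L (\<lambda>j. block_norm \<phi> s p u j + block_norm \<phi> s p v j)"
    by (rule Lebesgue_norm_cmult[OF q]) simp_all
  also have "\<dots> \<le> ennreal 4 * (4 * (?L (block_norm \<phi> s p u) + ?L (block_norm \<phi> s p v)))"
    by (intro mult_left_mono Lebesgue_norm_add[OF q]) simp_all
  also have "\<dots> = (4 * 4) * (?L (block_norm \<phi> s p u) + ?L (block_norm \<phi> s p v))"
    by (simp only: mult.assoc ennreal_numeral)
  finally show ?thesis by (simp add: besov_enorm_block_norm)
qed

section \<open>Resolvents of parabolic symbols\<close>

lemma inverse_blinfun_exists:
  fixes T :: "'e::real_normed_vector \<Rightarrow>\<^sub>L 'e"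
  assumes bij: "bij (blinfun_apply T)" and bd: "\<And>x. norm x \<le> C * norm (T x)" and C: "0 \<le> C"
  obtains b where "\<And>x. blinfun_apply b (T x) = x" "\<And>y. T (blinfun_apply b y) = y" "norm b \<le> C"
proof -
  let ?i = "inv (blinfun_apply T)"
  have 1: "?i (T x) = x" for x using bij by (simp add: bij_is_inj)
  have 2: "T (?i y) = y" for y using bij by (simp add: bij_is_surj surj_f_inv_f)
  have bl: "bounded_linear ?i"
  proof (rule bounded_linear_intro[where K=C])
    show "?i (x + y) = ?i x + ?i y" for x y
      using 1[of "?i x + ?i y"] by (simp add: blinfun.add_right 2)
    show "?i (r *\<^sub>R x) = r *\<^sub>R ?i x" for r x
      using 1[of "r *\<^sub>R ?i x"] by (simp add: blinfun.scaleR_right 2)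
    show "norm (?i x) \<le> norm x * C" for x
      using bd[of "?i x"] by (simp add: 2 mult.commute)
  qed
  have ap: "blinfun_apply (Blinfun ?i) = ?i" by (rule bounded_linear_Blinfun_apply[OF bl])
  show thesis
  proof (rule that[of "Blinfun ?i"])
    show "norm (Blinfun ?i) \<le> C"
      by (rule norm_blinfun_bound[OF C]) (use bd 2 in \<open>simp add: ap\<close>, metis 2 bd)
  qed (simp_all add: ap 1 2)
qed

text \<open>A perturbation of relative size at most one half is inverted by a fixed point iteration.\<close>

lemma bij_perturbation:
  fixes T :: "'e::complex_banach \<Rightarrow>\<^sub>L 'e"
  assumes bij: "bij (blinfun_apply T)" and bd: "\<And>x. norm x \<le> C * norm (T x)" and C: "0 \<le> C"
    and z: "C * cmod z \<le> 1 / 2"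
  shows "bij (blinfun_apply (T + cscale z))" "\<And>x. norm x \<le> (2 * C) * norm ((T + cscale z) x)"
proof -
  obtain b where b: "\<And>x. blinfun_apply b (T x) = x" "\<And>y. T (blinfun_apply b y) = y" "norm b \<le> C"
    by (rule inverse_blinfun_exists[OF bij bd C]) (rule that)
  show bd2: "norm x \<le> (2 * C) * norm ((T + cscale z) x)" for x
  proof -
    have "norm (T x) \<le> norm ((T + cscale z) x) + cmod z * norm x"
      using norm_triangle_ineq4[of "(T + cscale z) x" "z *\<^sub>C x"]
      by (simp add: blinfun.add_left norm_scaleC)
    then have "C * norm (T x) \<le> C * (norm ((T + cscale z) x) + cmod z * norm x)"
      using C by (rule mult_left_mono)
    moreover have "C * cmod z * norm x \<le> 1 / 2 * norm x" using z by (rule mult_right_mono) simp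
    ultimately show ?thesis using bd[of x] by (simp add: distrib_left mult.assoc)
  qed
  have "inj (blinfun_apply (T + cscale z))"
  proof (rule injI)
    fix x y assume "(T + cscale z) x = (T + cscale z) y"
    then have "(T + cscale z) (x - y) = 0" by (simp add: blinfun.diff_right)
    then show "x = y" using bd2[of "x - y"] by simp
  qed
  moreover have "surj (blinfun_apply (T + cscale z))"
    unfolding surj_def
  proof
    fix y
    let ?f = "\<lambda>x. b (y - z *\<^sub>C x)"
    have "\<exists>!x. ?f x = x"
    proof (rule banach_fix_type[where c="1/2"])
      show "\<forall>x x'. dist (?f x) (?f x') \<le> 1 / 2 * dist x x'"
      proof (intro allI)
        fix x x'
        have "?f x - ?f x' = b (z *\<^sub>C (x' - x))"
          by (simp add: scaleC_diff_right flip: blinfun.diff_right)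
        then have "norm (?f x - ?f x') \<le> norm b * norm (z *\<^sub>C (x' - x))" by (simp only: norm_blinfun)
        also have "\<dots> \<le> C * (cmod z * norm (x' - x))"
          unfolding norm_scaleC using b(3) by (intro mult_right_mono) auto
        also have "\<dots> \<le> 1 / 2 * norm (x' - x)"
          using mult_right_mono[OF z, of "norm (x' - x)"] by (simp add: mult.assoc)
        finally show "dist (?f x) (?f x') \<le> 1 / 2 * dist x x'" by (simp add: dist_norm norm_minus_commute)
      qed
    qed simp_all
    then obtain x where "b (y - z *\<^sub>C x) = x" by blast
    then have "T x = y - z *\<^sub>C x" using b(2)[of "y - z *\<^sub>C x"] by simp
    then show "\<exists>x. y = (T + cscale z) x" by (intro exI[of _ x]) (simp add: blinfun.add_left)
  qed
  ultimately show "bij (blinfun_apply (T + cscale z))" by (rule bijI)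
qed

text \<open>Every point of the sector is close to a point of the right half-plane, relative to the modulus
  of the latter: points to the left of the vertex are projected to the vertical line
  through it.\<close>

lemma sector_half_plane:
  fixes \<mu> :: complex
  assumes w: "0 < w" and e: "0 < e" "e \<le> 1" and ne: "\<mu> \<noteq> of_real w"
    and arg: "\<bar>Arg (\<mu> - of_real w)\<bar> < pi / 2 + arctan e"
  shows "\<exists>\<mu>0. Re \<mu>0 \<ge> 0 \<and> cmod \<mu>0 \<ge> w \<and> cmod (\<mu> - \<mu>0) \<le> e * cmod \<mu>0 \<and> cmod (\<mu> - of_real w) \<le> 2 * cmod \<mu>0"
proof -
  define z where "z = \<mu> - of_real w"
  have \<mu>: "\<mu> = of_real w + z" by (simp add: z_def)
  show ?thesis
  proof (cases "Re z \<ge> 0")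
    case True
    have "w \<le> Re \<mu>" using True by (simp add: \<mu>)
    then have 1: "w \<le> cmod \<mu>" using complex_Re_le_cmod[of \<mu>] by linarith
    have "(Re z)\<^sup>2 \<le> (w + Re z)\<^sup>2" using True w by (intro power_mono) auto
    then have "cmod z \<le> cmod \<mu>" by (simp add: cmod_def \<mu>)
    then have "cmod z \<le> 2 * cmod \<mu>" using norm_ge_zero[of \<mu>] by linarith
    then show ?thesis using 1 w True e by (intro exI[of _ \<mu>]) (simp add: \<mu>)
  next
    case False
    define B where "B = \<bar>Arg z\<bar>"
    have polar: "rcis (cmod z) (Arg z) = z" by (rule rcis_cmod_Arg)
    have cosB: "Re z = cmod z * cos B"
      using arg_cong[OF polar, of Re] by (simp add: B_def)
    have "\<bar>sin (Arg z)\<bar> = \<bar>sin B\<bar>" by (simp add: B_def abs_if)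
    moreover have "Im z = cmod z * sin (Arg z)" using arg_cong[OF polar, of Im] by simp
    then have "\<bar>Im z\<bar> = \<bar>cmod z * sin (Arg z)\<bar>" by (rule arg_cong)
    ultimately have sinB: "\<bar>Im z\<bar> = cmod z * \<bar>sin B\<bar>"
      by (simp only: abs_mult abs_norm_cancel)
    have "cos B < 0" using False cosB by (metis mult_nonneg_nonneg norm_ge_zero not_le)
    have B: "0 \<le> B" "B < pi / 2 + arctan e" using arg by (simp_all add: B_def z_def)
    have "\<not> B \<le> pi / 2" using \<open>cos B < 0\<close> cos_ge_zero[of B] B(1) pi_gt_zero by auto
    define d where "d = B - pi / 2"
    have d: "0 < d" "d < arctan e" using \<open>\<not> B \<le> pi / 2\<close> B by (auto simp: d_def)
    have dpi: "d < pi / 2" using d arctan_ubound[of e] by linarith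
    have cosd: "0 < cos d" using d(1) dpi by (intro cos_gt_zero_pi) auto
    have "tan d < tan (arctan e)"
      using d arctan_ubound[of e] by (intro tan_monotone) (use pi_gt_zero in linarith)+
    then have "sin d / cos d < e" unfolding tan_arctan unfolding tan_def .
    then have "sin d < e * cos d" by (simp only: pos_divide_less_eq[OF cosd])
    moreover have "cos B = - sin d" "sin B = cos d"
      by (simp_all add: d_def sin_diff cos_diff)
    ultimately have "- cos B \<le> e * \<bar>sin B\<bar>" using cosd by simp
    then have "cmod z * (- cos B) \<le> cmod z * (e * \<bar>sin B\<bar>)" by (rule mult_left_mono) simp
    then have Re: "\<bar>Re z\<bar> \<le> e * \<bar>Im z\<bar>" using False by (simp add: cosB[symmetric] sinB mult_ac)
    define \<mu>0 where "\<mu>0 = Complex w (Im z)"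
    have "w \<le> cmod \<mu>0" using complex_Re_le_cmod[of \<mu>0] by (simp add: \<mu>0_def)
    moreover have Im: "\<bar>Im z\<bar> \<le> cmod \<mu>0" using abs_Im_le_cmod[of \<mu>0] by (simp add: \<mu>0_def)
    moreover have "cmod (\<mu> - \<mu>0) \<le> e * cmod \<mu>0"
    proof -
      have "\<mu> - \<mu>0 = of_real (Re z)" by (simp add: complex_eq_iff \<mu> \<mu>0_def)
      then have "cmod (\<mu> - \<mu>0) \<le> e * \<bar>Im z\<bar>" using Re by simp
      also have "\<dots> \<le> e * cmod \<mu>0" using e Im by (intro mult_left_mono) auto
      finally show ?thesis .
    qed
    moreover have "cmod z \<le> 2 * cmod \<mu>0"
    proof -
      have "cmod z \<le> \<bar>Re z\<bar> + \<bar>Im z\<bar>" by (rule cmod_le)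
      also have "\<dots> \<le> e * \<bar>Im z\<bar> + \<bar>Im z\<bar>" using Re by simp
      also have "\<dots> \<le> 1 * \<bar>Im z\<bar> + \<bar>Im z\<bar>" using e by (intro add_mono mult_right_mono) auto
      finally show ?thesis using Im by linarith
    qed
    ultimately show ?thesis using w by (intro exI[of _ \<mu>0]) (simp add: \<mu>0_def z_def)
  qed
qed

lemma symbol_class_bound:
  fixes a :: "int^'n::finite \<Rightarrow> 'e::complex_banach \<Rightarrow>\<^sub>L 'e"
  assumes a: "a \<in> symbol_class m \<rho>" and N: "N \<le> \<rho>"
  shows "\<exists>A>0. \<forall>l. symbol_bound l (\<lambda>k. bracket k powr m) N A a"
proof -
  have fin: "symbol_norm m \<rho> a < \<infinity>" using a by (simp add: symbol_class_def)
  define S where "S = enn2real (symbol_norm m \<rho> a)"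
  have S: "symbol_norm m \<rho> a = ennreal S" "S \<ge> 0" using fin by (simp_all add: S_def)
  have "norm ((difference l ^^ r) a k) \<le> (S + 1) * bracket k powr m * bracket k powr (- real r)"
    if r: "r \<le> N" for l r k
  proof -
    let ?\<alpha> = "single_index l r"
    let ?g = "\<lambda>\<alpha> k. ennreal (sqrt (1 + (norm (real_vec k))\<^sup>2) powr (real (order_of \<alpha>) - m) *
              norm (multi_difference \<alpha> a k))"
    have "?g ?\<alpha> k \<le> (SUP k. ?g ?\<alpha> k)" by (rule SUP_upper) simp
    also have "\<dots> \<le> symbol_norm m \<rho> a"
      unfolding symbol_norm_def
    proof (rule Max_ge)
      show "finite ((\<lambda>\<alpha>. SUP k. ?g \<alpha> k) ` {\<alpha>. order_of \<alpha> \<le> \<rho>})"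
        by (rule finite_imageI[OF finite_order_le])
      have "order_of ?\<alpha> \<le> \<rho>" using r N by (simp only: order_single_index)
      then show "(SUP k. ?g ?\<alpha> k) \<in> (\<lambda>\<alpha>. SUP k. ?g \<alpha> k) ` {\<alpha>. order_of \<alpha> \<le> \<rho>}"
        by (intro image_eqI[where x="?\<alpha>"] refl CollectI)
    qed
    finally have "bracket k powr (real r - m) * norm ((difference l ^^ r) a k) \<le> S"
      using S by (simp add: multi_difference_def multi_power_single_index flip: bracket_def)
    then have "bracket k powr (m - real r) * (bracket k powr (real r - m) * norm ((difference l ^^ r) a k)) \<le>
        bracket k powr (m - real r) * S" by (intro mult_left_mono) auto
    moreover have "bracket k powr (m - real r) * bracket k powr (real r - m) = 1"
      by (simp flip: powr_add)
    ultimately have "norm ((difference l ^^ r) a k) \<le> bracket k powr (m - real r) * S"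
      by (simp flip: mult.assoc)
    also have "\<dots> \<le> bracket k powr (m - real r) * (S + 1)" by (intro mult_left_mono) auto
    also have "bracket k powr (m - real r) = bracket k powr m * bracket k powr (- real r)"
      by (simp flip: powr_add)
    finally show ?thesis by (simp add: mult_ac)
  qed
  then show ?thesis unfolding symbol_bound_def using S(2) by (intro exI[of _ "S + 1"]) auto
qed

text \<open>The bracket with the spectral parameter as an additional variable of homogeneity \<open>m\<close>.\<close>

definition spectral_bracket :: "real \<Rightarrow> complex \<Rightarrow> int^'n \<Rightarrow> real" where
  "spectral_bracket m \<mu> k = sqrt (1 + (norm (real_vec k))\<^sup>2 + cmod \<mu> powr (2 / m))"

lemma spectral_bracket_ge: "bracket k \<le> spectral_bracket m \<mu> k"
  by (simp add: bracket_def spectral_bracket_def)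

lemma spectral_bracket_pos [simp]:
  "0 < spectral_bracket m \<mu> k" "spectral_bracket m \<mu> k \<noteq> 0" "0 \<le> spectral_bracket m \<mu> k"
  using spectral_bracket_ge[of k m \<mu>] bracket_pos(1)[of k] by linarith+

lemma norm_le_spectral_bracket:
  assumes m: "0 < m"
  shows "cmod \<mu> \<le> spectral_bracket m \<mu> k powr m"
proof -
  let ?X = "1 + (norm (real_vec k))\<^sup>2 + cmod \<mu> powr (2 / m)"
  have "cmod \<mu> = (cmod \<mu> powr (2 / m)) powr (m / 2)"
    using m by (cases "\<mu> = 0") (simp_all add: powr_powr)
  also have "\<dots> \<le> ?X powr (m / 2)" using m by (intro powr_mono2) auto
  also have "\<dots> = (?X powr (1 / 2)) powr m" by (simp add: powr_powr)
  also have "?X powr (1 / 2) = spectral_bracket m \<mu> k"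
    unfolding spectral_bracket_def by (rule powr_half_sqrt) (simp add: add_nonneg_nonneg)
  finally show ?thesis .
qed

lemma spectral_bracket_shift:
  "spectral_bracket m \<mu> (k + axis l 1) \<le> 2 * spectral_bracket m \<mu> k"
  "spectral_bracket m \<mu> k \<le> 2 * spectral_bracket m \<mu> (k + axis l 1)"
proof -
  have sq: "(bracket k)\<^sup>2 = 1 + (norm (real_vec k))\<^sup>2" for k :: "int^'a"
    by (simp add: bracket_def add_nonneg_nonneg)
  have le: "spectral_bracket m \<mu> k \<le> 2 * spectral_bracket m \<mu> k'" if "bracket k \<le> 2 * bracket k'"
    for k k' :: "int^'a"
  proof -
    have "(bracket k)\<^sup>2 \<le> (2 * bracket k')\<^sup>2" using that by (intro power_mono) auto
    then have *: "1 + (norm (real_vec k))\<^sup>2 \<le> 4 * (1 + (norm (real_vec k'))\<^sup>2)"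
      by (simp only: power_mult_distrib sq) simp
    have "0 \<le> cmod \<mu> powr (2 / m)" by simp
    with * have "1 + (norm (real_vec k))\<^sup>2 + cmod \<mu> powr (2 / m) \<le>
        4 * (1 + (norm (real_vec k'))\<^sup>2 + cmod \<mu> powr (2 / m))" by argo
    then have "spectral_bracket m \<mu> k \<le> sqrt (4 * (1 + (norm (real_vec k'))\<^sup>2 + cmod \<mu> powr (2 / m)))"
      unfolding spectral_bracket_def by (rule real_sqrt_le_mono)
    also have "\<dots> = 2 * spectral_bracket m \<mu> k'"
      unfolding spectral_bracket_def by (subst real_sqrt_mult) simp
    finally show ?thesis .
  qed
  show "spectral_bracket m \<mu> (k + axis l 1) \<le> 2 * spectral_bracket m \<mu> k"
    by (rule le[OF bracket_shift(1)])
  show "spectral_bracket m \<mu> k \<le> 2 * spectral_bracket m \<mu> (k + axis l 1)"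
    by (rule le[OF bracket_shift(2)])
qed

lemma moderate_spectral_bracket: "moderate l (2 powr \<bar>t\<bar>) (\<lambda>k. spectral_bracket m \<mu> k powr t)"
  unfolding moderate_def
  by (intro allI conjI powr_comparable spectral_bracket_shift) simp_all

text \<open>Inside the right half-plane the inverse is given by parabolicity, and it persists under
  the small perturbation that is needed to reach a larger sector. The symbol estimates for the
  inverse hold with the weight \<^const>\<open>spectral_bracket\<close>, uniformly in the spectral
  parameter. This weight is dominated both by the decay in the spectral parameter and by that
  in the frequency.\<close>

lemma resolvent_symbol:
  fixes a :: "int^'n::finite \<Rightarrow> 'e::complex_banach \<Rightarrow>\<^sub>L 'e"
  assumes m: "0 < m" and a: "a \<in> symbol_class m \<rho>" and N: "N \<le> \<rho>" and par: "parabolic m a"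
  shows "\<exists>w \<theta> K. \<theta> \<in> {pi / 2<..<pi} \<and> 0 < K \<and>
    (\<forall>\<mu>. \<mu> \<noteq> complex_of_real w \<and> \<bar>Arg (\<mu> - complex_of_real w)\<bar> < \<theta> \<longrightarrow>
      (\<exists>b. (\<forall>k x. blinfun_apply (b k) (a k x + \<mu> *\<^sub>C x) = x) \<and>
        (\<forall>k y. a k (b k y) + \<mu> *\<^sub>C b k y = y) \<and>
        (\<forall>l. symbol_bound l (\<lambda>k. bracket k powr 0) N (K / cmod (\<mu> - complex_of_real w)) b) \<and>
        (\<forall>l. symbol_bound l (\<lambda>k. bracket k powr (- m)) N K b)))"
proof -
  obtain \<omega> \<kappa> where \<omega>: "0 \<le> \<omega>" and \<kappa>: "0 < \<kappa>" and pw: "parabolic_with m \<omega> \<kappa> a"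
    using par unfolding parabolic_def by blast
  obtain A where A: "0 < A" "\<And>l. symbol_bound l (\<lambda>k. bracket k powr m) N A a"
    using symbol_class_bound[OF a N] by blast
  \<comment> \<open>If \<open>|\<mu>|\<close> is at least \<open>w\<close>, then \<open>(k, \<mu>)\<close> is admissible in the definition of parabolicity for all \<open>k\<close>.\<close>
  define w where "w = max 1 (\<omega> powr m)"
  have w: "0 < w" by (simp add: w_def)
  \<comment> \<open>The shift \<open>\<mu> - \<mu>0\<close> is then at most half the lower bound of the operator at \<open>\<mu>0\<close>.\<close>
  define e where "e = min 1 (1 / (2 * \<kappa>))"
  have e: "0 < e" "e \<le> 1" "\<kappa> * e \<le> 1 / 2" using \<kappa> by (auto simp: e_def min_def field_simps)
  define \<theta> where "\<theta> = pi / 2 + arctan e"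
  have \<theta>: "\<theta> \<in> {pi / 2<..<pi}" using arctan_ubound[of e] e(1) by (simp add: \<theta>_def)
  define c where "c = 2 powr \<bar>m\<bar>"
  have c: "0 \<le> c" by (simp add: c_def)
  have A2: "0 \<le> A + 2" "0 \<le> 2 * \<kappa>" using A(1) \<kappa> by simp_all
  have "\<forall>l::'n. \<exists>K\<ge>0. \<forall>w v (f :: int^'n \<Rightarrow> 'e \<Rightarrow>\<^sub>L 'e) b.
    moderate l c w \<longrightarrow> moderate l c v \<longrightarrow> (\<forall>k. v k * w k \<le> 1) \<longrightarrow> symbol_bound l w N (A + 2) f \<longrightarrow>
    (\<forall>k. b k o\<^sub>L f k = id_blinfun) \<longrightarrow> (\<forall>k. f k o\<^sub>L b k = id_blinfun) \<longrightarrow>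
    (\<forall>k. norm (b k) \<le> (2 * \<kappa>) * v k) \<longrightarrow> symbol_bound l v N K b"
    by (intro allI symbol_bound_inverse c A2)
  from choice[OF this] obtain K0 where K0: "\<forall>l::'n. 0 \<le> K0 l \<and> (\<forall>w v (f :: int^'n \<Rightarrow> 'e \<Rightarrow>\<^sub>L 'e) b.
    moderate l c w \<longrightarrow> moderate l c v \<longrightarrow> (\<forall>k. v k * w k \<le> 1) \<longrightarrow> symbol_bound l w N (A + 2) f \<longrightarrow>
    (\<forall>k. b k o\<^sub>L f k = id_blinfun) \<longrightarrow> (\<forall>k. f k o\<^sub>L b k = id_blinfun) \<longrightarrow>
    (\<forall>k. norm (b k) \<le> (2 * \<kappa>) * v k) \<longrightarrow> symbol_bound l v N (K0 l) b)" by (elim exE)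
  define K where "K = 2 * ((\<Sum>l\<in>UNIV. K0 l) + 1)"
  have S0: "0 \<le> (\<Sum>l\<in>UNIV. K0 l)" using K0 by (intro sum_nonneg) auto
  have K: "0 < K" using S0 by (simp add: K_def)
  have K0K: "2 * K0 l \<le> K" for l
  proof -
    have "K0 l \<le> (\<Sum>l\<in>UNIV. K0 l)" using K0 by (intro member_le_sum) auto
    then show ?thesis by (simp add: K_def)
  qed
  have main: "\<exists>b. (\<forall>k x. blinfun_apply (b k) (a k x + \<mu> *\<^sub>C x) = x) \<and>
        (\<forall>k y. a k (b k y) + \<mu> *\<^sub>C b k y = y) \<and>
        (\<forall>l. symbol_bound l (\<lambda>k. bracket k powr 0) N (K / cmod (\<mu> - complex_of_real w)) b) \<and>
        (\<forall>l. symbol_bound l (\<lambda>k. bracket k powr (- m)) N K b)"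
    if ne: "\<mu> \<noteq> complex_of_real w" and arg: "\<bar>Arg (\<mu> - complex_of_real w)\<bar> < \<theta>" for \<mu>
  proof -
    obtain \<mu>0 where \<mu>0: "Re \<mu>0 \<ge> 0" "w \<le> cmod \<mu>0" "cmod (\<mu> - \<mu>0) \<le> e * cmod \<mu>0"
      "cmod (\<mu> - of_real w) \<le> 2 * cmod \<mu>0"
      using sector_half_plane[OF w e(1,2) ne arg[unfolded \<theta>_def]] by blast
    define v where "v k = spectral_bracket m \<mu>0 k powr (- m)" for k :: "int^'n"
    define wt where "wt k = spectral_bracket m \<mu>0 k powr m" for k :: "int^'n"
    have vw: "v k * wt k = 1" for k by (simp add: v_def wt_def flip: powr_add)
    have vpos: "0 < v k" "0 < wt k" for k by (simp_all add: v_def wt_def)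
    have \<mu>0w: "cmod \<mu>0 \<le> wt k" for k unfolding wt_def by (rule norm_le_spectral_bracket[OF m])
    have vz: "v k \<le> 2 / cmod (\<mu> - of_real w)" for k
    proof -
      have "0 < cmod (\<mu> - of_real w)" using ne by simp
      moreover have "cmod (\<mu> - of_real w) \<le> 2 * wt k" using \<mu>0(4) \<mu>0w[of k] by linarith
      then have "v k * cmod (\<mu> - of_real w) \<le> v k * (2 * wt k)"
        using vpos(1)[of k] by (intro mult_left_mono) auto
      ultimately show ?thesis using vw[of k] by (simp add: field_simps)
    qed
    have T: "bij (blinfun_apply (a k + cscale \<mu>0))"
      "\<And>x. norm x \<le> (\<kappa> * v k) * norm ((a k + cscale \<mu>0) x)" for k
    proof -
      have "\<omega> \<le> sqrt ((norm (real_vec k))\<^sup>2 + cmod \<mu>0 powr (2 / m))"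
      proof (rule real_le_rsqrt)
        have "\<omega> powr m \<le> cmod \<mu>0" using \<mu>0(2) by (simp add: w_def)
        then have "(\<omega> powr m) powr (2 / m) \<le> cmod \<mu>0 powr (2 / m)" using m by (intro powr_mono2) auto
        moreover have "(\<omega> powr m) powr (2 / m) = \<omega>\<^sup>2"
          using m \<omega> by (cases "\<omega> = 0") (simp_all add: powr_powr powr_numeral)
        ultimately show "\<omega>\<^sup>2 \<le> (norm (real_vec k))\<^sup>2 + cmod \<mu>0 powr (2 / m)"
          by (simp add: add_increasing)
      qed
      then have P: "bij (\<lambda>x. a k x + \<mu>0 *\<^sub>C x)" "bounded_linear (inv (\<lambda>x. a k x + \<mu>0 *\<^sub>C x))"
        "onorm (inv (\<lambda>x. a k x + \<mu>0 *\<^sub>C x)) \<le> \<kappa> * v k"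
        using pw \<mu>0(1) unfolding parabolic_with_def Let_def v_def spectral_bracket_def by blast+
      have eq: "blinfun_apply (a k + cscale \<mu>0) = (\<lambda>x. a k x + \<mu>0 *\<^sub>C x)"
        by (simp add: fun_eq_iff blinfun.add_left)
      show "bij (blinfun_apply (a k + cscale \<mu>0))" unfolding eq by (rule P)
      fix x
      let ?T = "\<lambda>x. a k x + \<mu>0 *\<^sub>C x"
      have "inv ?T (?T x) = x" by (rule inv_f_f[OF bij_is_inj[OF P(1)]])
      then have "norm x \<le> onorm (inv ?T) * norm (?T x)" using onorm[OF P(2), of "?T x"] by simp
      also have "\<dots> \<le> (\<kappa> * v k) * norm (?T x)" using P(3) by (rule mult_right_mono) simp
      finally show "norm x \<le> (\<kappa> * v k) * norm ((a k + cscale \<mu>0) x)" by (simp add: eq)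
    qed
    define f where "f k = a k + cscale \<mu>" for k
    have "\<exists>b. (\<forall>x. blinfun_apply b (f k x) = x) \<and> (\<forall>y. f k (blinfun_apply b y) = y) \<and> norm b \<le> (2 * \<kappa>) * v k"
      for k
    proof -
      have \<kappa>v: "0 \<le> \<kappa> * v k" using \<kappa> vpos(1)[of k] by simp
      have small: "(\<kappa> * v k) * cmod (\<mu> - \<mu>0) \<le> 1 / 2"
      proof -
        have "(\<kappa> * v k) * cmod (\<mu> - \<mu>0) \<le> (\<kappa> * v k) * (e * wt k)"
          using \<mu>0(3) \<mu>0w[of k] e(1) \<kappa>v by (intro mult_left_mono) (auto intro: order_trans mult_left_mono)
        also have "\<dots> = (\<kappa> * e) * (v k * wt k)" by simp
        finally show ?thesis using e(3) vw[of k] by simp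
      qed
      have eq: "a k + cscale \<mu>0 + cscale (\<mu> - \<mu>0) = f k" by (simp add: f_def cscale_diff)
      note pb = bij_perturbation[OF T \<kappa>v small, unfolded eq]
      have "0 \<le> 2 * (\<kappa> * v k)" using \<kappa>v by simp
      from inverse_blinfun_exists[OF pb this] show ?thesis by (metis mult.assoc)
    qed
    then have "\<forall>k. \<exists>b. (\<forall>x. blinfun_apply b (f k x) = x) \<and> (\<forall>y. f k (blinfun_apply b y) = y) \<and>
        norm b \<le> (2 * \<kappa>) * v k" by (rule allI)
    from choice[OF this] obtain b where b: "\<forall>k. (\<forall>x. blinfun_apply (b k) (f k x) = x) \<and>
        (\<forall>y. f k (blinfun_apply (b k) y) = y) \<and> norm (b k) \<le> (2 * \<kappa>) * v k" by (elim exE)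
    have sf: "symbol_bound l wt N (A + 2) f" for l
    proof -
      have "symbol_bound l wt N A a"
      proof (rule symbol_bound_weaken[OF A(2)])
        fix k
        have "bracket k powr m \<le> wt k"
          unfolding wt_def using m by (intro powr_mono2 spectral_bracket_ge) auto
        then show "A * bracket k powr m \<le> A * wt k" using A(1) by simp
      qed
      moreover have "symbol_bound l wt N 2 (\<lambda>k. cscale \<mu> :: 'e \<Rightarrow>\<^sub>L 'e)"
        unfolding symbol_bound_def funpow_difference_const
      proof (intro allI impI)
        fix r and k :: "int^'n"
        have "cmod \<mu> \<le> cmod \<mu>0 + cmod (\<mu> - \<mu>0)" using norm_triangle_ineq[of \<mu>0 "\<mu> - \<mu>0"] by simp
        also have "cmod (\<mu> - \<mu>0) \<le> 1 * cmod \<mu>0"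
          by (rule order_trans[OF \<mu>0(3) mult_right_mono[OF e(2) norm_ge_zero]])
        finally have "cmod \<mu> \<le> 2 * wt k" using \<mu>0w[of k] by simp
        then have "norm (cscale \<mu> :: 'e \<Rightarrow>\<^sub>L 'e) \<le> 2 * wt k" using norm_cscale_le[of \<mu>] order_trans by blast
        then show "norm (if r = 0 then cscale \<mu> else (0 :: 'e \<Rightarrow>\<^sub>L 'e)) \<le> 2 * wt k * bracket k powr (- real r)"
          using vpos(2)[of k] by auto
      qed
      ultimately show ?thesis unfolding f_def by (rule symbol_bound_add)
    qed
    have sb: "symbol_bound l v N (K0 l) b" for l
    proof (rule K0[rule_format, THEN conjunct2, rule_format])
      show "moderate l c wt" unfolding c_def wt_def[abs_def] by (rule moderate_spectral_bracket)
      show "moderate l c v"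
        unfolding c_def v_def[abs_def] using moderate_spectral_bracket[of l "- m" m \<mu>0] by simp
      show "v k * wt k \<le> 1" for k by (simp add: vw)
      show "symbol_bound l wt N (A + 2) f" by (rule sf)
      show "b k o\<^sub>L f k = id_blinfun" "f k o\<^sub>L b k = id_blinfun" for k
        using b by (auto intro!: blinfun_eqI)
      show "norm (b k) \<le> 2 * \<kappa> * v k" for k using b by simp
    qed
    have s0: "symbol_bound l (\<lambda>k. bracket k powr 0) N (K / cmod (\<mu> - complex_of_real w)) b" for l
    proof (rule symbol_bound_weaken[OF sb])
      fix k
      have "K0 l * v k \<le> K0 l * (2 / cmod (\<mu> - of_real w))" using K0 vz[of k] by (intro mult_left_mono) auto
      also have "\<dots> = 2 * K0 l / cmod (\<mu> - of_real w)" by simp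
      also have "\<dots> \<le> K / cmod (\<mu> - of_real w)" by (intro divide_right_mono K0K) simp
      finally show "K0 l * v k \<le> K / cmod (\<mu> - complex_of_real w) * bracket k powr 0" by simp
    qed
    have sm: "symbol_bound l (\<lambda>k. bracket k powr (- m)) N K b" for l
    proof (rule symbol_bound_weaken[OF sb])
      fix k
      have "v k \<le> bracket k powr (- m)"
        unfolding v_def using m by (intro powr_mono2' spectral_bracket_ge) auto
      then show "K0 l * v k \<le> K * bracket k powr (- m)"
        using K0K[of l] K0 vpos(1)[of k] by (intro mult_mono) (auto intro: order_trans[rotated])
    qed
    have "b k (a k x + \<mu> *\<^sub>C x) = x" for k x using b by (simp add: f_def blinfun.add_left)
    moreover have "a k (b k y) + \<mu> *\<^sub>C b k y = y" for k y using b by (simp add: f_def blinfun.add_left)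
    ultimately show ?thesis using s0 sm by blast
  qed
  then show ?thesis using \<theta> K by blast
qed

section \<open>Generation of the analytic semigroup\<close>

lemma besov_space_iff: "u \<in> besov_space \<phi> s p q \<longleftrightarrow> besov_enorm \<phi> s p q u < \<infinity>"
  by (simp add: besov_space_def)

text \<open>The qualitative part of the multiplier theorem, for a fixed symbol.\<close>

lemma besov_multiplier_space:
  fixes b :: "int^'n \<Rightarrow> 'e::complex_banach \<Rightarrow>\<^sub>L 'e"
  assumes dy: "dyadic_decomposition \<phi>" and p: "1 \<le> p" and q: "1 \<le> q" and N: "N = CARD('n) + 1"
    and lin: "\<And>k z v. blinfun_apply (b k) (z *\<^sub>C v) = z *\<^sub>C blinfun_apply (b k) v"
    and A: "A > 0" and b: "\<And>l. symbol_bound l (\<lambda>k. bracket k powr \<sigma>) N A b"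
    and u: "u \<in> besov_space \<phi> (s + \<sigma>) p q"
  shows "torus_op (\<lambda>k. blinfun_apply (b k)) u \<in> besov_space \<phi> s p q"
proof -
  obtain K where "\<forall>A>0. \<forall>(b :: int^'n \<Rightarrow> 'e \<Rightarrow>\<^sub>L 'e).
    (\<forall>k z v. blinfun_apply (b k) (z *\<^sub>C v) = z *\<^sub>C blinfun_apply (b k) v) \<longrightarrow>
    (\<forall>l. symbol_bound l (\<lambda>k. bracket k powr \<sigma>) N A b) \<longrightarrow>
    (\<forall>u. besov_enorm \<phi> s p q (torus_op (\<lambda>k. blinfun_apply (b k)) u) \<le>
      ennreal (K * A) * besov_enorm \<phi> (s + \<sigma>) p q u)"
    using besov_multiplier[OF dy p q N, of \<sigma> s] by (elim exE conjE)
  then have "besov_enorm \<phi> s p q (torus_op (\<lambda>k. blinfun_apply (b k)) u) \<le>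
      ennreal (K * A) * besov_enorm \<phi> (s + \<sigma>) p q u"
    using A lin b by simp
  also have "\<dots> < \<infinity>" using u by (simp add: besov_space_iff ennreal_mult_less_top)
  finally show ?thesis by (simp add: besov_space_iff)
qed

lemma symbol_bound_const:
  fixes T :: "'e::complex_banach \<Rightarrow>\<^sub>L 'e"
  assumes "\<sigma> \<ge> 0"
  shows "symbol_bound l (\<lambda>k. bracket k powr \<sigma>) N (norm T + 1) (\<lambda>k. T)"
  unfolding symbol_bound_def funpow_difference_const
proof (intro allI impI)
  fix r and k :: "int^'b"
  have "1 \<le> bracket k powr \<sigma>" using bracket_ge_1[of k] assms by (rule ge_one_powr_ge_zero)
  then have "norm T * 1 \<le> (norm T + 1) * bracket k powr \<sigma>" by (intro mult_mono) auto
  moreover have "0 \<le> (norm T + 1) * bracket k powr \<sigma>" by simp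
  ultimately show "norm (if r = 0 then T else 0) \<le> (norm T + 1) * bracket k powr \<sigma> * bracket k powr - real r"
    by auto
qed

lemma tempered_symbol_bound:
  fixes b :: "int^'n \<Rightarrow> 'e::complex_banach \<Rightarrow>\<^sub>L 'e"
  assumes "symbol_bound l (\<lambda>k. bracket k powr \<sigma>) N A b" and "A > 0"
  shows "tempered (\<lambda>k. blinfun_apply (b k))"
  by (rule tempered_symbol[OF symbol_bound_0[OF assms(1)]]) (use assms(2) in simp)

lemma torus_op_cscale:
  fixes u :: "('n::finite, 'e::complex_banach) distribution"
  shows "torus_op (\<lambda>k. blinfun_apply (cscale z)) u = z *\<^sub>C u"
proof (rule distribution_eqI)
  have "symbol_bound undefined (\<lambda>k::int^'n. bracket k powr 0) 0 (norm (cscale z :: 'e \<Rightarrow>\<^sub>L 'e) + 1) (\<lambda>k. cscale z :: 'e \<Rightarrow>\<^sub>L 'e)"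
    by (rule symbol_bound_const) simp
  then have "tempered (\<lambda>k::int^'n. blinfun_apply (cscale z :: 'e \<Rightarrow>\<^sub>L 'e))"
    by (rule tempered_symbol_bound) (simp add: add_nonneg_pos)
  then show "fourier_coeff (torus_op (\<lambda>k. blinfun_apply (cscale z)) u) k = fourier_coeff (z *\<^sub>C u) k" for k
    by (simp add: fourier_coeff_torus_op)
qed

text \<open>A constant symbol is of every non-negative order, so the multiplier theorem provides both the
  multiplication by scalars and the embedding of Besov spaces.\<close>

lemma besov_space_scale:
  fixes u :: "('n::finite, 'e::complex_banach) distribution"
  assumes dy: "dyadic_decomposition \<phi>" and p: "1 \<le> p" and q: "1 \<le> q"
    and \<sigma>: "\<sigma> \<ge> 0" and u: "u \<in> besov_space \<phi> (s + \<sigma>) p q"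
  shows "z *\<^sub>C u \<in> besov_space \<phi> s p q"
  unfolding torus_op_cscale[symmetric]
  by (rule besov_multiplier_space[OF dy p q refl _ _ symbol_bound_const[OF \<sigma>] u])
    (simp_all add: scaleC_left_commute add_nonneg_pos)

lemma besov_space_add:
  fixes u v :: "('n::finite, 'e::complex_banach) distribution"
  assumes dy: "dyadic_decomposition \<phi>" and p: "1 \<le> p" and q: "1 \<le> q"
    and "u \<in> besov_space \<phi> s p q" "v \<in> besov_space \<phi> s p q"
  shows "u + v \<in> besov_space \<phi> s p q"
  using order_le_less_trans[OF besov_enorm_add[OF dy p q, of s u v]] assms(4,5)
  by (simp add: besov_space_iff ennreal_mult_less_top)

lemma zero_in_besov_space:
  assumes dy: "dyadic_decomposition \<phi>" and p: "1 \<le> p" and q: "1 \<le> q"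
  shows "(0 :: ('n::finite, 'e::complex_banach) distribution) \<in> besov_space \<phi> s p q"
proof -
  have "dyadic_block \<phi> j (0 :: ('n, 'e) distribution) = 0" for j
    by (rule distribution_eqI) (simp add: fourier_coeff_dyadic_block[OF dy])
  then have "block_norm \<phi> s p (0 :: ('n, 'e) distribution) = (\<lambda>j. 0)"
    by (simp add: fun_eq_iff block_norm_def distribution_norm_zero[OF p])
  moreover have "Lebesgue_norm q (count_space UNIV :: nat measure) (\<lambda>j. 0) \<le> ennreal 0 * Lebesgue_norm q (count_space UNIV :: nat measure) (\<lambda>j. 0)"
    using Lebesgue_norm_cmult[OF q, of 0 "\<lambda>j::nat. 0" "count_space UNIV"] by simp
  ultimately show ?thesis by (simp add: besov_space_iff besov_enorm_block_norm)
qed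

theorem corollary4p4:
  fixes a :: "int^'n::finite \<Rightarrow> 'e::complex_banach \<Rightarrow>\<^sub>L 'e"
    and \<phi> :: "nat \<Rightarrow> real^'n \<Rightarrow> complex"
    and s m :: real and p q :: ennreal and \<rho> :: nat
  assumes "dyadic_decomposition \<phi>"
    and "m > 0" and "1 \<le> p" and "1 \<le> q" and "\<rho> \<ge> CARD('n) + 1"
    and "a \<in> symbol_class m \<rho>" and "parabolic m a"
  shows "generates_analytic_semigroup (besov_space \<phi> s p q) (besov_norm \<phi> s p q)
           (neg_operator (besov_realization \<phi> s p q m a))"
proof -
  note dy = assms(1) and m = assms(2) and p = assms(3) and q = assms(4) and a = assms(6)
  define N where "N = CARD('n) + 1"
  have N: "N \<le> \<rho>" using assms(5) by (simp only: N_def)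
  let ?X = "besov_space \<phi> s p q :: ('n, 'e) distribution set"
  let ?D = "besov_space \<phi> (s + m) p q :: ('n, 'e) distribution set"
  let ?A = "torus_op (\<lambda>k. blinfun_apply (a k)) :: ('n, 'e) distribution \<Rightarrow> _"
  let ?B = "\<lambda>u. - ?A u"
  have op: "neg_operator (besov_realization \<phi> s p q m a) = (?D, ?B)"
    by (simp add: neg_operator_def besov_realization_def)
  have lin_a: "blinfun_apply (a k) (z *\<^sub>C x) = z *\<^sub>C blinfun_apply (a k) x" for k z x
    using a by (simp add: symbol_class_def)
  obtain Aa where Aa: "Aa > 0" "\<And>l. symbol_bound l (\<lambda>k. bracket k powr m) N Aa a"
    using symbol_class_bound[OF a N] by blast
  have temp_a: "tempered (\<lambda>k. blinfun_apply (a k))" by (rule tempered_symbol_bound[OF Aa(2,1)])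
  have A_X: "?A u \<in> ?X" if "u \<in> ?D" for u
    by (rule besov_multiplier_space[OF dy p q N_def lin_a Aa that])
  have scale: "z *\<^sub>C u \<in> besov_space \<phi> t p q" if "u \<in> besov_space \<phi> t p q" for z t and u :: "('n, 'e) distribution"
    using besov_space_scale[OF dy p q, of 0 u t z] that by simp
  have D_X: "u \<in> ?X" if "u \<in> ?D" for u
    using besov_space_scale[OF dy p q _ that, of 1] m by (simp add: scaleC_one)
  have minus: "- u = (-1) *\<^sub>C u" for u :: "('n, 'e) distribution"
    by (simp add: scaleC_minus_left scaleC_one)
  have "linear_operator_in ?X (?D, ?B)"
    unfolding linear_operator_in_def complex_subspace_def split_conv
  proof (intro conjI allI ballI subsetI)
    show "0 \<in> ?D" by (rule zero_in_besov_space[OF dy p q])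
    show "u + v \<in> ?D" if "u \<in> ?D" "v \<in> ?D" for u v by (rule besov_space_add[OF dy p q that])
    show "z *\<^sub>C u \<in> ?D" if "u \<in> ?D" for z u by (rule scale[OF that])
    show "u \<in> ?X" if "u \<in> ?D" for u by (rule D_X[OF that])
    show "w \<in> ?X" if w: "w \<in> ?B ` ?D" for w
    proof -
      obtain u where u: "u \<in> ?D" "w = - ?A u" using w by blast
      show ?thesis unfolding u(2) minus[of "?A u"] by (rule scale[OF A_X[OF u(1)]])
    qed
    show "- ?A (u + v) = - ?A u + - ?A v" for u v
      by (rule distribution_eqI) (simp add: fourier_coeff_torus_op[OF temp_a] blinfun.add_right)
    show "- ?A (z *\<^sub>C u) = z *\<^sub>C - ?A u" for z u
      by (rule distribution_eqI)
        (simp add: fourier_coeff_torus_op[OF temp_a] lin_a scaleC_minus_right)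
  qed
  moreover obtain w \<theta> K where \<theta>: "\<theta> \<in> {pi / 2<..<pi}" and K: "0 < K" and
    res: "\<forall>\<mu>. \<mu> \<noteq> complex_of_real w \<and> \<bar>Arg (\<mu> - complex_of_real w)\<bar> < \<theta> \<longrightarrow>
      (\<exists>b. (\<forall>k x. blinfun_apply (b k) (a k x + \<mu> *\<^sub>C x) = x) \<and>
        (\<forall>k y. a k (b k y) + \<mu> *\<^sub>C b k y = y) \<and>
        (\<forall>l. symbol_bound l (\<lambda>k. bracket k powr 0) N (K / cmod (\<mu> - complex_of_real w)) b) \<and>
        (\<forall>l. symbol_bound l (\<lambda>k. bracket k powr (- m)) N K b))"
    using resolvent_symbol[OF m a N assms(7)] by (elim exE conjE) (rule that)
  obtain L where L: "L > 0" "\<forall>A>0. \<forall>(b :: int^'n \<Rightarrow> 'e \<Rightarrow>\<^sub>L 'e).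
    (\<forall>k z v. blinfun_apply (b k) (z *\<^sub>C v) = z *\<^sub>C blinfun_apply (b k) v) \<longrightarrow>
    (\<forall>l. symbol_bound l (\<lambda>k. bracket k powr 0) N A b) \<longrightarrow>
    (\<forall>u. besov_enorm \<phi> s p q (torus_op (\<lambda>k. blinfun_apply (b k)) u) \<le>
      ennreal (L * A) * besov_enorm \<phi> (s + 0) p q u)"
    using besov_multiplier[OF dy p q N_def, of 0 s] by (elim exE conjE)
  have "\<mu> \<in> resolvent_set ?X (besov_norm \<phi> s p q) (?D, ?B) \<and>
      (\<forall>v\<in>?X. besov_norm \<phi> s p q (resolvent (?D, ?B) \<mu> v) \<le>
        (L * K) / cmod (\<mu> - complex_of_real w) * besov_norm \<phi> s p q v)"
    if \<mu>: "\<mu> \<noteq> complex_of_real w \<and> \<bar>Arg (\<mu> - complex_of_real w)\<bar> < \<theta>" for \<mu>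
  proof -
    let ?d = "cmod (\<mu> - complex_of_real w)"
    have d: "0 < ?d" using \<mu> by simp
    obtain b where b1: "\<And>k x. blinfun_apply (b k) (a k x + \<mu> *\<^sub>C x) = x"
      and b2: "\<And>k y. a k (b k y) + \<mu> *\<^sub>C b k y = y"
      and b0: "\<And>l. symbol_bound l (\<lambda>k. bracket k powr 0) N (K / ?d) b"
      and bm: "\<And>l. symbol_bound l (\<lambda>k. bracket k powr (- m)) N K b"
      using res[rule_format, OF \<mu>] by blast
    have lin_b: "blinfun_apply (b k) (z *\<^sub>C y) = z *\<^sub>C blinfun_apply (b k) y" for k z y
    proof -
      let ?x = "b k y"
      have "a k (z *\<^sub>C ?x) + \<mu> *\<^sub>C z *\<^sub>C ?x = z *\<^sub>C (a k ?x + \<mu> *\<^sub>C ?x)"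
        by (simp add: lin_a scaleC_add_right scaleC_left_commute[of \<mu>])
      also have "\<dots> = z *\<^sub>C y" by (simp only: b2)
      finally show ?thesis using b1[of k "z *\<^sub>C ?x"] by simp
    qed
    \<comment> \<open>The estimate of order 0 bounds \<open>?R\<close>, and the estimate of order \<open>- m\<close> puts its values into \<open>?D\<close>.\<close>
    let ?R = "torus_op (\<lambda>k. blinfun_apply (b k)) :: ('n, 'e) distribution \<Rightarrow> _"
    let ?S = "\<lambda>u. \<mu> *\<^sub>C u - ?B u"
    have temp_b: "tempered (\<lambda>k. blinfun_apply (b k))" by (rule tempered_symbol_bound[OF bm K])
    have R_D: "?R v \<in> ?D" if "v \<in> ?X" for v
      using that by (intro besov_multiplier_space[OF dy p q N_def lin_b K bm]) simp
    have S_X: "?S u \<in> ?X" if "u \<in> ?D" for u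
      using besov_space_add[OF dy p q scale[OF D_X[OF that], of \<mu>] A_X[OF that]] by simp
    have b1': "b k (\<mu> *\<^sub>C x + a k x) = x" for k x using b1[of k x] by (simp only: add.commute)
    have b2': "\<mu> *\<^sub>C b k y + a k (b k y) = y" for k y using b2[of k y] by (simp only: add.commute)
    have RS: "?R (?S u) = u" for u
      by (rule distribution_eqI)
        (simp add: fourier_coeff_torus_op[OF temp_b] fourier_coeff_torus_op[OF temp_a] b1')
    have SR: "?S (?R v) = v" for v
      by (rule distribution_eqI)
        (simp add: fourier_coeff_torus_op[OF temp_b] fourier_coeff_torus_op[OF temp_a] b2')
    have bij: "bij_betw ?S ?D ?X"
      by (rule bij_betw_byWitness[where f'="?R"]) (use RS SR R_D S_X in auto)
    have R: "resolvent (?D, ?B) \<mu> v = ?R v" if "v \<in> ?X" for v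
    proof -
      have "inv_into ?D ?S v = ?R v"
        by (rule inv_into_f_eq[OF bij_betw_imp_inj_on[OF bij] R_D[OF that] SR])
      then show ?thesis unfolding resolvent_def split_conv .
    qed
    have bound: "besov_norm \<phi> s p q (resolvent (?D, ?B) \<mu> v) \<le> (L * K) / ?d * besov_norm \<phi> s p q v"
      if v: "v \<in> ?X" for v
    proof -
      have Kd: "0 < K / ?d" using K d by (rule divide_pos_pos)
      have lin_b': "\<forall>k z v. blinfun_apply (b k) (z *\<^sub>C v) = z *\<^sub>C blinfun_apply (b k) v"
        by (intro allI lin_b)
      have b0': "\<forall>l. symbol_bound l (\<lambda>k. bracket k powr 0) N (K / ?d) b" by (rule allI) (rule b0)
      have "besov_enorm \<phi> s p q (?R v) \<le> ennreal (L * (K / ?d)) * besov_enorm \<phi> (s + 0) p q v"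
        by (rule L(2)[THEN spec, THEN mp, OF Kd, THEN spec, THEN mp, OF lin_b', THEN mp, OF b0',
            THEN spec])
      then have "besov_enorm \<phi> s p q (?R v) \<le> ennreal (L * (K / ?d)) * besov_enorm \<phi> s p q v" by simp
      moreover have "ennreal (L * (K / ?d)) * besov_enorm \<phi> s p q v < top"
        using v by (simp add: besov_space_iff ennreal_mult_less_top)
      ultimately have "enn2real (besov_enorm \<phi> s p q (?R v)) \<le>
          enn2real (ennreal (L * (K / ?d)) * besov_enorm \<phi> s p q v)" by (rule enn2real_mono)
      then show ?thesis using L(1) K d unfolding besov_norm_def R[OF v] by (simp add: enn2real_mult)
    qed
    have "\<mu> \<in> resolvent_set ?X (besov_norm \<phi> s p q) (?D, ?B)"
      unfolding resolvent_set_def split_conv using bij bound by blast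
    then show ?thesis using bound by blast
  qed
  moreover have "0 < L * K" using L(1) K by simp
  ultimately show ?thesis
    unfolding op generates_analytic_semigroup_def using \<theta>
    by (intro conjI exI[of _ w] exI[of _ \<theta>] exI[of _ "L * K"]) blast+
qed

end
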